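(* Let $n$ be a positive integer, let $H$ be a subgroup of $\mathrm{GL}_2(\mathbb Z/n\mathbb Z)$ and let $\ell\ge5$ be a prime not dividing $n$. Let $\rho=e^{2\pi i/3}$ and, for $\tau$ in the complex upper half-plane, let $E_\tau=\mathbb C/(\mathbb Z+\mathbb Z\tau)$. Then, for all points $P\in X_H(\mathbb C)$, we have that: \begin{enumerate} \item in the divisor $T_\ell(P)$ there is a point with multiplicity at least $4$ if and only if $P$ is a cusp; \item in $T_\ell(P)$ there is a point with multiplicity $3$ if and only if $P=(E_\rho,\phi)$ for some $\phi$ such that the matrix $\phi^{-1}\circ\rho|_{E_\rho[n]}\circ\phi$ lies in $\pm H$; \item in $T_\ell(P)$ there are two distinct points with multiplicity $2$ if and only if $P=(E_i,\phi)$ for some $\phi$ such that the matrix $\phi^{-1}\circ i|_{E_i[n]}\circ\phi$ lies in $\pm H$. \end{enumerate}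
   Context: For a positive integer $n$, $Y(n)$ is the (coarse if $n<3$) moduli space over $\mathbb Q$ of pairs $(E,\phi)$ with $E$ an elliptic curve over a $\mathbb Q$-scheme $S$ and $\phi\colon(\mathbb Z/n\mathbb Z)^2_S\to E[n]$ an isomorphism; $X(n)$ is its compactification. $\gamma\in\mathrm{GL}_2(\mathbb Z/n\mathbb Z)$ acts by $(E,\phi)\mapsto(E,\phi\circ\gamma)$; for a subgroup $H$, $X_H:=X(n)/H$ and $Y_H:=Y(n)/H$. The cusps are the points of $X_H$ not in $Y_H$. Write $\pm H:=\{\pm\mathrm{Id}\}\cdot H$. Points of $Y_H(\mathbb C)$ are pairs $(E,\phi)$ over $\mathbb C$ modulo $(E,\phi)\sim(E',\phi')$ iff there is an isomorphism $\iota\colon E\to E'$ with $(\phi')^{-1}\circ\iota|_{E[n]}\circ\phi\in H$ (equivalently, $\in\pm H$). Hecke operators. Let $\ell\nmid n$ be prime and let $H_\ell<\mathrm{GL}_2(\mathbb Z/n\ell\mathbb Z)$ be the subgroup of matrices whose reduction mod $n$ lies in $H$ and whose reduction mod $\ell$ is upper triangular. For $(E,\phi)$ with $\phi\colon(\mathbb Z/n\ell\mathbb Z)^2\to E[n\ell]$, identify the $n$-torsion of $(\mathbb Z/n\ell\mathbb Z)^2$ with $(\mathbb Z/n\mathbb Z)^2$ by the Chinese Remainder Theorem. The maps $\mathrm{pr}(E,\phi)=(E,\phi|_{(\mathbb Z/n\mathbb Z)^2})$ and $\mathrm{qt}(E,\phi)=(E/C,\pi_C\circ\phi|_{(\mathbb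 Z/n\mathbb Z)^2})$, where $C=\langle\phi\binom n0\rangle$ and $\pi_C\colon E\to E/C$ is the projection, extend to morphisms $\mathrm{pr},\mathrm{qt}\colon X_{H_\ell}\to X_H$, and $T_\ell:=\mathrm{qt}_*\circ\mathrm{pr}^*$ on $\mathrm{Div}(X_H)$. On $Y_H(\mathbb C)$ it is given by $T_\ell(E,\phi)=\sum_{0\lneq C\lneq E[\ell]}(E/C,\pi_C\circ\phi)$. *)

theory Defs
  imports "HOL-Analysis.Analysis" "HOL-Library.Poly_Mapping" "HOL-Algebra.Generated_Groups"
begin

section \<open>Matrices and vectors over \<open>\<int>/n\<int>\<close>\<close>

text \<open>
  An element of \<open>\<int>/n\<int>\<close> is represented by its residue in \<open>{0..<n}\<close>, so a matrix or a vector over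
  \<open>\<int>/n\<int>\<close> is an integer matrix or vector that is fixed by entrywise reduction.  For \<open>n = 1\<close> all
  these structures are trivial.
\<close>

definition red_mat :: "nat \<Rightarrow> int^2^2 \<Rightarrow> int^2^2" where
  "red_mat n A = (\<chi> i j. A $ i $ j mod int n)"

definition red_vec :: "nat \<Rightarrow> int^2 \<Rightarrow> int^2" where
  "red_vec n v = (\<chi> i. v $ i mod int n)"

definition mat2_monoid :: "nat \<Rightarrow> (int^2^2) monoid" where
  "mat2_monoid n =
     \<lparr>carrier = {A. red_mat n A = A},
      monoid.mult = (\<lambda>A B. red_mat n (A ** B)),
      one = red_mat n (mat 1)\<rparr>"

definition GL2 :: "nat \<Rightarrow> (int^2^2) monoid" where
  "GL2 n = units_of (mat2_monoid n)"

definition SL2Z :: "(int^2^2) set" where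
  "SL2Z = {A. det A = 1}"

definition plus_minus :: "nat \<Rightarrow> (int^2^2) set \<Rightarrow> (int^2^2) set" where
  "plus_minus n H = {red_mat n (mat 1), red_mat n (- mat 1)} <#>\<^bsub>GL2 n\<^esub> H"

definition vec2_group :: "nat \<Rightarrow> (int^2) monoid" where
  "vec2_group n =
     \<lparr>carrier = {v. red_vec n v = v},
      monoid.mult = (\<lambda>u v. red_vec n (u + v)),
      one = 0\<rparr>"


section \<open>Elliptic curves over \<open>\<complex>\<close> as complex tori\<close>

definition period_lattice :: "complex \<Rightarrow> complex \<Rightarrow> complex set" where
  "period_lattice \<omega>\<^sub>1 \<omega>\<^sub>2 = {of_int a * \<omega>\<^sub>1 + of_int b * \<omega>\<^sub>2 | a b. True}"

text \<open>Since \<open>x / 0 = 0\<close>, the condition on the periods implies that both are nonzero.\<close>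

definition is_lattice :: "complex set \<Rightarrow> bool" where
  "is_lattice \<Lambda> \<longleftrightarrow> (\<exists>\<omega>\<^sub>1 \<omega>\<^sub>2. Im (\<omega>\<^sub>2 / \<omega>\<^sub>1) \<noteq> 0 \<and> \<Lambda> = period_lattice \<omega>\<^sub>1 \<omega>\<^sub>2)"

definition complex_add_group :: "complex monoid" where
  "complex_add_group = \<lparr>carrier = UNIV, monoid.mult = (+), one = 0\<rparr>"

definition torus :: "complex set \<Rightarrow> complex set monoid" where
  "torus \<Lambda> = complex_add_group Mod \<Lambda>"

definition torus_point :: "complex set \<Rightarrow> complex \<Rightarrow> complex set" where
  "torus_point \<Lambda> z = \<Lambda> #>\<^bsub>complex_add_group\<^esub> z"

definition torsion :: "nat \<Rightarrow> complex set \<Rightarrow> complex set set" where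
  "torsion n \<Lambda> = {X \<in> carrier (torus \<Lambda>). X [^]\<^bsub>torus \<Lambda>\<^esub> n = \<one>\<^bsub>torus \<Lambda>\<^esub>}"

text \<open>
  Isomorphisms of elliptic curves over \<open>\<complex>\<close> are holomorphic group isomorphisms of tori; holomorphy is
  expressed through a lift to the universal cover \<open>\<complex>\<close>.
\<close>

definition torus_isos :: "complex set \<Rightarrow> complex set \<Rightarrow> (complex set \<Rightarrow> complex set) set" where
  "torus_isos \<Lambda> \<Lambda>' =
     {\<iota> \<in> iso (torus \<Lambda>) (torus \<Lambda>').
        \<exists>f. f holomorphic_on UNIV \<and> (\<forall>z. \<iota> (torus_point \<Lambda> z) = torus_point \<Lambda>' (f z))}"

text \<open>
  For a finite subgroup \<open>C\<close> of \<open>E = \<complex>/\<Lambda>\<close>, the quotient \<open>E/C\<close> is \<open>\<complex>/\<Union>C\<close>, where \<open>\<Union>C\<close> is the preimage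
  of \<open>C\<close> in \<open>\<complex>\<close> (points of \<open>E\<close> being cosets of \<open>\<Lambda>\<close>).  The projection sends \<open>z + \<Lambda>\<close> to \<open>z + \<Union>C\<close>.
\<close>

definition quot_lattice :: "complex set set \<Rightarrow> complex set" where
  "quot_lattice C = \<Union>C"

definition quot_proj :: "complex set set \<Rightarrow> complex set \<Rightarrow> complex set" where
  "quot_proj C X = quot_lattice C <#>\<^bsub>complex_add_group\<^esub> X"


section \<open>Complex points of \<open>Y\<^sub>H\<close> and \<open>X\<^sub>H\<close>\<close>

type_synonym level_pair = "complex set \<times> (int^2 \<Rightarrow> complex set)"

text \<open>
  A pair \<open>(\<Lambda>, \<phi>)\<close> stands for \<open>(\<complex>/\<Lambda>, \<phi>)\<close>.  The values of \<open>\<phi>\<close> outside \<open>(\<int>/n\<int>)\<^sup>2\<close> are irrelevant: they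
  do not enter the equivalence relation below.
\<close>

definition level_pairs :: "nat \<Rightarrow> level_pair set" where
  "level_pairs n =
     {(\<Lambda>, \<phi>). is_lattice \<Lambda> \<and> \<phi> \<in> iso (vec2_group n) ((torus \<Lambda>)\<lparr>carrier := torsion n \<Lambda>\<rparr>)}"

text \<open>\<open>level_matrix n \<phi>' \<alpha> \<phi> A\<close> says that \<open>\<phi>'\<^sup>-\<^sup>1 \<circ> \<alpha> \<circ> \<phi>\<close> is the matrix \<open>A\<close>.\<close>

definition level_matrix ::
  "nat \<Rightarrow> (int^2 \<Rightarrow> complex set) \<Rightarrow> (complex set \<Rightarrow> complex set) \<Rightarrow> (int^2 \<Rightarrow> complex set)
     \<Rightarrow> int^2^2 \<Rightarrow> bool" where
  "level_matrix n \<phi>' \<alpha> \<phi> A \<longleftrightarrow>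
     A \<in> carrier (GL2 n) \<and> (\<forall>v \<in> carrier (vec2_group n). \<alpha> (\<phi> v) = \<phi>' (red_vec n (A *v v)))"

definition level_rel :: "nat \<Rightarrow> (int^2^2) set \<Rightarrow> (level_pair \<times> level_pair) set" where
  "level_rel n H =
     {((\<Lambda>, \<phi>), (\<Lambda>', \<phi>')).
        (\<Lambda>, \<phi>) \<in> level_pairs n \<and> (\<Lambda>', \<phi>') \<in> level_pairs n \<and>
        (\<exists>\<iota> \<in> torus_isos \<Lambda> \<Lambda>'. \<exists>h \<in> H. level_matrix n \<phi>' \<iota> \<phi> h)}"

text \<open>
  Over the upper half-plane, \<open>\<tau>\<close> carries the standard level structure
  \<open>(x, y) \<mapsto> (x - y\<tau>)/n\<close> on \<open>\<complex>/(\<int> + \<int>\<tau>)\<close>.  With this choice multiplication by \<open>(c\<tau> + d)\<^sup>-\<^sup>1\<close> identifies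
  the pair given by \<open>(\<tau>, g)\<close> with the pair given by \<open>(\<gamma>\<tau>, \<gamma>g)\<close> for every \<open>\<gamma> = (a b; c d)\<close> in \<open>SL\<^sub>2(\<int>)\<close>, so
  \<open>Y\<^sub>H(\<complex>)\<close> is the quotient of \<open>\<H> \<times> GL\<^sub>2(\<int>/n\<int>)\<close> by \<open>SL\<^sub>2(\<int>)\<close> acting diagonally on the left and \<open>H\<close>
  acting on the second factor on the right.
\<close>

definition std_pair :: "nat \<Rightarrow> complex \<Rightarrow> int^2^2 \<Rightarrow> level_pair" where
  "std_pair n \<tau> g =
     (period_lattice 1 \<tau>,
      \<lambda>v. let w = g *v v
          in torus_point (period_lattice 1 \<tau>) ((of_int (w $ 1) - of_int (w $ 2) * \<tau>) / of_nat n))"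

text \<open>
  The compactification adds the quotient of \<open>\<P>\<^sup>1(\<rat>) \<times> GL\<^sub>2(\<int>/n\<int>)\<close> by the same action.  A point \<open>(x : y)\<close>
  of \<open>\<P>\<^sup>1(\<rat>)\<close> is represented by one of its two primitive integer vectors, whence the sign \<open>\<epsilon>\<close>.
\<close>

definition cusp_pairs :: "nat \<Rightarrow> ((int^2) \<times> (int^2^2)) set" where
  "cusp_pairs n = {(c, g). coprime (c $ 1) (c $ 2) \<and> g \<in> carrier (GL2 n)}"

definition cusp_rel ::
  "nat \<Rightarrow> (int^2^2) set \<Rightarrow> (((int^2) \<times> (int^2^2)) \<times> ((int^2) \<times> (int^2^2))) set" where
  "cusp_rel n H =
     {((c, g), (c', g')).
        (c, g) \<in> cusp_pairs n \<and> (c', g') \<in> cusp_pairs n \<and>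
        (\<exists>\<gamma> \<in> SL2Z. \<exists>h \<in> H. \<exists>\<epsilon> \<in> {1, -1}. c' = \<epsilon> *s (\<gamma> *v c) \<and> g' = red_mat n (\<gamma> ** g ** h))}"

datatype modular_point =
    Noncusp "level_pair set"
  | Cusp "((int^2) \<times> (int^2^2)) set"

definition ell_point :: "nat \<Rightarrow> (int^2^2) set \<Rightarrow> level_pair \<Rightarrow> modular_point" where
  "ell_point n H p = Noncusp (level_rel n H `` {p})"

definition cusp_point :: "nat \<Rightarrow> (int^2^2) set \<Rightarrow> (int^2) \<times> (int^2^2) \<Rightarrow> modular_point" where
  "cusp_point n H c = Cusp (cusp_rel n H `` {c})"

definition Y_points :: "nat \<Rightarrow> (int^2^2) set \<Rightarrow> modular_point set" where
  "Y_points n H = ell_point n H ` level_pairs n"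

definition cusps :: "nat \<Rightarrow> (int^2^2) set \<Rightarrow> modular_point set" where
  "cusps n H = cusp_point n H ` cusp_pairs n"

definition X_points :: "nat \<Rightarrow> (int^2^2) set \<Rightarrow> modular_point set" where
  "X_points n H = Y_points n H \<union> cusps n H"

text \<open>
  The analytic topology of \<open>X\<^sub>H(\<complex>)\<close> is the quotient topology from \<open>\<H>\<^sup>* \<times> GL\<^sub>2(\<int>/n\<int>)\<close>, where the second
  factor is discrete and a basis of neighbourhoods of the cusp \<open>(x : y)\<close> in \<open>\<H>\<^sup>*\<close> is given by
  the horoballs \<open>{\<tau>. Im \<tau> > A \<bar>x - y\<tau>\<bar>\<^sup>2}\<close>; for \<open>(1 : 0) = \<infinity>\<close> this reads \<open>Im \<tau> > A\<close>.
\<close>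

definition X_open :: "nat \<Rightarrow> (int^2^2) set \<Rightarrow> modular_point set \<Rightarrow> bool" where
  "X_open n H U \<longleftrightarrow>
     U \<subseteq> X_points n H \<and>
     (\<forall>g \<in> carrier (GL2 n). open {\<tau>. Im \<tau> > 0 \<and> ell_point n H (std_pair n \<tau> g) \<in> U}) \<and>
     (\<forall>(c, g) \<in> cusp_pairs n. cusp_point n H (c, g) \<in> U \<longrightarrow>
        (\<exists>A > 0. \<forall>\<tau>. Im \<tau> > 0 \<and> Im \<tau> > A * (cmod (of_int (c $ 1) - of_int (c $ 2) * \<tau>))\<^sup>2
                   \<longrightarrow> ell_point n H (std_pair n \<tau> g) \<in> U))"

definition X_top :: "nat \<Rightarrow> (int^2^2) set \<Rightarrow> modular_point topology" where
  "X_top n H = topology (X_open n H)"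

lemma istopology_X_open: "istopology (X_open n H)"
proof -
  let ?e = "\<lambda>\<tau> g. ell_point n H (std_pair n \<tau> g)"
  have "X_open n H (S \<inter> T)" if S: "X_open n H S" and T: "X_open n H T" for S T
    unfolding X_open_def
  proof (intro conjI ballI)
    show "S \<inter> T \<subseteq> X_points n H" using S by (auto simp: X_open_def)
  next
    fix g assume g: "g \<in> carrier (GL2 n)"
    have "{\<tau>. Im \<tau> > 0 \<and> ?e \<tau> g \<in> S \<inter> T} =
          {\<tau>. Im \<tau> > 0 \<and> ?e \<tau> g \<in> S} \<inter> {\<tau>. Im \<tau> > 0 \<and> ?e \<tau> g \<in> T}" by auto
    then show "open {\<tau>. Im \<tau> > 0 \<and> ?e \<tau> g \<in> S \<inter> T}"
      using S T g by (auto simp: X_open_def intro: open_Int)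
  next
    fix p assume p: "p \<in> cusp_pairs n"
    obtain c g where cg: "p = (c, g)" by (cases p)
    let ?q = "\<lambda>\<tau>. (cmod (of_int (c $ 1) - of_int (c $ 2) * \<tau>))\<^sup>2"
    have "\<exists>A>0. \<forall>\<tau>. Im \<tau> > 0 \<and> Im \<tau> > A * ?q \<tau> \<longrightarrow> ?e \<tau> g \<in> S \<inter> T"
      if hP: "cusp_point n H (c, g) \<in> S \<inter> T"
    proof -
      obtain A where A: "A > 0" "\<And>\<tau>. Im \<tau> > 0 \<Longrightarrow> Im \<tau> > A * ?q \<tau> \<Longrightarrow> ?e \<tau> g \<in> S"
        using S p hP unfolding X_open_def cg by fast
      obtain B where B: "B > 0" "\<And>\<tau>. Im \<tau> > 0 \<Longrightarrow> Im \<tau> > B * ?q \<tau> \<Longrightarrow> ?e \<tau> g \<in> T"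
        using T p hP unfolding X_open_def cg by fast
      have "A * ?q \<tau> \<le> max A B * ?q \<tau>" "B * ?q \<tau> \<le> max A B * ?q \<tau>" for \<tau>
        by (auto intro: mult_right_mono)
      then have "\<forall>\<tau>. Im \<tau> > 0 \<and> Im \<tau> > max A B * ?q \<tau> \<longrightarrow> ?e \<tau> g \<in> S \<inter> T"
        by (meson A(2) B(2) IntI le_less_trans)
      moreover have "max A B > 0" using A(1) by auto
      ultimately show ?thesis by blast
    qed
    then show "case p of (c, g) \<Rightarrow> cusp_point n H (c, g) \<in> S \<inter> T \<longrightarrow>
        (\<exists>A>0. \<forall>\<tau>. Im \<tau> > 0 \<and> Im \<tau> > A * (cmod (of_int (c $ 1) - of_int (c $ 2) * \<tau>))\<^sup>2
                 \<longrightarrow> ?e \<tau> g \<in> S \<inter> T)"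
      unfolding cg by simp
  qed
  moreover have "X_open n H (\<Union>K)" if K: "\<And>S. S \<in> K \<Longrightarrow> X_open n H S" for K
    unfolding X_open_def
  proof (intro conjI ballI)
    show "\<Union>K \<subseteq> X_points n H" using K unfolding X_open_def by (meson Sup_least)
  next
    fix g assume g: "g \<in> carrier (GL2 n)"
    have "{\<tau>. Im \<tau> > 0 \<and> ?e \<tau> g \<in> \<Union>K} = (\<Union>S\<in>K. {\<tau>. Im \<tau> > 0 \<and> ?e \<tau> g \<in> S})" by auto
    moreover have "open {\<tau>. Im \<tau> > 0 \<and> ?e \<tau> g \<in> S}" if "S \<in> K" for S
      using K[OF that] g by (auto simp: X_open_def)
    ultimately show "open {\<tau>. Im \<tau> > 0 \<and> ?e \<tau> g \<in> \<Union>K}" by auto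
  next
    fix p assume p: "p \<in> cusp_pairs n"
    obtain c g where cg: "p = (c, g)" by (cases p)
    have "\<exists>A>0. \<forall>\<tau>. Im \<tau> > 0 \<and> Im \<tau> > A * (cmod (of_int (c $ 1) - of_int (c $ 2) * \<tau>))\<^sup>2
                 \<longrightarrow> ?e \<tau> g \<in> \<Union>K" if hP: "cusp_point n H (c, g) \<in> \<Union>K"
    proof -
      obtain S where "S \<in> K" "cusp_point n H (c, g) \<in> S" using hP by blast
      then show ?thesis using K[of S] p unfolding X_open_def cg by fast
    qed
    then show "case p of (c, g) \<Rightarrow> cusp_point n H (c, g) \<in> \<Union>K \<longrightarrow>
        (\<exists>A>0. \<forall>\<tau>. Im \<tau> > 0 \<and> Im \<tau> > A * (cmod (of_int (c $ 1) - of_int (c $ 2) * \<tau>))\<^sup>2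
                 \<longrightarrow> ?e \<tau> g \<in> \<Union>K)"
      unfolding cg by simp
  qed
  ultimately show ?thesis unfolding istopology_def by blast
qed

lemma openin_X_top: "openin (X_top n H) U \<longleftrightarrow> X_open n H U"
  by (simp add: X_top_def topology_inverse' istopology_X_open)


section \<open>Divisors, pullback and pushforward\<close>

text \<open>
  The ramification index at \<open>a\<close> of a nonconstant holomorphic map of Riemann surfaces is its
  local degree: arbitrarily small neighbourhoods of \<open>a\<close> contain exactly \<open>k\<close> preimages of every
  point that is different from and sufficiently close to \<open>f a\<close>.  This determines \<open>k\<close>
  and depends only on the topologies.
\<close>

definition ram_index :: "'a topology \<Rightarrow> 'b topology \<Rightarrow> ('a \<Rightarrow> 'b) \<Rightarrow> 'a \<Rightarrow> nat" where
  "ram_index X Y f a =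
     (THE k. \<forall>U\<^sub>0. openin X U\<^sub>0 \<and> a \<in> U\<^sub>0 \<longrightarrow>
        (\<exists>U W. openin X U \<and> a \<in> U \<and> U \<subseteq> U\<^sub>0 \<and> openin Y W \<and> f a \<in> W \<and>
           (\<forall>y \<in> W - {f a}. finite {x \<in> U. f x = y} \<and> card {x \<in> U. f x = y} = k)))"

text \<open>A divisor is a finitely supported integer-valued function on points, of type \<^typ>\<open>'a \<Rightarrow>\<^sub>0 int\<close>.\<close>

definition div_pullback ::
  "'a topology \<Rightarrow> 'b topology \<Rightarrow> ('a \<Rightarrow> 'b) \<Rightarrow> ('b \<Rightarrow>\<^sub>0 int) \<Rightarrow> ('a \<Rightarrow>\<^sub>0 int)" where
  "div_pullback X Y f =
     frag_extend (\<lambda>P. \<Sum>R \<in> {R \<in> topspace X. f R = P}. frag_cmul (int (ram_index X Y f R)) (frag_of R))"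

definition div_pushforward :: "('a \<Rightarrow> 'b) \<Rightarrow> ('a \<Rightarrow>\<^sub>0 int) \<Rightarrow> ('b \<Rightarrow>\<^sub>0 int)" where
  "div_pushforward f = frag_extend (frag_of \<circ> f)"


section \<open>The Hecke operator\<close>

definition hecke_subgroup :: "nat \<Rightarrow> (int^2^2) set \<Rightarrow> nat \<Rightarrow> (int^2^2) set" where
  "hecke_subgroup n H l = {A \<in> carrier (GL2 (n * l)). red_mat n A \<in> H \<and> int l dvd A $ 2 $ 1}"

text \<open>
  The identification of \<open>(\<int>/n\<int>)\<^sup>2\<close> with the \<open>n\<close>-torsion of \<open>(\<int>/nl\<int>)\<^sup>2\<close> coming from the Chinese
  Remainder Theorem \<open>\<int>/nl\<int> \<cong> \<int>/n\<int> \<times> \<int>/l\<int>\<close>, for \<open>n\<close> and \<open>l\<close> coprime.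
\<close>

definition crt_embed :: "nat \<Rightarrow> nat \<Rightarrow> int^2 \<Rightarrow> int^2" where
  "crt_embed n l v =
     (\<chi> i. THE x. x \<in> {0..<int (n * l)} \<and> x mod int n = v $ i mod int n \<and> x mod int l = 0)"

definition pr_pair :: "nat \<Rightarrow> nat \<Rightarrow> level_pair \<Rightarrow> level_pair" where
  "pr_pair n l = (\<lambda>(\<Lambda>, \<phi>). (\<Lambda>, \<phi> \<circ> crt_embed n l))"

definition qt_pair :: "nat \<Rightarrow> nat \<Rightarrow> level_pair \<Rightarrow> level_pair" where
  "qt_pair n l = (\<lambda>(\<Lambda>, \<phi>).
     let C = generate (torus \<Lambda>) {\<phi> (vector [int n, 0])}
     in (quot_lattice C, quot_proj C \<circ> \<phi> \<circ> crt_embed n l))"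

text \<open>
  A morphism of modular curves is given on noncuspidal points by an operation \<open>F\<close> on pairs and
  extended to the cusps.  The extension is the unique continuous one, as \<open>Y\<^sub>H(\<complex>)\<close> is dense and the
  target is Hausdorff; it is holomorphic whenever \<open>F\<close> is holomorphic on \<open>Y\<^sub>H(\<complex>)\<close>.
\<close>

definition modular_morphism ::
  "nat \<Rightarrow> (int^2^2) set \<Rightarrow> nat \<Rightarrow> (int^2^2) set \<Rightarrow> (level_pair \<Rightarrow> level_pair)
     \<Rightarrow> modular_point \<Rightarrow> modular_point" where
  "modular_morphism m G n H F =
     (THE f. f \<in> extensional (X_points m G) \<and> continuous_map (X_top m G) (X_top n H) f \<and>
        (\<forall>p \<in> level_pairs m. f (ell_point m G p) = ell_point n H (F p)))"

definition pr_map :: "nat \<Rightarrow> (int^2^2) set \<Rightarrow> nat \<Rightarrow> modular_point \<Rightarrow> modular_point" where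
  "pr_map n H l = modular_morphism (n * l) (hecke_subgroup n H l) n H (pr_pair n l)"

definition qt_map :: "nat \<Rightarrow> (int^2^2) set \<Rightarrow> nat \<Rightarrow> modular_point \<Rightarrow> modular_point" where
  "qt_map n H l = modular_morphism (n * l) (hecke_subgroup n H l) n H (qt_pair n l)"

definition hecke ::
  "nat \<Rightarrow> (int^2^2) set \<Rightarrow> nat \<Rightarrow> (modular_point \<Rightarrow>\<^sub>0 int) \<Rightarrow> (modular_point \<Rightarrow>\<^sub>0 int)" where
  "hecke n H l =
     div_pushforward (qt_map n H l) \<circ>
     div_pullback (X_top (n * l) (hecke_subgroup n H l)) (X_top n H) (pr_map n H l)"

abbreviation multiplicity_at :: "('a \<Rightarrow>\<^sub>0 int) \<Rightarrow> 'a \<Rightarrow> int" where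
  "multiplicity_at D Q \<equiv> Poly_Mapping.lookup D Q"

text \<open>
  For \<open>\<alpha>\<close> with \<open>\<alpha>(\<int> + \<int>\<alpha>) = \<int> + \<int>\<alpha>\<close> (here \<open>\<alpha> = \<rho>, \<i>\<close>), the automorphism \<open>\<alpha>\<close> of \<open>E\<^sub>\<alpha> = \<complex>/(\<int> + \<int>\<alpha>)\<close> sends
  the coset \<open>X\<close> to its image \<open>\<alpha>X\<close>.
\<close>

definition represented_with_automorphism ::
  "complex \<Rightarrow> nat \<Rightarrow> (int^2^2) set \<Rightarrow> modular_point \<Rightarrow> bool" where
  "represented_with_automorphism \<alpha> n H P \<longleftrightarrow>
     (\<exists>\<phi>. (period_lattice 1 \<alpha>, \<phi>) \<in> level_pairs n \<and>
          P = ell_point n H (period_lattice 1 \<alpha>, \<phi>) \<and>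
          (\<exists>A \<in> plus_minus n H. level_matrix n \<phi> ((`) ((*) \<alpha>)) \<phi> A))"

end

theory Submission
  imports Defs
begin

text \<open>
  A point of \<open>X\<^sub>H\<close> is the class of a pair \<open>(x, g)\<close>, with \<open>x\<close> in the upper half-plane or a cusp and \<open>g\<close>
  an invertible matrix modulo \<open>n\<close>.  Its preimages under \<open>pr\<close> are the classes of \<open>(x, g\<^sub>\<sigma>)\<close>, where \<open>\<sigma>\<close>
  runs through the \<open>l + 1\<close> lines of \<open>(\<int>/l\<int>)\<^sup>2\<close>.  Only \<open>\<plusminus>1\<close> fixes a point near
  \<open>x\<close> other than \<open>x\<close> itself, hence the \<open>l + 1\<close> lifts of such a point are distinct, and the ramification index of a preimage is the number of lines that
  give it.  So \<open>T\<^sub>l(P)\<close> is the sum of the \<open>l + 1\<close> points \<open>qt(x, g\<^sub>\<sigma>)\<close>, at cusps too.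

  Over a cusp, a translation by a multiple of \<open>n\<close> permutes \<open>l\<close> of the lines cyclically, so the
  multiplicities are \<open>l\<close> and \<open>1\<close>, or \<open>l + 1\<close>.  Over \<open>\<tau>\<close>, a coincidence of the quotients by two lines gives
  an endomorphism \<open>B\<close> of norm \<open>l\<^sup>2\<close> compatible with the level structure.  If \<open>l\<close> divides \<open>B\<close>, then \<open>B/l\<close> is
  an automorphism carrying one line to the other.  Otherwise the two lines are the kernel and the image of
  \<open>B\<close> modulo \<open>l\<close>.  Since all endomorphisms commute, there is at most one such pair of lines, and
  automorphisms fix both of its members.  Hence automorphisms of order 3 (up to sign) give orbits of
  three lines and those of order 4 orbits of two lines; at most two lines are fixed, so for order 4
  there are at least two such orbits.  A curve without extra automorphisms gives at most one double point.
\<close>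

section \<open>Two by two integer matrices and congruences\<close>

text \<open>The two maps are specified only as continuous extensions from pairs, and the
  ramification index only as a topological count. So the topology has to be settled before any
  multiplicity can be computed, and one separation property of the \<open>SL2Z\<close> action on
  points and cusps (\<open>nbf_apart\<close>) carries it: it gives the Hausdorff property, hence
  unique extensions, and it keeps stabilizers near \<open>x\<close> inside the stabilizer of
  \<open>x\<close>, where two fixed points leave only the signs. The constant \<open>kk\<close>, an
  inverse of \<open>l\<close> modulo \<open>n\<close>, comes from the Chinese Remainder embedding of
  the n-torsion. It twists the level matrix under both maps, which is why a preimage
  (\<open>gs\<close>) is made to agree with \<open>l\<close> times \<open>g\<close> modulo
  \<open>n\<close>. The bound \<open>l \<ge> 5\<close> enters twice. At a cusp a fibre has at least
  \<open>l\<close> lines or at most one, which gives a multiplicity of at least 4 and excludes 2 and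
  3. At an elliptic point the characteristic polynomial has discriminant -4 or -3, a unit modulo
  \<open>l\<close>, so an automorphism fixes at most two of the \<open>l + 1\<close> lines and moves
  at least four.\<close>

definition mk2 :: "int \<Rightarrow> int \<Rightarrow> int \<Rightarrow> int \<Rightarrow> int^2^2" where
  "mk2 a b c d = vector [vector [a, b], vector [c, d]]"

lemma mk2_nth [simp]:
  "mk2 a b c d $ 1 $ 1 = a" "mk2 a b c d $ 1 $ 2 = b"
  "mk2 a b c d $ 2 $ 1 = c" "mk2 a b c d $ 2 $ 2 = d"
  by (simp_all add: mk2_def)

lemma mat2_eq_iff:
  "(A :: int^2^2) = B \<longleftrightarrow>
     A $ 1 $ 1 = B $ 1 $ 1 \<and> A $ 1 $ 2 = B $ 1 $ 2 \<and> A $ 2 $ 1 = B $ 2 $ 1 \<and> A $ 2 $ 2 = B $ 2 $ 2"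
  by (auto simp: vec_eq_iff forall_2)

lemma vec2_eq_iff: "(u :: int^2) = v \<longleftrightarrow> u $ 1 = v $ 1 \<and> u $ 2 = v $ 2"
  by (auto simp: vec_eq_iff forall_2)

lemma mult2_nth [simp]: "((A :: int^2^2) ** B) $ i $ j = A $ i $ 1 * B $ 1 $ j + A $ i $ 2 * B $ 2 $ j"
  by (simp add: matrix_matrix_mult_def sum_2)

lemma mv2_nth [simp]: "((A :: int^2^2) *v v) $ i = A $ i $ 1 * v $ 1 + A $ i $ 2 * v $ 2"
  by (simp add: matrix_vector_mult_def sum_2)

lemma mat_nth2 [simp]:
  "(mat k :: int^2^2) $ 1 $ 1 = k" "(mat k :: int^2^2) $ 1 $ 2 = 0"
  "(mat k :: int^2^2) $ 2 $ 1 = 0" "(mat k :: int^2^2) $ 2 $ 2 = k"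
  by (simp_all add: mat_def)

lemma uminus_nth2 [simp]: "(- (A :: int^2^2)) $ i $ j = - (A $ i $ j)"
  by simp

text \<open>The adjugate: the inverse of a matrix in \<open>SL2Z\<close>, and the dual isogeny when
  the matrix describes an isogeny of tori.\<close>

definition adj2 :: "int^2^2 \<Rightarrow> int^2^2" where
  "adj2 A = mk2 (A $ 2 $ 2) (- A $ 1 $ 2) (- A $ 2 $ 1) (A $ 1 $ 1)"

lemma adj2_nth [simp]:
  "adj2 A $ 1 $ 1 = A $ 2 $ 2" "adj2 A $ 1 $ 2 = - A $ 1 $ 2"
  "adj2 A $ 2 $ 1 = - A $ 2 $ 1" "adj2 A $ 2 $ 2 = A $ 1 $ 1"
  by (simp_all add: adj2_def)

definition scal :: "int \<Rightarrow> int^2^2 \<Rightarrow> int^2^2" where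
  "scal k A = (\<chi> i j. k * A $ i $ j)"

lemma scal_nth [simp]: "scal k A $ i $ j = k * A $ i $ j"
  by (simp add: scal_def)

lemma scal_mult [simp]: "scal k A ** B = scal k (A ** B)" "A ** scal k B = scal k (A ** B)"
  "scal j (scal k A) = scal (j * k) A" "scal 1 A = A" "scal (-1) A = - A"
  by (simp_all add: mat2_eq_iff algebra_simps)

lemma scal_eq_mat: "scal k A = mat k ** A"
  by (simp add: mat2_eq_iff)

lemma det_scal [simp]: "det (scal k A) = k * k * det A"
  by (simp add: det_2 algebra_simps)

lemma adj2_mult: "A ** adj2 A = scal (det A) (mat 1)" "adj2 A ** A = scal (det A) (mat 1)"
  by (simp_all add: mat2_eq_iff det_2 algebra_simps)

lemma det_adj2 [simp]: "det (adj2 A) = det (A :: int^2^2)"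
  by (simp add: det_2 algebra_simps)

lemma det_uminus2 [simp]: "det (- A) = det (A :: int^2^2)"
  by (simp add: det_2)

lemma SL2Z_iff: "A \<in> SL2Z \<longleftrightarrow> det A = 1"
  by (simp add: SL2Z_def)

lemma SL2Z_mult: "A \<in> SL2Z \<Longrightarrow> B \<in> SL2Z \<Longrightarrow> A ** B \<in> SL2Z"
  by (simp add: SL2Z_def det_mul)

lemma SL2Z_adj2: "A \<in> SL2Z \<Longrightarrow> adj2 A \<in> SL2Z"
  by (simp add: SL2Z_def)

lemma SL2Z_uminus: "A \<in> SL2Z \<Longrightarrow> - A \<in> SL2Z"
  by (simp add: SL2Z_def)

lemma SL2Z_one: "mat 1 \<in> SL2Z"
  by (simp add: SL2Z_def)

lemma SL2Z_adj2_mult: "A \<in> SL2Z \<Longrightarrow> A ** adj2 A = mat 1" "A \<in> SL2Z \<Longrightarrow> adj2 A ** A = mat 1"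
  by (simp_all add: adj2_mult SL2Z_def)

section \<open>Congruence of matrices modulo n and the group \<open>GL2 n\<close>\<close>

definition mcong :: "nat \<Rightarrow> int^2^2 \<Rightarrow> int^2^2 \<Rightarrow> bool" where
  "mcong n A B \<longleftrightarrow> red_mat n A = red_mat n B"

lemma red_mat_nth [simp]: "red_mat n A $ i $ j = A $ i $ j mod int n"
  by (simp add: red_mat_def)

lemma red_vec_nth [simp]: "red_vec n v $ i = v $ i mod int n"
  by (simp add: red_vec_def)

lemma mcong_nth: "mcong n A B \<Longrightarrow> A $ i $ j mod int n = B $ i $ j mod int n"
  unfolding mcong_def by (metis red_mat_nth)

lemma mcong_iff: "mcong n A B \<longleftrightarrow> (\<forall>i j. int n dvd A $ i $ j - B $ i $ j)"
  by (auto simp: mcong_def vec_eq_iff mod_eq_dvd_iff)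

lemma mcong_refl [simp]: "mcong n A A"
  by (simp add: mcong_def)

lemma mcong_sym: "mcong n A B \<Longrightarrow> mcong n B A"
  by (simp add: mcong_def)

lemma mcong_trans [trans]: "mcong n A B \<Longrightarrow> mcong n B C \<Longrightarrow> mcong n A C"
  by (simp add: mcong_def)

lemma red_mat_red_mat [simp]: "red_mat n (red_mat n A) = red_mat n A"
  by (simp add: mat2_eq_iff)

lemma red_vec_red_vec [simp]: "red_vec n (red_vec n v) = red_vec n v"
  by (simp add: vec2_eq_iff)

lemma mcong_red [simp]: "mcong n (red_mat n A) B \<longleftrightarrow> mcong n A B" "mcong n A (red_mat n B) \<longleftrightarrow> mcong n A B"
  by (simp_all add: mcong_def)

lemma mcong_mult:
  assumes "mcong n A A'" "mcong n B B'"
  shows "mcong n (A ** B) (A' ** B')"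
proof -
  have *: "red_mat n (A ** B) $ i $ j = red_mat n (A' ** B') $ i $ j" for i j
    unfolding red_mat_nth mult2_nth by (intro mod_add_cong mod_mult_cong mcong_nth assms)
  show ?thesis unfolding mcong_def by (simp only: vec_eq_iff *) simp
qed

lemma mcong_mult_left: "mcong n B B' \<Longrightarrow> mcong n (A ** B) (A ** B')"
  and mcong_mult_right: "mcong n B B' \<Longrightarrow> mcong n (B ** A) (B' ** A)"
  by (simp_all add: mcong_mult)

lemma mcong_uminus: "mcong n A B \<Longrightarrow> mcong n (- A) (- B)"
  unfolding mcong_iff by (metis (no_types, opaque_lifting) dvd_minus_iff minus_diff_minus uminus_nth2)

lemma mcong_dvd_mono: "mcong n A B \<Longrightarrow> m dvd n \<Longrightarrow> mcong m A B"
  unfolding mcong_iff by (meson dvd_trans of_nat_dvd_iff)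

lemma red_mat_eq_iff: "red_mat n A = red_mat n B \<longleftrightarrow> mcong n A B"
  by (simp add: mcong_def)

lemma mcong_coprime: "mcong n A B \<Longrightarrow> mcong l A B \<Longrightarrow> coprime n l \<Longrightarrow> mcong (n * l) A B"
  unfolding mcong_iff by (simp add: divides_mult)

lemma mcong_det: "mcong n A B \<Longrightarrow> det A mod int n = det B mod int n"
  unfolding det_2 by (intro mod_diff_cong mod_mult_cong mcong_nth)

lemma coprime_mod_cong: "a mod m = b mod m \<Longrightarrow> coprime a m \<longleftrightarrow> coprime b (m::int)"
  by (metis coprime_mod_left_iff mod_by_0)

lemma mcong_coprime_det: "mcong n A B \<Longrightarrow> coprime (det A) (int n) \<longleftrightarrow> coprime (det B) (int n)"
  using mcong_det coprime_mod_cong by blast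

lemma exists_inverse_mod:
  assumes "coprime a (m::int)" shows "\<exists>b. m dvd a * b - 1"
proof -
  obtain u v where "u * a + v * m = gcd a m" using bezout_int by blast
  then have "a * u - 1 = m * (- v)" using assms by (simp add: algebra_simps)
  then show ?thesis by (metis dvd_triv_left)
qed

lemma mcong_scal: "int n dvd j - k \<Longrightarrow> mcong n A B \<Longrightarrow> mcong n (scal j A) (scal k B)"
  unfolding scal_eq_mat by (rule mcong_mult) (auto simp: mcong_iff mat_def)

lemma mcong_scal_one: "int n dvd k - 1 \<Longrightarrow> mcong n (scal k A) A"
  using mcong_scal[of n k 1 A A] by simp

text \<open>Multiplicativity of the determinant gives one inclusion. For the other, the adjugate
  scaled by an inverse of the determinant modulo \<open>n\<close> is a two-sided inverse.\<close>

lemma carrier_GL2: "carrier (GL2 n) = {A. red_mat n A = A \<and> coprime (det A) (int n)}" (is "?L = ?R")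
proof (intro equalityI subsetI)
  fix A assume "A \<in> ?L"
  then obtain B where A: "red_mat n A = A" and B: "red_mat n (A ** B) = red_mat n (mat 1)"
    by (auto simp: GL2_def units_of_def Units_def mat2_monoid_def)
  have "coprime (det (A ** B)) (int n)"
    using B mcong_coprime_det[of n "A ** B" "mat 1"] by (simp add: mcong_def)
  then show "A \<in> ?R" using A by (simp add: det_mul)
next
  fix A assume A: "A \<in> ?R"
  then obtain d where d: "int n dvd det A * d - 1" using exists_inverse_mod by blast
  let ?B = "scal d (adj2 A)"
  have AB: "mcong n (A ** ?B) (mat 1)" "mcong n (?B ** A) (mat 1)"
    using mcong_scal_one[OF d, of "mat 1"] by (simp_all add: adj2_mult mult.commute)
  have "mcong n (A ** red_mat n ?B) (mat 1)" "mcong n (red_mat n ?B ** A) (mat 1)"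
    using AB by (meson mcong_mult mcong_red mcong_refl mcong_trans)+
  then have "\<exists>B. red_mat n B = B \<and> red_mat n (B ** A) = red_mat n (mat 1) \<and> red_mat n (A ** B) = red_mat n (mat 1)"
    unfolding mcong_def using red_mat_red_mat by blast
  then show "A \<in> ?L" using A
    by (simp add: GL2_def units_of_def Units_def mat2_monoid_def)
qed

lemma mult_GL2 [simp]: "A \<otimes>\<^bsub>GL2 n\<^esub> B = red_mat n (A ** B)"
  by (simp add: GL2_def units_of_def mat2_monoid_def)

lemma one_GL2 [simp]: "\<one>\<^bsub>GL2 n\<^esub> = red_mat n (mat 1)"
  by (simp add: GL2_def units_of_def mat2_monoid_def)

lemma red_mult_red [simp]:
  "red_mat n (red_mat n A ** B) = red_mat n (A ** B)"
  "red_mat n (A ** red_mat n B) = red_mat n (A ** B)"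
  unfolding red_mat_eq_iff by (meson mcong_mult mcong_red mcong_refl)+

lemma monoid_mat2: "monoid (mat2_monoid n)"
  by (rule monoidI) (auto simp: mat2_monoid_def matrix_mul_assoc)

lemma group_GL2: "group (GL2 n)"
  unfolding GL2_def using monoid_mat2 by (rule monoid.units_group)

lemma subgroup_GL2D:
  assumes "subgroup H (GL2 n)"
  shows "A \<in> H \<Longrightarrow> A \<in> carrier (GL2 n)"
    and "red_mat n (mat 1) \<in> H"
    and "A \<in> H \<Longrightarrow> B \<in> H \<Longrightarrow> red_mat n (A ** B) \<in> H"
    and "A \<in> H \<Longrightarrow> \<exists>B\<in>H. mcong n (A ** B) (mat 1) \<and> mcong n (B ** A) (mat 1)"
proof -
  show 1: "A \<in> H \<Longrightarrow> A \<in> carrier (GL2 n)" for A using assms by (auto dest: subgroup.subset)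
  show "red_mat n (mat 1) \<in> H" using subgroup.one_closed[OF assms] by simp
  show "A \<in> H \<Longrightarrow> B \<in> H \<Longrightarrow> red_mat n (A ** B) \<in> H" using subgroup.m_closed[OF assms] by simp
  assume A: "A \<in> H"
  then have "inv\<^bsub>GL2 n\<^esub> A \<in> H" using subgroup.m_inv_closed[OF assms] by simp
  moreover have "A \<otimes>\<^bsub>GL2 n\<^esub> inv\<^bsub>GL2 n\<^esub> A = \<one>\<^bsub>GL2 n\<^esub>" "inv\<^bsub>GL2 n\<^esub> A \<otimes>\<^bsub>GL2 n\<^esub> A = \<one>\<^bsub>GL2 n\<^esub>"
    using group.r_inv[OF group_GL2] group.l_inv[OF group_GL2] 1[OF A] by auto
  ultimately show "\<exists>B\<in>H. mcong n (A ** B) (mat 1) \<and> mcong n (B ** A) (mat 1)"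
    by (auto simp: mcong_def)
qed

lemma GL2_D: "A \<in> carrier (GL2 n) \<Longrightarrow> red_mat n A = A"
  by (simp add: carrier_GL2)

lemma GL2_red_mem: "red_mat n A \<in> carrier (GL2 n) \<longleftrightarrow> coprime (det A) (int n)"
  using mcong_coprime_det[of n "red_mat n A" A] by (simp add: carrier_GL2)

lemma GL2_coprime: "A \<in> carrier (GL2 n) \<Longrightarrow> coprime (det A) (int n)"
  by (simp add: carrier_GL2)

lemma crt_int:
  assumes "coprime (a::int) b" shows "\<exists>x. a dvd x - u \<and> b dvd x - v"
proof -
  obtain s where s: "b dvd a * s - 1" using exists_inverse_mod assms by blast
  have "b dvd (a * s - 1) * (v - u)" using s by simp
  moreover have "(a * s - 1) * (v - u) = (u + a * s * (v - u)) - v" by (simp add: algebra_simps)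
  ultimately show ?thesis by (intro exI[of _ "u + a * s * (v - u)"]) auto
qed

text \<open>The Chinese Remainder Theorem entry by entry. The result is reduced modulo
  \<open>n * l\<close>, so that it can itself be an element of \<open>GL2 (n * l)\<close>.\<close>

lemma crt_mat:
  assumes "coprime n l"
  shows "\<exists>M. red_mat (n * l) M = M \<and> mcong n M A \<and> mcong l M B"
proof -
  have c: "coprime (int n) (int l)" using assms by simp
  define f where "f i j = (SOME x. int n dvd x - A $ i $ j \<and> int l dvd x - B $ i $ j)" for i j
  have f: "int n dvd f i j - A $ i $ j \<and> int l dvd f i j - B $ i $ j" for i j
    unfolding f_def by (rule someI_ex[OF crt_int[OF c]])
  let ?M = "(\<chi> i j. f i j) :: int^2^2"
  have "mcong n ?M A" "mcong l ?M B" using f by (auto simp: mcong_iff)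
  moreover have "mcong n (red_mat (n * l) ?M) ?M" "mcong l (red_mat (n * l) ?M) ?M"
    by (rule mcong_dvd_mono[of "n * l"]; simp)+
  ultimately show ?thesis by (metis mcong_trans red_mat_red_mat)
qed

section \<open>The action on the upper half-plane and on the rational cusps\<close>

text \<open>The automorphy factor of the action.\<close>

definition den :: "int^2^2 \<Rightarrow> complex \<Rightarrow> complex" where
  "den \<gamma> \<tau> = of_int (\<gamma> $ 2 $ 1) * \<tau> + of_int (\<gamma> $ 2 $ 2)"

definition num :: "int^2^2 \<Rightarrow> complex \<Rightarrow> complex" where
  "num \<gamma> \<tau> = of_int (\<gamma> $ 1 $ 1) * \<tau> + of_int (\<gamma> $ 1 $ 2)"

definition mob :: "int^2^2 \<Rightarrow> complex \<Rightarrow> complex" where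
  "mob \<gamma> \<tau> = num \<gamma> \<tau> / den \<gamma> \<tau>"

text \<open>The lattice element with coordinate vector \<open>v\<close>, in the sign convention of
  \<open>std_pair\<close>. For a primitive vector the same expression measures the distance to the
  cusp in the definition of the horoballs.\<close>

definition Jf :: "int^2 \<Rightarrow> complex \<Rightarrow> complex" where
  "Jf v \<tau> = of_int (v $ 1) - of_int (v $ 2) * \<tau>"

lemma of_int_lin_eq_0:
  assumes "Im \<tau> > 0" shows "of_int a * \<tau> + of_int b = 0 \<longleftrightarrow> a = 0 \<and> b = 0"
  using assms by (auto simp: complex_eq_iff)

lemma of_int_lin_eq_iff:
  assumes "Im \<tau> > 0"
  shows "of_int a * \<tau> + of_int b = of_int c * \<tau> + of_int d \<longleftrightarrow> a = c \<and> b = d"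
  using assms by (auto simp: complex_eq_iff)

lemma Jf_eq_0: "Im \<tau> > 0 \<Longrightarrow> Jf v \<tau> = 0 \<longleftrightarrow> v = 0"
  by (auto simp: Jf_def complex_eq_iff vec2_eq_iff)

lemma Jf_inj: "Im \<tau> > 0 \<Longrightarrow> Jf v \<tau> = Jf w \<tau> \<longleftrightarrow> v = w"
  by (auto simp: Jf_def complex_eq_iff vec2_eq_iff)

lemma den_nz:
  assumes "Im \<tau> > 0" "det \<gamma> \<noteq> 0" shows "den \<gamma> \<tau> \<noteq> 0"
  using assms of_int_lin_eq_0[OF assms(1)] by (auto simp: den_def det_2)

lemma Im_mob:
  assumes "Im \<tau> > 0" "det \<gamma> \<noteq> 0"
  shows "Im (mob \<gamma> \<tau>) = of_int (det \<gamma>) * Im \<tau> / (cmod (den \<gamma> \<tau>))\<^sup>2"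
proof -
  have "Im (num \<gamma> \<tau> * cnj (den \<gamma> \<tau>)) = of_int (det \<gamma>) * Im \<tau>"
    by (simp add: num_def den_def det_2 algebra_simps)
  moreover have "mob \<gamma> \<tau> = (num \<gamma> \<tau> * cnj (den \<gamma> \<tau>)) / of_real ((cmod (den \<gamma> \<tau>))\<^sup>2)"
    using den_nz[OF assms] unfolding mob_def complex_norm_square by simp
  ultimately show ?thesis by (metis Im_divide_of_real)
qed

lemma Im_mob_pos: "Im \<tau> > 0 \<Longrightarrow> det \<gamma> > 0 \<Longrightarrow> Im (mob \<gamma> \<tau>) > 0"
  using den_nz[of \<tau> \<gamma>] by (simp add: Im_mob)

lemma Im_mob_SL2Z: "Im \<tau> > 0 \<Longrightarrow> \<gamma> \<in> SL2Z \<Longrightarrow> Im (mob \<gamma> \<tau>) > 0"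
  by (simp add: Im_mob_pos SL2Z_iff)

lemma den_mult:
  assumes "Im \<tau> > 0" "det \<delta> \<noteq> 0"
  shows "den (\<gamma> ** \<delta>) \<tau> = den \<gamma> (mob \<delta> \<tau>) * den \<delta> \<tau>"
    and "num (\<gamma> ** \<delta>) \<tau> = num \<gamma> (mob \<delta> \<tau>) * den \<delta> \<tau>"
proof -
  have *: "mob \<delta> \<tau> * den \<delta> \<tau> = num \<delta> \<tau>" using den_nz[OF assms] by (simp add: mob_def)
  have "den \<gamma> (mob \<delta> \<tau>) * den \<delta> \<tau> = of_int (\<gamma> $ 2 $ 1) * (mob \<delta> \<tau> * den \<delta> \<tau>) + of_int (\<gamma> $ 2 $ 2) * den \<delta> \<tau>"
    by (simp add: den_def algebra_simps)
  then show "den (\<gamma> ** \<delta>) \<tau> = den \<gamma> (mob \<delta> \<tau>) * den \<delta> \<tau>"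
    unfolding * by (simp add: den_def num_def algebra_simps)
  have "num \<gamma> (mob \<delta> \<tau>) * den \<delta> \<tau> = of_int (\<gamma> $ 1 $ 1) * (mob \<delta> \<tau> * den \<delta> \<tau>) + of_int (\<gamma> $ 1 $ 2) * den \<delta> \<tau>"
    by (simp add: num_def algebra_simps)
  then show "num (\<gamma> ** \<delta>) \<tau> = num \<gamma> (mob \<delta> \<tau>) * den \<delta> \<tau>"
    unfolding * by (simp add: den_def num_def algebra_simps)
qed

lemma mob_mult:
  assumes "Im \<tau> > 0" "det \<delta> \<noteq> 0"
  shows "mob (\<gamma> ** \<delta>) \<tau> = mob \<gamma> (mob \<delta> \<tau>)"
  using den_nz[OF assms] by (simp add: mob_def[of \<gamma>] mob_def[of "\<gamma> ** \<delta>"] den_mult[OF assms])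

lemma mob_one [simp]: "mob (mat 1) \<tau> = \<tau>"
  by (simp add: mob_def num_def den_def)

lemma mob_scal: "k \<noteq> 0 \<Longrightarrow> mob (scal k \<gamma>) \<tau> = mob \<gamma> \<tau>"
proof -
  assume k: "k \<noteq> 0"
  have "num (scal k \<gamma>) \<tau> = of_int k * num \<gamma> \<tau>" "den (scal k \<gamma>) \<tau> = of_int k * den \<gamma> \<tau>"
    by (simp_all add: num_def den_def algebra_simps)
  then show ?thesis using k by (simp add: mob_def)
qed

lemma mob_uminus [simp]: "mob (- \<gamma>) \<tau> = mob \<gamma> \<tau>"
  using mob_scal[of "-1" \<gamma> \<tau>] by simp

lemma mob_adj2:
  assumes "Im \<tau> > 0" "det \<gamma> \<noteq> 0" shows "mob (adj2 \<gamma>) (mob \<gamma> \<tau>) = \<tau>"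
  using mob_mult[OF assms, of "adj2 \<gamma>"] assms by (simp add: adj2_mult mob_scal)

lemma mob_adj2_SL2Z: "Im \<tau> > 0 \<Longrightarrow> \<gamma> \<in> SL2Z \<Longrightarrow> mob (adj2 \<gamma>) (mob \<gamma> \<tau>) = \<tau>"
  by (simp add: mob_adj2 SL2Z_iff)

lemma mob_mult_SL2Z: "Im \<tau> > 0 \<Longrightarrow> \<delta> \<in> SL2Z \<Longrightarrow> mob (\<gamma> ** \<delta>) \<tau> = mob \<gamma> (mob \<delta> \<tau>)"
  by (simp add: mob_mult SL2Z_iff)

lemma mob_eq_iff:
  assumes "Im \<tau> > 0" "det \<gamma> \<noteq> 0" shows "mob \<gamma> \<tau> = \<sigma> \<longleftrightarrow> num \<gamma> \<tau> = \<sigma> * den \<gamma> \<tau>"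
  using den_nz[OF assms] by (simp add: mob_def field_simps)

text \<open>The transformation law behind both uses of \<open>Jf\<close>: multiplying coordinate
  vectors by \<gamma> rescales the lattice by the inverse automorphy factor, times the
  determinant.\<close>

lemma Jf_mob:
  assumes "Im \<tau> > 0" "det \<gamma> \<noteq> 0"
  shows "Jf (\<gamma> *v w) (mob \<gamma> \<tau>) * den \<gamma> \<tau> = of_int (det \<gamma>) * Jf w \<tau>"
proof -
  have *: "mob \<gamma> \<tau> * den \<gamma> \<tau> = num \<gamma> \<tau>" using den_nz[OF assms] by (simp add: mob_def)
  have "Jf (\<gamma> *v w) (mob \<gamma> \<tau>) * den \<gamma> \<tau> =
      of_int ((\<gamma> *v w) $ 1) * den \<gamma> \<tau> - of_int ((\<gamma> *v w) $ 2) * (mob \<gamma> \<tau> * den \<gamma> \<tau>)"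
    by (simp add: Jf_def algebra_simps)
  also have "\<dots> = of_int (det \<gamma>) * Jf w \<tau>"
    unfolding * by (simp add: Jf_def num_def den_def det_2 algebra_simps)
  finally show ?thesis .
qed

text \<open>By \<open>Im_mob\<close> and \<open>Jf_mob\<close> both sides of the inequality change
  by the squared modulus of the same automorphy factor.\<close>

lemma horoball_mob:
  assumes "Im \<tau> > 0" "\<gamma> \<in> SL2Z"
  shows "Im (mob \<gamma> \<tau>) > A * (cmod (Jf (\<gamma> *v c) (mob \<gamma> \<tau>)))\<^sup>2 \<longleftrightarrow> Im \<tau> > A * (cmod (Jf c \<tau>))\<^sup>2"
proof -
  have d: "det \<gamma> = 1" using assms(2) by (simp add: SL2Z_iff)
  have nz: "den \<gamma> \<tau> \<noteq> 0" using den_nz assms d by simp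
  have "Jf c \<tau> = Jf (\<gamma> *v c) (mob \<gamma> \<tau>) * den \<gamma> \<tau>" using Jf_mob[OF assms(1), of \<gamma> c] d by simp
  then have "A * (cmod (Jf c \<tau>))\<^sup>2 = (A * (cmod (Jf (\<gamma> *v c) (mob \<gamma> \<tau>)))\<^sup>2) * (cmod (den \<gamma> \<tau>))\<^sup>2"
    by (simp add: norm_mult power_mult_distrib)
  moreover have "Im \<tau> = Im (mob \<gamma> \<tau>) * (cmod (den \<gamma> \<tau>))\<^sup>2"
    using Im_mob[OF assms(1), of \<gamma>] d nz by simp
  ultimately show ?thesis using nz by (metis mult_less_cancel_right_disj norm_eq_zero zero_less_power2 not_less_iff_gr_or_eq zero_le_power2 linorder_not_le)
qed

lemma tendsto_mob:
  assumes "Im \<tau> > 0" "det \<gamma> \<noteq> 0" shows "filterlim (mob \<gamma>) (nhds (mob \<gamma> \<tau>)) (nhds \<tau>)"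
proof -
  have "isCont (\<lambda>\<tau>. (of_int (\<gamma> $ 1 $ 1) * \<tau> + of_int (\<gamma> $ 1 $ 2)) / (of_int (\<gamma> $ 2 $ 1) * \<tau> + of_int (\<gamma> $ 2 $ 2))) \<tau>"
    using den_nz[OF assms] by (intro continuous_intros) (simp add: den_def)
  then have "isCont (mob \<gamma>) \<tau>" by (simp add: mob_def[abs_def] num_def den_def)
  then show ?thesis unfolding isCont_def tendsto_at_iff_tendsto_nhds .
qed

text \<open>
  Interior points and cusps are treated alike: each comes with a filter on the upper half-plane, so that
  the topology of \<open>X\<^sub>H\<close> is described by one condition.
\<close>

datatype hpt = Pt complex | Cu "int^2"

fun vx :: "hpt \<Rightarrow> bool" where
  "vx (Pt \<tau>) \<longleftrightarrow> Im \<tau> > 0"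
| "vx (Cu c) \<longleftrightarrow> coprime (c $ 1) (c $ 2)"

fun act :: "int^2^2 \<Rightarrow> hpt \<Rightarrow> hpt" where
  "act \<gamma> (Pt \<tau>) = Pt (mob \<gamma> \<tau>)"
| "act \<gamma> (Cu c) = Cu (\<gamma> *v c)"

text \<open>A cusp has two primitive representatives, so equality of points is this relation and not
  equality of \<open>hpt\<close>.\<close>

fun xeq :: "hpt \<Rightarrow> hpt \<Rightarrow> bool" where
  "xeq (Pt \<tau>) (Pt \<sigma>) \<longleftrightarrow> \<tau> = \<sigma>"
| "xeq (Cu c) (Cu d) \<longleftrightarrow> c = d \<or> c = - d"
| "xeq _ _ \<longleftrightarrow> False"

section \<open>Horoballs and neighbourhood filters\<close>

definition hb :: "real \<Rightarrow> int^2 \<Rightarrow> complex set" where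
  "hb A c = {\<tau>. Im \<tau> > 0 \<and> Im \<tau> > A * (cmod (Jf c \<tau>))\<^sup>2}"

fun nbf :: "hpt \<Rightarrow> complex filter" where
  "nbf (Pt \<tau>) = nhds \<tau>"
| "nbf (Cu c) = (INF A\<in>{0<..}. principal (hb A c))"

lemma hb_mono: "A \<le> B \<Longrightarrow> hb B c \<subseteq> hb A c"
  unfolding hb_def by (auto intro: le_less_trans[OF mult_right_mono])

lemma eventually_nbf_Cu:
  "eventually P (nbf (Cu c)) \<longleftrightarrow> (\<exists>A>0. \<forall>\<tau>\<in>hb A c. P \<tau>)"
proof -
  have "eventually P (nbf (Cu c)) \<longleftrightarrow> (\<exists>A\<in>{0<..}. eventually P (principal (hb A c)))"
    unfolding nbf.simps
  proof (rule eventually_INF_base)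
    show "{0<..} \<noteq> ({}::real set)" by auto
    fix A B :: real assume "A \<in> {0<..}" "B \<in> {0<..}"
    then show "\<exists>C\<in>{0<..}. principal (hb C c) \<le> inf (principal (hb A c)) (principal (hb B c))"
      using hb_mono[of A "max A B" c] hb_mono[of B "max A B" c] by (intro bexI[of _ "max A B"]) auto
  qed
  then show ?thesis by (auto simp: eventually_principal)
qed

lemma open_hb: "open (hb A c)"
  unfolding hb_def Jf_def by (intro open_Collect_conj open_Collect_less continuous_intros)

lemma eventually_Im_pos: "vx x \<Longrightarrow> eventually (\<lambda>\<tau>. Im \<tau> > 0) (nbf x)"
proof (cases x)
  case (Pt \<tau>)
  assume "vx x"
  then have "\<tau> \<in> {\<tau>. Im \<tau> > 0}" using Pt by simp
  moreover have "open {\<tau>. Im \<tau> > 0}" by (simp add: open_halfspace_Im_gt)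
  ultimately have "eventually (\<lambda>\<tau>. \<tau> \<in> {\<tau>. Im \<tau> > 0}) (nhds \<tau>)" by (metis eventually_nhds)
  then show ?thesis using Pt by simp
next
  case (Cu c)
  then show ?thesis unfolding Cu eventually_nbf_Cu by (auto simp: hb_def intro!: exI[of _ 1])
qed

text \<open>Turns an eventual property into an open subset of the half-plane, the form that
  \<open>X_open_base\<close> takes. The last clause keeps an interior centre inside
  \<open>V\<close>; a cusp has no representative in the plane.\<close>

lemma nbf_open:
  assumes "vx x" "eventually P (nbf x)"
  obtains V where "open V" "\<And>\<tau>. \<tau> \<in> V \<Longrightarrow> Im \<tau> > 0" "\<And>\<tau>. \<tau> \<in> V \<Longrightarrow> P \<tau>"
    "eventually (\<lambda>\<tau>. \<tau> \<in> V) (nbf x)" "\<And>\<tau>. x = Pt \<tau> \<Longrightarrow> \<tau> \<in> V"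
proof -
  have ev: "eventually (\<lambda>\<tau>. P \<tau> \<and> Im \<tau> > 0) (nbf x)"
    using assms eventually_Im_pos by (simp add: eventually_conj)
  show thesis
  proof (cases x)
    case (Pt \<tau>)
    with ev obtain V where "open V" "\<tau> \<in> V" "\<forall>\<tau>\<in>V. P \<tau> \<and> Im \<tau> > 0" by (auto simp: eventually_nhds)
    then show thesis using Pt that[of V] by (auto simp: eventually_nhds)
  next
    case (Cu c)
    with ev obtain A where "A > 0" "\<forall>\<tau>\<in>hb A c. P \<tau> \<and> Im \<tau> > 0" by (auto simp: eventually_nbf_Cu simp del: nbf.simps)
    then show thesis using Cu that[of "hb A c"] open_hb
      by (auto simp: eventually_nbf_Cu simp del: nbf.simps)
  qed
qed

lemma exists_SL2Z_column:
  assumes "coprime (c $ 1) (c $ 2 :: int)" shows "\<exists>\<gamma>\<in>SL2Z. \<gamma> *v vector [1, 0] = c"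
proof -
  obtain u v where "u * c $ 1 + v * c $ 2 = 1" using assms bezout_int[of "c $ 1" "c $ 2"] by auto
  then have "mk2 (c $ 1) (- v) (c $ 2) u \<in> SL2Z" by (simp add: SL2Z_iff det_2 algebra_simps)
  moreover have "mk2 (c $ 1) (- v) (c $ 2) u *v vector [1, 0] = c" by (simp add: vec2_eq_iff)
  ultimately show ?thesis by blast
qed

lemma vx_act: "vx x \<Longrightarrow> \<gamma> \<in> SL2Z \<Longrightarrow> vx (act \<gamma> x)"
proof (cases x)
  case (Pt \<tau>) then show "vx x \<Longrightarrow> \<gamma> \<in> SL2Z \<Longrightarrow> vx (act \<gamma> x)" by (simp add: Im_mob_SL2Z)
next
  case (Cu c)
  assume x: "vx x" and g: "\<gamma> \<in> SL2Z"
  then obtain u v where uv: "u * c $ 1 + v * c $ 2 = 1" using Cu bezout_int[of "c $ 1" "c $ 2"] by auto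
  let ?d = "\<gamma> *v c"
  \<comment> \<open>The row of Bezout coefficients is multiplied by the adjugate of \<gamma>, so the
    combination only gains the factor \<open>det \<gamma>\<close>.\<close>
  have "(u * \<gamma> $ 2 $ 2 - v * \<gamma> $ 2 $ 1) * ?d $ 1 + (v * \<gamma> $ 1 $ 1 - u * \<gamma> $ 1 $ 2) * ?d $ 2
      = det \<gamma> * (u * c $ 1 + v * c $ 2)" by (simp add: det_2 algebra_simps)
  also have "\<dots> = 1" using uv g by (simp add: SL2Z_iff)
  finally have "coprime (?d $ 1) (?d $ 2)" by (metis coprimeI dvd_add dvd_mult)
  then show ?thesis using Cu by simp
qed

lemma filterlim_act:
  assumes "vx x" "\<gamma> \<in> SL2Z" shows "filterlim (mob \<gamma>) (nbf (act \<gamma> x)) (nbf x)"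
proof (cases x)
  case (Pt \<tau>)
  then show ?thesis using assms tendsto_mob by (simp add: SL2Z_iff)
next
  case (Cu c)
  show ?thesis unfolding filterlim_iff Cu act.simps eventually_nbf_Cu
  proof (intro allI impI, elim exE conjE)
    fix P A assume "A > 0" "\<forall>\<tau>\<in>hb A (\<gamma> *v c). P \<tau>"
    then show "\<exists>A>0. \<forall>\<tau>\<in>hb A c. P (mob \<gamma> \<tau>)"
      using horoball_mob[OF _ assms(2), of _ A c] Im_mob_SL2Z[OF _ assms(2)]
      by (intro exI[of _ A]) (auto simp: hb_def)
  qed
qed

lemma hb_uminus: "hb A (- c) = hb A c"
proof -
  have "Jf (- c) \<tau> = - Jf c \<tau>" for \<tau> by (simp add: Jf_def)
  then show ?thesis by (simp add: hb_def norm_minus_cancel)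
qed

lemma nbf_xeq: "xeq x y \<Longrightarrow> nbf x = nbf y"
  by (cases x; cases y) (auto simp: hb_uminus)

lemma nbf_ne_bot: "vx x \<Longrightarrow> nbf x \<noteq> bot"
proof (cases x)
  case (Pt \<tau>) then show ?thesis by simp
next
  case (Cu c)
  have "hb A c \<noteq> {}" if A: "A > 0" for A
  proof (cases "c $ 2 = 0")
    case True
    define t where "t = A * (of_int (c $ 1))\<^sup>2 + 1"
    have "Jf c (\<i> * of_real t) = of_int (c $ 1)" using True by (simp add: Jf_def)
    then have "\<i> * of_real t \<in> hb A c"
      using A by (simp add: hb_def t_def[symmetric] add_nonneg_pos del: of_real_add) (simp add: t_def add_nonneg_pos)
    then show ?thesis by blast
  next
    case False
    \<comment> \<open>At a finite cusp the horoball is a disc tangent to the real line, and this is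
      the height of its centre.\<close>
    define t where "t = 1 / (2 * A * (of_int (c $ 2))\<^sup>2)"
    have t: "t > 0" using False A by (simp add: t_def)
    define \<tau> where "\<tau> = Complex (of_int (c $ 1) / of_int (c $ 2)) t"
    have "Jf c \<tau> = - of_int (c $ 2) * \<i> * of_real t"
      using False by (simp add: Jf_def \<tau>_def complex_eq_iff)
    then have "(cmod (Jf c \<tau>))\<^sup>2 = (of_int (c $ 2))\<^sup>2 * t\<^sup>2" by (simp add: norm_mult power_mult_distrib)
    moreover have "A * ((of_int (c $ 2))\<^sup>2 * t\<^sup>2) = t / 2"
      using A False by (simp add: t_def power2_eq_square field_simps)
    ultimately have "\<tau> \<in> hb A c" using t by (simp add: hb_def \<tau>_def)
    then show ?thesis by blast
  qed
  then show ?thesis unfolding Cu trivial_limit_def eventually_nbf_Cu by auto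
qed

section \<open>Proper discontinuity of the action, and stabilizers\<close>

text \<open>Coprimality turns proportionality into mutual divisibility of the coordinates, so they
  agree up to signs; the proportionality then excludes mixed signs.\<close>

lemma primitive_parallel:
  assumes "coprime (c $ 1) (c $ 2 :: int)" "coprime (d $ 1) (d $ 2 :: int)" "c $ 1 * d $ 2 = d $ 1 * c $ 2"
  shows "d = c \<or> d = - (c :: int^2)"
proof -
  have c1: "c $ 1 dvd d $ 1" using assms by (metis coprime_dvd_mult_left_iff dvd_triv_left)
  have c2: "c $ 2 dvd d $ 2" using assms by (metis coprime_dvd_mult_right_iff coprime_commute dvd_triv_right)
  have d1: "d $ 1 dvd c $ 1" using assms by (metis coprime_dvd_mult_left_iff dvd_triv_left)
  have d2: "d $ 2 dvd c $ 2" using assms by (metis coprime_dvd_mult_right_iff coprime_commute dvd_triv_right)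
  have "\<bar>c $ 1\<bar> = \<bar>d $ 1\<bar>" "\<bar>c $ 2\<bar> = \<bar>d $ 2\<bar>"
    using c1 c2 d1 d2 by (auto intro: zdvd_antisym_abs)
  then have a: "d $ 1 = c $ 1 \<or> d $ 1 = - c $ 1" "d $ 2 = c $ 2 \<or> d $ 2 = - c $ 2" by linarith+
  show ?thesis
  proof (cases "c $ 1 = 0 \<or> c $ 2 = 0")
    case True then show ?thesis using a by (auto simp: vec2_eq_iff)
  next
    case False then show ?thesis using a assms(3) by (auto simp: vec2_eq_iff)
  qed
qed

lemma Jf_cross: "Im (Jf c \<tau> * cnj (Jf d \<tau>)) = of_int (c $ 1 * d $ 2 - d $ 1 * c $ 2) * Im \<tau>"
  by (simp add: Jf_def algebra_simps)

text \<open>\<open>Jf_cross\<close> expresses the determinant of the two vectors times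
  \<open>Im \<tau>\<close> through their lattice elements. In both horoballs of depth 1 the
  arithmetic-geometric mean inequality makes this determinant smaller than 1, and it is an
  integer.\<close>

lemma horoballs_disjoint:
  assumes "coprime (c $ 1) (c $ 2)" "coprime (d $ 1) (d $ 2)" "\<tau> \<in> hb 1 c" "\<tau> \<in> hb 1 d"
  shows "d = c \<or> d = - c"
proof -
  have I: "Im \<tau> > 0" "Im \<tau> > (cmod (Jf c \<tau>))\<^sup>2" "Im \<tau> > (cmod (Jf d \<tau>))\<^sup>2" using assms by (auto simp: hb_def)
  let ?D = "c $ 1 * d $ 2 - d $ 1 * c $ 2"
  have "\<bar>of_int ?D * Im \<tau>\<bar> \<le> cmod (Jf c \<tau>) * cmod (Jf d \<tau>)"
    unfolding Jf_cross[symmetric] using abs_Im_le_cmod[of "Jf c \<tau> * cnj (Jf d \<tau>)"] by (simp add: norm_mult)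
  also have "\<dots> \<le> ((cmod (Jf c \<tau>))\<^sup>2 + (cmod (Jf d \<tau>))\<^sup>2) / 2"
    using sum_squares_bound[of "cmod (Jf c \<tau>)" "cmod (Jf d \<tau>)"] by simp
  also have "\<dots> < Im \<tau>" using I by simp
  finally have "\<bar>of_int ?D :: real\<bar> < 1" using I(1) by (simp add: abs_mult)
  then have "?D = 0" by linarith
  then show ?thesis using primitive_parallel assms by simp
qed

lemma hb_mob: "\<tau> \<in> hb A c \<Longrightarrow> \<gamma> \<in> SL2Z \<Longrightarrow> mob \<gamma> \<tau> \<in> hb A (\<gamma> *v c)"
  using horoball_mob[of \<tau> \<gamma> A c] Im_mob_SL2Z[of \<tau> \<gamma>] by (auto simp: hb_def)

lemma SL2Z_vec_cancel: "\<gamma> \<in> SL2Z \<Longrightarrow> \<gamma> *v (adj2 \<gamma> *v c) = c"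
  by (simp add: matrix_vector_mul_assoc SL2Z_adj2_mult)

text \<open>Moving the horoball back by \<gamma> only replaces \<open>c\<close> by another primitive
  vector \<open>d\<close>. For \<sigma> in \<open>V\<close> the modulus of
  \<open>Jf d \<sigma>\<close> is at least \<open>min 1 \<epsilon>\<close>: its imaginary part is
  large unless \<open>d $ 2 = 0\<close>, and then \<open>d $ 1\<close> is a sign.\<close>

lemma point_cusp_apart:
  assumes "Im \<tau> > 0" "coprime (c $ 1) (c $ 2)"
  shows "\<exists>V A. open V \<and> \<tau> \<in> V \<and> A > 0 \<and> (\<forall>\<gamma>\<in>SL2Z. \<forall>\<sigma>\<in>V. Im \<sigma> > 0 \<longrightarrow> mob \<gamma> \<sigma> \<notin> hb A c)"
proof -
  define \<epsilon> where "\<epsilon> = Im \<tau> / 2"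
  define M where "M = Im \<tau> + 1"
  \<comment> \<open>With this depth, the lower bound \<open>min 1 \<epsilon>\<close> for the modulus
    of \<open>Jf\<close> forces the points of the horoball to have height above
    \<open>M\<close>.\<close>
  define A where "A = M / (min 1 \<epsilon>)\<^sup>2"
  define V where "V = {\<sigma>. Im \<sigma> > \<epsilon>} \<inter> {\<sigma>. Im \<sigma> < M}"
  have pos: "\<epsilon> > 0" "M > 0" "A > 0" using assms(1) by (auto simp: \<epsilon>_def M_def A_def)
  have V: "open V" unfolding V_def by (intro open_Int open_halfspace_Im_gt open_halfspace_Im_lt)
  have tV: "\<tau> \<in> V" using assms(1) by (auto simp: V_def \<epsilon>_def M_def)
  have "mob \<gamma> \<sigma> \<notin> hb A c" if g: "\<gamma> \<in> SL2Z" and s: "\<sigma> \<in> V" "Im \<sigma> > 0" for \<gamma> \<sigma>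
  proof
    assume "mob \<gamma> \<sigma> \<in> hb A c"
    then have "mob (adj2 \<gamma>) (mob \<gamma> \<sigma>) \<in> hb A (adj2 \<gamma> *v c)" using hb_mob SL2Z_adj2 g by blast
    then have h: "\<sigma> \<in> hb A (adj2 \<gamma> *v c)" using mob_adj2_SL2Z g s by simp
    define d where "d = adj2 \<gamma> *v c"
    have "vx (act (adj2 \<gamma>) (Cu c))" using assms(2) g by (intro vx_act SL2Z_adj2) auto
    then have d: "coprime (d $ 1) (d $ 2)" by (simp add: d_def)
    have "min 1 \<epsilon> \<le> cmod (Jf d \<sigma>)"
    proof (cases "d $ 2 = 0")
      case True
      then have "\<bar>d $ 1\<bar> = 1" using d by simp
      then have "\<bar>of_int (d $ 1) :: real\<bar> = 1" by linarith
      then show ?thesis using True by (simp add: Jf_def)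
    next
      case False
      then have "1 \<le> \<bar>of_int (d $ 2) :: real\<bar>" by linarith
      then have "1 * Im \<sigma> \<le> \<bar>of_int (d $ 2)\<bar> * Im \<sigma>" using s by (intro mult_right_mono) auto
      also have "\<dots> = \<bar>Im (Jf d \<sigma>)\<bar>" using s by (simp add: Jf_def abs_mult)
      also have "\<dots> \<le> cmod (Jf d \<sigma>)" by (rule abs_Im_le_cmod)
      finally show ?thesis using s by (auto simp: V_def)
    qed
    then have "(min 1 \<epsilon>)\<^sup>2 \<le> (cmod (Jf d \<sigma>))\<^sup>2" using pos by (intro power_mono) auto
    then have "A * (min 1 \<epsilon>)\<^sup>2 \<le> A * (cmod (Jf d \<sigma>))\<^sup>2" using pos by simp
    moreover have "A * (min 1 \<epsilon>)\<^sup>2 = M" using pos by (simp add: A_def)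
    ultimately show False using h s by (auto simp: hb_def d_def V_def)
  qed
  then show ?thesis using V tV pos by blast
qed

lemma finite_bounded_mat2: "finite {A :: int^2^2. \<forall>i j. \<bar>A $ i $ j\<bar> \<le> B}"
proof -
  have "{A :: int^2^2. \<forall>i j. \<bar>A $ i $ j\<bar> \<le> B} \<subseteq>
        (\<lambda>(a, b, c, d). mk2 a b c d) ` ({-B..B} \<times> {-B..B} \<times> {-B..B} \<times> {-B..B})"
  proof
    fix A :: "int^2^2" assume "A \<in> {A. \<forall>i j. \<bar>A $ i $ j\<bar> \<le> B}"
    then have *: "A $ i $ j \<in> {-B..B}" for i j by (auto simp: abs_le_iff minus_le_iff)
    have "A = mk2 (A $ 1 $ 1) (A $ 1 $ 2) (A $ 2 $ 1) (A $ 2 $ 2)" by (simp add: mat2_eq_iff)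
    then show "A \<in> (\<lambda>(a, b, c, d). mk2 a b c d) ` ({-B..B} \<times> {-B..B} \<times> {-B..B} \<times> {-B..B})"
      using * by (intro image_eqI[of _ _ "(A $ 1 $ 1, A $ 1 $ 2, A $ 2 $ 1, A $ 2 $ 2)"]) auto
  qed
  then show ?thesis by (rule finite_subset) auto
qed

text \<open>The imaginary part bounds \<open>a\<close>, and the triangle inequality then bounds
  \<open>b\<close>. Applied to \<open>den\<close> and \<open>num\<close> it bounds the rows of a
  matrix.\<close>

lemma int_lin_bound:
  assumes "cmod (of_int a * \<sigma> + of_int b) \<le> K" "\<epsilon> \<le> Im \<sigma>" "cmod \<sigma> \<le> M" "\<epsilon> > 0"
  shows "\<bar>of_int a\<bar> \<le> K / \<epsilon>" "\<bar>of_int b\<bar> \<le> K + K / \<epsilon> * M"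
proof -
  have "\<bar>of_int a\<bar> * \<epsilon> \<le> \<bar>of_int a\<bar> * Im \<sigma>" using assms by (intro mult_left_mono) auto
  also have "\<dots> = \<bar>Im (of_int a * \<sigma> + of_int b)\<bar>" using assms by (simp add: abs_mult)
  also have "\<dots> \<le> K" using abs_Im_le_cmod assms(1) order_trans by blast
  finally show a: "\<bar>of_int a\<bar> \<le> K / \<epsilon>" using assms(4) by (simp add: field_simps)
  have "cmod (of_int b) \<le> cmod (of_int a * \<sigma> + of_int b) + cmod (of_int a * \<sigma>)"
    by (metis add_diff_cancel_left' norm_triangle_ineq4)
  also have "\<dots> \<le> K + K / \<epsilon> * M" unfolding norm_mult
    using assms a by (intro add_mono mult_mono) auto
  finally show "\<bar>of_int b\<bar> \<le> K + K / \<epsilon> * M" by simp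
qed

text \<open>Only the finitely many matrices in \<open>F\<close> map a point of \<open>W\<close> into
  \<open>W\<close>, because height bounds on both sides bound their entries. Each of them is treated
  by separating two points of the plane, and the neighbourhoods are intersected.\<close>

lemma points_apart:
  assumes "Im \<tau> > 0" "Im \<tau>' > 0"
  shows "\<exists>V V'. open V \<and> \<tau> \<in> V \<and> open V' \<and> \<tau>' \<in> V' \<and>
           (\<forall>\<gamma>\<in>SL2Z. \<forall>\<sigma>\<in>V. Im \<sigma> > 0 \<longrightarrow> mob \<gamma> \<sigma> \<in> V' \<longrightarrow> \<tau>' = mob \<gamma> \<tau>)"
proof -
  define \<epsilon> where "\<epsilon> = min (Im \<tau>) (Im \<tau>') / 2"
  define M where "M = max (cmod \<tau>) (cmod \<tau>') + 1"
  define W where "W = {\<sigma>. Im \<sigma> > \<epsilon>} \<inter> ball 0 M"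
  have pos: "\<epsilon> > 0" "M > 0"
    using assms norm_ge_zero[of \<tau>] unfolding \<epsilon>_def M_def by (auto intro: add_nonneg_pos simp: le_max_iff_disj)
  have oW: "open W" unfolding W_def by (intro open_Int open_halfspace_Im_gt open_ball)
  have W: "\<tau> \<in> W" "\<tau>' \<in> W" using assms by (auto simp: W_def \<epsilon>_def M_def)
  \<comment> \<open>\<open>K\<close> is at least 1, so that its square bounds
    \<open>M / \<epsilon>\<close> and hence the squared modulus of \<open>den\<close>. Then
    \<open>K * M\<close> bounds \<open>num\<close>, and \<open>R\<close> adds up the resulting
    bounds for all four entries.\<close>
  define K where "K = max 1 (M / \<epsilon>)"
  define R where "R = K * M + (K * M) / \<epsilon> * M + (K * M) / \<epsilon> + (K + K / \<epsilon> * M + K / \<epsilon>)"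
  define F where "F = {\<gamma> \<in> SL2Z. \<forall>i j. \<bar>\<gamma> $ i $ j\<bar> \<le> \<lceil>R\<rceil>}"
  have finF: "finite F" unfolding F_def by (rule finite_subset[OF _ finite_bounded_mat2[of "\<lceil>R\<rceil>"]]) auto
  have K: "K \<ge> 1" by (simp add: K_def)
  have "M / \<epsilon> \<le> K * 1" by (simp add: K_def)
  moreover have "K * 1 \<le> K * K" using K by (intro mult_left_mono) auto
  ultimately have KK: "M / \<epsilon> \<le> K * K" by linarith
  have inF: "\<gamma> \<in> F" if g: "\<gamma> \<in> SL2Z" and s: "\<sigma> \<in> W" "mob \<gamma> \<sigma> \<in> W" for \<gamma> \<sigma>
  proof -
    have d: "det \<gamma> = 1" using g by (simp add: SL2Z_iff)
    have Is: "Im \<sigma> > 0" "\<epsilon> \<le> Im \<sigma>" "cmod \<sigma> \<le> M" using s pos by (auto simp: W_def)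
    have nz: "den \<gamma> \<sigma> \<noteq> 0" using den_nz Is d by simp
    have "\<epsilon> < Im \<sigma> / (cmod (den \<gamma> \<sigma>))\<^sup>2" using s Im_mob[OF Is(1), of \<gamma>] d by (auto simp: W_def)
    then have "\<epsilon> * (cmod (den \<gamma> \<sigma>))\<^sup>2 < Im \<sigma>" using nz by (simp add: field_simps)
    also have "\<dots> \<le> M" using Is abs_Im_le_cmod[of \<sigma>] by linarith
    finally have "(cmod (den \<gamma> \<sigma>))\<^sup>2 \<le> M / \<epsilon>" using pos by (simp add: field_simps)
    then have "(cmod (den \<gamma> \<sigma>))\<^sup>2 \<le> K\<^sup>2" using KK unfolding power2_eq_square[of K] by linarith
    then have dK: "cmod (den \<gamma> \<sigma>) \<le> K" by (rule power2_le_imp_le) (use K in simp)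
    have "num \<gamma> \<sigma> = mob \<gamma> \<sigma> * den \<gamma> \<sigma>" using nz by (simp add: mob_def)
    then have "cmod (num \<gamma> \<sigma>) \<le> M * K" unfolding norm_mult
      using s dK pos by (auto simp: norm_mult W_def intro!: mult_mono)
    then have nK: "cmod (num \<gamma> \<sigma>) \<le> K * M" by (simp add: mult.commute)
    note bd = int_lin_bound[OF dK[unfolded den_def] Is(2,3) pos(1)]
    note bn = int_lin_bound[OF nK[unfolded num_def] Is(2,3) pos(1)]
    have ge0: "0 \<le> K * M" "0 \<le> K * M / \<epsilon> * M" "0 \<le> K * M / \<epsilon>" "0 \<le> K" "0 \<le> K / \<epsilon> * M" "0 \<le> K / \<epsilon>"
      using K pos by auto
    have "\<bar>of_int (\<gamma> $ i $ j) :: real\<bar> \<le> R" for i j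
    proof -
      have "\<bar>of_int (\<gamma> $ 1 $ 1) :: real\<bar> \<le> R" "\<bar>of_int (\<gamma> $ 1 $ 2) :: real\<bar> \<le> R"
        "\<bar>of_int (\<gamma> $ 2 $ 1) :: real\<bar> \<le> R" "\<bar>of_int (\<gamma> $ 2 $ 2) :: real\<bar> \<le> R"
        using bd bn ge0 unfolding R_def by linarith+
      then show ?thesis using exhaust_2[of i] exhaust_2[of j] by metis
    qed
    then have "\<bar>\<gamma> $ i $ j\<bar> \<le> \<lceil>R\<rceil>" for i j by (metis le_of_int_ceiling of_int_abs of_int_le_iff order_trans)
    then show ?thesis using g by (simp add: F_def)
  qed
  have "\<exists>V V'. open V \<and> \<tau> \<in> V \<and> open V' \<and> \<tau>' \<in> V' \<and> (\<forall>\<sigma>\<in>V. mob \<gamma> \<sigma> \<in> V' \<longrightarrow> \<tau>' = mob \<gamma> \<tau>)"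
    if g: "\<gamma> \<in> F" for \<gamma>
  proof (cases "\<tau>' = mob \<gamma> \<tau>")
    case True then show ?thesis by (intro exI[of _ UNIV]) auto
  next
    case False
    then obtain A B where AB: "open A" "open B" "\<tau>' \<in> A" "mob \<gamma> \<tau> \<in> B" "A \<inter> B = {}"
      using hausdorff[OF False] by auto
    have "filterlim (mob \<gamma>) (nbf (act \<gamma> (Pt \<tau>))) (nbf (Pt \<tau>))"
      using filterlim_act[of "Pt \<tau>" \<gamma>] assms g by (simp add: F_def)
    then have "filterlim (mob \<gamma>) (nhds (mob \<gamma> \<tau>)) (nhds \<tau>)" by simp
    then have "eventually (\<lambda>\<sigma>. mob \<gamma> \<sigma> \<in> B) (nhds \<tau>)"
      using AB(2,4) by (rule topological_tendstoD)
    then obtain V where "open V" "\<tau> \<in> V" "\<forall>\<sigma>\<in>V. mob \<gamma> \<sigma> \<in> B" by (auto simp: eventually_nhds)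
    then show ?thesis using AB by (intro exI[of _ V] exI[of _ A]) auto
  qed
  then obtain V V' where VV: "\<And>\<gamma>. \<gamma> \<in> F \<Longrightarrow> open (V \<gamma>) \<and> \<tau> \<in> V \<gamma> \<and> open (V' \<gamma>) \<and> \<tau>' \<in> V' \<gamma> \<and>
      (\<forall>\<sigma>\<in>V \<gamma>. mob \<gamma> \<sigma> \<in> V' \<gamma> \<longrightarrow> \<tau>' = mob \<gamma> \<tau>)" by metis
  have "open (W \<inter> (\<Inter>\<gamma>\<in>F. V \<gamma>))" "open (W \<inter> (\<Inter>\<gamma>\<in>F. V' \<gamma>))"
    using oW finF VV by (auto intro!: open_Int open_INT)
  moreover have "\<tau>' = mob \<gamma> \<tau>" if "\<gamma> \<in> SL2Z" "\<sigma> \<in> W \<inter> (\<Inter>\<gamma>\<in>F. V \<gamma>)" "mob \<gamma> \<sigma> \<in> W \<inter> (\<Inter>\<gamma>\<in>F. V' \<gamma>)" for \<gamma> \<sigma>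
    using inF[of \<gamma> \<sigma>] VV[of \<gamma>] that by auto
  ultimately show ?thesis using W VV
    by (intro exI[of _ "W \<inter> (\<Inter>\<gamma>\<in>F. V \<gamma>)"] exI[of _ "W \<inter> (\<Inter>\<gamma>\<in>F. V' \<gamma>)"]) auto
qed

text \<open>The common form of proper discontinuity for points and cusps. For inequivalent
  \<open>x\<close> and \<open>y\<close> it separates their images in the quotient; for
  \<open>y = x\<close> it shows that elements fixing a nearby point also fix
  \<open>x\<close>.\<close>

lemma nbf_apart:
  assumes "vx x" "vx y"
  shows "\<exists>V V'. eventually (\<lambda>\<tau>. \<tau> \<in> V) (nbf x) \<and> eventually (\<lambda>\<tau>. \<tau> \<in> V') (nbf y) \<and>
           (\<forall>\<gamma>\<in>SL2Z. \<forall>\<sigma>\<in>V. Im \<sigma> > 0 \<longrightarrow> mob \<gamma> \<sigma> \<in> V' \<longrightarrow> xeq y (act \<gamma> x))"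
proof (cases x; cases y)
  fix \<tau> \<tau>' assume xy: "x = Pt \<tau>" "y = Pt \<tau>'"
  then obtain V V' where "open V" "\<tau> \<in> V" "open V'" "\<tau>' \<in> V'"
    "\<forall>\<gamma>\<in>SL2Z. \<forall>\<sigma>\<in>V. Im \<sigma> > 0 \<longrightarrow> mob \<gamma> \<sigma> \<in> V' \<longrightarrow> \<tau>' = mob \<gamma> \<tau>"
    using points_apart[of \<tau> \<tau>'] assms by auto
  then show ?thesis using xy by (intro exI[of _ V] exI[of _ V']) (auto simp: eventually_nhds)
next
  fix \<tau> c assume xy: "x = Pt \<tau>" "y = Cu c"
  then obtain V A where "open V" "\<tau> \<in> V" "A > 0" "\<forall>\<gamma>\<in>SL2Z. \<forall>\<sigma>\<in>V. Im \<sigma> > 0 \<longrightarrow> mob \<gamma> \<sigma> \<notin> hb A c"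
    using point_cusp_apart[of \<tau> c] assms by auto
  then show ?thesis unfolding xy eventually_nbf_Cu
    by (intro exI[of _ V] exI[of _ "hb A c"]) (auto simp: eventually_nhds)
next
  fix \<tau> c assume xy: "x = Cu c" "y = Pt \<tau>"
  then obtain V A where VA: "open V" "\<tau> \<in> V" "A > 0" "\<And>\<gamma> \<sigma>. \<gamma>\<in>SL2Z \<Longrightarrow> \<sigma>\<in>V \<Longrightarrow> Im \<sigma> > 0 \<Longrightarrow> mob \<gamma> \<sigma> \<notin> hb A c"
    using point_cusp_apart[of \<tau> c] assms by auto
  have "mob \<gamma> \<sigma> \<notin> V" if "\<gamma> \<in> SL2Z" "\<sigma> \<in> hb A c" for \<gamma> \<sigma>
    using VA(4)[OF SL2Z_adj2[OF that(1)], of "mob \<gamma> \<sigma>"] mob_adj2_SL2Z[of \<sigma> \<gamma>] Im_mob_SL2Z[of \<sigma> \<gamma>] that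
    by (auto simp: hb_def)
  then show ?thesis unfolding xy eventually_nbf_Cu using VA
    by (intro exI[of _ "hb A c"] exI[of _ V]) (auto simp: eventually_nhds)
next
  fix c d assume xy: "x = Cu c" "y = Cu d"
  have "xeq y (act \<gamma> x)" if "\<gamma> \<in> SL2Z" "\<sigma> \<in> hb 1 c" "mob \<gamma> \<sigma> \<in> hb 1 d" for \<gamma> \<sigma>
    using horoballs_disjoint[of "\<gamma> *v c" d "mob \<gamma> \<sigma>"] hb_mob[of \<sigma> 1 c \<gamma>] vx_act[OF assms(1) that(1)] assms that
    by (auto simp: xy)
  then show ?thesis unfolding xy eventually_nbf_Cu
    by (intro exI[of _ "hb 1 c"] exI[of _ "hb 1 d"]) (auto intro: exI[of _ 1])
qed

text \<open>Subtracting the two fixed point equations and dividing by \<tau> - \<sigma> leaves an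
  integral linear equation for \<tau> + \<sigma>, which has positive imaginary part; so its
  coefficients vanish.\<close>

lemma fix_two_points:
  assumes "Im \<tau> > 0" "Im \<sigma> > 0" "\<tau> \<noteq> \<sigma>" "\<gamma> \<in> SL2Z" "mob \<gamma> \<tau> = \<tau>" "mob \<gamma> \<sigma> = \<sigma>"
  shows "\<gamma> = mat 1 \<or> \<gamma> = - mat 1"
proof -
  have d: "det \<gamma> = 1" using assms by (simp add: SL2Z_iff)
  let ?c = "of_int (\<gamma> $ 2 $ 1) :: complex" and ?e = "of_int (\<gamma> $ 2 $ 2 - \<gamma> $ 1 $ 1) :: complex"
    and ?b = "of_int (\<gamma> $ 1 $ 2) :: complex"
  have q: "?c * z * z + ?e * z = ?b" if "Im z > 0" "mob \<gamma> z = z" for z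
    using mob_eq_iff[of z \<gamma> z] that d by (simp add: num_def den_def algebra_simps)
  have "(\<tau> - \<sigma>) * (?c * (\<tau> + \<sigma>) + ?e) = 0"
    using q[of \<tau>] q[of \<sigma>] assms by (simp add: algebra_simps)
  then have *: "of_int (\<gamma> $ 2 $ 1) * (\<tau> + \<sigma>) + of_int (\<gamma> $ 2 $ 2 - \<gamma> $ 1 $ 1) = 0" using assms(3) by simp
  have "Im (\<tau> + \<sigma>) > 0" using assms by simp
  then have "\<gamma> $ 2 $ 1 = 0" "\<gamma> $ 2 $ 2 = \<gamma> $ 1 $ 1" using of_int_lin_eq_0 * by (metis, metis eq_iff_diff_eq_0)
  moreover have "\<gamma> $ 1 $ 2 = 0" using q[of \<tau>] assms calculation by simp
  moreover have "\<gamma> $ 1 $ 1 = 1 \<or> \<gamma> $ 1 $ 1 = -1"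
    using d calculation by (simp add: det_2 zmult_eq_1_iff) 
  ultimately show ?thesis by (auto simp: mat2_eq_iff)
qed

text \<open>Fixing the cusp makes the automorphy factor at \<tau> equal to 1 or -1, which determines
  the lower row; the fixed point equation then determines the upper row.\<close>

lemma elliptic_not_fix_cusp:
  assumes "Im \<tau> > 0" "coprime (c $ 1) (c $ 2)" "\<gamma> \<in> SL2Z" "mob \<gamma> \<tau> = \<tau>" "xeq (Cu c) (act \<gamma> (Cu c))"
  shows "\<gamma> = mat 1 \<or> \<gamma> = - mat 1"
proof -
  have d: "det \<gamma> = 1" using assms by (simp add: SL2Z_iff)
  have nz: "Jf c \<tau> \<noteq> 0" using Jf_eq_0[OF assms(1)] assms(2) by (metis coprime_0_left_iff one_neq_zero zero_index not_is_unit_0)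
  have "Jf (\<gamma> *v c) \<tau> * den \<gamma> \<tau> = Jf c \<tau>" using Jf_mob[OF assms(1), of \<gamma> c] d assms(4) by simp
  moreover have "\<gamma> *v c = c \<or> \<gamma> *v c = - c" using assms(5) by (metis act.simps(2) xeq.simps(2) minus_minus)
  moreover have "Jf (- c) \<tau> = - Jf c \<tau>" by (simp add: Jf_def)
  ultimately have "den \<gamma> \<tau> = 1 \<or> den \<gamma> \<tau> = -1" using nz
    by (metis mult_cancel_left1 mult_minus_left minus_mult_commute mult_cancel_left2 minus_minus)
  then have dn: "\<gamma> $ 2 $ 1 = 0 \<and> \<gamma> $ 2 $ 2 = 1 \<or> \<gamma> $ 2 $ 1 = 0 \<and> \<gamma> $ 2 $ 2 = - 1"
    using of_int_lin_eq_iff[OF assms(1), of "\<gamma> $ 2 $ 1" "\<gamma> $ 2 $ 2" 0 1]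
      of_int_lin_eq_iff[OF assms(1), of "\<gamma> $ 2 $ 1" "\<gamma> $ 2 $ 2" 0 "-1"] by (auto simp: den_def)
  have "num \<gamma> \<tau> = \<tau> * den \<gamma> \<tau>" using mob_eq_iff[OF assms(1), of \<gamma> \<tau>] d assms(4) by simp
  then have "\<gamma> $ 1 $ 2 = 0 \<and> \<gamma> $ 1 $ 1 = \<gamma> $ 2 $ 2"
    using dn of_int_lin_eq_iff[OF assms(1), of "\<gamma> $ 1 $ 1" "\<gamma> $ 1 $ 2" "\<gamma> $ 2 $ 2" 0] by (auto simp: den_def num_def)
  then show ?thesis using dn by (auto simp: mat2_eq_iff)
qed

text \<open>An element fixing a nearby \<tau> also fixes \<open>x\<close> by
  \<open>nbf_apart\<close>, hence two points, or a point and a cusp. The point \<open>x\<close>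
  itself is excluded because it may be elliptic.\<close>

lemma eventually_no_stabilizer:
  assumes "vx x"
  shows "eventually (\<lambda>\<tau>. Pt \<tau> \<noteq> x \<longrightarrow> (\<forall>\<gamma>\<in>SL2Z. mob \<gamma> \<tau> = \<tau> \<longrightarrow> \<gamma> = mat 1 \<or> \<gamma> = - mat 1)) (nbf x)"
proof -
  obtain V V' where VV: "eventually (\<lambda>\<tau>. \<tau> \<in> V) (nbf x)" "eventually (\<lambda>\<tau>. \<tau> \<in> V') (nbf x)"
    and fx: "\<And>\<gamma> \<sigma>. \<gamma>\<in>SL2Z \<Longrightarrow> \<sigma>\<in>V \<Longrightarrow> Im \<sigma> > 0 \<Longrightarrow> mob \<gamma> \<sigma> \<in> V' \<Longrightarrow> xeq x (act \<gamma> x)"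
    using nbf_apart[OF assms assms] by blast
  from VV eventually_Im_pos[OF assms] show ?thesis
  proof eventually_elim
    case (elim \<tau>)
    show ?case
    proof (intro impI ballI)
      fix \<gamma> assume "Pt \<tau> \<noteq> x" and g: "\<gamma> \<in> SL2Z" and f: "mob \<gamma> \<tau> = \<tau>"
      have "xeq x (act \<gamma> x)" using fx[OF g elim(1,3)] f elim(2) by simp
      then show "\<gamma> = mat 1 \<or> \<gamma> = - mat 1"
        using fix_two_points[OF elim(3) _ _ g f] elliptic_not_fix_cusp[OF elim(3) _ g f] assms \<open>Pt \<tau> \<noteq> x\<close>
        by (cases x) (fastforce, auto)
    qed
  qed
qed

section \<open>Complex tori and level structures\<close>

text \<open>Isolates the group-theoretic part of the torus computations, for a lattice and its
  overlattices alike.\<close>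

definition csub :: "complex set \<Rightarrow> bool" where
  "csub \<Lambda> \<longleftrightarrow> 0 \<in> \<Lambda> \<and> (\<forall>x\<in>\<Lambda>. \<forall>y\<in>\<Lambda>. x - y \<in> \<Lambda>)"

lemma csub_closed:
  assumes "csub \<Lambda>"
  shows "0 \<in> \<Lambda>" "x \<in> \<Lambda> \<Longrightarrow> y \<in> \<Lambda> \<Longrightarrow> x - y \<in> \<Lambda>" "x \<in> \<Lambda> \<Longrightarrow> - x \<in> \<Lambda>"
    "x \<in> \<Lambda> \<Longrightarrow> y \<in> \<Lambda> \<Longrightarrow> x + y \<in> \<Lambda>" "x \<in> \<Lambda> \<Longrightarrow> of_nat k * x \<in> \<Lambda>" "x \<in> \<Lambda> \<Longrightarrow> of_int j * x \<in> \<Lambda>"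
proof -
  show z: "0 \<in> \<Lambda>" and s: "x \<in> \<Lambda> \<Longrightarrow> y \<in> \<Lambda> \<Longrightarrow> x - y \<in> \<Lambda>" for x y using assms by (auto simp: csub_def)
  show m: "x \<in> \<Lambda> \<Longrightarrow> - x \<in> \<Lambda>" for x using s[OF z] by simp
  show p: "x \<in> \<Lambda> \<Longrightarrow> y \<in> \<Lambda> \<Longrightarrow> x + y \<in> \<Lambda>" for x y using s[OF _ m] by simp
  show n: "x \<in> \<Lambda> \<Longrightarrow> of_nat k * x \<in> \<Lambda>" for x k by (induction k) (auto simp: z p algebra_simps)
  show "x \<in> \<Lambda> \<Longrightarrow> of_int j * x \<in> \<Lambda>" by (cases j rule: int_cases2) (auto dest: n m)
qed

lemma complex_add_group_simps [simp]:
  "carrier complex_add_group = UNIV" "x \<otimes>\<^bsub>complex_add_group\<^esub> y = x + y" "\<one>\<^bsub>complex_add_group\<^esub> = 0"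
  by (simp_all add: complex_add_group_def)

lemma comm_group_complex: "comm_group complex_add_group"
proof (rule comm_groupI)
  fix x :: complex assume "x \<in> carrier complex_add_group"
  show "\<exists>y\<in>carrier complex_add_group. y \<otimes>\<^bsub>complex_add_group\<^esub> x = \<one>\<^bsub>complex_add_group\<^esub>"
    by (rule bexI[of _ "- x"]) simp_all
qed simp_all

lemma inv_complex [simp]: "inv\<^bsub>complex_add_group\<^esub> x = - x"
  by (rule group.inv_equality[OF comm_group.axioms(2)[OF comm_group_complex]]) auto

lemma normal_csub: "csub \<Lambda> \<Longrightarrow> normal \<Lambda> complex_add_group"
  unfolding comm_group.normal_iff_subgroup[OF comm_group_complex]
  by (rule group.subgroupI[OF comm_group.axioms(2)[OF comm_group_complex]]) (auto dest: csub_closed)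

lemma set_mult_complex: "A <#>\<^bsub>complex_add_group\<^esub> B = {a + b | a b. a \<in> A \<and> b \<in> B}"
  by (auto simp: set_mult_def)

lemma tp_mem: "w \<in> torus_point \<Lambda> z \<longleftrightarrow> w - z \<in> \<Lambda>"
  by (force simp: torus_point_def r_coset_def)

lemma tp_eq_iff: "csub \<Lambda> \<Longrightarrow> torus_point \<Lambda> z = torus_point \<Lambda> w \<longleftrightarrow> z - w \<in> \<Lambda>"
proof
  assume L: "csub \<Lambda>" "torus_point \<Lambda> z = torus_point \<Lambda> w"
  have "z \<in> torus_point \<Lambda> z" using L(1) by (simp add: tp_mem csub_closed)
  then show "z - w \<in> \<Lambda>" unfolding L(2) by (simp add: tp_mem)
next
  assume L: "csub \<Lambda>" "z - w \<in> \<Lambda>"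
  have "x - z \<in> \<Lambda> \<longleftrightarrow> x - w \<in> \<Lambda>" for x
    using csub_closed(4)[OF L(1) _ L(2), of "x - z"] csub_closed(2)[OF L(1) _ L(2), of "x - w"] by auto
  then show "torus_point \<Lambda> z = torus_point \<Lambda> w" by (auto simp: tp_mem)
qed

lemma tp_0: "torus_point \<Lambda> 0 = \<Lambda>"
  by (auto simp: tp_mem)

lemma carrier_torus: "carrier (torus \<Lambda>) = range (torus_point \<Lambda>)"
  by (auto simp: torus_def FactGroup_def RCOSETS_def torus_point_def)

lemma one_torus: "\<one>\<^bsub>torus \<Lambda>\<^esub> = torus_point \<Lambda> 0"
  by (simp add: torus_def FactGroup_def tp_0)

lemma mult_torus:
  assumes "csub \<Lambda>" shows "torus_point \<Lambda> z \<otimes>\<^bsub>torus \<Lambda>\<^esub> torus_point \<Lambda> w = torus_point \<Lambda> (z + w)"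
proof -
  have "x \<in> torus_point \<Lambda> z \<otimes>\<^bsub>torus \<Lambda>\<^esub> torus_point \<Lambda> w \<longleftrightarrow> (\<exists>a b. a - z \<in> \<Lambda> \<and> b - w \<in> \<Lambda> \<and> x = a + b)" for x
    by (auto simp: torus_def FactGroup_def set_mult_complex tp_mem)
  moreover have "(\<exists>a b. a - z \<in> \<Lambda> \<and> b - w \<in> \<Lambda> \<and> x = a + b) \<longleftrightarrow> x - (z + w) \<in> \<Lambda>" for x
  proof
    assume "\<exists>a b. a - z \<in> \<Lambda> \<and> b - w \<in> \<Lambda> \<and> x = a + b"
    then obtain a b where ab: "a - z \<in> \<Lambda>" "b - w \<in> \<Lambda>" "x = a + b" by blast
    have "(a - z) + (b - w) \<in> \<Lambda>" using csub_closed(4)[OF assms] ab by blast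
    moreover have "(a - z) + (b - w) = x - (z + w)" using ab by simp
    ultimately show "x - (z + w) \<in> \<Lambda>" by simp
  next
    assume x: "x - (z + w) \<in> \<Lambda>"
    show "\<exists>a b. a - z \<in> \<Lambda> \<and> b - w \<in> \<Lambda> \<and> x = a + b"
      by (rule exI[of _ z], rule exI[of _ "x - z"]) (use x csub_closed(1)[OF assms] in \<open>simp add: algebra_simps\<close>)
  qed
  ultimately show ?thesis by (auto simp: tp_mem)
qed

lemma group_torus: "csub \<Lambda> \<Longrightarrow> group (torus \<Lambda>)"
  unfolding torus_def by (intro normal.factorgroup_is_group normal_csub)

lemma pow_torus:
  assumes "csub \<Lambda>" shows "torus_point \<Lambda> z [^]\<^bsub>torus \<Lambda>\<^esub> (k::nat) = torus_point \<Lambda> (of_nat k * z)"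
proof (induction k)
  case 0 show ?case using group.is_monoid[OF group_torus[OF assms]] by (simp add: monoid.nat_pow_0 one_torus)
next
  case (Suc k)
  then show ?case using group.is_monoid[OF group_torus[OF assms]]
    by (simp add: monoid.nat_pow_Suc mult_torus[OF assms] algebra_simps)
qed

lemma int_pow_torus:
  assumes "csub \<Lambda>" shows "torus_point \<Lambda> z [^]\<^bsub>torus \<Lambda>\<^esub> (k::int) = torus_point \<Lambda> (of_int k * z)"
proof -
  interpret group "torus \<Lambda>" by (rule group_torus[OF assms])
  have m: "torus_point \<Lambda> z \<in> carrier (torus \<Lambda>)" for z by (simp add: carrier_torus)
  have i: "inv\<^bsub>torus \<Lambda>\<^esub> torus_point \<Lambda> z = torus_point \<Lambda> (- z)" for z
    by (rule inv_equality) (simp_all add: m mult_torus[OF assms] one_torus)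
  show ?thesis
  proof (cases k rule: int_cases2)
    case (nonneg n) then show ?thesis by (simp add: int_pow_int pow_torus[OF assms])
  next
    case (nonpos n)
    then have "torus_point \<Lambda> z [^]\<^bsub>torus \<Lambda>\<^esub> k = inv\<^bsub>torus \<Lambda>\<^esub> (torus_point \<Lambda> z [^]\<^bsub>torus \<Lambda>\<^esub> n)"
      by (metis int_pow_neg_int m)
    then show ?thesis using nonpos by (simp add: pow_torus[OF assms] i)
  qed
qed

lemma torsion_eq:
  assumes "csub \<Lambda>" shows "torsion n \<Lambda> = torus_point \<Lambda> ` {z. of_nat n * z \<in> \<Lambda>}"
proof -
  have "torus_point \<Lambda> z [^]\<^bsub>torus \<Lambda>\<^esub> n = \<one>\<^bsub>torus \<Lambda>\<^esub> \<longleftrightarrow> of_nat n * z \<in> \<Lambda>" for z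
    by (simp add: pow_torus[OF assms] one_torus tp_eq_iff[OF assms])
  then show ?thesis unfolding torsion_def carrier_torus by blast
qed

lemma generate_torus:
  assumes "csub \<Lambda>"
  shows "generate (torus \<Lambda>) {torus_point \<Lambda> z} = range (\<lambda>k. torus_point \<Lambda> (of_int k * z))"
  using group.generate_pow[OF group_torus[OF assms], of "torus_point \<Lambda> z"]
  by (auto simp: carrier_torus int_pow_torus[OF assms])

lemma quot_lattice_generate:
  assumes "csub \<Lambda>"
  shows "quot_lattice (generate (torus \<Lambda>) {torus_point \<Lambda> z}) = {w + of_int k * z | w k. w \<in> \<Lambda>}"
proof -
  have "(\<exists>k. x - of_int k * z \<in> \<Lambda>) \<longleftrightarrow> (\<exists>w k. x = w + of_int k * z \<and> w \<in> \<Lambda>)" for x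
    by (metis add_diff_cancel_right' diff_add_cancel)
  moreover have "\<Union>(range (\<lambda>k. torus_point \<Lambda> (of_int k * z))) = {x. \<exists>k. x - of_int k * z \<in> \<Lambda>}"
    by (auto simp: tp_mem)
  ultimately show ?thesis unfolding quot_lattice_def generate_torus[OF assms] by simp
qed

lemma quot_proj_torus_point:
  assumes "csub \<Lambda>" "csub \<Lambda>'" "\<Lambda> \<subseteq> \<Lambda>'" "quot_lattice C = \<Lambda>'"
  shows "quot_proj C (torus_point \<Lambda> w) = torus_point \<Lambda>' w"
proof -
  have "x \<in> quot_proj C (torus_point \<Lambda> w) \<longleftrightarrow> (\<exists>a b. a \<in> \<Lambda>' \<and> b - w \<in> \<Lambda> \<and> x = a + b)" for x
    unfolding quot_proj_def assms(4) by (auto simp: set_mult_complex tp_mem)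
  moreover have "(\<exists>a b. a \<in> \<Lambda>' \<and> b - w \<in> \<Lambda> \<and> x = a + b) \<longleftrightarrow> x - w \<in> \<Lambda>'" for x
  proof
    assume "\<exists>a b. a \<in> \<Lambda>' \<and> b - w \<in> \<Lambda> \<and> x = a + b"
    then obtain a b where ab: "a \<in> \<Lambda>'" "b - w \<in> \<Lambda>'" "x = a + b" using assms(3) by blast
    then show "x - w \<in> \<Lambda>'" using csub_closed(4)[OF assms(2) ab(1,2)] by (simp add: algebra_simps)
  next
    assume "x - w \<in> \<Lambda>'"
    then show "\<exists>a b. a \<in> \<Lambda>' \<and> b - w \<in> \<Lambda> \<and> x = a + b"
      using csub_closed(1)[OF assms(1)] by (intro exI[of _ "x - w"] exI[of _ w]) auto
  qed
  ultimately show ?thesis by (auto simp: tp_mem)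
qed

section \<open>Lattices with an oriented basis, their torsion points and level structures\<close>

text \<open>The lattice \<alpha>(Z + Z\<tau>), with \<open>Jf\<close> as coordinates so that lattice
  elements and torsion points are labelled by vectors in the same convention.\<close>

definition ulat :: "complex \<Rightarrow> complex \<Rightarrow> complex set" where
  "ulat \<alpha> \<tau> = range (\<lambda>w. \<alpha> * Jf w \<tau>)"

lemma Jf_add: "Jf (u + v) \<tau> = Jf u \<tau> + Jf v \<tau>" and Jf_diff: "Jf (u - v) \<tau> = Jf u \<tau> - Jf v \<tau>"
  and Jf_smult: "Jf (k *s v) \<tau> = of_int k * Jf v \<tau>" and Jf_0: "Jf 0 \<tau> = 0"
  by (simp_all add: Jf_def algebra_simps)

lemma ulat_memI: "\<alpha> * Jf w \<tau> \<in> ulat \<alpha> \<tau>"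
  unfolding ulat_def by (rule rangeI)

lemma ulat_memE: "x \<in> ulat \<alpha> \<tau> \<Longrightarrow> (\<And>w. x = \<alpha> * Jf w \<tau> \<Longrightarrow> P) \<Longrightarrow> P"
  by (auto simp: ulat_def)

lemma csub_ulat: "csub (ulat \<alpha> \<tau>)"
  unfolding csub_def
proof (intro conjI ballI)
  show "0 \<in> ulat \<alpha> \<tau>" using ulat_memI[of \<alpha> 0 \<tau>] by (simp add: Jf_0)
  fix x y assume "x \<in> ulat \<alpha> \<tau>" "y \<in> ulat \<alpha> \<tau>"
  then obtain u v where "x = \<alpha> * Jf u \<tau>" "y = \<alpha> * Jf v \<tau>" by (elim ulat_memE)
  then have "x - y = \<alpha> * Jf (u - v) \<tau>" by (simp add: Jf_diff right_diff_distrib)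
  then show "x - y \<in> ulat \<alpha> \<tau>" by (simp add: ulat_memI)
qed

text \<open>Stands in for discreteness: a continuous function on the plane with values in a
  countable set is constant.\<close>

lemma countable_ulat: "countable (ulat \<alpha> \<tau>)"
proof -
  have "ulat \<alpha> \<tau> = (\<lambda>(a, b). \<alpha> * (of_int a - of_int b * \<tau>)) ` (UNIV :: (int \<times> int) set)"
  proof (rule equalityI; rule subsetI)
    fix x assume "x \<in> ulat \<alpha> \<tau>"
    then obtain w where "x = \<alpha> * Jf w \<tau>" by (auto simp: ulat_def)
    then show "x \<in> (\<lambda>(a, b). \<alpha> * (of_int a - of_int b * \<tau>)) ` UNIV"
      by (intro image_eqI[of _ _ "(w $ 1, w $ 2)"]) (auto simp: Jf_def)
  next
    fix x assume "x \<in> (\<lambda>(a, b). \<alpha> * (of_int a - of_int b * \<tau>)) ` (UNIV :: (int \<times> int) set)"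
    then obtain a b where "x = \<alpha> * (of_int a - of_int b * \<tau>)" by auto
    then have "x = \<alpha> * Jf (vector [a, b]) \<tau>" by (simp add: Jf_def)
    then show "x \<in> ulat \<alpha> \<tau>" by (auto simp: ulat_def)
  qed
  then show ?thesis by simp
qed

lemma period_lattice_ulat: "\<alpha> \<noteq> 0 \<Longrightarrow> period_lattice \<alpha> (\<alpha> * \<tau>) = ulat \<alpha> \<tau>"
proof (rule equalityI; rule subsetI)
  fix x assume "x \<in> period_lattice \<alpha> (\<alpha> * \<tau>)"
  then obtain a b where "x = of_int a * \<alpha> + of_int b * (\<alpha> * \<tau>)" by (auto simp: period_lattice_def)
  then have "x = \<alpha> * Jf (vector [a, - b]) \<tau>" by (simp add: Jf_def algebra_simps)
  then show "x \<in> ulat \<alpha> \<tau>" by (auto simp: ulat_def)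
next
  fix x assume "x \<in> ulat \<alpha> \<tau>"
  then obtain w where "x = \<alpha> * Jf w \<tau>" by (auto simp: ulat_def)
  then have "x = of_int (w $ 1) * \<alpha> + of_int (- w $ 2) * (\<alpha> * \<tau>)" by (simp add: Jf_def algebra_simps)
  then show "x \<in> period_lattice \<alpha> (\<alpha> * \<tau>)" unfolding period_lattice_def by blast
qed

lemma is_lattice_ulat: "\<alpha> \<noteq> 0 \<Longrightarrow> Im \<tau> > 0 \<Longrightarrow> is_lattice (ulat \<alpha> \<tau>)"
  unfolding is_lattice_def by (intro exI[of _ \<alpha>] exI[of _ "\<alpha> * \<tau>"]) (auto simp: period_lattice_ulat)

text \<open>Negating the second period keeps the lattice, so the ratio of the periods can be moved
  to the upper half-plane.\<close>

lemma is_lattice_obtain: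
  assumes "is_lattice \<Lambda>" obtains \<alpha> \<tau> where "\<alpha> \<noteq> 0" "Im \<tau> > 0" "\<Lambda> = ulat \<alpha> \<tau>"
proof -
  obtain w1 w2 where w: "Im (w2 / w1) \<noteq> 0" "\<Lambda> = period_lattice w1 w2"
    using assms by (auto simp: is_lattice_def)
  then have nz: "w1 \<noteq> 0" by auto
  have sub: "period_lattice w1 (- w) \<subseteq> period_lattice w1 w" for w
  proof
    fix x assume "x \<in> period_lattice w1 (- w)"
    then obtain a b where "x = of_int a * w1 + of_int b * (- w)" by (auto simp: period_lattice_def)
    then have "x = of_int a * w1 + of_int (- b) * w" by simp
    then show "x \<in> period_lattice w1 w" unfolding period_lattice_def by blast
  qed
  have neg: "period_lattice w1 (- w2) = period_lattice w1 w2" using sub[of w2] sub[of "- w2"] by auto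
  show thesis
  proof (cases "Im (w2 / w1) > 0")
    case True
    then show thesis using that[OF nz, of "w2 / w1"] w nz period_lattice_ulat[OF nz, of "w2 / w1"] by simp
  next
    case False
    then show thesis using that[OF nz, of "- (w2 / w1)"] w nz neg period_lattice_ulat[OF nz, of "- (w2 / w1)"] by simp
  qed
qed

definition vcong :: "nat \<Rightarrow> int^2 \<Rightarrow> int^2 \<Rightarrow> bool" where
  "vcong n u v \<longleftrightarrow> int n dvd u $ 1 - v $ 1 \<and> int n dvd u $ 2 - v $ 2"

lemma vcong_red: "vcong n u v \<longleftrightarrow> red_vec n u = red_vec n v"
  by (simp add: vcong_def vec2_eq_iff mod_eq_dvd_iff)

text \<open>Multiplication by \<open>n\<close> turns membership in the lattice into divisibility of
  the coordinate vector by \<open>n\<close>, by injectivity of \<open>Jf\<close>. Every comparison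
  of level structures passes through this equivalence.\<close>

lemma tp_Jf_eq_iff:
  assumes "n > 0" "\<alpha> \<noteq> 0" "Im \<tau> > 0"
  shows "torus_point (ulat \<alpha> \<tau>) (\<alpha> * (Jf u \<tau> / of_nat n)) = torus_point (ulat \<alpha> \<tau>) (\<alpha> * (Jf v \<tau> / of_nat n)) \<longleftrightarrow> vcong n u v"
proof -
  have "torus_point (ulat \<alpha> \<tau>) (\<alpha> * (Jf u \<tau> / of_nat n)) = torus_point (ulat \<alpha> \<tau>) (\<alpha> * (Jf v \<tau> / of_nat n))
     \<longleftrightarrow> (\<exists>w. \<alpha> * (Jf u \<tau> / of_nat n) - \<alpha> * (Jf v \<tau> / of_nat n) = \<alpha> * Jf w \<tau>)"
    unfolding tp_eq_iff[OF csub_ulat] by (auto simp: ulat_def)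
  also have "\<dots> \<longleftrightarrow> (\<exists>w. Jf (u - v) \<tau> = Jf (int n *s w) \<tau>)"
  proof -
    have "\<alpha> * (Jf u \<tau> / of_nat n) - \<alpha> * (Jf v \<tau> / of_nat n) = \<alpha> * Jf w \<tau> \<longleftrightarrow> Jf (u - v) \<tau> = Jf (int n *s w) \<tau>" for w
    proof -
      have "\<alpha> * (Jf u \<tau> / of_nat n) - \<alpha> * (Jf v \<tau> / of_nat n) = \<alpha> * (Jf (u - v) \<tau> / of_nat n)"
        by (simp only: Jf_diff diff_divide_distrib right_diff_distrib)
      moreover have "Jf (u - v) \<tau> / of_nat n = Jf w \<tau> \<longleftrightarrow> Jf (u - v) \<tau> = Jf (int n *s w) \<tau>"
        using assms(1) by (simp add: Jf_smult nonzero_divide_eq_eq mult.commute)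
      ultimately show ?thesis using assms(2) by (simp only: mult_cancel_left) simp
    qed
    then show ?thesis by simp
  qed
  also have "\<dots> \<longleftrightarrow> (\<exists>w. u - v = int n *s w)" by (simp add: Jf_inj[OF assms(3)])
  also have "\<dots> \<longleftrightarrow> vcong n u v"
  proof
    assume "\<exists>w. u - v = int n *s w" then show "vcong n u v" by (auto simp: vcong_def vec2_eq_iff)
  next
    assume "vcong n u v"
    then obtain a b where "u $ 1 - v $ 1 = int n * a" "u $ 2 - v $ 2 = int n * b"
      unfolding vcong_def dvd_def by blast
    then have "u - v = int n *s vector [a, b]" by (simp add: vec2_eq_iff)
    then show "\<exists>w. u - v = int n *s w" by blast
  qed
  finally show ?thesis .
qed

lemma torsion_ulat:
  assumes "n > 0"
  shows "torsion n (ulat \<alpha> \<tau>) = range (\<lambda>w. torus_point (ulat \<alpha> \<tau>) (\<alpha> * (Jf w \<tau> / of_nat n)))"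
proof -
  have "of_nat n * z = \<alpha> * Jf w \<tau> \<longleftrightarrow> z = \<alpha> * (Jf w \<tau> / of_nat n)" for z w
    using assms(1) by (simp add: nonzero_eq_divide_eq mult.commute)
  then have "{z. of_nat n * z \<in> ulat \<alpha> \<tau>} = range (\<lambda>w. \<alpha> * (Jf w \<tau> / of_nat n))"
    unfolding ulat_def by (simp add: image_def)
  then show ?thesis unfolding torsion_eq[OF csub_ulat] by (simp only: image_image)
qed

text \<open>
  \<open>rep n p \<tau> g\<close>: the pair \<open>p\<close> is isomorphic, by a scaling of \<open>\<complex>\<close>, to the standard pair of \<open>(\<tau>, g)\<close>.
\<close>

definition rep :: "nat \<Rightarrow> level_pair \<Rightarrow> complex \<Rightarrow> int^2^2 \<Rightarrow> bool" where
  "rep n p \<tau> g \<longleftrightarrow> Im \<tau> > 0 \<and> coprime (det g) (int n) \<and>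
     (\<exists>\<alpha>. \<alpha> \<noteq> 0 \<and> fst p = ulat \<alpha> \<tau> \<and>
        (\<forall>v\<in>carrier (vec2_group n). snd p v = torus_point (ulat \<alpha> \<tau>) (\<alpha> * (Jf (g *v v) \<tau> / of_nat n))))"

lemma carrier_vec2: "carrier (vec2_group n) = {v. red_vec n v = v}"
  by (simp add: vec2_group_def)

lemma rep_std:
  assumes "Im \<tau> > 0" "coprime (det g) (int n)" shows "rep n (std_pair n \<tau> g) \<tau> g"
proof -
  have "period_lattice 1 \<tau> = ulat 1 \<tau>" using period_lattice_ulat[of 1 \<tau>] by simp
  then show ?thesis unfolding rep_def using assms
    by (auto simp: std_pair_def Let_def Jf_def intro!: exI[of _ 1])
qed

lemma vcong_mult:
  assumes "mcong n A B" "vcong n u v" shows "vcong n (A *v u) (B *v v)"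
proof -
  have "int n dvd (A *v u) $ i - (B *v v) $ i" for i
  proof -
    have "(A *v u) $ i - (B *v v) $ i = A $ i $ 1 * (u $ 1 - v $ 1) + (A $ i $ 1 - B $ i $ 1) * v $ 1
        + A $ i $ 2 * (u $ 2 - v $ 2) + (A $ i $ 2 - B $ i $ 2) * v $ 2" by (simp add: algebra_simps)
    then show ?thesis using assms by (simp add: mcong_iff vcong_def)
  qed
  then show ?thesis by (simp add: vcong_def)
qed

lemma vcong_refl [simp]: "vcong n v v" by (simp add: vcong_def)
lemma vcong_sym: "vcong n u v \<Longrightarrow> vcong n v u" by (simp add: vcong_red)
lemma vcong_trans [trans]: "vcong n u v \<Longrightarrow> vcong n v w \<Longrightarrow> vcong n u w" by (simp add: vcong_red)
lemma vcong_red_left [simp]: "vcong n (red_vec n u) v \<longleftrightarrow> vcong n u v" "vcong n u (red_vec n v) \<longleftrightarrow> vcong n u v"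
  by (simp_all add: vcong_red)

lemma vcong_all_imp_mcong:
  assumes "\<And>v. v \<in> carrier (vec2_group n) \<Longrightarrow> vcong n (A *v v) (B *v v)"
  shows "mcong n A B"
proof -
  have *: "vcong n (A *v v) (B *v v)" for v
  proof -
    have "vcong n (A *v v) (A *v red_vec n v)" by (rule vcong_mult) auto
    also have "vcong n \<dots> (B *v red_vec n v)" by (rule assms) (simp add: carrier_vec2)
    also have "vcong n \<dots> (B *v v)" by (rule vcong_mult) auto
    finally show ?thesis .
  qed
  have "int n dvd A $ i $ j - B $ i $ j" for i j
    using exhaust_2[of i] exhaust_2[of j] *[of "vector [1, 0]"] *[of "vector [0, 1]"] by (auto simp: vcong_def)
  then show ?thesis by (simp add: mcong_iff)
qed

text \<open>The adjugate scaled by an inverse of \<open>det g\<close> modulo \<open>n\<close> yields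
  both injectivity and surjectivity on the torsion.\<close>

lemma rep_level_pairs:
  assumes "n > 0" "rep n p \<tau> g" shows "p \<in> level_pairs n"
proof -
  obtain \<Lambda> \<phi> where p: "p = (\<Lambda>, \<phi>)" by (cases p)
  obtain \<alpha> where \<alpha>: "\<alpha> \<noteq> 0" "\<Lambda> = ulat \<alpha> \<tau>"
    and \<phi>: "\<And>v. v \<in> carrier (vec2_group n) \<Longrightarrow> \<phi> v = torus_point \<Lambda> (\<alpha> * (Jf (g *v v) \<tau> / of_nat n))"
    and t: "Im \<tau> > 0" and g: "coprime (det g) (int n)" using assms(2) by (auto simp: rep_def p)
  note eq = tp_Jf_eq_iff[OF assms(1) \<alpha>(1) t, folded \<alpha>(2)]
  have "\<phi> \<in> hom (vec2_group n) ((torus \<Lambda>)\<lparr>carrier := torsion n \<Lambda>\<rparr>)"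
  proof (rule homI)
    fix x assume "x \<in> carrier (vec2_group n)"
    then show "\<phi> x \<in> carrier (torus \<Lambda>\<lparr>carrier := torsion n \<Lambda>\<rparr>)"
      using \<phi> torsion_ulat[OF assms(1)] \<alpha>(2) by simp
  next
    fix u v assume uv: "u \<in> carrier (vec2_group n)" "v \<in> carrier (vec2_group n)"
    have "u \<otimes>\<^bsub>vec2_group n\<^esub> v = red_vec n (u + v)" by (simp add: vec2_group_def)
    then have "\<phi> (u \<otimes>\<^bsub>vec2_group n\<^esub> v) = torus_point \<Lambda> (\<alpha> * (Jf (g *v red_vec n (u + v)) \<tau> / of_nat n))"
      using \<phi> by (simp add: carrier_vec2)
    also have "\<dots> = torus_point \<Lambda> (\<alpha> * (Jf (g *v (u + v)) \<tau> / of_nat n))"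
      unfolding eq by (rule vcong_mult) auto
    also have "\<alpha> * (Jf (g *v (u + v)) \<tau> / of_nat n) = \<alpha> * (Jf (g *v u) \<tau> / of_nat n) + \<alpha> * (Jf (g *v v) \<tau> / of_nat n)"
      by (simp add: matrix_vector_right_distrib Jf_add add_divide_distrib distrib_left)
    also have "torus_point \<Lambda> \<dots> = \<phi> u \<otimes>\<^bsub>torus \<Lambda>\<^esub> \<phi> v" using mult_torus[OF csub_ulat] \<phi> uv \<alpha> by simp
    finally show "\<phi> (u \<otimes>\<^bsub>vec2_group n\<^esub> v) = \<phi> u \<otimes>\<^bsub>torus \<Lambda>\<lparr>carrier := torsion n \<Lambda>\<rparr>\<^esub> \<phi> v" by simp
  qed
  moreover have "inj_on \<phi> (carrier (vec2_group n))"
  proof (rule inj_onI)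
    fix u v assume uv: "u \<in> carrier (vec2_group n)" "v \<in> carrier (vec2_group n)" "\<phi> u = \<phi> v"
    then have c: "vcong n (g *v u) (g *v v)" using eq \<phi> by metis
    obtain d where d: "int n dvd det g * d - 1" using exists_inverse_mod g by blast
    have inv: "mcong n (scal d (adj2 g) ** g) (mat 1)"
      using mcong_scal_one[OF d, of "mat 1"] by (simp add: adj2_mult mult.commute)
    have i: "vcong n (scal d (adj2 g) *v (g *v w)) w" for w
      using vcong_mult[OF inv vcong_refl, of w] by (simp add: matrix_vector_mul_assoc)
    have "vcong n u v" using vcong_mult[OF mcong_refl c, of "scal d (adj2 g)"] i
      by (meson vcong_sym vcong_trans)
    then show "u = v" using uv by (simp add: vcong_red carrier_vec2)
  qed
  moreover have "\<phi> ` carrier (vec2_group n) = torsion n \<Lambda>"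
  proof (rule equalityI; rule subsetI)
    fix y assume "y \<in> \<phi> ` carrier (vec2_group n)"
    then show "y \<in> torsion n \<Lambda>" using \<phi> torsion_ulat[OF assms(1)] \<alpha>(2) by auto
  next
    fix y assume "y \<in> torsion n \<Lambda>"
    then obtain w where w: "y = torus_point \<Lambda> (\<alpha> * (Jf w \<tau> / of_nat n))"
      using torsion_ulat[OF assms(1)] \<alpha>(2) by auto
    obtain d where d: "int n dvd det g * d - 1" using exists_inverse_mod g by blast
    have inv: "mcong n (g ** scal d (adj2 g)) (mat 1)"
      using mcong_scal_one[OF d, of "mat 1"] by (simp add: adj2_mult mult.commute)
    let ?v = "red_vec n (scal d (adj2 g) *v w)"
    have "vcong n (g *v ?v) (g *v (scal d (adj2 g) *v w))" by (rule vcong_mult) auto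
    also have "vcong n \<dots> w" using vcong_mult[OF inv vcong_refl, of w] by (simp add: matrix_vector_mul_assoc)
    finally have "\<phi> ?v = y" using eq \<phi>[of ?v] w by (simp add: carrier_vec2)
    then show "y \<in> \<phi> ` carrier (vec2_group n)" by (auto simp: carrier_vec2 intro!: image_eqI[of _ _ ?v])
  qed
  ultimately have "\<phi> \<in> iso (vec2_group n) ((torus \<Lambda>)\<lparr>carrier := torsion n \<Lambda>\<rparr>)"
    by (simp add: iso_def bij_betw_def)
  then show ?thesis using is_lattice_ulat \<alpha> t by (simp add: level_pairs_def p)
qed

lemma hom_zero_torsion:
  assumes "csub \<Lambda>" "\<phi> \<in> hom (vec2_group n) ((torus \<Lambda>)\<lparr>carrier := torsion n \<Lambda>\<rparr>)"
  shows "\<phi> 0 = torus_point \<Lambda> 0"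
proof -
  have z: "0 \<in> carrier (vec2_group n)" by (simp add: carrier_vec2 vec2_eq_iff)
  have "\<phi> 0 \<in> torsion n \<Lambda>" using hom_in_carrier[OF assms(2) z] by simp
  then obtain w where w: "\<phi> 0 = torus_point \<Lambda> w" by (auto simp: torsion_eq[OF assms(1)])
  have "0 \<otimes>\<^bsub>vec2_group n\<^esub> 0 = 0" by (simp add: vec2_group_def vec2_eq_iff)
  then have "\<phi> 0 = \<phi> 0 \<otimes>\<^bsub>torus \<Lambda>\<^esub> \<phi> 0" using hom_mult[OF assms(2) z z] by simp
  then have "torus_point \<Lambda> w = torus_point \<Lambda> (w + w)" by (simp add: w mult_torus[OF assms(1)])
  then have "w \<in> \<Lambda>" using tp_eq_iff[OF assms(1), of "w + w" w] by simp
  then show ?thesis using tp_eq_iff[OF assms(1), of w 0] w by simp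
qed

text \<open>The columns of the matrix are the coordinates of the images of the two basis vectors,
  and additivity extends this by induction to the reduced vectors, whose entries are nonnegative.
  Surjectivity provides a right inverse modulo \<open>n\<close>, so the determinant is a
  unit.\<close>

lemma level_structure_matrix:
  assumes "n > 0" "\<alpha> \<noteq> 0" "Im \<tau> > 0" "(ulat \<alpha> \<tau>, \<phi>) \<in> level_pairs n"
  shows "\<exists>g. coprime (det g) (int n) \<and>
    (\<forall>v\<in>carrier (vec2_group n). \<phi> v = torus_point (ulat \<alpha> \<tau>) (\<alpha> * (Jf (g *v v) \<tau> / of_nat n)))"
proof -
  define \<Lambda> where "\<Lambda> = ulat \<alpha> \<tau>"
  have \<alpha>: "\<alpha> \<noteq> 0" "Im \<tau> > 0" "\<Lambda> = ulat \<alpha> \<tau>" using assms by (simp_all add: \<Lambda>_def)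
  have iso: "\<phi> \<in> iso (vec2_group n) ((torus \<Lambda>)\<lparr>carrier := torsion n \<Lambda>\<rparr>)"
    using assms(4) by (auto simp: level_pairs_def \<Lambda>_def)
  have cs: "csub \<Lambda>" by (simp add: \<alpha> csub_ulat)
  note eq = tp_Jf_eq_iff[OF assms(1) \<alpha>(1,2), folded \<alpha>(3)]
  note tors = torsion_ulat[OF assms(1), of \<alpha> \<tau>, folded \<alpha>(3)]
  have hom: "\<phi> \<in> hom (vec2_group n) ((torus \<Lambda>)\<lparr>carrier := torsion n \<Lambda>\<rparr>)"
    and surj: "\<phi> ` carrier (vec2_group n) = torsion n \<Lambda>"
    using iso by (auto simp: iso_def bij_betw_def)
  define t where "t w = torus_point \<Lambda> (\<alpha> * (Jf w \<tau> / of_nat n))" for w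
  have tadd: "t u \<otimes>\<^bsub>torus \<Lambda>\<^esub> t v = t (u + v)" for u v
    unfolding t_def by (simp add: mult_torus[OF cs] Jf_add add_divide_distrib distrib_left)
  have tc: "t u = t v \<longleftrightarrow> vcong n u v" for u v unfolding t_def by (rule eq)
  have lift: "\<exists>w. \<phi> (red_vec n v) = t w" for v
    using hom_in_carrier[OF hom, of "red_vec n v"] tors by (auto simp: carrier_vec2 t_def)
  obtain a b where ab: "\<phi> (red_vec n (vector [1, 0])) = t a" "\<phi> (red_vec n (vector [0, 1])) = t b"
    using lift by metis
  have step: "\<phi> (red_vec n (u + v)) = \<phi> (red_vec n u) \<otimes>\<^bsub>torus \<Lambda>\<^esub> \<phi> (red_vec n v)" for u v
  proof -
    have "red_vec n u \<otimes>\<^bsub>vec2_group n\<^esub> red_vec n v = red_vec n (u + v)"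
      by (simp add: vec2_group_def vec2_eq_iff mod_add_eq)
    then show ?thesis using hom_mult[OF hom, of "red_vec n u" "red_vec n v"] by (simp add: carrier_vec2)
  qed
  define M where "M = mk2 (a $ 1) (b $ 1) (a $ 2) (b $ 2)"
  have Mv: "\<phi> (red_vec n (vector [int x, int y])) = t (M *v vector [int x, int y])" for x y
  proof (induction x)
    case 0
    show ?case
    proof (induction y)
      case 0
      have "red_vec n (vector [int 0, int 0]) = 0" by (simp add: vec2_eq_iff)
      moreover have "M *v vector [int 0, int 0] = 0" by (simp add: vec2_eq_iff)
      ultimately show ?case using hom_zero_torsion[OF cs hom] by (simp add: t_def Jf_0)
    next
      case (Suc y)
      have e: "vector [int 0, int (Suc y)] = vector [int 0, int y] + (vector [0, 1] :: int^2)" by (simp add: vec2_eq_iff)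
      have "M *v vector [int 0, int (Suc y)] = M *v vector [int 0, int y] + b"
        by (simp add: vec2_eq_iff M_def algebra_simps)
      then show ?case unfolding e step Suc ab tadd by simp
    qed
  next
    case (Suc x)
    have e: "vector [int (Suc x), int y] = vector [int x, int y] + (vector [1, 0] :: int^2)" by (simp add: vec2_eq_iff)
    have "M *v vector [int (Suc x), int y] = M *v vector [int x, int y] + a"
      by (simp add: vec2_eq_iff M_def algebra_simps)
    then show ?case unfolding e step Suc ab tadd by simp
  qed
  have \<phi>M: "\<phi> v = t (M *v v)" if v: "v \<in> carrier (vec2_group n)" for v
  proof -
    have r: "red_vec n v = v" using v by (simp add: carrier_vec2)
    then have "v $ 1 mod int n = v $ 1" "v $ 2 mod int n = v $ 2" by (metis red_vec_nth)+
    then have "v $ 1 \<ge> 0" "v $ 2 \<ge> 0" using assms(1) by (metis of_nat_0_less_iff pos_mod_sign)+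
    then have "v = vector [int (nat (v $ 1)), int (nat (v $ 2))]" by (simp add: vec2_eq_iff)
    then show ?thesis using Mv r by metis
  qed
  have "\<exists>v. vcong n (M *v v) w" for w
  proof -
    have "t w \<in> \<phi> ` carrier (vec2_group n)" unfolding surj tors t_def by (rule rangeI)
    then show ?thesis using \<phi>M tc by (metis imageE)
  qed
  then obtain u v where uv: "vcong n (M *v u) (vector [1, 0])" "vcong n (M *v v) (vector [0, 1])" by metis
  have "mcong n (M ** mk2 (u $ 1) (v $ 1) (u $ 2) (v $ 2)) (mat 1)"
    unfolding mcong_iff forall_2 using uv by (simp add: vcong_def)
  then have "coprime (det (M ** mk2 (u $ 1) (v $ 1) (u $ 2) (v $ 2))) (int n)" using mcong_coprime_det by fastforce
  then have "coprime (det M) (int n)" by (simp add: det_mul)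
  then show ?thesis using \<phi>M unfolding t_def \<alpha>(3) by blast
qed

lemma level_pairs_rep:
  assumes "n > 0" "p \<in> level_pairs n" shows "\<exists>\<tau> g. rep n p \<tau> g"
proof -
  obtain \<Lambda> \<phi> where p: "p = (\<Lambda>, \<phi>)" by (cases p)
  have "is_lattice \<Lambda>" using assms(2) by (auto simp: level_pairs_def p)
  then obtain \<alpha> \<tau> where \<alpha>: "\<alpha> \<noteq> 0" "Im \<tau> > 0" "\<Lambda> = ulat \<alpha> \<tau>" by (rule is_lattice_obtain)
  obtain g where "coprime (det g) (int n)"
    "\<forall>v\<in>carrier (vec2_group n). \<phi> v = torus_point (ulat \<alpha> \<tau>) (\<alpha> * (Jf (g *v v) \<tau> / of_nat n))"
    using level_structure_matrix[OF assms(1) \<alpha>(1,2)] assms(2) unfolding p \<alpha>(3) by blast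
  then show ?thesis unfolding rep_def p fst_conv snd_conv using \<alpha> by blast
qed

section \<open>Isomorphisms of tori and homotheties of lattices\<close>

text \<open>Increments independent of the base point make the derivative invariant under
  translation, hence constant.\<close>

lemma constant_differences_affine:
  assumes f: "f holomorphic_on UNIV" and c: "\<And>z w. f (z + w) - f z = f w - f (0::complex)"
  shows "\<exists>\<beta> c. \<forall>z. f z = \<beta> * z + c"
proof -
  have d: "(f has_field_derivative deriv f z) (at z)" for z
    using holomorphic_derivI[OF f open_UNIV, of z] by simp
  have "deriv f z = deriv f 0" for z
  proof -
    have "((\<lambda>w. f (w + z)) has_field_derivative deriv f (0 + z)) (at 0)"
      using DERIV_shift[of f "deriv f (0 + z)" 0 z] d[of "0 + z"] by simp
    moreover have "(\<lambda>w. f (w + z)) = (\<lambda>w. f w + (f z - f 0))"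
      using c by (auto simp: algebra_simps fun_eq_iff)
    moreover have "((\<lambda>w. f w + (f z - f 0)) has_field_derivative deriv f 0) (at 0)"
      using d[of 0] by (auto intro!: derivative_eq_intros)
    ultimately show ?thesis using DERIV_unique by fastforce
  qed
  then have "((\<lambda>z. f z - deriv f 0 * z) has_field_derivative 0) (at z within UNIV)" for z
    using d[of z] by (auto intro!: derivative_eq_intros)
  then obtain c where "\<And>z. f z - deriv f 0 * z = c"
    using has_field_derivative_zero_constant[OF convex_UNIV, of "\<lambda>z. f z - deriv f 0 * z"] by auto
  then show ?thesis by (metis add.commute diff_add_cancel)
qed

text \<open>The defect of additivity of the lift is continuous with values in a countable lattice,
  so it is constant and the lift is affine. Its constant term lies in the lattice, and slope 0 would
  collapse the target torus to a point.\<close>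

lemma torus_isos_scaling:
  assumes L: "\<Lambda> = ulat \<alpha> \<tau>" and L': "\<Lambda>' = ulat \<alpha>' \<tau>'" and i: "\<iota> \<in> torus_isos \<Lambda> \<Lambda>'"
  shows "\<exists>\<beta>. \<beta> \<noteq> 0 \<and> (\<forall>z. \<iota> (torus_point \<Lambda> z) = torus_point \<Lambda>' (\<beta> * z)) \<and> (\<forall>z. z \<in> \<Lambda> \<longleftrightarrow> \<beta> * z \<in> \<Lambda>')"
proof -
  have cs: "csub \<Lambda>" "csub \<Lambda>'" using L L' csub_ulat by auto
  have count: "countable \<Lambda>'" using L' countable_ulat by simp
  note eq = tp_eq_iff[OF cs(2)] and eq1 = tp_eq_iff[OF cs(1)]
  from i obtain f where iso: "\<iota> \<in> iso (torus \<Lambda>) (torus \<Lambda>')" and f: "f holomorphic_on UNIV"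
    and fi: "\<And>z. \<iota> (torus_point \<Lambda> z) = torus_point \<Lambda>' (f z)" by (auto simp: torus_isos_def)
  have hom: "\<iota> \<in> hom (torus \<Lambda>) (torus \<Lambda>')" and inj: "inj_on \<iota> (carrier (torus \<Lambda>))"
    and surj: "\<iota> ` carrier (torus \<Lambda>) = carrier (torus \<Lambda>')"
    using iso by (auto simp: iso_def bij_betw_def)
  have mem: "torus_point \<Lambda> z \<in> carrier (torus \<Lambda>)" for z by (simp add: carrier_torus)
  have fadd: "f (z + w) - f z - f w \<in> \<Lambda>'" for z w
  proof -
    have "torus_point \<Lambda>' (f (z + w)) = torus_point \<Lambda>' (f z + f w)"
      using hom_mult[OF hom mem mem, of z w] by (simp add: mult_torus[OF cs(1)] mult_torus[OF cs(2)] fi)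
    then show ?thesis by (simp add: eq algebra_simps)
  qed
  have cont: "continuous_on UNIV f" using f by (rule holomorphic_on_imp_continuous_on)
  have const: "f (z + w) - f z - f w = - f 0" for z w
  proof -
    let ?h = "\<lambda>z. f (z + w) - f z - f w"
    have "continuous_on UNIV ?h"
      by (intro continuous_intros continuous_on_compose2[OF cont]) auto
    then have "connected (range ?h)" using connected_continuous_image connected_UNIV by blast
    moreover have "countable (range ?h)" using count fadd
      by (intro countable_subset[OF _ count]) auto
    ultimately have "?h z = ?h 0" using connected_uncountable[of "range ?h" "?h z" "?h 0"] by blast
    then show ?thesis by simp
  qed
  have "f (z + w) - f z = f w - f 0" for z w
    using const[of z w] by (metis add.commute diff_eq_eq uminus_add_conv_diff)
  then obtain \<beta> c where fb: "\<And>z. f z = \<beta> * z + c" using constant_differences_affine[OF f] by blast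
  have c: "c \<in> \<Lambda>'" using csub_closed(3)[OF cs(2) fadd[of 0 0]] fb[of 0] by simp
  have ib: "\<iota> (torus_point \<Lambda> z) = torus_point \<Lambda>' (\<beta> * z)" for z
    unfolding fi eq fb using c by simp
  have "\<beta> \<noteq> 0"
  proof
    assume "\<beta> = 0"
    then have "torus_point \<Lambda>' w = torus_point \<Lambda>' 0" for w
      using surj ib by (metis (no_types, lifting) carrier_torus imageE mult_zero_left rangeI)
    then have "w \<in> \<Lambda>'" for w unfolding eq by simp
    then have "\<Lambda>' = UNIV" by blast
    then show False using count uncountable_UNIV_complex by simp
  qed
  moreover have "z \<in> \<Lambda> \<longleftrightarrow> \<beta> * z \<in> \<Lambda>'" for z
  proof -
    have "z \<in> \<Lambda> \<longleftrightarrow> torus_point \<Lambda> z = torus_point \<Lambda> 0" by (simp add: eq1)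
    also have "\<dots> \<longleftrightarrow> \<iota> (torus_point \<Lambda> z) = \<iota> (torus_point \<Lambda> 0)" using inj mem by (metis inj_onD)
    also have "\<dots> \<longleftrightarrow> \<beta> * z \<in> \<Lambda>'" by (simp add: ib eq)
    finally show ?thesis .
  qed
  ultimately show ?thesis using ib by blast
qed

lemma scaling_torus_isos:
  assumes cs: "csub \<Lambda>" "csub \<Lambda>'" and b: "\<beta> \<noteq> 0" and L: "\<And>z. z \<in> \<Lambda> \<longleftrightarrow> \<beta> * z \<in> \<Lambda>'"
  shows "(`) ((*) \<beta>) \<in> torus_isos \<Lambda> \<Lambda>'" and "(*) \<beta> ` torus_point \<Lambda> z = torus_point \<Lambda>' (\<beta> * z)"
proof -
  show *: "(*) \<beta> ` torus_point \<Lambda> z = torus_point \<Lambda>' (\<beta> * z)" for z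
  proof (rule equalityI; rule subsetI)
    fix x assume "x \<in> (*) \<beta> ` torus_point \<Lambda> z"
    then obtain y where "y - z \<in> \<Lambda>" "x = \<beta> * y" by (auto simp: tp_mem)
    then show "x \<in> torus_point \<Lambda>' (\<beta> * z)" using L[of "y - z"] by (simp add: tp_mem right_diff_distrib)
  next
    fix x assume x: "x \<in> torus_point \<Lambda>' (\<beta> * z)"
    have e: "\<beta> * (x / \<beta> - z) = x - \<beta> * z" using b by (simp add: right_diff_distrib)
    have "x / \<beta> \<in> torus_point \<Lambda> z" using x L[of "x / \<beta> - z"] unfolding tp_mem e by blast
    moreover have "x = \<beta> * (x / \<beta>)" using b by simp
    ultimately show "x \<in> (*) \<beta> ` torus_point \<Lambda> z" by (metis imageI)
  qed
  have "(`) ((*) \<beta>) \<in> hom (torus \<Lambda>) (torus \<Lambda>')"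
  proof (rule homI)
    fix x y assume "x \<in> carrier (torus \<Lambda>)" "y \<in> carrier (torus \<Lambda>)"
    then obtain z w where "x = torus_point \<Lambda> z" "y = torus_point \<Lambda> w" by (auto simp: carrier_torus)
    then show "(*) \<beta> ` (x \<otimes>\<^bsub>torus \<Lambda>\<^esub> y) = (*) \<beta> ` x \<otimes>\<^bsub>torus \<Lambda>'\<^esub> (*) \<beta> ` y"
      by (simp only: * mult_torus[OF cs(1)] mult_torus[OF cs(2)] distrib_left)
  qed (auto simp: carrier_torus *)
  moreover have "bij_betw ((`) ((*) \<beta>)) (carrier (torus \<Lambda>)) (carrier (torus \<Lambda>'))"
    unfolding bij_betw_def
  proof
    show "inj_on ((`) ((*) \<beta>)) (carrier (torus \<Lambda>))"
      using b by (auto intro!: inj_onI simp: inj_image_eq_iff inj_def)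
    show "(`) ((*) \<beta>) ` carrier (torus \<Lambda>) = carrier (torus \<Lambda>')"
    proof (rule equalityI; rule subsetI)
      fix y assume "y \<in> carrier (torus \<Lambda>')"
      then obtain w where w: "y = torus_point \<Lambda>' w" by (auto simp: carrier_torus)
      then have "y = (*) \<beta> ` torus_point \<Lambda> (w / \<beta>)" using b by (simp add: *)
      then show "y \<in> (`) ((*) \<beta>) ` carrier (torus \<Lambda>)" by (auto simp: carrier_torus)
    qed (auto simp: carrier_torus *)
  qed
  ultimately have "(`) ((*) \<beta>) \<in> iso (torus \<Lambda>) (torus \<Lambda>')" by (simp add: iso_def)
  moreover have "(*) \<beta> holomorphic_on UNIV" by (intro holomorphic_intros)
  ultimately show "(`) ((*) \<beta>) \<in> torus_isos \<Lambda> \<Lambda>'" unfolding torus_isos_def using * by blast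
qed

text \<open>Expressing the scaled bases in terms of each other gives two integral matrices inverse
  to each other. Both basis ratios have positive imaginary part, which excludes determinant
  -1.\<close>

lemma homothetic_lattices:
  assumes t: "Im \<tau> > 0" "Im \<tau>' > 0" and L: "\<And>z. z \<in> ulat 1 \<tau> \<longleftrightarrow> \<delta> * z \<in> ulat 1 \<tau>'" and d: "\<delta> \<noteq> 0"
  shows "\<exists>\<gamma>\<in>SL2Z. \<tau>' = mob \<gamma> \<tau> \<and> \<delta> * den \<gamma> \<tau> = 1"
proof -
  have rp: "x \<in> ulat 1 \<sigma> \<longleftrightarrow> (\<exists>a b. x = of_int a * \<sigma> + of_int b)" for x \<sigma>
  proof
    assume "x \<in> ulat 1 \<sigma>"
    then obtain w where "x = 1 * Jf w \<sigma>" by (elim ulat_memE)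
    then have "x = of_int (- w $ 2) * \<sigma> + of_int (w $ 1)" by (simp add: Jf_def)
    then show "\<exists>a b. x = of_int a * \<sigma> + of_int b" by blast
  next
    assume "\<exists>a b. x = of_int a * \<sigma> + of_int b"
    then obtain a b where "x = of_int a * \<sigma> + of_int b" by blast
    then have "x = 1 * Jf (vector [b, - a]) \<sigma>" by (simp add: Jf_def)
    then show "x \<in> ulat 1 \<sigma>" using ulat_memI by metis
  qed
  have "\<tau>' / \<delta> \<in> ulat 1 \<tau>" "1 / \<delta> \<in> ulat 1 \<tau>"
  proof -
    have "\<tau>' \<in> ulat 1 \<tau>'" "1 \<in> ulat 1 \<tau>'"
      unfolding rp by (rule exI[of _ 1], rule exI[of _ 0], simp) (rule exI[of _ 0], rule exI[of _ 1], simp)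
    then show "\<tau>' / \<delta> \<in> ulat 1 \<tau>" "1 / \<delta> \<in> ulat 1 \<tau>" using L d by simp_all
  qed
  then obtain a b c e where ab: "\<tau>' / \<delta> = of_int a * \<tau> + of_int b" "1 / \<delta> = of_int c * \<tau> + of_int e"
    unfolding rp by blast
  have "\<tau> \<in> ulat 1 \<tau>" "1 \<in> ulat 1 \<tau>" unfolding rp by (rule exI[of _ 1], rule exI[of _ 0], simp) (rule exI[of _ 0], rule exI[of _ 1], simp)
  then have "\<delta> * \<tau> \<in> ulat 1 \<tau>'" "\<delta> * 1 \<in> ulat 1 \<tau>'" using L by blast+
  then obtain a' b' c' e' where ab': "\<delta> * \<tau> = of_int a' * \<tau>' + of_int b'" "\<delta> = of_int c' * \<tau>' + of_int e'"
    unfolding rp by auto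
  define \<gamma> where "\<gamma> = mk2 a b c e"
  define \<gamma>' where "\<gamma>' = mk2 a' b' c' e'"
  have n: "num \<gamma> \<tau> = \<tau>' / \<delta>" "den \<gamma> \<tau> = 1 / \<delta>" by (simp_all add: \<gamma>_def num_def den_def ab)
  have "\<tau> = (of_int a' * \<tau>' + of_int b') / \<delta>" "1 = (of_int c' * \<tau>' + of_int e') / \<delta>"
    using ab' d by (metis nonzero_mult_div_cancel_left, metis divide_self)
  then have "\<tau> = of_int a' * (\<tau>' / \<delta>) + of_int b' * (1 / \<delta>)" "1 = of_int c' * (\<tau>' / \<delta>) + of_int e' * (1 / \<delta>)"
    by (simp_all add: add_divide_distrib)
  then have "of_int 1 * \<tau> + of_int 0 = of_int (a' * a + b' * c) * \<tau> + of_int (a' * b + b' * e)"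
    "of_int 0 * \<tau> + of_int 1 = of_int (c' * a + e' * c) * \<tau> + of_int (c' * b + e' * e)"
    unfolding ab by (simp_all add: algebra_simps)
  then have "1 = a' * a + b' * c" "0 = a' * b + b' * e" "0 = c' * a + e' * c" "1 = c' * b + e' * e"
    using of_int_lin_eq_iff[OF t(1)] by blast+
  then have "\<gamma>' ** \<gamma> = mat 1" by (simp add: \<gamma>_def \<gamma>'_def mat2_eq_iff)
  then have "det \<gamma>' * det \<gamma> = 1" by (metis det_I det_mul)
  then have dd: "det \<gamma> = 1 \<or> det \<gamma> = -1" by (metis zmult_eq_1_iff mult.commute)
  have m: "mob \<gamma> \<tau> = \<tau>'" using d by (simp add: mob_def n)
  then have I: "Im \<tau>' = of_int (det \<gamma>) * Im \<tau> / (cmod (den \<gamma> \<tau>))\<^sup>2" using Im_mob[OF t(1), of \<gamma>] dd by auto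
  have "det \<gamma> \<noteq> -1"
  proof
    assume "det \<gamma> = -1"
    then have "Im \<tau>' = - (Im \<tau> / (cmod (den \<gamma> \<tau>))\<^sup>2)" using I by simp
    moreover have "Im \<tau> / (cmod (den \<gamma> \<tau>))\<^sup>2 \<ge> 0" using t by simp
    ultimately show False using t(2) by linarith
  qed
  then have "\<gamma> \<in> SL2Z" using dd by (simp add: SL2Z_iff)
  then show ?thesis using m n d by (intro bexI[of _ \<gamma>]) auto
qed

section \<open>Points of the modular curve in terms of the upper half-plane\<close>

lemma ulat_scale: "\<alpha> \<noteq> 0 \<Longrightarrow> \<alpha> * z \<in> ulat \<alpha> \<tau> \<longleftrightarrow> z \<in> ulat 1 \<tau>"
  by (auto simp: ulat_def)

text \<open>Equality of points in double coset form, for interior points and cusps at once. The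
  element of \<open>H\<close> stands next to \<open>g'\<close>, matching the direction of
  \<open>level_matrix\<close>.\<close>

definition orb :: "nat \<Rightarrow> (int^2^2) set \<Rightarrow> hpt \<Rightarrow> int^2^2 \<Rightarrow> hpt \<Rightarrow> int^2^2 \<Rightarrow> bool" where
  "orb n H x g y g' \<longleftrightarrow> (\<exists>\<gamma>\<in>SL2Z. \<exists>h\<in>H. xeq y (act \<gamma> x) \<and> mcong n (\<gamma> ** g) (g' ** h))"

text \<open>The matrix \<open>g\<close> need not be reduced modulo \<open>n\<close> here.\<close>

fun ept :: "nat \<Rightarrow> (int^2^2) set \<Rightarrow> hpt \<Rightarrow> int^2^2 \<Rightarrow> modular_point" where
  "ept n H (Pt \<tau>) g = ell_point n H (std_pair n \<tau> g)"
| "ept n H (Cu c) g = cusp_point n H (c, red_mat n g)"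

lemma act_mult: "vx x \<Longrightarrow> \<gamma> \<in> SL2Z \<Longrightarrow> act (\<delta> ** \<gamma>) x = act \<delta> (act \<gamma> x)"
  by (cases x) (auto simp: mob_mult_SL2Z matrix_vector_mul_assoc)

lemma act_one [simp]: "act (mat 1) x = x"
  by (cases x) auto

lemma xeq_refl [simp]: "xeq x x" by (cases x) auto
lemma xeq_sym: "xeq x y \<Longrightarrow> xeq y x" by (cases x; cases y) auto
lemma xeq_trans: "xeq x y \<Longrightarrow> xeq y z \<Longrightarrow> xeq x z" by (cases x; cases y; cases z) auto

lemma mv_uminus2: "A *v (- v) = - ((A :: int^2^2) *v v)"
  by (simp add: vec2_eq_iff)

lemma xeq_act: "xeq x y \<Longrightarrow> xeq (act \<gamma> x) (act \<gamma> y)"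
  by (cases x; cases y) (auto simp: mv_uminus2)

lemma orb_trans:
  assumes "subgroup H (GL2 n)" "vx x" "orb n H x g y g'" "orb n H y g' z g''"
  shows "orb n H x g z g''"
proof -
  obtain \<gamma> h where 1: "\<gamma> \<in> SL2Z" "h \<in> H" "xeq y (act \<gamma> x)" "mcong n (\<gamma> ** g) (g' ** h)"
    using assms(3) by (auto simp: orb_def)
  obtain \<delta> k where 2: "\<delta> \<in> SL2Z" "k \<in> H" "xeq z (act \<delta> y)" "mcong n (\<delta> ** g') (g'' ** k)"
    using assms(4) by (auto simp: orb_def)
  have "xeq z (act (\<delta> ** \<gamma>) x)" unfolding act_mult[OF assms(2) 1(1)]
    using xeq_act[OF 1(3)] 2(3) xeq_trans by blast
  moreover have "mcong n ((\<delta> ** \<gamma>) ** g) (g'' ** red_mat n (k ** h))"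
  proof -
    have "mcong n (\<delta> ** (\<gamma> ** g)) (\<delta> ** (g' ** h))" using 1(4) by (rule mcong_mult_left)
    also have "mcong n (\<delta> ** (g' ** h)) ((g'' ** k) ** h)"
      unfolding matrix_mul_assoc using 2(4) by (rule mcong_mult_right)
    also have "mcong n \<dots> (g'' ** red_mat n (k ** h))"
      unfolding matrix_mul_assoc[symmetric] by (intro mcong_mult) auto
    finally show ?thesis by (simp add: matrix_mul_assoc)
  qed
  ultimately show ?thesis unfolding orb_def
    using SL2Z_mult 1 2 subgroup_GL2D(3)[OF assms(1)] by blast
qed

lemma orb_sym:
  assumes "subgroup H (GL2 n)" "vx x" "orb n H x g y g'"
  shows "orb n H y g' x g"
proof -
  obtain \<gamma> h where 1: "\<gamma> \<in> SL2Z" "h \<in> H" "xeq y (act \<gamma> x)" "mcong n (\<gamma> ** g) (g' ** h)"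
    using assms(3) by (auto simp: orb_def)
  obtain k where k: "k \<in> H" "mcong n (h ** k) (mat 1)" using subgroup_GL2D(4)[OF assms(1) 1(2)] by blast
  have "xeq (act (adj2 \<gamma>) y) (act (adj2 \<gamma>) (act \<gamma> x))" using 1(3) by (rule xeq_act)
  then have "xeq x (act (adj2 \<gamma>) y)"
    using act_mult[OF assms(2) 1(1), of "adj2 \<gamma>"] SL2Z_adj2_mult(2)[OF 1(1)] by (simp add: xeq_sym)
  moreover have "mcong n (adj2 \<gamma> ** g') (g ** k)"
  proof -
    have "mcong n (adj2 \<gamma> ** (g' ** mat 1)) (adj2 \<gamma> ** (g' ** (h ** k)))"
      using k by (intro mcong_mult) (auto simp: mcong_sym)
    also have "\<dots> = adj2 \<gamma> ** ((g' ** h) ** k)" by (simp add: matrix_mul_assoc)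
    also have "mcong n \<dots> (adj2 \<gamma> ** ((\<gamma> ** g) ** k))"
      using 1(4) by (intro mcong_mult_left mcong_mult_right) (rule mcong_sym)
    also have "\<dots> = g ** k" using SL2Z_adj2_mult(2)[OF 1(1)] by (simp add: matrix_mul_assoc)
    finally show ?thesis by simp
  qed
  ultimately show ?thesis unfolding orb_def using SL2Z_adj2 1 k by blast
qed

lemma orb_refl: "subgroup H (GL2 n) \<Longrightarrow> mcong n g g' \<Longrightarrow> xeq x y \<Longrightarrow> orb n H x g y g'"
  unfolding orb_def
proof (rule bexI[of _ "mat 1"], rule bexI[of _ "red_mat n (mat 1)"], rule conjI)
  assume "mcong n g g'"
  also have "mcong n g' (g' ** red_mat n (mat 1))"
    using mcong_mult[of n g' g' "mat 1" "red_mat n (mat 1)"] by simp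
  finally show "mcong n (mat 1 ** g) (g' ** red_mat n (mat 1))" by simp
qed (auto simp: SL2Z_one xeq_sym dest: subgroup_GL2D)

locale level =
  fixes n :: nat and H :: "(int^2^2) set"
  assumes npos: "n > 0" and sub: "subgroup H (GL2 n)"
begin

text \<open>An isomorphism of tori is a homothety of lattices, hence comes from a \<gamma> in
  \<open>SL2Z\<close>; comparing the two level structures in the coordinates of the target gives the
  congruence. The converse builds the scaling from \<gamma>.\<close>

lemma level_rel_iff:
  assumes p: "rep n p \<tau> g" and q: "rep n q \<tau>' g'"
  shows "(p, q) \<in> level_rel n H \<longleftrightarrow> orb n H (Pt \<tau>) g (Pt \<tau>') g'"
proof -
  obtain \<Lambda> \<phi> where pp: "p = (\<Lambda>, \<phi>)" by (cases p)
  obtain \<Lambda>' \<phi>' where qq: "q = (\<Lambda>', \<phi>')" by (cases q)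
  obtain \<alpha> where a: "\<alpha> \<noteq> 0" "\<Lambda> = ulat \<alpha> \<tau>" "Im \<tau> > 0"
    and \<phi>: "\<And>v. v \<in> carrier (vec2_group n) \<Longrightarrow> \<phi> v = torus_point \<Lambda> (\<alpha> * (Jf (g *v v) \<tau> / of_nat n))"
    using p by (auto simp: rep_def pp)
  obtain \<alpha>' where a': "\<alpha>' \<noteq> 0" "\<Lambda>' = ulat \<alpha>' \<tau>'" "Im \<tau>' > 0"
    and \<phi>': "\<And>v. v \<in> carrier (vec2_group n) \<Longrightarrow> \<phi>' v = torus_point \<Lambda>' (\<alpha>' * (Jf (g' *v v) \<tau>' / of_nat n))"
    using q by (auto simp: rep_def qq)
  note eq = tp_Jf_eq_iff[OF npos a'(1,3), folded a'(2)]
  have \<phi>'h: "\<phi>' (red_vec n (h *v v)) = torus_point \<Lambda>' (\<alpha>' * (Jf ((g' ** h) *v v) \<tau>' / of_nat n))" for h v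
  proof -
    have "\<phi>' (red_vec n (h *v v)) = torus_point \<Lambda>' (\<alpha>' * (Jf (g' *v red_vec n (h *v v)) \<tau>' / of_nat n))"
      using \<phi>' by (simp add: carrier_vec2)
    also have "\<dots> = torus_point \<Lambda>' (\<alpha>' * (Jf ((g' ** h) *v v) \<tau>' / of_nat n))"
      unfolding eq matrix_vector_mul_assoc[symmetric] by (rule vcong_mult) auto
    finally show ?thesis .
  qed
  have J: "Jf (g *v v) \<tau> = Jf ((\<gamma> ** g) *v v) \<tau>' * den \<gamma> \<tau>" if "\<gamma> \<in> SL2Z" "\<tau>' = mob \<gamma> \<tau>" for \<gamma> v
    using Jf_mob[OF a(3), of \<gamma> "g *v v"] that by (simp add: SL2Z_iff matrix_vector_mul_assoc)
  show ?thesis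
  proof
    assume "(p, q) \<in> level_rel n H"
    then obtain \<iota> h where i: "\<iota> \<in> torus_isos \<Lambda> \<Lambda>'" and h: "h \<in> H" and lm: "level_matrix n \<phi>' \<iota> \<phi> h"
      by (auto simp: level_rel_def pp qq)
    obtain \<beta> where b: "\<beta> \<noteq> 0" "\<And>z. \<iota> (torus_point \<Lambda> z) = torus_point \<Lambda>' (\<beta> * z)" "\<And>z. z \<in> \<Lambda> \<longleftrightarrow> \<beta> * z \<in> \<Lambda>'"
      using torus_isos_scaling[OF a(2) a'(2) i] by blast
    \<comment> \<open>Normalizes both lattices to the form Z + Z\<tau>, to which
      \<open>homothetic_lattices\<close> applies.\<close>
    define \<delta> where "\<delta> = \<beta> * \<alpha> / \<alpha>'"
    have d: "\<delta> \<noteq> 0" "\<beta> * \<alpha> = \<alpha>' * \<delta>" using a a' b by (simp_all add: \<delta>_def)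
    have "z \<in> ulat 1 \<tau> \<longleftrightarrow> \<delta> * z \<in> ulat 1 \<tau>'" for z
      using ulat_scale[OF a(1), of z \<tau>] ulat_scale[OF a'(1), of "\<delta> * z" \<tau>'] b(3)[of "\<alpha> * z"] d(2)
      by (simp add: a a' mult.assoc[symmetric])
    then obtain \<gamma> where g: "\<gamma> \<in> SL2Z" "\<tau>' = mob \<gamma> \<tau>" "\<delta> * den \<gamma> \<tau> = 1"
      using homothetic_lattices[OF a(3) a'(3) _ d(1)] by blast
    have "mcong n (\<gamma> ** g) (g' ** h)"
    proof (rule vcong_all_imp_mcong)
      fix v assume v: "v \<in> carrier (vec2_group n)"
      have "torus_point \<Lambda>' (\<alpha>' * (Jf ((\<gamma> ** g) *v v) \<tau>' / of_nat n)) = torus_point \<Lambda>' (\<beta> * (\<alpha> * (Jf (g *v v) \<tau> / of_nat n)))"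
      proof -
        have "\<beta> * (\<alpha> * (Jf (g *v v) \<tau> / of_nat n)) = \<alpha>' * (Jf ((\<gamma> ** g) *v v) \<tau>' * (\<delta> * den \<gamma> \<tau>) / of_nat n)"
          unfolding mult.assoc[of \<beta> \<alpha>, symmetric] d(2) J[OF g(1,2), of v]
          by (simp only: times_divide_eq_right mult_ac)
        then show ?thesis unfolding g(3) by (simp only: mult_1_right)
      qed
      also have "\<dots> = \<iota> (\<phi> v)" using b(2) \<phi>[OF v] by simp
      also have "\<dots> = \<phi>' (red_vec n (h *v v))" using lm v by (simp add: level_matrix_def)
      finally show "vcong n ((\<gamma> ** g) *v v) ((g' ** h) *v v)" unfolding \<phi>'h eq .
    qed
    then show "orb n H (Pt \<tau>) g (Pt \<tau>') g'" unfolding orb_def using g h by auto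
  next
    assume "orb n H (Pt \<tau>) g (Pt \<tau>') g'"
    then obtain \<gamma> h where g: "\<gamma> \<in> SL2Z" "\<tau>' = mob \<gamma> \<tau>" and h: "h \<in> H" "mcong n (\<gamma> ** g) (g' ** h)"
      by (auto simp: orb_def)
    have nz: "den \<gamma> \<tau> \<noteq> 0" using den_nz a(3) g by (simp add: SL2Z_iff)
    \<comment> \<open>The scaling that absorbs the automorphy factor and takes the scale \<alpha> of
      the first lattice to the scale \<alpha>' of the second.\<close>
    define \<beta> where "\<beta> = \<alpha>' / (\<alpha> * den \<gamma> \<tau>)"
    have b: "\<beta> \<noteq> 0" "\<beta> * \<alpha> * den \<gamma> \<tau> = \<alpha>'" using nz a a' by (simp_all add: \<beta>_def)
    have L: "z \<in> \<Lambda> \<longleftrightarrow> \<beta> * z \<in> \<Lambda>'" for z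
    proof
      assume "z \<in> \<Lambda>"
      then obtain w where "z = \<alpha> * Jf w \<tau>" unfolding a by (elim ulat_memE)
      then have "\<beta> * z = \<beta> * (\<alpha> * (Jf (\<gamma> *v w) \<tau>' * den \<gamma> \<tau>))"
        using Jf_mob[OF a(3), of \<gamma> w] g by (simp add: SL2Z_iff)
      also have "\<dots> = \<beta> * \<alpha> * den \<gamma> \<tau> * Jf (\<gamma> *v w) \<tau>'" by (simp only: mult_ac)
      finally have "\<beta> * z = \<alpha>' * Jf (\<gamma> *v w) \<tau>'" unfolding b(2) .
      then show "\<beta> * z \<in> \<Lambda>'" unfolding a' by (simp add: ulat_memI)
    next
      assume "\<beta> * z \<in> \<Lambda>'"
      then obtain w where w: "\<beta> * z = \<alpha>' * Jf w \<tau>'" unfolding a' by (elim ulat_memE)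
      have jw: "Jf w \<tau>' * den \<gamma> \<tau> = Jf (adj2 \<gamma> *v w) \<tau>"
        using Jf_mob[OF a(3), of \<gamma> "adj2 \<gamma> *v w"] g SL2Z_vec_cancel[OF g(1), of w] by (simp add: SL2Z_iff)
      have "\<beta> * z = \<beta> * (\<alpha> * (Jf w \<tau>' * den \<gamma> \<tau>))" unfolding w b(2)[symmetric] by (simp only: mult_ac)
      then have "z = \<alpha> * Jf (adj2 \<gamma> *v w) \<tau>" unfolding jw using b(1) by simp
      then show "z \<in> \<Lambda>" unfolding a by (simp add: ulat_memI)
    qed
    have cs: "csub \<Lambda>" "csub \<Lambda>'" by (simp_all add: a a' csub_ulat)
    note sc = scaling_torus_isos[OF cs b(1) L]
    have "level_matrix n \<phi>' ((`) ((*) \<beta>)) \<phi> h"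
      unfolding level_matrix_def
    proof (intro conjI ballI)
      show "h \<in> carrier (GL2 n)" using subgroup_GL2D(1)[OF sub] h by blast
      fix v assume v: "v \<in> carrier (vec2_group n)"
      have "(*) \<beta> ` \<phi> v = torus_point \<Lambda>' (\<beta> * (\<alpha> * (Jf (g *v v) \<tau> / of_nat n)))" using \<phi>[OF v] sc(2) by simp
      also have "\<beta> * (\<alpha> * (Jf (g *v v) \<tau> / of_nat n)) = \<alpha>' * (Jf ((\<gamma> ** g) *v v) \<tau>' / of_nat n)"
        unfolding b(2)[symmetric] J[OF g] by (simp only: times_divide_eq_right mult_ac)
      also have "torus_point \<Lambda>' \<dots> = \<phi>' (red_vec n (h *v v))"
        unfolding \<phi>'h eq using h by (intro vcong_mult) auto
      finally show "(*) \<beta> ` \<phi> v = \<phi>' (red_vec n (h *v v))" .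
    qed
    then show "(p, q) \<in> level_rel n H"
      using sc(1) h rep_level_pairs[OF npos] p q unfolding level_rel_def pp qq by blast
  qed
qed

lemma ell_point_eq_iff:
  assumes p: "rep n p \<tau> g" and q: "rep n q \<tau>' g'"
  shows "ell_point n H p = ell_point n H q \<longleftrightarrow> orb n H (Pt \<tau>) g (Pt \<tau>') g'"
proof
  assume "ell_point n H p = ell_point n H q"
  then have "level_rel n H `` {p} = level_rel n H `` {q}" by (simp add: ell_point_def)
  moreover have "(q, q) \<in> level_rel n H" unfolding level_rel_iff[OF q q] by (rule orb_refl[OF sub]) auto
  ultimately show "orb n H (Pt \<tau>) g (Pt \<tau>') g'" unfolding level_rel_iff[OF p q, symmetric] by blast
next
  assume o: "orb n H (Pt \<tau>) g (Pt \<tau>') g'"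
  have v: "vx (Pt \<tau>)" "vx (Pt \<tau>')" using p q by (auto simp: rep_def)
  have "(p, r) \<in> level_rel n H \<longleftrightarrow> (q, r) \<in> level_rel n H" for r
  proof (cases "r \<in> level_pairs n")
    case True
    then obtain \<sigma> k where r: "rep n r \<sigma> k" using level_pairs_rep[OF npos] by blast
    show ?thesis unfolding level_rel_iff[OF p r] level_rel_iff[OF q r]
      using orb_trans[OF sub] orb_sym[OF sub] o v by blast
  next
    case False then show ?thesis by (auto simp: level_rel_def)
  qed
  then show "ell_point n H p = ell_point n H q" by (auto simp: ell_point_def)
qed

text \<open>The definition multiplies \<open>g\<close> by an element of \<open>H\<close>, while
  \<open>orb\<close> multiplies \<open>g'\<close>; the two differ by an inverse in
  \<open>H\<close>.\<close>

lemma cusp_rel_iff: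
  assumes "coprime (c $ 1) (c $ 2)" "coprime (d $ 1) (d $ 2)" "g \<in> carrier (GL2 n)" "g' \<in> carrier (GL2 n)"
  shows "((c, g), (d, g')) \<in> cusp_rel n H \<longleftrightarrow> orb n H (Cu c) g (Cu d) g'"
proof -
  have e: "(\<exists>\<epsilon>\<in>{1, -1}. d = \<epsilon> *s (\<gamma> *v c)) \<longleftrightarrow> xeq (Cu d) (act \<gamma> (Cu c))" for \<gamma>
    by (auto simp: vec2_eq_iff)
  have m: "(\<exists>h\<in>H. g' = red_mat n (\<gamma> ** g ** h)) \<longleftrightarrow> (\<exists>h\<in>H. mcong n (\<gamma> ** g) (g' ** h))" for \<gamma>
  proof
    assume "\<exists>h\<in>H. g' = red_mat n (\<gamma> ** g ** h)"
    then obtain h where h: "h \<in> H" "g' = red_mat n (\<gamma> ** g ** h)" by blast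
    obtain k where k: "k \<in> H" "mcong n (h ** k) (mat 1)" using subgroup_GL2D(4)[OF sub h(1)] by blast
    have "mcong n (g' ** k) ((\<gamma> ** g ** h) ** k)" unfolding h by (intro mcong_mult) auto
    also have "\<dots> = (\<gamma> ** g) ** (h ** k)" by (simp add: matrix_mul_assoc)
    also have "mcong n \<dots> ((\<gamma> ** g) ** mat 1)" using k(2) by (rule mcong_mult_left)
    finally show "\<exists>h\<in>H. mcong n (\<gamma> ** g) (g' ** h)" using k mcong_sym by (auto simp del: mult2_nth)
  next
    assume "\<exists>h\<in>H. mcong n (\<gamma> ** g) (g' ** h)"
    then obtain h where h: "h \<in> H" "mcong n (\<gamma> ** g) (g' ** h)" by blast
    obtain k where k: "k \<in> H" "mcong n (h ** k) (mat 1)" using subgroup_GL2D(4)[OF sub h(1)] by blast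
    have "mcong n (\<gamma> ** g ** k) ((g' ** h) ** k)" using h(2) by (rule mcong_mult_right)
    also have "\<dots> = g' ** (h ** k)" by (simp add: matrix_mul_assoc)
    also have "mcong n \<dots> (g' ** mat 1)" using k(2) by (rule mcong_mult_left)
    finally have "mcong n (\<gamma> ** g ** k) g'" by simp
    then have "g' = red_mat n (\<gamma> ** g ** k)" using GL2_D[OF assms(4)] by (simp add: mcong_def)
    then show "\<exists>h\<in>H. g' = red_mat n (\<gamma> ** g ** h)" using k by blast
  qed
  show ?thesis unfolding cusp_rel_def orb_def e[symmetric] using assms m by (auto simp: cusp_pairs_def) 
qed

lemma cusp_point_eq_iff:
  assumes "coprime (c $ 1) (c $ 2)" "coprime (d $ 1) (d $ 2)" "g \<in> carrier (GL2 n)" "g' \<in> carrier (GL2 n)"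
  shows "cusp_point n H (c, g) = cusp_point n H (d, g') \<longleftrightarrow> orb n H (Cu c) g (Cu d) g'"
proof
  assume "cusp_point n H (c, g) = cusp_point n H (d, g')"
  then have "cusp_rel n H `` {(c, g)} = cusp_rel n H `` {(d, g')}" by (simp add: cusp_point_def)
  moreover have "((d, g'), (d, g')) \<in> cusp_rel n H"
    unfolding cusp_rel_iff[OF assms(2,2,4,4)] by (rule orb_refl[OF sub]) auto
  ultimately show "orb n H (Cu c) g (Cu d) g'" unfolding cusp_rel_iff[OF assms, symmetric] by blast
next
  assume o: "orb n H (Cu c) g (Cu d) g'"
  have v: "vx (Cu c)" "vx (Cu d)" using assms by auto
  have "((c, g), r) \<in> cusp_rel n H \<longleftrightarrow> ((d, g'), r) \<in> cusp_rel n H" for r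
  proof (cases "r \<in> cusp_pairs n")
    case True
    obtain e k where r: "r = (e, k)" by (cases r)
    then have ek: "coprime (e $ 1) (e $ 2)" "k \<in> carrier (GL2 n)" using True by (auto simp: cusp_pairs_def)
    show ?thesis unfolding r cusp_rel_iff[OF assms(1) ek(1) assms(3) ek(2)] cusp_rel_iff[OF assms(2) ek(1) assms(4) ek(2)]
      using orb_trans[OF sub] orb_sym[OF sub] o v by blast
  next
    case False then show ?thesis by (auto simp: cusp_rel_def)
  qed
  then show "cusp_point n H (c, g) = cusp_point n H (d, g')" by (auto simp: cusp_point_def)
qed

abbreviation cop :: "int^2^2 \<Rightarrow> bool" where "cop g \<equiv> coprime (det g) (int n)"

lemma ept_eq_iff:
  assumes "vx x" "vx y" "cop g" "cop g'"
  shows "ept n H x g = ept n H y g' \<longleftrightarrow> orb n H x g y g'"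
proof (cases x; cases y)
  fix \<tau> \<tau>' assume "x = Pt \<tau>" "y = Pt \<tau>'"
  then show ?thesis using ell_point_eq_iff[OF rep_std rep_std] assms by simp
next
  fix c d assume xy: "x = Cu c" "y = Cu d"
  have "orb n H x g x (red_mat n g)" "orb n H y g' y (red_mat n g')" by (auto intro: orb_refl[OF sub])
  moreover have "ept n H x g = ept n H y g' \<longleftrightarrow> orb n H x (red_mat n g) y (red_mat n g')"
    using cusp_point_eq_iff[of c d "red_mat n g" "red_mat n g'"] assms by (simp add: xy GL2_red_mem)
  ultimately show ?thesis using orb_trans[OF sub] orb_sym[OF sub] assms by blast
qed (auto simp: ell_point_def cusp_point_def orb_def)

lemma ell_point_rep: "rep n p \<tau> g \<Longrightarrow> ell_point n H p = ept n H (Pt \<tau>) g"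
  using ell_point_eq_iff[OF _ rep_std, of p \<tau> g \<tau> g] orb_refl[OF sub] by (auto simp: rep_def)

lemma X_points_iff: "P \<in> X_points n H \<longleftrightarrow> (\<exists>x g. vx x \<and> cop g \<and> P = ept n H x g)"
proof
  assume "P \<in> X_points n H"
  then consider p where "p \<in> level_pairs n" "P = ell_point n H p"
    | c g where "(c, g) \<in> cusp_pairs n" "P = cusp_point n H (c, g)"
    by (auto simp: X_points_def Y_points_def cusps_def)
  then show "\<exists>x g. vx x \<and> cop g \<and> P = ept n H x g"
  proof cases
    case 1
    then obtain \<tau> g where "rep n p \<tau> g" using level_pairs_rep[OF npos] by blast
    then show ?thesis using ell_point_rep 1 by (intro exI[of _ "Pt \<tau>"] exI[of _ g]) (auto simp: rep_def)
  next
    case 2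
    then show ?thesis
      by (intro exI[of _ "Cu c"] exI[of _ g]) (auto simp: cusp_pairs_def GL2_coprime GL2_D)
  qed
next
  assume "\<exists>x g. vx x \<and> cop g \<and> P = ept n H x g"
  then obtain x g where x: "vx x" "cop g" "P = ept n H x g" by blast
  show "P \<in> X_points n H"
  proof (cases x)
    case (Pt \<tau>)
    then show ?thesis using x rep_level_pairs[OF npos rep_std, of \<tau> g] by (auto simp: X_points_def Y_points_def)
  next
    case (Cu c)
    then have "(c, red_mat n g) \<in> cusp_pairs n" using x by (simp add: cusp_pairs_def GL2_red_mem)
    then show ?thesis using x Cu by (auto simp: X_points_def cusps_def)
  qed
qed

lemma ept_mem: "vx x \<Longrightarrow> cop g \<Longrightarrow> ept n H x g \<in> X_points n H"
  using X_points_iff by blast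

lemma cusps_iff: "vx x \<Longrightarrow> cop g \<Longrightarrow> ept n H x g \<in> cusps n H \<longleftrightarrow> (\<exists>c. x = Cu c)"
  by (cases x) (auto simp: cusps_def cusp_point_def ell_point_def cusp_pairs_def GL2_red_mem)

lemma ept_cong: "vx x \<Longrightarrow> cop g \<Longrightarrow> mcong n g g' \<Longrightarrow> ept n H x g = ept n H x g'"
  using ept_eq_iff[of x x g g'] orb_refl[OF sub, of g g' x x] mcong_coprime_det by simp

section \<open>The topology through representatives\<close>

text \<open>Openness in the half-plane means eventual membership at each point of the set, which is
  also the shape of the horoball condition; so both clauses of the topology become one statement
  along \<open>nbf\<close>.\<close>

lemma X_open_iff:
  "X_open n H U \<longleftrightarrow> U \<subseteq> X_points n H \<and>
     (\<forall>x g. vx x \<longrightarrow> cop g \<longrightarrow> ept n H x g \<in> U \<longrightarrow> eventually (\<lambda>\<tau>. ept n H (Pt \<tau>) g \<in> U) (nbf x))"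
  (is "?L \<longleftrightarrow> ?R")
proof -
  have red: "ept n H (Pt \<tau>) (red_mat n g) = ept n H (Pt \<tau>) g" if "Im \<tau> > 0" "cop g" for \<tau> g
    using ept_cong[of "Pt \<tau>" g "red_mat n g"] that by simp
  have 1: "(\<forall>g\<in>carrier (GL2 n). open {\<tau>. Im \<tau> > 0 \<and> ell_point n H (std_pair n \<tau> g) \<in> U}) \<longleftrightarrow>
        (\<forall>\<tau> g. Im \<tau> > 0 \<longrightarrow> cop g \<longrightarrow> ept n H (Pt \<tau>) g \<in> U \<longrightarrow> eventually (\<lambda>\<tau>. ept n H (Pt \<tau>) g \<in> U) (nhds \<tau>))"
    (is "?A \<longleftrightarrow> ?B")
  proof
    assume A: ?A
    show ?B
    proof (intro allI impI)
      fix \<tau> g assume t: "Im \<tau> > 0" "cop g" "ept n H (Pt \<tau>) g \<in> U"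
      let ?S = "{\<tau>. Im \<tau> > 0 \<and> ell_point n H (std_pair n \<tau> (red_mat n g)) \<in> U}"
      have "open ?S" using A t by (simp add: GL2_red_mem)
      moreover have "\<tau> \<in> ?S" using t red[of \<tau> g] by simp
      moreover have "\<forall>\<sigma>\<in>?S. ept n H (Pt \<sigma>) g \<in> U" using t red[of _ g] by auto
      ultimately show "eventually (\<lambda>\<tau>. ept n H (Pt \<tau>) g \<in> U) (nhds \<tau>)" unfolding eventually_nhds by blast
    qed
  next
    assume B: ?B
    show ?A
    proof
      fix g assume g: "g \<in> carrier (GL2 n)"
      show "open {\<tau>. Im \<tau> > 0 \<and> ell_point n H (std_pair n \<tau> g) \<in> U}"
      proof (subst open_subopen, intro ballI)
        fix \<tau> assume t: "\<tau> \<in> {\<tau>. Im \<tau> > 0 \<and> ell_point n H (std_pair n \<tau> g) \<in> U}"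
        then have "eventually (\<lambda>\<tau>. ept n H (Pt \<tau>) g \<in> U \<and> Im \<tau> > 0) (nhds \<tau>)"
          using B GL2_coprime[OF g] eventually_Im_pos[of "Pt \<tau>"] by (auto intro!: eventually_conj)
        then obtain S where "open S" "\<tau> \<in> S" "\<forall>\<sigma>\<in>S. ept n H (Pt \<sigma>) g \<in> U \<and> Im \<sigma> > 0"
          unfolding eventually_nhds by blast
        then show "\<exists>T. open T \<and> \<tau> \<in> T \<and> T \<subseteq> {\<tau>. Im \<tau> > 0 \<and> ell_point n H (std_pair n \<tau> g) \<in> U}" by auto
      qed
    qed
  qed
  have 2: "(\<forall>(c, g)\<in>cusp_pairs n. cusp_point n H (c, g) \<in> U \<longrightarrow>
        (\<exists>A>0. \<forall>\<tau>. Im \<tau> > 0 \<and> Im \<tau> > A * (cmod (of_int (c $ 1) - of_int (c $ 2) * \<tau>))\<^sup>2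
                 \<longrightarrow> ell_point n H (std_pair n \<tau> g) \<in> U)) \<longleftrightarrow>
        (\<forall>c g. coprime (c $ 1) (c $ 2) \<longrightarrow> cop g \<longrightarrow> ept n H (Cu c) g \<in> U \<longrightarrow>
          eventually (\<lambda>\<tau>. ept n H (Pt \<tau>) g \<in> U) (nbf (Cu c)))" (is "?A \<longleftrightarrow> ?B")
  proof
    assume A: ?A
    show ?B
    proof (intro allI impI)
      fix c g assume t: "coprime (c $ 1) (c $ 2)" "cop g" "ept n H (Cu c) g \<in> U"
      then have "(c, red_mat n g) \<in> cusp_pairs n" by (simp add: cusp_pairs_def GL2_red_mem)
      then obtain A where "A > 0" "\<And>\<tau>. Im \<tau> > 0 \<Longrightarrow> Im \<tau> > A * (cmod (Jf c \<tau>))\<^sup>2 \<Longrightarrow> ept n H (Pt \<tau>) (red_mat n g) \<in> U"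
        using bspec[OF A, of "(c, red_mat n g)"] t(3) by (auto simp: Jf_def)
      then show "eventually (\<lambda>\<tau>. ept n H (Pt \<tau>) g \<in> U) (nbf (Cu c))"
        unfolding eventually_nbf_Cu using red t(2) by (intro exI[of _ A]) (auto simp: hb_def)
    qed
  next
    assume B: ?B
    show ?A
    proof (intro ballI, clarify)
      fix c g assume t: "(c, g) \<in> cusp_pairs n" "cusp_point n H (c, g) \<in> U"
      then have "coprime (c $ 1) (c $ 2)" "cop g" "ept n H (Cu c) g \<in> U" by (auto simp: cusp_pairs_def GL2_coprime GL2_D)
      then have "eventually (\<lambda>\<tau>. ept n H (Pt \<tau>) g \<in> U) (nbf (Cu c))" using B by blast
      then show "\<exists>A>0. \<forall>\<tau>. Im \<tau> > 0 \<and> Im \<tau> > A * (cmod (of_int (c $ 1) - of_int (c $ 2) * \<tau>))\<^sup>2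
                 \<longrightarrow> ell_point n H (std_pair n \<tau> g) \<in> U"
        unfolding eventually_nbf_Cu by (auto simp: hb_def Jf_def)
    qed
  qed
  have 3: "(\<forall>x g. vx x \<longrightarrow> cop g \<longrightarrow> ept n H x g \<in> U \<longrightarrow> eventually (\<lambda>\<tau>. ept n H (Pt \<tau>) g \<in> U) (nbf x)) \<longleftrightarrow>
     (\<forall>\<tau> g. Im \<tau> > 0 \<longrightarrow> cop g \<longrightarrow> ept n H (Pt \<tau>) g \<in> U \<longrightarrow> eventually (\<lambda>\<tau>. ept n H (Pt \<tau>) g \<in> U) (nhds \<tau>)) \<and>
     (\<forall>c g. coprime (c $ 1) (c $ 2) \<longrightarrow> cop g \<longrightarrow> ept n H (Cu c) g \<in> U \<longrightarrow>
          eventually (\<lambda>\<tau>. ept n H (Pt \<tau>) g \<in> U) (nbf (Cu c)))" (is "?A \<longleftrightarrow> ?B \<and> ?C")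
  proof
    assume A: ?A
    then show "?B \<and> ?C" by (metis vx.simps nbf.simps(1))
  next
    assume BC: "?B \<and> ?C"
    show ?A
    proof (intro allI impI)
      fix x g assume "vx x" "cop g" "ept n H x g \<in> U"
      then show "eventually (\<lambda>\<tau>. ept n H (Pt \<tau>) g \<in> U) (nbf x)"
        using BC by (cases x) (auto simp del: ept.simps nbf.simps(2))
    qed
  qed
  show ?thesis unfolding X_open_def 1 2 3 by blast
qed

text \<open>If another representative \<open>y\<close> of a point of the set is moved by \<gamma> to
  the chosen representative \<open>z\<close>, then \<gamma> carries the filter of \<open>y\<close>
  to that of \<open>z\<close>, and \<open>V\<close> is eventually reached.\<close>

lemma X_open_base:
  assumes x: "vx x" and g: "cop g" and V: "open V" "\<And>\<tau>. \<tau> \<in> V \<Longrightarrow> Im \<tau> > 0"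
    "eventually (\<lambda>\<tau>. \<tau> \<in> V) (nbf x)"
  shows "X_open n H (insert (ept n H x g) ((\<lambda>\<tau>. ept n H (Pt \<tau>) g) ` V))" (is "X_open n H ?W")
  unfolding X_open_iff
proof (intro conjI allI impI)
  have "ept n H (Pt \<tau>) g \<in> X_points n H" if "\<tau> \<in> V" for \<tau>
    by (rule ept_mem) (use V(2)[OF that] g in auto)
  then show "?W \<subseteq> X_points n H" using ept_mem[OF x g] by blast
  fix y g' assume y: "vx y" "cop g'" "ept n H y g' \<in> ?W"
  then obtain z where z: "vx z" "ept n H y g' = ept n H z g" "eventually (\<lambda>\<tau>. \<tau> \<in> V) (nbf z)"
  proof -
    from y(3) consider "ept n H y g' = ept n H x g" | \<tau> where "\<tau> \<in> V" "ept n H y g' = ept n H (Pt \<tau>) g" by blast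
    then show thesis
    proof cases
      case 1 then show thesis using that[of x] x V by blast
    next
      case 2
      then have "eventually (\<lambda>\<tau>. \<tau> \<in> V) (nbf (Pt \<tau>))" using V(1) by (auto simp: eventually_nhds)
      then show thesis using that[of "Pt \<tau>"] 2 V(2) by simp
    qed
  qed
  then have "orb n H y g' z g" using ept_eq_iff y g by blast
  then obtain \<gamma> h where c: "\<gamma> \<in> SL2Z" "h \<in> H" "xeq z (act \<gamma> y)" "mcong n (\<gamma> ** g') (g ** h)"
    by (auto simp: orb_def)
  have "filterlim (mob \<gamma>) (nbf z) (nbf y)" using filterlim_act[OF y(1) c(1)] nbf_xeq[OF c(3)] by simp
  then have "eventually (\<lambda>\<sigma>. mob \<gamma> \<sigma> \<in> V) (nbf y)"
    by (rule eventually_compose_filterlim[OF z(3)])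
  then show "eventually (\<lambda>\<sigma>. ept n H (Pt \<sigma>) g' \<in> ?W) (nbf y)"
    using eventually_Im_pos[OF y(1)]
  proof eventually_elim
    case (elim \<sigma>)
    have "orb n H (Pt \<sigma>) g' (Pt (mob \<gamma> \<sigma>)) g" unfolding orb_def using c by auto
    then have "ept n H (Pt \<sigma>) g' = ept n H (Pt (mob \<gamma> \<sigma>)) g"
      using ept_eq_iff[of "Pt \<sigma>" "Pt (mob \<gamma> \<sigma>)" g' g] elim V(2) y(2) g by simp
    then show ?case using elim by auto
  qed
qed

lemma topspace_X_top: "topspace (X_top n H) = X_points n H"
proof -
  have "X_open n H (X_points n H)" unfolding X_open_iff
  proof (intro conjI allI impI)
    fix x g assume x: "vx x" "cop g"
    from eventually_Im_pos[OF x(1)] show "eventually (\<lambda>\<tau>. ept n H (Pt \<tau>) g \<in> X_points n H) (nbf x)"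
      by eventually_elim (rule ept_mem; use x in simp)
  qed auto
  then show ?thesis unfolding topspace_def openin_X_top by (auto simp: X_open_def)
qed

text \<open>A common point of the two basic open sets yields a \<gamma> that, by
  \<open>nbf_apart\<close>, identifies \<open>x\<close> with \<open>y\<close>, against the choice of
  distinct points. A cusp lies in such a set only as its centre.\<close>

lemma Hausdorff_X_top: "Hausdorff_space (X_top n H)"
  unfolding Hausdorff_space_def topspace_X_top openin_X_top
proof (intro allI impI, elim conjE)
  fix P Q assume "P \<in> X_points n H" "Q \<in> X_points n H" and PQ: "P \<noteq> Q"
  then obtain x g y g' where x: "vx x" "cop g" "P = ept n H x g" and y: "vx y" "cop g'" "Q = ept n H y g'"
    unfolding X_points_iff by blast
  obtain V0 V0' where V0: "eventually (\<lambda>\<tau>. \<tau> \<in> V0) (nbf x)" "eventually (\<lambda>\<tau>. \<tau> \<in> V0') (nbf y)"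
    and ap: "\<And>\<gamma> \<sigma>. \<gamma> \<in> SL2Z \<Longrightarrow> \<sigma> \<in> V0 \<Longrightarrow> Im \<sigma> > 0 \<Longrightarrow> mob \<gamma> \<sigma> \<in> V0' \<Longrightarrow> xeq y (act \<gamma> x)"
    using nbf_apart[OF x(1) y(1)] by blast
  obtain V where V: "open V" "\<And>\<tau>. \<tau> \<in> V \<Longrightarrow> Im \<tau> > 0" "\<And>\<tau>. \<tau> \<in> V \<Longrightarrow> \<tau> \<in> V0"
    "eventually (\<lambda>\<tau>. \<tau> \<in> V) (nbf x)" "\<And>\<tau>. x = Pt \<tau> \<Longrightarrow> \<tau> \<in> V" using nbf_open[OF x(1) V0(1)] by metis
  obtain V' where V': "open V'" "\<And>\<tau>. \<tau> \<in> V' \<Longrightarrow> Im \<tau> > 0" "\<And>\<tau>. \<tau> \<in> V' \<Longrightarrow> \<tau> \<in> V0'"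
    "eventually (\<lambda>\<tau>. \<tau> \<in> V') (nbf y)" "\<And>\<tau>. y = Pt \<tau> \<Longrightarrow> \<tau> \<in> V'" using nbf_open[OF y(1) V0(2)] by metis
  let ?W = "insert (ept n H x g) ((\<lambda>\<tau>. ept n H (Pt \<tau>) g) ` V)"
  let ?W' = "insert (ept n H y g') ((\<lambda>\<tau>. ept n H (Pt \<tau>) g') ` V')"
  have "disjnt ?W ?W'"
  proof (rule ccontr)
    assume "\<not> disjnt ?W ?W'"
    then obtain R where R: "R \<in> ?W" "R \<in> ?W'" by (auto simp: disjnt_def)
    obtain z where z: "R = ept n H z g" "vx z" "z = x \<or> (\<exists>\<tau>\<in>V. z = Pt \<tau>)"
    proof -
      from R(1) consider "R = ept n H x g" | \<tau> where "\<tau> \<in> V" "R = ept n H (Pt \<tau>) g" by blast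
      then show thesis by cases (use that[of x] that[of "Pt _"] x V(2) in \<open>auto simp del: ept.simps\<close>)
    qed
    obtain z' where z': "R = ept n H z' g'" "vx z'" "z' = y \<or> (\<exists>\<tau>\<in>V'. z' = Pt \<tau>)"
    proof -
      from R(2) consider "R = ept n H y g'" | \<tau> where "\<tau> \<in> V'" "R = ept n H (Pt \<tau>) g'" by blast
      then show thesis by cases (use that[of y] that[of "Pt _"] y V'(2) in \<open>auto simp del: ept.simps\<close>)
    qed
    have "orb n H z g z' g'" using ept_eq_iff[OF z(2) z'(2) x(2) y(2)] z z' by simp
    then obtain \<gamma> h where c: "\<gamma> \<in> SL2Z" "h \<in> H" "xeq z' (act \<gamma> z)" "mcong n (\<gamma> ** g) (g' ** h)"
      by (auto simp: orb_def)
    have "xeq y (act \<gamma> x)"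
    proof (cases z)
      case (Pt \<tau>)
      then have "z' = Pt (mob \<gamma> \<tau>)" using c(3) by (cases z') auto
      moreover have "\<tau> \<in> V" using Pt z(3) V(5) by auto
      ultimately show ?thesis using ap[OF c(1), of \<tau>] V V' z'(3) by auto
    next
      case (Cu d)
      then obtain e where "z' = Cu e" using c(3) by (cases z') auto
      then have "z = x" "z' = y" using Cu z(3) z'(3) by auto
      then show ?thesis using c(3) by simp
    qed
    then have "orb n H x g y g'" unfolding orb_def using c by blast
    then show False using ept_eq_iff x y PQ by blast
  qed
  moreover have "X_open n H ?W" "X_open n H ?W'" using X_open_base V V' x y by blast+
  ultimately show "\<exists>U V. X_open n H U \<and> X_open n H V \<and> P \<in> U \<and> Q \<in> V \<and> disjnt U V"
    using x y by blast
qed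

lemma limitin_ept:
  assumes "vx x" "cop g"
  shows "limitin (X_top n H) (\<lambda>\<tau>. ept n H (Pt \<tau>) g) (ept n H x g) (nbf x)"
  unfolding limitin_def topspace_X_top openin_X_top using assms ept_mem X_open_iff by blast

end

section \<open>Morphisms and ramification\<close>

text \<open>The filter \<open>nhds a\<close> sees the point \<open>a\<close> itself, so a limit
  along it must agree with the value there.\<close>

lemma limitin_nhds_eq:
  assumes "Hausdorff_space X" "limitin X f Q (nhds a)" "f a \<in> topspace X"
  shows "f a = Q"
proof (rule ccontr)
  assume ne: "f a \<noteq> Q"
  have "Q \<in> topspace X" using assms(2) by (simp add: limitin_def)
  then obtain U V where UV: "openin X U" "openin X V" "f a \<in> U" "Q \<in> V" "disjnt U V"
    using assms ne unfolding Hausdorff_space_def by blast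
  then have "eventually (\<lambda>x. f x \<in> V) (nhds a)" using assms(2) by (simp add: limitin_def)
  then have "f a \<in> V" by (rule eventually_nhds_x_imp_x)
  then show False using UV by (auto simp: disjnt_def)
qed

lemma limitin_compose_filterlim:
  assumes "limitin X f Q G" "filterlim g G F" shows "limitin X (\<lambda>x. f (g x)) Q F"
  using assms unfolding limitin_def by (auto intro: eventually_compose_filterlim)

text \<open>What \<open>pr_pair\<close> and \<open>qt_pair\<close> have in common. The limit
  condition says continuity at interior points and the existence of a value at cusps, which is
  enough for a unique continuous extension.\<close>

locale modular_map = A: level m G + B: level n H for m G n H +
  fixes F :: "level_pair \<Rightarrow> level_pair"
  assumes F_pairs: "p \<in> level_pairs m \<Longrightarrow> F p \<in> level_pairs n"
    and F_cong: "p \<in> level_pairs m \<Longrightarrow> q \<in> level_pairs m \<Longrightarrow> ell_point m G p = ell_point m G q \<Longrightarrow>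
      ell_point n H (F p) = ell_point n H (F q)"
    and F_lim: "vx x \<Longrightarrow> A.cop g \<Longrightarrow>
      \<exists>Q. limitin (X_top n H) (\<lambda>\<tau>. ell_point n H (F (std_pair m \<tau> g))) Q (nbf x)"
begin

definition extends :: "(modular_point \<Rightarrow> modular_point) \<Rightarrow> bool" where
  "extends f \<longleftrightarrow> f \<in> extensional (X_points m G) \<and> continuous_map (X_top m G) (X_top n H) f \<and>
        (\<forall>p \<in> level_pairs m. f (ell_point m G p) = ell_point n H (F p))"

abbreviation "Flim \<equiv> \<lambda>x g Q. limitin (X_top n H) (\<lambda>\<tau>. ell_point n H (F (std_pair m \<tau> g))) Q (nbf x)"

lemma std_mem: "Im \<tau> > 0 \<Longrightarrow> A.cop g \<Longrightarrow> std_pair m \<tau> g \<in> level_pairs m"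
  using rep_level_pairs[OF A.npos rep_std] .

text \<open>Two representatives differ by a \<gamma> that carries one filter to the other and, by
  \<open>F_cong\<close>, keeps the values; limits in a Hausdorff space are unique.\<close>

lemma Flim_unique:
  assumes x: "vx x" "A.cop g" and y: "vx y" "A.cop g'" and e: "ept m G x g = ept m G y g'"
    and Q: "Flim x g Q" "Flim y g' Q'"
  shows "Q = Q'"
proof -
  obtain \<gamma> h where c: "\<gamma> \<in> SL2Z" "h \<in> G" "xeq y (act \<gamma> x)" "mcong m (\<gamma> ** g) (g' ** h)"
    using A.ept_eq_iff[OF x(1) y(1) x(2) y(2)] e by (auto simp: orb_def)
  have fl: "filterlim (mob \<gamma>) (nbf y) (nbf x)" using filterlim_act[OF x(1) c(1)] nbf_xeq[OF c(3)] by simp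
  have lim: "limitin (X_top n H) (\<lambda>\<tau>. ell_point n H (F (std_pair m (mob \<gamma> \<tau>) g'))) Q' (nbf x)"
    using limitin_compose_filterlim[OF Q(2) fl] .
  have "eventually (\<lambda>\<tau>. ell_point n H (F (std_pair m (mob \<gamma> \<tau>) g')) = ell_point n H (F (std_pair m \<tau> g))) (nbf x)"
    using eventually_Im_pos[OF x(1)]
  proof eventually_elim
    case (elim \<tau>)
    have I: "Im (mob \<gamma> \<tau>) > 0" using Im_mob_SL2Z[OF elim c(1)] .
    have "orb m G (Pt \<tau>) g (Pt (mob \<gamma> \<tau>)) g'" unfolding orb_def using c by auto
    then have "ept m G (Pt \<tau>) g = ept m G (Pt (mob \<gamma> \<tau>)) g'"
      using A.ept_eq_iff[of "Pt \<tau>" "Pt (mob \<gamma> \<tau>)" g g'] elim I x y by simp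
    then show ?case using F_cong[OF std_mem[OF elim x(2)] std_mem[OF I y(2)]] by simp
  qed
  then have "Flim x g Q'" by (rule limitin_transform_eventually[OF _ lim])
  then show ?thesis
    using limitin_Hausdorff_unique[OF Q(1) _ _ B.Hausdorff_X_top] nbf_ne_bot[OF x(1)] by blast
qed

lemma ell_point_F_mem: "p \<in> level_pairs m \<Longrightarrow> ell_point n H (F p) \<in> X_points n H"
  using F_pairs by (auto simp: X_points_def Y_points_def)

lemma Flim_Pt:
  assumes "Im \<tau> > 0" "A.cop g" shows "Flim (Pt \<tau>) g (ell_point n H (F (std_pair m \<tau> g)))"
proof -
  obtain Q where Q: "Flim (Pt \<tau>) g Q" using F_lim[of "Pt \<tau>" g] assms by auto
  have "ell_point n H (F (std_pair m \<tau> g)) = Q"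
    by (rule limitin_nhds_eq[OF B.Hausdorff_X_top])
      (use Q ell_point_F_mem[OF std_mem[OF assms]] in \<open>auto simp: B.topspace_X_top\<close>)
  then show ?thesis using Q by simp
qed

lemma extends_limit:
  assumes f: "extends f" and x: "vx x" "A.cop g" shows "Flim x g (f (ept m G x g))"
proof -
  have l: "limitin (X_top n H) (f \<circ> (\<lambda>\<tau>. ept m G (Pt \<tau>) g)) (f (ept m G x g)) (nbf x)"
    using f A.limitin_ept[OF x] by (auto simp: extends_def intro: continuous_map_limit)
  have "eventually (\<lambda>\<tau>. (f \<circ> (\<lambda>\<tau>. ept m G (Pt \<tau>) g)) \<tau> = ell_point n H (F (std_pair m \<tau> g))) (nbf x)"
    using eventually_Im_pos[OF x(1)]
  proof eventually_elim
    case (elim \<tau>)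
    then show ?case using f std_mem[OF elim x(2)] by (simp add: extends_def)
  qed
  then show ?thesis by (rule limitin_transform_eventually[OF _ l])
qed

lemma extends_unique:
  assumes "extends f" "extends f'" shows "f = f'"
proof (rule extensionalityI)
  show "f \<in> extensional (X_points m G)" "f' \<in> extensional (X_points m G)" using assms by (auto simp: extends_def)
  fix P assume "P \<in> X_points m G"
  then obtain x g where x: "vx x" "A.cop g" "P = ept m G x g" unfolding A.X_points_iff by blast
  show "f P = f' P"
    using Flim_unique[OF x(1,2) x(1,2) refl extends_limit[OF assms(1) x(1,2)] extends_limit[OF assms(2) x(1,2)]] x by simp
qed

text \<open>The value at a point is the limit along its filter. Since openness is itself tested
  along these filters, convergence there already gives continuity.\<close>

lemma extends_exists: "\<exists>f. extends f"
proof -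
  have ex: "\<exists>Q. \<exists>x g. vx x \<and> A.cop g \<and> P = ept m G x g \<and> Flim x g Q" if "P \<in> X_points m G" for P
  proof -
    obtain x g where x: "vx x" "A.cop g" "P = ept m G x g" using \<open>P \<in> X_points m G\<close> unfolding A.X_points_iff by blast
    obtain Q where "Flim x g Q" using F_lim[OF x(1,2)] ..
    then show ?thesis using x by blast
  qed
  define f where "f = restrict (\<lambda>P. SOME Q. \<exists>x g. vx x \<and> A.cop g \<and> P = ept m G x g \<and> Flim x g Q) (X_points m G)"
  have f: "f (ept m G x g) = Q" if x: "vx x" "A.cop g" "Flim x g Q" for x g Q
  proof -
    have P: "ept m G x g \<in> X_points m G" using A.ept_mem x by blast
    from someI_ex[OF ex[OF P]] obtain y g' where "vx y" "A.cop g'" "ept m G x g = ept m G y g'" "Flim y g' (f (ept m G x g))"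
      unfolding f_def restrict_apply'[OF P] by blast
    then show ?thesis using Flim_unique[of x g y g' Q "f (ept m G x g)"] x by simp
  qed
  have fp: "f (ell_point m G p) = ell_point n H (F p)" if p: "p \<in> level_pairs m" for p
  proof -
    obtain \<tau> g where r: "rep m p \<tau> g" using level_pairs_rep[OF A.npos p] by blast
    then have t: "Im \<tau> > 0" "A.cop g" by (auto simp: rep_def)
    have e: "ell_point m G p = ept m G (Pt \<tau>) g" using A.ell_point_rep[OF r] .
    have "f (ept m G (Pt \<tau>) g) = ell_point n H (F (std_pair m \<tau> g))" using f[of "Pt \<tau>"] Flim_Pt t by simp
    also have "\<dots> = ell_point n H (F p)" using F_cong[OF std_mem[OF t] p] e by simp
    finally show ?thesis using e by simp
  qed
  have lim: "Flim x g (f (ept m G x g))" if "vx x" "A.cop g" for x g using F_lim[OF that] f[OF that] by auto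
  have "continuous_map (X_top m G) (X_top n H) f"
    unfolding continuous_map_def A.topspace_X_top B.topspace_X_top
  proof (intro conjI allI impI)
    show "f \<in> X_points m G \<rightarrow> X_points n H"
    proof
      fix P assume "P \<in> X_points m G"
      then obtain x g where x: "vx x" "A.cop g" "P = ept m G x g" unfolding A.X_points_iff by blast
      then show "f P \<in> X_points n H" using lim[OF x(1,2)] by (simp add: limitin_def B.topspace_X_top)
    qed
    fix U assume U: "openin (X_top n H) U"
    show "openin (X_top m G) {P \<in> X_points m G. f P \<in> U}"
      unfolding openin_X_top A.X_open_iff
    proof (intro conjI allI impI)
      fix x g assume x: "vx x" "A.cop g" "ept m G x g \<in> {P \<in> X_points m G. f P \<in> U}"
      then have "eventually (\<lambda>\<tau>. ell_point n H (F (std_pair m \<tau> g)) \<in> U) (nbf x)"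
        using lim[OF x(1,2)] U by (simp add: limitin_def)
      then show "eventually (\<lambda>\<tau>. ept m G (Pt \<tau>) g \<in> {P \<in> X_points m G. f P \<in> U}) (nbf x)"
        using eventually_Im_pos[OF x(1)]
      proof eventually_elim
        case (elim \<tau>)
        then show ?case using fp[OF std_mem, of \<tau> g] A.ept_mem[of "Pt \<tau>" g] x(2) by simp
      qed
    qed auto
  qed
  moreover have "f \<in> extensional (X_points m G)" by (simp add: f_def)
  ultimately show ?thesis unfolding extends_def using fp by blast
qed

lemma modular_morphism_extends: "extends (modular_morphism m G n H F)"
proof -
  have "\<exists>!f. extends f" using extends_exists extends_unique by blast
  from theI'[OF this] show ?thesis unfolding modular_morphism_def extends_def .
qed

end

text \<open>Two admissible counts are compared on nested neighbourhoods over a common value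
  different from \<open>f a\<close>; the hypothesis \<open>ne\<close> supplies such a value and so
  makes the definite description well determined.\<close>

lemma ram_index_eqI:
  assumes spec: "\<And>U0. openin X U0 \<Longrightarrow> a \<in> U0 \<Longrightarrow>
      \<exists>U W. openin X U \<and> a \<in> U \<and> U \<subseteq> U0 \<and> openin Y W \<and> f a \<in> W \<and>
         (\<forall>y \<in> W - {f a}. finite {x \<in> U. f x = y} \<and> card {x \<in> U. f x = y} = k)"
    and a: "a \<in> topspace X" and ne: "\<And>W. openin Y W \<Longrightarrow> f a \<in> W \<Longrightarrow> \<exists>y\<in>W. y \<noteq> f a"
  shows "ram_index X Y f a = k"
proof -
  let ?P = "\<lambda>k. \<forall>U0. openin X U0 \<and> a \<in> U0 \<longrightarrow>
      (\<exists>U W. openin X U \<and> a \<in> U \<and> U \<subseteq> U0 \<and> openin Y W \<and> f a \<in> W \<and>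
         (\<forall>y \<in> W - {f a}. finite {x \<in> U. f x = y} \<and> card {x \<in> U. f x = y} = k))"
  have le: "j' \<le> j" if j: "?P j" and j': "?P j'" for j j'
  proof -
    obtain U W where U: "openin X U" "a \<in> U" "openin Y W" "f a \<in> W"
      and c: "\<And>y. y \<in> W - {f a} \<Longrightarrow> finite {x \<in> U. f x = y} \<and> card {x \<in> U. f x = y} = j"
      using j[rule_format, of "topspace X"] a by auto
    obtain U' W' where U': "openin X U'" "a \<in> U'" "U' \<subseteq> U" "openin Y W'" "f a \<in> W'"
      and c': "\<And>y. y \<in> W' - {f a} \<Longrightarrow> finite {x \<in> U'. f x = y} \<and> card {x \<in> U'. f x = y} = j'"
      using j'[rule_format, of U] U by blast
    obtain y where y: "y \<in> W \<inter> W'" "y \<noteq> f a" using ne[of "W \<inter> W'"] U U' by blast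
    have "card {x \<in> U'. f x = y} \<le> card {x \<in> U. f x = y}"
      using c[of y] y U' by (intro card_mono) auto
    then show ?thesis using c[of y] c'[of y] y by simp
  qed
  have k: "?P k" using spec by blast
  show ?thesis unfolding ram_index_def
    by (rule the_equality, rule k) (use le[OF k] le[OF _ k] in \<open>meson order_antisym\<close>)
qed

section \<open>The Hecke correspondence\<close>

definition col :: "int^2^2 \<Rightarrow> int^2" where
  "col M = M *v vector [1, 0]"

lemma col_nth [simp]: "col M $ i = M $ i $ 1"
  by (simp add: col_def)

text \<open>Vanishing of the cross product modulo \<open>l\<close>. The zero vector is parallel to
  everything, so transitivity requires a nonzero vector in the middle.\<close>

definition par :: "nat \<Rightarrow> int^2 \<Rightarrow> int^2 \<Rightarrow> bool" where
  "par l u v \<longleftrightarrow> int l dvd u $ 1 * v $ 2 - u $ 2 * v $ 1"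

text \<open>Elements of \<open>SL\<^sub>2(\<int>)\<close> whose first columns run through the lines of \<open>(\<int>/l\<int>)\<^sup>2\<close>.\<close>

definition lines :: "nat \<Rightarrow> (int^2^2) set" where
  "lines l = insert (mat 1) ((\<lambda>j. mk2 (- j) 1 (- 1) 0) ` {0..<int l})"

lemma lines_SL2Z: "\<sigma> \<in> lines l \<Longrightarrow> \<sigma> \<in> SL2Z"
  by (auto simp: lines_def SL2Z_iff det_2)

lemma finite_lines: "finite (lines l)"
  by (simp add: lines_def)

lemma card_lines: "card (lines l) = l + 1"
proof -
  have "inj_on (\<lambda>j. mk2 (- j) 1 (- 1) 0) {0..<int l}" by (auto intro!: inj_onI simp: mat2_eq_iff)
  then have "card ((\<lambda>j. mk2 (- j) 1 (- 1) 0) ` {0..<int l}) = l" by (simp add: card_image)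
  moreover have "mat 1 \<notin> (\<lambda>j. mk2 (- j) 1 (- 1) 0) ` {0..<int l}" by (auto simp: mat2_eq_iff)
  ultimately show ?thesis unfolding lines_def by (subst card_insert_disjoint) auto
qed

text \<open>The matrix \<open>mat 1\<close> stands for the line (1 : 0), and the matrix with
  parameter \<open>j\<close> for (j : 1).\<close>

lemma lines_unique:
  assumes l: "prime l" and v: "\<not> (int l dvd v $ 1 \<and> int l dvd v $ 2)"
  shows "\<exists>!\<sigma>. \<sigma> \<in> lines l \<and> par l (col \<sigma>) v"
proof -
  have pl: "prime (int l)" using l by simp
  have l0: "int l > 0" using l by (simp add: prime_gt_0_nat)
  show ?thesis
  proof (cases "int l dvd v $ 2")
    case True
    show ?thesis
    proof (rule ex1I[of _ "mat 1"])
      show "mat 1 \<in> lines l \<and> par l (col (mat 1)) v" using True by (simp add: lines_def par_def)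
      fix \<sigma> assume s: "\<sigma> \<in> lines l \<and> par l (col \<sigma>) v"
      have "\<sigma> \<noteq> mk2 (- j) 1 (- 1) 0" for j
      proof
        assume "\<sigma> = mk2 (- j) 1 (- 1) 0"
        then have "int l dvd v $ 1 - j * v $ 2" using s by (simp add: par_def)
        moreover have "int l dvd j * v $ 2" using True by simp
        ultimately have "int l dvd (v $ 1 - j * v $ 2) + j * v $ 2" by (rule dvd_add)
        then show False using v True by simp
      qed
      then show "\<sigma> = mat 1" using s by (auto simp: lines_def)
    qed
  next
    case False
    then have "coprime (v $ 2) (int l)" using pl by (metis coprime_commute prime_imp_coprime)
    then obtain w where w: "int l dvd v $ 2 * w - 1" using exists_inverse_mod by blast
    \<comment> \<open>The affine coordinate of the line, namely the quotient of \<open>v $ 1\<close>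
      by \<open>v $ 2\<close> modulo \<open>l\<close>.\<close>
    define j where "j = (v $ 1 * w) mod int l"
    have j: "j \<in> {0..<int l}" using l0 by (simp add: j_def)
    have jw: "int l dvd v $ 1 * w - j" by (metis j_def dvd_minus_mod)
    have "int l dvd (v $ 1 * w - j) * v $ 2 - v $ 1 * (v $ 2 * w - 1)" 
      by (rule dvd_diff[OF dvd_mult2[OF jw] dvd_mult[OF w]])
    moreover have "(v $ 1 * w - j) * v $ 2 - v $ 1 * (v $ 2 * w - 1) = v $ 1 - j * v $ 2" by (simp add: algebra_simps)
    ultimately have vj: "int l dvd v $ 1 - j * v $ 2" by simp
    show ?thesis
    proof (rule ex1I[of _ "mk2 (- j) 1 (- 1) 0"])
      show "mk2 (- j) 1 (- 1) 0 \<in> lines l \<and> par l (col (mk2 (- j) 1 (- 1) 0)) v"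
        using j vj by (auto simp: lines_def par_def)
      fix \<sigma> assume s: "\<sigma> \<in> lines l \<and> par l (col \<sigma>) v"
      have "\<sigma> \<noteq> mat 1" using s False by (auto simp: par_def)
      then obtain i where i: "i \<in> {0..<int l}" "\<sigma> = mk2 (- i) 1 (- 1) 0" using s by (auto simp: lines_def)
      have "int l dvd v $ 1 - i * v $ 2" using s i by (simp add: par_def)
      then have "int l dvd (v $ 1 - i * v $ 2) - (v $ 1 - j * v $ 2)" using vj by (rule dvd_diff)
      then have "int l dvd (j - i) * v $ 2" by (simp add: algebra_simps)
      then have "int l dvd j - i" using pl False by (metis prime_dvd_mult_iff)
      then have "i = j" using i(1) j by (metis atLeastLessThan_iff mod_eq_dvd_iff mod_pos_pos_trivial)
      then show "\<sigma> = mk2 (- j) 1 (- 1) 0" using i by simp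
    qed
  qed
qed

lemma SL2Z_col_ndvd:
  assumes "prime l" "\<not> int l dvd det M" shows "\<not> (int l dvd col M $ 1 \<and> int l dvd col M $ 2)"
  using assms(2) by (auto simp: det_2)

lemma par_self [simp]: "par l u u" by (simp add: par_def mult.commute)

lemma lines_eqI:
  assumes "prime l" "\<sigma> \<in> lines l" "\<sigma>' \<in> lines l" "par l (col \<sigma>) (col \<sigma>')" shows "\<sigma> = \<sigma>'"
proof -
  have "\<not> int l dvd det \<sigma>'" using lines_SL2Z[OF assms(3)] prime_gt_1_nat[OF assms(1)] by (simp add: SL2Z_iff)
  then have "\<exists>!\<sigma>. \<sigma> \<in> lines l \<and> par l (col \<sigma>) (col \<sigma>')" using lines_unique SL2Z_col_ndvd assms(1) by blast
  then show ?thesis using assms par_self by blast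
qed

lemma exists_line:
  assumes "prime l" "\<not> int l dvd det M" shows "\<exists>\<sigma>\<in>lines l. par l (col \<sigma>) (col M)"
  using lines_unique[OF assms(1) SL2Z_col_ndvd[OF assms]] by blast

lemma adj2_mult_21: "par l (col \<sigma>) (col M) \<longleftrightarrow> int l dvd (adj2 \<sigma> ** M) $ 2 $ 1"
  by (simp add: par_def algebra_simps)

locale hecke_level = level n H for n H +
  fixes l :: nat
  assumes prime: "prime l" and l5: "l \<ge> 5" and ndvd: "\<not> l dvd n"
begin

lemma lpos: "l > 0" using l5 by simp

lemma cop_nl: "coprime n l"
  using prime ndvd by (metis coprime_commute prime_imp_coprime)

abbreviation "Hl \<equiv> hecke_subgroup n H l"

lemma red_red_n: "red_mat n (red_mat (n * l) A) = red_mat n A"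
  unfolding red_mat_eq_iff by (rule mcong_dvd_mono[of "n * l"]) auto

lemma Hl_iff: "A \<in> Hl \<longleftrightarrow> red_mat (n * l) A = A \<and> coprime (det A) (int (n * l)) \<and> red_mat n A \<in> H \<and> int l dvd A $ 2 $ 1"
  unfolding hecke_subgroup_def carrier_GL2 by auto

lemma coprime_l_iff: "coprime a (int l) \<longleftrightarrow> \<not> int l dvd a"
proof -
  have "Factorial_Ring.prime (int l)" using prime by simp
  then show ?thesis by (metis coprime_commute prime_imp_coprime coprime_absorb_left not_prime_unit)
qed

lemma subgroup_Hl: "subgroup Hl (GL2 (n * l))"
proof (rule group.subgroupI[OF group_GL2])
  show "Hl \<subseteq> carrier (GL2 (n * l))" by (auto simp: hecke_subgroup_def)
  have "red_mat (n * l) (mat 1) \<in> Hl" unfolding Hl_iff red_red_n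
    using subgroup_GL2D(2)[OF sub] mcong_coprime_det[of "n * l" "red_mat (n * l) (mat 1)" "mat 1"]
    by (simp del: of_nat_mult coprime_mult_right_iff) 
  then show "Hl \<noteq> {}" by blast
  fix A assume A: "A \<in> Hl"
  then have Ac: "A \<in> carrier (GL2 (n * l))" by (auto simp: hecke_subgroup_def)
  let ?B = "inv\<^bsub>GL2 (n * l)\<^esub> A"
  have Bc: "?B \<in> carrier (GL2 (n * l))" using group.inv_closed[OF group_GL2 Ac] .
  have AB: "mcong (n * l) (A ** ?B) (mat 1)"
    using group.r_inv[OF group_GL2 Ac] by (simp add: mcong_def)
  have "red_mat n A \<in> H" using A by (simp add: Hl_iff)
  then obtain k where k: "k \<in> H" "mcong n (k ** red_mat n A) (mat 1)" using subgroup_GL2D(4)[OF sub] by blast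
  have ABn: "mcong n (A ** ?B) (mat 1)" using AB by (rule mcong_dvd_mono) simp
  have "mcong n ?B (k ** A ** ?B)"
  proof -
    have "mcong n (mat 1 ** ?B) ((k ** red_mat n A) ** ?B)" using mcong_sym[OF k(2)] by (rule mcong_mult_right)
    also have "mcong n \<dots> (k ** A ** ?B)" by (intro mcong_mult_right mcong_mult_left) simp
    finally show ?thesis by simp
  qed
  also have "k ** A ** ?B = k ** (A ** ?B)" by (simp add: matrix_mul_assoc)
  also have "mcong n \<dots> (k ** mat 1)" using ABn by (rule mcong_mult_left)
  finally have "red_mat n ?B = k" using GL2_D subgroup_GL2D(1)[OF sub k(1)] by (simp add: mcong_def)
  moreover have "int l dvd ?B $ 2 $ 1"
  proof -
    have "mcong l (A ** ?B) (mat 1)" using AB by (rule mcong_dvd_mono) simp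
    then have "int l dvd (A ** ?B) $ 2 $ 1 - (mat 1 :: int^2^2) $ 2 $ 1" unfolding mcong_iff by blast
    then have "int l dvd A $ 2 $ 1 * ?B $ 1 $ 1 + A $ 2 $ 2 * ?B $ 2 $ 1" by simp
    moreover have A21: "int l dvd A $ 2 $ 1" using A by (simp add: Hl_iff)
    ultimately have "int l dvd A $ 2 $ 2 * ?B $ 2 $ 1" by (meson dvd_add_right_iff dvd_mult2)
    moreover have "\<not> int l dvd A $ 2 $ 2"
    proof
      assume "int l dvd A $ 2 $ 2"
      then have "int l dvd det A" using A21 by (simp add: det_2)
      moreover have "coprime (det A) (int l)" using A by (simp add: Hl_iff)
      ultimately show False by (simp add: coprime_l_iff)
    qed
    ultimately show ?thesis using prime prime_dvd_mult_iff[of "int l"] by simp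
  qed
  ultimately show "?B \<in> Hl" using Bc k(1) by (simp add: hecke_subgroup_def)
next
  fix A B assume AB: "A \<in> Hl" "B \<in> Hl"
  have "coprime (det (red_mat (n * l) (A ** B))) (int (n * l))"
    using AB mcong_coprime_det[of "n * l" "red_mat (n * l) (A ** B)" "A ** B"]
    by (simp add: Hl_iff det_mul del: of_nat_mult coprime_mult_right_iff)
  moreover have "red_mat n (A ** B) \<in> H"
  proof -
    have "red_mat n (red_mat n A ** red_mat n B) \<in> H" 
      by (rule subgroup_GL2D(3)[OF sub]) (use AB in \<open>simp_all add: Hl_iff\<close>)
    then show ?thesis by simp
  qed
  moreover have "int l dvd red_mat (n * l) (A ** B) $ 2 $ 1"
  proof -
    have "int l dvd (A ** B) $ 2 $ 1" using AB by (simp add: Hl_iff)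
    then show ?thesis by (simp add: dvd_mod)
  qed
  ultimately show "A \<otimes>\<^bsub>GL2 (n * l)\<^esub> B \<in> Hl" unfolding Hl_iff mult_GL2 red_red_n by simp
qed

sublocale L: level "n * l" Hl
  by (rule level.intro) (use npos lpos subgroup_Hl in simp_all)

section \<open>The two degeneracy maps on representatives\<close>

text \<open>An inverse of \<open>l\<close> modulo \<open>n\<close>: the Chinese Remainder embedding
  is multiplication by \<open>l * kk\<close>.\<close>

definition kk :: int where "kk = (SOME k. int n dvd int l * k - 1)"

lemma kk: "int n dvd int l * kk - 1"
proof -
  have "coprime (int l) (int n)" using cop_nl by (simp add: coprime_commute)
  then have "\<exists>k. int n dvd int l * k - 1" by (rule exists_inverse_mod)
  then show ?thesis unfolding kk_def by (rule someI_ex)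
qed

lemma coprime_kk: "coprime kk (int n)"
proof (rule coprimeI)
  fix d assume "d dvd kk" "d dvd int n"
  then have "d dvd int l * kk" "d dvd int l * kk - 1" using kk by (auto intro: dvd_trans)
  then have "d dvd int l * kk - (int l * kk - 1)" by (rule dvd_diff)
  then show "is_unit d" by simp
qed

lemma mcong_kk_l: "mcong n (scal kk (scal (int l) A)) A" "mcong n (scal (int l) (scal kk A)) A"
  using mcong_scal_one[OF kk, of A] by (simp_all add: mult.commute)

lemma crt_embed_eq: "crt_embed n l v = red_vec (n * l) (int l *s (kk *s v))"
proof -
  have "(THE x. x \<in> {0..<int (n * l)} \<and> x mod int n = a mod int n \<and> x mod int l = 0) = (int l * (kk * a)) mod int (n * l)" for a
  proof (rule the_equality)
    have pos: "int (n * l) > 0" using npos lpos by simp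
    let ?x = "(int l * (kk * a)) mod int (n * l)"
    have xb: "0 \<le> ?x" "?x < int (n * l)" by (rule pos_mod_sign[OF pos], rule pos_mod_bound[OF pos])
    have xn: "?x mod int n = a mod int n"
    proof -
      have "?x mod int n = (int l * (kk * a)) mod int n" by (rule mod_mod_cancel) simp
      also have "\<dots> = a mod int n"
      proof -
        have "int n dvd (int l * kk - 1) * a" using kk by (rule dvd_mult2)
        then show ?thesis unfolding mod_eq_dvd_iff by (simp add: algebra_simps)
      qed
      finally show ?thesis .
    qed
    have xl: "?x mod int l = 0"
    proof -
      have "?x mod int l = (int l * (kk * a)) mod int l" by (rule mod_mod_cancel) simp
      then show ?thesis by simp
    qed
    show "?x \<in> {0..<int (n * l)} \<and> ?x mod int n = a mod int n \<and> ?x mod int l = 0"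
      unfolding atLeastLessThan_iff using xb xn xl by blast
    fix y assume y: "y \<in> {0..<int (n * l)} \<and> y mod int n = a mod int n \<and> y mod int l = 0"
    have "int n dvd y - ?x" "int l dvd y - ?x" unfolding mod_eq_dvd_iff[symmetric] xn xl using y by blast+
    then have "int n * int l dvd y - ?x" using cop_nl by (intro divides_mult) auto
    then have "int (n * l) dvd y - ?x" by (simp only: of_nat_mult)
    then have "y mod int (n * l) = ?x mod int (n * l)" by (simp only: mod_eq_dvd_iff)
    moreover have "y mod int (n * l) = y" using y by (intro mod_pos_pos_trivial) (simp_all only: atLeastLessThan_iff)
    ultimately show "y = ?x" by (simp only: mod_mod_trivial)
  qed
  then show ?thesis unfolding crt_embed_def by (simp add: vec_eq_iff)
qed

text \<open>The factor \<open>l\<close> of the embedding cancels against the denominator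
  \<open>n * l\<close>, so restricting to n-torsion multiplies the level matrix by
  \<open>kk\<close>.\<close>

lemma rep_crt:
  assumes "\<alpha> \<noteq> 0" "Im \<tau> > 0"
    and \<phi>: "\<And>v. v \<in> carrier (vec2_group (n * l)) \<Longrightarrow>
        \<phi> v = torus_point (ulat \<alpha> \<tau>) (\<alpha> * (Jf (g *v v) \<tau> / of_nat (n * l)))"
  shows "\<phi> (crt_embed n l v) = torus_point (ulat \<alpha> \<tau>) (\<alpha> * (Jf (scal kk g *v v) \<tau> / of_nat n))"
proof -
  have nlp: "n * l > 0" using npos lpos by simp
  let ?w = "int l *s (kk *s v)"
  have "\<phi> (crt_embed n l v) = torus_point (ulat \<alpha> \<tau>) (\<alpha> * (Jf (g *v red_vec (n * l) ?w) \<tau> / of_nat (n * l)))"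
    unfolding crt_embed_eq by (rule \<phi>) (simp add: carrier_vec2)
  also have "\<dots> = torus_point (ulat \<alpha> \<tau>) (\<alpha> * (Jf (g *v ?w) \<tau> / of_nat (n * l)))"
    unfolding tp_Jf_eq_iff[OF nlp assms(1,2)] by (rule vcong_mult) auto
  also have "g *v ?w = int l *s (scal kk g *v v)" by (simp add: vec2_eq_iff algebra_simps)
  also have "Jf \<dots> \<tau> / of_nat (n * l) = Jf (scal kk g *v v) \<tau> / of_nat n"
    unfolding Jf_smult using lpos by simp
  finally show ?thesis .
qed

lemma rep_pr:
  assumes "rep (n * l) p \<tau> g" shows "rep n (pr_pair n l p) \<tau> (scal kk g)"
proof -
  obtain \<Lambda> \<phi> where p: "p = (\<Lambda>, \<phi>)" by (cases p)
  obtain \<alpha> where a: "\<alpha> \<noteq> 0" "\<Lambda> = ulat \<alpha> \<tau>" "Im \<tau> > 0" "coprime (det g) (int (n * l))"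
    and \<phi>: "\<And>v. v \<in> carrier (vec2_group (n * l)) \<Longrightarrow> \<phi> v = torus_point (ulat \<alpha> \<tau>) (\<alpha> * (Jf (g *v v) \<tau> / of_nat (n * l)))"
    using assms unfolding rep_def p fst_conv snd_conv by blast
  have "coprime (det (scal kk g)) (int n)" using a(4) coprime_kk by simp
  then show ?thesis unfolding rep_def using a rep_crt[OF a(1,3) \<phi>] by (auto simp: pr_pair_def p)
qed

text \<open>Modulo \<open>n\<close> this is \<open>kk\<close> times diag(l, 1): the scalar comes
  from the Chinese Remainder embedding, the diagonal matrix from passing to the basis of the
  quotient lattice with ratio l\<tau>.\<close>

definition Dk :: "int^2^2" where "Dk = mk2 1 0 0 kk"

lemma det_Dk: "det Dk = kk" by (simp add: Dk_def det_2)

text \<open>Modulo \<open>l\<close> the first column of \<open>g\<close> is a unit times (1, 0).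
  Hence adjoining the generator of the kernel to the lattice is the same as adjoining
  \<alpha>/l.\<close>

lemma qt_lattice:
  assumes a: "\<alpha> \<noteq> 0" and t: "Im \<tau> > 0" and g: "coprime (det g) (int l)" and c: "g $ 2 $ 1 = int l * c"
  shows "{w + of_int k * (\<alpha> * (Jf (col g) \<tau> / of_nat l)) | w k. w \<in> ulat \<alpha> \<tau>} = ulat (\<alpha> / of_nat l) (of_nat l * \<tau>)"
    (is "?A = ?B")
proof -
  have l0: "of_nat l \<noteq> (0 :: complex)" using lpos by simp
  have csB: "csub ?B" by (rule csub_ulat)
  have gen: "\<alpha> * (Jf (col g) \<tau> / of_nat l) = (\<alpha> / of_nat l) * of_int (g $ 1 $ 1) - of_int c * (\<alpha> * \<tau>)"
    using l0 by (simp add: Jf_def c field_simps)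
  have gB: "\<alpha> * (Jf (col g) \<tau> / of_nat l) = (\<alpha> / of_nat l) * Jf (vector [g $ 1 $ 1, c]) (of_nat l * \<tau>)"
    using l0 by (simp add: Jf_def c field_simps)
  have LB: "\<alpha> * Jf w \<tau> = (\<alpha> / of_nat l) * Jf (vector [int l * w $ 1, w $ 2]) (of_nat l * \<tau>)" for w
    using l0 by (simp add: Jf_def field_simps)
  show ?thesis
  proof (rule equalityI; rule subsetI)
    fix x assume "x \<in> ?A"
    then obtain w k where "w \<in> ulat \<alpha> \<tau>" "x = w + of_int k * (\<alpha> * (Jf (col g) \<tau> / of_nat l))" by blast
    then obtain u where x: "x = \<alpha> * Jf u \<tau> + of_int k * (\<alpha> * (Jf (col g) \<tau> / of_nat l))" by (auto elim: ulat_memE)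
    show "x \<in> ?B" unfolding x LB gB by (intro csub_closed(4,6)[OF csB] ulat_memI)
  next
    fix x assume "x \<in> ?B"
    then obtain w where x: "x = (\<alpha> / of_nat l) * Jf w (of_nat l * \<tau>)" by (elim ulat_memE)
    have "\<not> int l dvd g $ 1 $ 1"
    proof
      assume "int l dvd g $ 1 $ 1"
      then have "int l dvd det g" by (simp add: det_2 c)
      then show False using g by (simp add: coprime_l_iff)
    qed
    then have "coprime (g $ 1 $ 1) (int l)" by (simp add: coprime_l_iff)
    then obtain s where "int l dvd g $ 1 $ 1 * s - 1" using exists_inverse_mod by blast
    then obtain t' where st: "g $ 1 $ 1 * s - 1 = int l * t'" by (auto simp: dvd_def)
    let ?k = "s * w $ 1"
    let ?u = "vector [- t' * w $ 1, w $ 2 - ?k * c] :: int^2"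
    have gi: "of_int (g $ 1 $ 1) * of_int s - 1 = of_nat l * (of_int t' :: complex)"
      using arg_cong[OF st, of "of_int :: int \<Rightarrow> complex"] by simp
    have "\<alpha> * Jf ?u \<tau> + of_int ?k * (\<alpha> * (Jf (col g) \<tau> / of_nat l)) =
       (\<alpha> / of_nat l) * (of_nat l * Jf ?u \<tau> + of_int ?k * Jf (col g) \<tau>)"
      using l0 by (simp add: field_simps)
    also have "of_nat l * Jf ?u \<tau> + of_int ?k * Jf (col g) \<tau> =
       (of_int (g $ 1 $ 1) * of_int s - of_nat l * of_int t') * of_int (w $ 1) - of_int (w $ 2) * (of_nat l * \<tau>)"
      by (simp add: Jf_def c algebra_simps)
    also have "\<dots> = Jf w (of_nat l * \<tau>)" using gi by (simp add: Jf_def algebra_simps)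
    finally have "x = \<alpha> * Jf ?u \<tau> + of_int ?k * (\<alpha> * (Jf (col g) \<tau> / of_nat l))" unfolding x by simp
    then show "x \<in> ?A" using ulat_memI by blast
  qed
qed

lemma rep_qt:
  assumes r: "rep (n * l) p \<tau> g" and c: "int l dvd g $ 2 $ 1"
  shows "rep n (qt_pair n l p) (of_nat l * \<tau>) (Dk ** g)"
proof -
  obtain \<Lambda> \<phi> where p: "p = (\<Lambda>, \<phi>)" by (cases p)
  obtain \<alpha> where a: "\<alpha> \<noteq> 0" "\<Lambda> = ulat \<alpha> \<tau>" "Im \<tau> > 0" "coprime (det g) (int (n * l))"
    and \<phi>: "\<And>v. v \<in> carrier (vec2_group (n * l)) \<Longrightarrow> \<phi> v = torus_point (ulat \<alpha> \<tau>) (\<alpha> * (Jf (g *v v) \<tau> / of_nat (n * l)))"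
    using r unfolding rep_def p fst_conv snd_conv by blast
  obtain c' where c': "g $ 2 $ 1 = int l * c'" using c by (auto simp: dvd_def)
  have l0: "of_nat l \<noteq> (0 :: complex)" "of_nat n \<noteq> (0 :: complex)" using lpos npos by simp_all
  have "int n < int n * int l" using npos l5 by (simp add: mult_less_cancel_left1)
  then have "vector [int n, 0] \<in> carrier (vec2_group (n * l))"
    by (simp add: carrier_vec2 vec2_eq_iff)
  then have "\<phi> (vector [int n, 0]) = torus_point \<Lambda> (\<alpha> * (Jf (g *v vector [int n, 0]) \<tau> / of_nat (n * l)))"
    unfolding a(2) by (rule \<phi>)
  also have "g *v vector [int n, 0] = int n *s col g" by (simp add: vec2_eq_iff algebra_simps)
  also have "Jf \<dots> \<tau> / of_nat (n * l) = Jf (col g) \<tau> / of_nat l" unfolding Jf_smult using l0 by simp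
  finally have ph: "\<phi> (vector [int n, 0]) = torus_point \<Lambda> (\<alpha> * (Jf (col g) \<tau> / of_nat l))" .
  define C where "C = generate (torus \<Lambda>) {\<phi> (vector [int n, 0])}"
  define \<Lambda>' where "\<Lambda>' = ulat (\<alpha> / of_nat l) (of_nat l * \<tau>)"
  have cs: "csub \<Lambda>" "csub \<Lambda>'" by (simp_all add: a \<Lambda>'_def csub_ulat)
  have qc: "quot_lattice C = {w + of_int k * (\<alpha> * (Jf (col g) \<tau> / of_nat l)) | w k. w \<in> \<Lambda>}"
    unfolding C_def ph by (rule quot_lattice_generate[OF cs(1)])
  have q: "quot_lattice C = \<Lambda>'"
    unfolding qc unfolding a(2) \<Lambda>'_def by (rule qt_lattice[OF a(1,3) _ c']) (use a(4) in simp)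
  have sub: "\<Lambda> \<subseteq> \<Lambda>'"
  proof
    fix x assume "x \<in> \<Lambda>"
    then show "x \<in> \<Lambda>'" unfolding q[symmetric] qc
      by (intro CollectI exI[of _ x] exI[of _ 0]) simp
  qed
  have rc: "\<phi> (crt_embed n l v) = torus_point (ulat \<alpha> \<tau>) (\<alpha> * (Jf (scal kk g *v v) \<tau> / of_nat n))" for v
    by (rule rep_crt[OF a(1,3)]) (rule \<phi>)
  have snd: "quot_proj C (\<phi> (crt_embed n l v)) = torus_point \<Lambda>' (\<alpha> / of_nat l * (Jf ((Dk ** g) *v v) (of_nat l * \<tau>) / of_nat n))" for v
  proof -
    let ?w = "g *v v"
    \<comment> \<open>In the new coordinates the two torsion points differ by
      \<open>l * kk - 1\<close> times the first coordinate, divided by \<open>n\<close>; this is a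
      lattice vector.\<close>
    obtain m where m: "int l * kk - 1 = int n * m" using kk by (auto simp: dvd_def)
    have mc: "of_nat l * of_int kk = (1 + of_nat n * of_int m :: complex)"
      using arg_cong[OF m, of "of_int :: int \<Rightarrow> complex"] by (simp add: algebra_simps)
    have "quot_proj C (\<phi> (crt_embed n l v)) = torus_point \<Lambda>' (\<alpha> * (Jf (scal kk g *v v) \<tau> / of_nat n))"
      unfolding rc using quot_proj_torus_point[OF cs sub q] unfolding a(2) by blast
    also have "\<dots> = torus_point \<Lambda>' (\<alpha> / of_nat l * (Jf ((Dk ** g) *v v) (of_nat l * \<tau>) / of_nat n))"
      unfolding tp_eq_iff[OF cs(2)]
    proof -
      have "\<alpha> * (Jf (scal kk g *v v) \<tau> / of_nat n) - \<alpha> / of_nat l * (Jf ((Dk ** g) *v v) (of_nat l * \<tau>) / of_nat n)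
         = \<alpha> / of_nat l * (of_nat l * Jf (scal kk g *v v) \<tau> - Jf ((Dk ** g) *v v) (of_nat l * \<tau>)) / of_nat n"
        using l0 by (simp add: field_simps)
      also have "of_nat l * Jf (scal kk g *v v) \<tau> - Jf ((Dk ** g) *v v) (of_nat l * \<tau>)
         = (of_nat l * of_int kk) * of_int (?w $ 1) - of_int (?w $ 1)"
        by (simp add: Jf_def Dk_def algebra_simps)
      also have "\<dots> = of_nat n * Jf (vector [m * ?w $ 1, 0]) (of_nat l * \<tau>)"
        unfolding mc by (simp add: Jf_def algebra_simps)
      also have "\<alpha> / of_nat l * (of_nat n * Jf (vector [m * ?w $ 1, 0]) (of_nat l * \<tau>)) / of_nat n
        = \<alpha> / of_nat l * Jf (vector [m * ?w $ 1, 0]) (of_nat l * \<tau>)" using l0 by simp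
      finally have e: "\<alpha> * (Jf (scal kk g *v v) \<tau> / of_nat n) - \<alpha> / of_nat l * (Jf ((Dk ** g) *v v) (of_nat l * \<tau>) / of_nat n) =
        \<alpha> / of_nat l * Jf (vector [m * ?w $ 1, 0]) (of_nat l * \<tau>)" .
      show "\<alpha> * (Jf (scal kk g *v v) \<tau> / of_nat n) - \<alpha> / of_nat l * (Jf ((Dk ** g) *v v) (of_nat l * \<tau>) / of_nat n) \<in> \<Lambda>'"
        unfolding e \<Lambda>'_def by (rule ulat_memI)
    qed
    finally show ?thesis .
  qed
  have e: "qt_pair n l p = (\<Lambda>', quot_proj C \<circ> \<phi> \<circ> crt_embed n l)"
    unfolding qt_pair_def p by (simp add: Let_def C_def[symmetric] q)
  have "coprime (det (Dk ** g)) (int n)" using a(4) coprime_kk by (simp add: det_mul det_Dk)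
  moreover have "Im (of_nat l * \<tau>) > 0" using a(3) lpos by simp
  ultimately show ?thesis unfolding rep_def e using a(1) l0 snd \<Lambda>'_def by (intro conjI exI[of _ "\<alpha> / of_nat l"]) auto
qed

end

text \<open>The same pair seen in another oriented basis of its lattice: by \<open>Jf_mob\<close>
  the scale is multiplied by the automorphy factor.\<close>

lemma rep_act:
  assumes r: "rep n p \<tau> g" and g: "\<gamma> \<in> SL2Z" shows "rep n p (mob \<gamma> \<tau>) (\<gamma> ** g)"
proof -
  obtain \<alpha> where a: "Im \<tau> > 0" "coprime (det g) (int n)" "\<alpha> \<noteq> 0" "fst p = ulat \<alpha> \<tau>"
    and \<phi>: "\<forall>v\<in>carrier (vec2_group n). snd p v = torus_point (ulat \<alpha> \<tau>) (\<alpha> * (Jf (g *v v) \<tau> / of_nat n))"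
    using r by (auto simp: rep_def)
  have d: "det \<gamma> = 1" using g by (simp add: SL2Z_iff)
  have nz: "den \<gamma> \<tau> \<noteq> 0" using den_nz a(1) d by simp
  let ?a = "\<alpha> * den \<gamma> \<tau>"
  have J: "\<alpha> * Jf w \<tau> = ?a * Jf (\<gamma> *v w) (mob \<gamma> \<tau>)" for w
  proof -
    have "Jf w \<tau> = Jf (\<gamma> *v w) (mob \<gamma> \<tau>) * den \<gamma> \<tau>" using Jf_mob[OF a(1), of \<gamma> w] d by simp
    then show ?thesis by (simp only: mult_ac)
  qed
  have u: "ulat \<alpha> \<tau> = ulat ?a (mob \<gamma> \<tau>)"
  proof (rule equalityI; rule subsetI)
    fix x assume "x \<in> ulat \<alpha> \<tau>"
    then obtain w where "x = \<alpha> * Jf w \<tau>" by (elim ulat_memE)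
    then show "x \<in> ulat ?a (mob \<gamma> \<tau>)" unfolding J using ulat_memI by simp
  next
    fix x assume "x \<in> ulat ?a (mob \<gamma> \<tau>)"
    then obtain w where "x = ?a * Jf w (mob \<gamma> \<tau>)" by (elim ulat_memE)
    then have "x = \<alpha> * Jf (adj2 \<gamma> *v w) \<tau>" unfolding J SL2Z_vec_cancel[OF g] .
    then show "x \<in> ulat \<alpha> \<tau>" using ulat_memI by simp
  qed
  have e: "\<alpha> * (Jf (g *v v) \<tau> / of_nat n) = ?a * (Jf ((\<gamma> ** g) *v v) (mob \<gamma> \<tau>) / of_nat n)" for v
    using J[of "g *v v"] by (simp only: times_divide_eq_right matrix_vector_mul_assoc)
  show ?thesis unfolding rep_def
  proof (intro conjI exI[of _ ?a])
    show "Im (mob \<gamma> \<tau>) > 0" using Im_mob_SL2Z a(1) g by blast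
    show "coprime (det (\<gamma> ** g)) (int n)" using a(2) d by (simp add: det_mul)
    show "?a \<noteq> 0" using a(3) nz by simp
    show "fst p = ulat ?a (mob \<gamma> \<tau>)" unfolding a(4) by (rule u)
    show "\<forall>v\<in>carrier (vec2_group n). snd p v = torus_point (ulat ?a (mob \<gamma> \<tau>)) (?a * (Jf ((\<gamma> ** g) *v v) (mob \<gamma> \<tau>) / of_nat n))"
      unfolding u[symmetric] e[symmetric] by (rule \<phi>)
  qed
qed

context hecke_level
begin

lemma pr_orb:
  assumes "orb (n * l) Hl x g y g'" shows "orb n H x (scal kk g) y (scal kk g')"
proof -
  obtain \<gamma> A where c: "\<gamma> \<in> SL2Z" "A \<in> Hl" "xeq y (act \<gamma> x)" "mcong (n * l) (\<gamma> ** g) (g' ** A)"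
    using assms by (auto simp: orb_def)
  have "mcong n (\<gamma> ** g) (g' ** A)" using c(4) by (rule mcong_dvd_mono) simp
  then have "mcong n (scal kk (\<gamma> ** g)) (scal kk (g' ** A))" by (rule mcong_scal[rotated]) simp
  then have "mcong n (\<gamma> ** scal kk g) (scal kk g' ** A)" by simp
  also have "mcong n \<dots> (scal kk g' ** red_mat n A)" by (rule mcong_mult_left) simp
  finally have "mcong n (\<gamma> ** scal kk g) (scal kk g' ** red_mat n A)" .
  moreover have "red_mat n A \<in> H" using c(2) by (simp add: Hl_iff)
  ultimately show ?thesis unfolding orb_def using c by blast
qed

lemma cop_scal_kk: "L.cop g \<Longrightarrow> cop (scal kk g)"
  using coprime_kk by simp

lemma pr_std:
  assumes "Im \<tau> > 0" "L.cop g"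
  shows "ell_point n H (pr_pair n l (std_pair (n * l) \<tau> g)) = ept n H (Pt \<tau>) (scal kk g)"
  using ell_point_rep[OF rep_pr[OF rep_std[OF assms]]] .

lemma pr_limit:
  assumes "vx x" "L.cop g"
  shows "limitin (X_top n H) (\<lambda>\<tau>. ell_point n H (pr_pair n l (std_pair (n * l) \<tau> g))) (ept n H x (scal kk g)) (nbf x)"
proof (rule limitin_transform_eventually[OF _ limitin_ept[OF assms(1) cop_scal_kk[OF assms(2)]]])
  show "\<forall>\<^sub>F \<tau> in nbf x. ept n H (Pt \<tau>) (scal kk g) = ell_point n H (pr_pair n l (std_pair (n * l) \<tau> g))"
    using eventually_Im_pos[OF assms(1)] by eventually_elim (rule pr_std[symmetric, OF _ assms(2)])
qed

sublocale pr: modular_map "n * l" Hl n H "pr_pair n l"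
proof unfold_locales
  fix p assume p: "p \<in> level_pairs (n * l)"
  then obtain \<tau> g where "rep (n * l) p \<tau> g" using level_pairs_rep[OF L.npos] by blast
  then show "pr_pair n l p \<in> level_pairs n" using rep_level_pairs[OF npos rep_pr] by blast
next
  fix p q assume "p \<in> level_pairs (n * l)" "q \<in> level_pairs (n * l)" and e: "ell_point (n * l) Hl p = ell_point (n * l) Hl q"
  then obtain \<tau> g \<tau>' g' where r: "rep (n * l) p \<tau> g" "rep (n * l) q \<tau>' g'" using level_pairs_rep[OF L.npos] by meson
  have "orb (n * l) Hl (Pt \<tau>) g (Pt \<tau>') g'" using L.ell_point_eq_iff[OF r] e by blast
  then show "ell_point n H (pr_pair n l p) = ell_point n H (pr_pair n l q)"
    unfolding ell_point_eq_iff[OF rep_pr[OF r(1)] rep_pr[OF r(2)]] by (rule pr_orb)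
next
  fix x g assume "vx x" "L.cop g"
  then show "\<exists>Q. limitin (X_top n H) (\<lambda>\<tau>. ell_point n H (pr_pair n l (std_pair (n * l) \<tau> g))) Q (nbf x)"
    by (intro exI) (rule pr_limit)
qed

lemma pr_extends: "pr.extends (pr_map n H l)"
  unfolding pr_map_def by (rule pr.modular_morphism_extends)

lemma pr_ept:
  assumes "vx x" "L.cop g" shows "pr_map n H l (ept (n * l) Hl x g) = ept n H x (scal kk g)"
  by (rule limitin_Hausdorff_unique[OF pr.extends_limit[OF pr_extends assms] pr_limit[OF assms] nbf_ne_bot[OF assms(1)] Hausdorff_X_top])

lemma cop_ndvd: "L.cop g \<Longrightarrow> \<not> int l dvd det g"
  using coprime_l_iff by simp

text \<open>Each line modulo \<open>l\<close> is the first column of an element of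
  \<open>SL2Z\<close>, whose inverse moves it to the line of (1, 0). In this normal form the
  quotient map is explicit.\<close>

lemma exists_normal_form:
  assumes "L.cop g" shows "\<exists>\<gamma>\<in>SL2Z. int l dvd (\<gamma> ** g) $ 2 $ 1"
  using exists_line[OF prime cop_ndvd[OF assms]] lines_SL2Z SL2Z_adj2 adj2_mult_21 by blast

lemma rep_normal_form:
  assumes "p \<in> level_pairs (n * l)" shows "\<exists>\<tau> g. rep (n * l) p \<tau> g \<and> int l dvd g $ 2 $ 1"
proof -
  obtain \<tau> g where r: "rep (n * l) p \<tau> g" using level_pairs_rep[OF L.npos assms] by blast
  then have "L.cop g" by (simp add: rep_def)
  then obtain \<gamma> where "\<gamma> \<in> SL2Z" "int l dvd (\<gamma> ** g) $ 2 $ 1" using exists_normal_form by blast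
  then show ?thesis using rep_act[OF r] by blast
qed

text \<open>Conjugation by diag(l, 1) takes a matrix with lower left entry divisible by
  \<open>l\<close> to an integral one, and \<open>Dk\<close> is that diagonal matrix up to a scalar
  modulo \<open>n\<close>.\<close>

lemma Dk_cong: "int l * c = \<gamma> $ 2 $ 1 \<Longrightarrow>
  mcong n (mk2 (\<gamma> $ 1 $ 1) (int l * \<gamma> $ 1 $ 2) c (\<gamma> $ 2 $ 2) ** Dk) (Dk ** \<gamma>)"
proof -
  assume c: "int l * c = \<gamma> $ 2 $ 1"
  have "int n dvd (int l * kk - 1) * \<gamma> $ 1 $ 2" "int n dvd (int l * kk - 1) * (- c)" using kk by (rule dvd_mult2)+
  then have "int n dvd int l * \<gamma> $ 1 $ 2 * kk - \<gamma> $ 1 $ 2" "int n dvd c - kk * (int l * c)"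
    by (simp_all add: algebra_simps)
  then show ?thesis unfolding mcong_iff forall_2 by (simp add: Dk_def c[symmetric] algebra_simps)
qed

lemma mob_mult_l:
  assumes "Im \<tau> > 0" "\<gamma> \<in> SL2Z" "int l * c = \<gamma> $ 2 $ 1"
  shows "mob (mk2 (\<gamma> $ 1 $ 1) (int l * \<gamma> $ 1 $ 2) c (\<gamma> $ 2 $ 2)) (of_nat l * \<tau>) = of_nat l * mob \<gamma> \<tau>"
proof -
  have "of_int (\<gamma> $ 2 $ 1) = (of_nat l * of_int c :: complex)"
    using arg_cong[OF assms(3), of "of_int :: int \<Rightarrow> complex"] by simp
  then show ?thesis by (simp add: mob_def num_def den_def algebra_simps add_divide_distrib)
qed

text \<open>Since both level matrices are in normal form, \<gamma> preserves the line (1 : 0) modulo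
  \<open>l\<close>. Its lower left entry is therefore divisible by \<open>l\<close>, and it descends
  to the quotient by conjugation.\<close>

lemma qt_orb:
  assumes t: "Im \<tau> > 0" and g: "L.cop g" "int l dvd g $ 2 $ 1" "int l dvd g' $ 2 $ 1"
    and o: "orb (n * l) Hl (Pt \<tau>) g (Pt \<tau>') g'"
  shows "orb n H (Pt (of_nat l * \<tau>)) (Dk ** g) (Pt (of_nat l * \<tau>')) (Dk ** g')"
proof -
  obtain \<gamma> A where c: "\<gamma> \<in> SL2Z" "A \<in> Hl" "\<tau>' = mob \<gamma> \<tau>" "mcong (n * l) (\<gamma> ** g) (g' ** A)"
    using o by (auto simp: orb_def)
  have "mcong l (\<gamma> ** g) (g' ** A)" using c(4) by (rule mcong_dvd_mono) simp
  then have "int l dvd (\<gamma> ** g) $ 2 $ 1 - (g' ** A) $ 2 $ 1" unfolding mcong_iff by blast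
  moreover have "int l dvd (g' ** A) $ 2 $ 1" using c(2) g(3) by (simp add: Hl_iff)
  ultimately have "int l dvd (\<gamma> ** g) $ 2 $ 1" by (metis diff_add_cancel dvd_add)
  then have "int l dvd \<gamma> $ 2 $ 1 * g $ 1 $ 1 + \<gamma> $ 2 $ 2 * g $ 2 $ 1" by simp
  then have "int l dvd \<gamma> $ 2 $ 1 * g $ 1 $ 1" using g(2) by (meson dvd_add_left_iff dvd_mult)
  moreover have "\<not> int l dvd g $ 1 $ 1"
  proof
    assume "int l dvd g $ 1 $ 1"
    then have "int l dvd det g" using g(2) by (simp add: det_2)
    then show False using cop_ndvd[OF g(1)] by blast
  qed
  ultimately have "int l dvd \<gamma> $ 2 $ 1" using prime prime_dvd_mult_iff[of "int l"] by simp
  then obtain c' where c': "int l * c' = \<gamma> $ 2 $ 1" by (metis dvdE)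
  let ?\<gamma> = "mk2 (\<gamma> $ 1 $ 1) (int l * \<gamma> $ 1 $ 2) c' (\<gamma> $ 2 $ 2)"
  have "?\<gamma> \<in> SL2Z" using c(1) c' by (simp add: SL2Z_iff det_2 algebra_simps)
  moreover have "xeq (Pt (of_nat l * \<tau>')) (act ?\<gamma> (Pt (of_nat l * \<tau>)))"
    using mob_mult_l[OF t c(1) c'] c(3) by simp
  moreover have "mcong n (?\<gamma> ** (Dk ** g)) ((Dk ** g') ** red_mat n A)"
  proof -
    have "mcong n ((?\<gamma> ** Dk) ** g) ((Dk ** \<gamma>) ** g)" using Dk_cong[OF c'] by (rule mcong_mult_right)
    also have "(Dk ** \<gamma>) ** g = Dk ** (\<gamma> ** g)" by (simp add: matrix_mul_assoc)
    also have "mcong n \<dots> (Dk ** (g' ** A))"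
      by (rule mcong_mult_left, rule mcong_dvd_mono[OF c(4)]) simp
    also have "Dk ** (g' ** A) = (Dk ** g') ** A" by (simp add: matrix_mul_assoc)
    also have "mcong n \<dots> ((Dk ** g') ** red_mat n A)" by (rule mcong_mult_left) simp
    finally show ?thesis by (simp add: matrix_mul_assoc)
  qed
  moreover have "red_mat n A \<in> H" using c(2) by (simp add: Hl_iff)
  ultimately show ?thesis unfolding orb_def by blast
qed

text \<open>Multiplication by \<open>l\<close> sends the cusp (x : y) to (lx : y). This vector is
  primitive only when \<open>l\<close> does not divide \<open>y\<close>; otherwise \<open>l\<close>
  is divided out.\<close>

lemma filterlim_mult_l:
  assumes "vx x" shows "\<exists>y. vx y \<and> filterlim (\<lambda>\<tau>. of_nat l * \<tau>) (nbf y) (nbf x)"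
proof (cases x)
  case (Pt \<tau>)
  have "filterlim (\<lambda>\<tau>. of_nat l * \<tau> :: complex) (nhds (of_nat l * \<tau>)) (nhds \<tau>)"
    by (intro tendsto_intros filterlim_ident)
  then show ?thesis using Pt assms lpos by (intro exI[of _ "Pt (of_nat l * \<tau>)"]) simp
next
  case (Cu c)
  have l1: "real l \<ge> 1" using lpos by simp
  show ?thesis
  proof (cases "int l dvd c $ 2")
    case True
    then obtain e where e: "c $ 2 = int l * e" by (auto simp: dvd_def)
    have J: "Jf (vector [c $ 1, e]) (of_nat l * \<tau>) = Jf c \<tau>" for \<tau> by (simp add: Jf_def e)
    have "of_nat l * \<tau> \<in> hb A (vector [c $ 1, e])" if "\<tau> \<in> hb A c" for A \<tau>
    proof -
      have t: "Im \<tau> > 0" "A * (cmod (Jf c \<tau>))\<^sup>2 < Im \<tau>" using that by (simp_all add: hb_def)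
      have "1 * Im \<tau> \<le> real l * Im \<tau>" using l1 t(1) by (intro mult_right_mono) auto
      then have "A * (cmod (Jf c \<tau>))\<^sup>2 < real l * Im \<tau>" "real l * Im \<tau> > 0" using t by linarith+
      then show ?thesis by (simp add: hb_def J)
    qed
    then have "filterlim (\<lambda>\<tau>. of_nat l * \<tau>) (nbf (Cu (vector [c $ 1, e]))) (nbf x)"
      unfolding filterlim_iff Cu eventually_nbf_Cu by blast
    moreover have "vx (Cu (vector [c $ 1, e]))" using assms Cu e by simp
    ultimately show ?thesis by blast
  next
    case False
    have J: "Jf (vector [int l * c $ 1, c $ 2]) (of_nat l * \<tau>) = of_nat l * Jf c \<tau>" for \<tau>
      by (simp add: Jf_def algebra_simps)
    have "of_nat l * \<tau> \<in> hb A (vector [int l * c $ 1, c $ 2])" if "\<tau> \<in> hb (A * real l) c" for A \<tau>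
    proof -
      have lt: "real l * (A * real l * (cmod (Jf c \<tau>))\<^sup>2) < real l * Im \<tau>"
        using that lpos by (intro mult_strict_left_mono) (auto simp: hb_def)
      have e: "A * (cmod (Jf (vector [int l * c $ 1, c $ 2]) (of_nat l * \<tau>)))\<^sup>2 = real l * (A * real l * (cmod (Jf c \<tau>))\<^sup>2)"
        unfolding J norm_mult power_mult_distrib by (simp add: power2_eq_square)
      have i: "Im (of_nat l * \<tau>) = real l * Im \<tau>" by simp
      have "real l * Im \<tau> > 0" using that lpos by (simp add: hb_def)
      then show ?thesis unfolding hb_def mem_Collect_eq i e using lt by blast
    qed
    \<comment> \<open>Here the squared modulus of \<open>Jf\<close> grows by the square of
      \<open>l\<close> but the height only by \<open>l\<close>, so the source horoball must be
      deeper by the factor \<open>l\<close>.\<close>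
    then have "filterlim (\<lambda>\<tau>. of_nat l * \<tau>) (nbf (Cu (vector [int l * c $ 1, c $ 2]))) (nbf x)"
      unfolding filterlim_iff Cu eventually_nbf_Cu
      using lpos by (metis mult_pos_pos of_nat_0_less_iff)
    moreover have "coprime (int l) (c $ 2)" using False coprime_l_iff[of "c $ 2"] by (metis coprime_commute)
    then have "vx (Cu (vector [int l * c $ 1, c $ 2]))" using assms Cu by simp
    ultimately show ?thesis by blast
  qed
qed

lemma qt_std:
  assumes "Im \<tau> > 0" "L.cop g" "\<gamma> \<in> SL2Z" "int l dvd (\<gamma> ** g) $ 2 $ 1"
  shows "ell_point n H (qt_pair n l (std_pair (n * l) \<tau> g)) = ept n H (Pt (of_nat l * mob \<gamma> \<tau>)) (Dk ** (\<gamma> ** g))"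
  using ell_point_rep[OF rep_qt[OF rep_act[OF rep_std[OF assms(1,2)] assms(3)] assms(4)]] .

sublocale qt: modular_map "n * l" Hl n H "qt_pair n l"
proof unfold_locales
  fix p assume p: "p \<in> level_pairs (n * l)"
  then obtain \<tau> g where "rep (n * l) p \<tau> g" "int l dvd g $ 2 $ 1" using rep_normal_form by blast
  then show "qt_pair n l p \<in> level_pairs n" using rep_level_pairs[OF npos rep_qt] by blast
next
  fix p q assume pq: "p \<in> level_pairs (n * l)" "q \<in> level_pairs (n * l)" and e: "ell_point (n * l) Hl p = ell_point (n * l) Hl q"
  obtain \<tau> g where r: "rep (n * l) p \<tau> g" "int l dvd g $ 2 $ 1" using rep_normal_form[OF pq(1)] by blast
  obtain \<tau>' g' where r': "rep (n * l) q \<tau>' g'" "int l dvd g' $ 2 $ 1" using rep_normal_form[OF pq(2)] by blast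
  have o: "orb (n * l) Hl (Pt \<tau>) g (Pt \<tau>') g'" using L.ell_point_eq_iff[OF r(1) r'(1)] e by blast
  have "Im \<tau> > 0" "L.cop g" using r(1) by (simp_all add: rep_def)
  then show "ell_point n H (qt_pair n l p) = ell_point n H (qt_pair n l q)"
    unfolding ell_point_eq_iff[OF rep_qt[OF r] rep_qt[OF r']] using qt_orb r(2) r'(2) o by blast
next
  fix x g assume x: "vx x" "L.cop g"
  \<comment> \<open>The normal form depends on \<open>g\<close> alone, so one \<gamma> serves the
    whole filter.\<close>
  obtain \<gamma> where c: "\<gamma> \<in> SL2Z" "int l dvd (\<gamma> ** g) $ 2 $ 1" using exists_normal_form[OF x(2)] by blast
  obtain y where y: "vx y" "filterlim (\<lambda>\<tau>. of_nat l * \<tau>) (nbf y) (nbf (act \<gamma> x))"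
    using filterlim_mult_l[OF vx_act[OF x(1) c(1)]] by blast
  have fl: "filterlim (\<lambda>\<tau>. of_nat l * mob \<gamma> \<tau>) (nbf y) (nbf x)"
    using filterlim_compose[OF y(2) filterlim_act[OF x(1) c(1)]] .
  have "coprime (det g) (int n)" using x(2) by simp
  then have cop: "cop (Dk ** (\<gamma> ** g))" using coprime_kk c(1) by (simp add: det_mul det_Dk SL2Z_iff)
  have "limitin (X_top n H) (\<lambda>\<tau>. ept n H (Pt (of_nat l * mob \<gamma> \<tau>)) (Dk ** (\<gamma> ** g))) (ept n H y (Dk ** (\<gamma> ** g))) (nbf x)"
    by (rule limitin_compose_filterlim[OF limitin_ept[OF y(1) cop] fl])
  then have "limitin (X_top n H) (\<lambda>\<tau>. ell_point n H (qt_pair n l (std_pair (n * l) \<tau> g))) (ept n H y (Dk ** (\<gamma> ** g))) (nbf x)"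
  proof (rule limitin_transform_eventually[rotated])
    show "\<forall>\<^sub>F \<tau> in nbf x. ept n H (Pt (of_nat l * mob \<gamma> \<tau>)) (Dk ** (\<gamma> ** g)) = ell_point n H (qt_pair n l (std_pair (n * l) \<tau> g))"
      using eventually_Im_pos[OF x(1)] by eventually_elim (rule qt_std[symmetric, OF _ x(2) c])
  qed
  then show "\<exists>Q. limitin (X_top n H) (\<lambda>\<tau>. ell_point n H (qt_pair n l (std_pair (n * l) \<tau> g))) Q (nbf x)" by blast
qed

lemma qt_extends: "qt.extends (qt_map n H l)"
  unfolding qt_map_def by (rule qt.modular_morphism_extends)

lemma qt_mem: "R \<in> X_points (n * l) Hl \<Longrightarrow> qt_map n H l R \<in> X_points n H"
  using qt_extends unfolding qt.extends_def continuous_map_def topspace_X_top L.topspace_X_top by blast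

lemma pr_continuous: "continuous_map (X_top (n * l) Hl) (X_top n H) (pr_map n H l)"
  using pr_extends unfolding pr.extends_def by blast

lemma qt_ell_point: "Im \<tau> > 0 \<Longrightarrow> L.cop g \<Longrightarrow>
    qt_map n H l (ept (n * l) Hl (Pt \<tau>) g) = ell_point n H (qt_pair n l (std_pair (n * l) \<tau> g))"
  using qt_extends qt.std_mem[of \<tau> g] unfolding qt.extends_def by simp

section \<open>Fibres of the first map and its ramification\<close>

text \<open>The level matrix of the preimage that belongs to the line of \<sigma>. Modulo
  \<open>n\<close> it is \<open>l\<close> times \<open>g\<close>, so that the factor
  \<open>kk\<close> of the first map restores \<open>g\<close>; modulo \<open>l\<close> its first
  column is the line.\<close>

definition gs :: "int^2^2 \<Rightarrow> int^2^2 \<Rightarrow> int^2^2" where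
  "gs g \<sigma> = (SOME M. red_mat (n * l) M = M \<and> mcong n M (scal (int l) g) \<and> mcong l M \<sigma>)"

lemma gs: "mcong n (gs g \<sigma>) (scal (int l) g)" "mcong l (gs g \<sigma>) \<sigma>"
proof -
  from someI_ex[OF crt_mat[OF cop_nl, of "scal (int l) g" \<sigma>]]
  show "mcong n (gs g \<sigma>) (scal (int l) g)" "mcong l (gs g \<sigma>) \<sigma>" unfolding gs_def by blast+
qed

lemma cop_gs:
  assumes "cop g" "\<sigma> \<in> lines l" shows "L.cop (gs g \<sigma>)"
proof -
  have ln: "coprime (int l) (int n)" using cop_nl by (simp add: coprime_commute)
  have "coprime (det (scal (int l) g)) (int n)" using assms(1) ln by simp
  then have "coprime (det (gs g \<sigma>)) (int n)" using mcong_coprime_det[OF gs(1)] by blast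
  moreover have "coprime (det (gs g \<sigma>)) (int l)"
    using mcong_coprime_det[OF gs(2), of g \<sigma>] lines_SL2Z[OF assms(2)] by (simp add: SL2Z_iff)
  ultimately show ?thesis by simp
qed

definition Phi :: "hpt \<Rightarrow> int^2^2 \<Rightarrow> int^2^2 \<Rightarrow> modular_point" where
  "Phi x g \<sigma> = ept (n * l) Hl x (gs g \<sigma>)"

lemma Phi_mem: "vx x \<Longrightarrow> cop g \<Longrightarrow> \<sigma> \<in> lines l \<Longrightarrow> Phi x g \<sigma> \<in> X_points (n * l) Hl"
  unfolding Phi_def by (rule L.ept_mem) (auto simp del: of_nat_mult coprime_mult_right_iff intro: cop_gs)

lemma pr_Phi:
  assumes "vx x" "cop g" "\<sigma> \<in> lines l" shows "pr_map n H l (Phi x g \<sigma>) = ept n H x g"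
proof -
  have "mcong n (scal kk (gs g \<sigma>)) (scal kk (scal (int l) g))" using gs(1) by (rule mcong_scal[rotated]) simp
  also have "mcong n \<dots> g" by (rule mcong_kk_l)
  finally have "mcong n g (scal kk (gs g \<sigma>))" by (rule mcong_sym)
  then have "ept n H x g = ept n H x (scal kk (gs g \<sigma>))" by (rule ept_cong[OF assms(1,2)])
  then show ?thesis unfolding Phi_def pr_ept[OF assms(1) cop_gs[OF assms(2,3)]] by simp
qed

text \<open>The required element of \<open>Hl\<close> is glued from \<open>h\<close> modulo
  \<open>n\<close> and from the adjugate of \<sigma> times \<open>\<gamma> ** g'\<close> modulo
  \<open>l\<close>. The latter is upper triangular exactly because the first columns are
  parallel.\<close>

lemma orb_gs:
  assumes A: "mcong n (\<gamma> ** g') (scal (int l) g ** h)" "h \<in> H" "L.cop g'" "\<gamma> \<in> SL2Z"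
    and s: "\<sigma> \<in> lines l" "par l (col \<sigma>) (col (\<gamma> ** g'))" and x: "xeq x (act \<gamma> y)"
  shows "orb (n * l) Hl y g' x (gs g \<sigma>)"
proof -
  have s1: "\<sigma> \<in> SL2Z" using lines_SL2Z s(1) .
  obtain M where M: "red_mat (n * l) M = M" "mcong n M h" "mcong l M (adj2 \<sigma> ** (\<gamma> ** g'))"
    using crt_mat[OF cop_nl] by blast
  have hc: "h \<in> carrier (GL2 n)" using subgroup_GL2D(1)[OF sub A(2)] .
  have "red_mat n M = h" using M(2) GL2_D[OF hc] by (simp add: mcong_def)
  moreover have "coprime (det M) (int n)" using mcong_coprime_det[OF M(2)] GL2_coprime[OF hc] by blast
  moreover have "coprime (det M) (int l)"
  proof -
    have "coprime (det g') (int l)" using A(3) by simp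
    then show ?thesis using mcong_coprime_det[OF M(3)] s1 A(4) by (simp add: det_mul SL2Z_iff)
  qed
  moreover have "int l dvd M $ 2 $ 1"
  proof -
    have "int l dvd M $ 2 $ 1 - (adj2 \<sigma> ** (\<gamma> ** g')) $ 2 $ 1" using M(3) unfolding mcong_iff by blast
    moreover have "int l dvd (adj2 \<sigma> ** (\<gamma> ** g')) $ 2 $ 1" using s(2) unfolding adj2_mult_21 .
    ultimately show ?thesis by (metis diff_add_cancel dvd_add)
  qed
  ultimately have MH: "M \<in> Hl" using A(2) M(1) by (simp add: Hl_iff)
  have "mcong (n * l) (\<gamma> ** g') (gs g \<sigma> ** M)"
  proof (rule mcong_coprime[OF _ _ cop_nl])
    have "mcong n (scal (int l) g ** h) (gs g \<sigma> ** M)" using gs(1) M(2) by (intro mcong_mult) (auto intro: mcong_sym)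
    then show "mcong n (\<gamma> ** g') (gs g \<sigma> ** M)" using A(1) mcong_trans by blast
    have "mcong l (gs g \<sigma> ** M) (\<sigma> ** (adj2 \<sigma> ** (\<gamma> ** g')))" using gs(2) M(3) by (rule mcong_mult)
    also have "\<sigma> ** (adj2 \<sigma> ** (\<gamma> ** g')) = \<gamma> ** g'"
      using SL2Z_adj2_mult(1)[OF s1] by (simp add: matrix_mul_assoc)
    finally show "mcong l (\<gamma> ** g') (gs g \<sigma> ** M)" by (rule mcong_sym)
  qed
  then show ?thesis unfolding orb_def using A(4) MH x by blast
qed

text \<open>Multiplying the congruence by \<open>l\<close> removes \<open>kk\<close>. The right
  \<sigma> is then the line of the first column of \<open>\<gamma> ** g'\<close>.\<close>

lemma fibre_pr:
  assumes x: "vx x" "cop g" and R: "R \<in> X_points (n * l) Hl" "pr_map n H l R = ept n H x g"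
  shows "R \<in> Phi x g ` lines l"
proof -
  obtain y g' where y: "vx y" "L.cop g'" "R = ept (n * l) Hl y g'" using R(1) unfolding L.X_points_iff by blast
  have "ept n H y (scal kk g') = ept n H x g" using R(2) unfolding y(3) pr_ept[OF y(1,2)] .
  then have "orb n H y (scal kk g') x g" using ept_eq_iff[OF y(1) x(1) cop_scal_kk[OF y(2)] x(2)] by blast
  then obtain \<gamma> h where c: "\<gamma> \<in> SL2Z" "h \<in> H" "xeq x (act \<gamma> y)" "mcong n (\<gamma> ** scal kk g') (g ** h)"
    by (auto simp: orb_def)
  have "mcong n (scal (int l) (\<gamma> ** scal kk g')) (scal (int l) (g ** h))" using c(4) by (rule mcong_scal[rotated]) simp
  moreover have "mcong n (scal (int l) (scal kk (\<gamma> ** g'))) (\<gamma> ** g')" by (rule mcong_kk_l)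
  ultimately have m: "mcong n (\<gamma> ** g') (scal (int l) g ** h)"
    by (simp only: scal_mult) (blast intro: mcong_trans mcong_sym)
  have "\<not> int l dvd det (\<gamma> ** g')" using cop_ndvd[OF y(2)] c(1) by (simp add: det_mul SL2Z_iff)
  then obtain \<sigma> where s: "\<sigma> \<in> lines l" "par l (col \<sigma>) (col (\<gamma> ** g'))" using exists_line[OF prime] by blast
  have "orb (n * l) Hl y g' x (gs g \<sigma>)" by (rule orb_gs[OF m c(2) y(2) c(1) s c(3)])
  then have "R = Phi x g \<sigma>" unfolding y(3) Phi_def using L.ept_eq_iff[OF y(1) x(1) y(2) cop_gs[OF x(2) s(1)]] by blast
  then show ?thesis using s(1) by blast
qed

text \<open>A coincidence of two lifts comes from an element fixing \<tau>. Here this is 1 or -1,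
  and both preserve every line.\<close>

lemma Phi_inj:
  assumes t: "Im \<tau> > 0" "cop g" and st: "\<forall>\<gamma>\<in>SL2Z. mob \<gamma> \<tau> = \<tau> \<longrightarrow> \<gamma> = mat 1 \<or> \<gamma> = - mat 1"
  shows "inj_on (Phi (Pt \<tau>) g) (lines l)"
proof (rule inj_onI)
  fix \<sigma> \<sigma>' assume s: "\<sigma> \<in> lines l" "\<sigma>' \<in> lines l" and e: "Phi (Pt \<tau>) g \<sigma> = Phi (Pt \<tau>) g \<sigma>'"
  have v: "vx (Pt \<tau>)" using t by simp
  have "orb (n * l) Hl (Pt \<tau>) (gs g \<sigma>) (Pt \<tau>) (gs g \<sigma>')"
    using e L.ept_eq_iff[OF v v cop_gs[OF t(2) s(1)] cop_gs[OF t(2) s(2)]] unfolding Phi_def by blast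
  then obtain \<gamma> A where c: "\<gamma> \<in> SL2Z" "A \<in> Hl" "\<tau> = mob \<gamma> \<tau>" "mcong (n * l) (\<gamma> ** gs g \<sigma>) (gs g \<sigma>' ** A)"
    by (auto simp: orb_def)
  have pm: "\<gamma> = mat 1 \<or> \<gamma> = - mat 1" using st c(1) c(3)[symmetric] by blast
  have "mcong l (\<gamma> ** gs g \<sigma>) (gs g \<sigma>' ** A)" using c(4) by (rule mcong_dvd_mono) simp
  moreover have "mcong l (\<gamma> ** gs g \<sigma>) (\<gamma> ** \<sigma>)" using gs(2) by (rule mcong_mult_left)
  moreover have "mcong l (gs g \<sigma>' ** A) (\<sigma>' ** A)" using gs(2) by (rule mcong_mult_right)
  ultimately have "mcong l (\<gamma> ** \<sigma>) (\<sigma>' ** A)" by (meson mcong_sym mcong_trans)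
  then have "mcong l (adj2 \<sigma>' ** (\<gamma> ** \<sigma>)) (adj2 \<sigma>' ** (\<sigma>' ** A))" by (rule mcong_mult_left)
  also have "adj2 \<sigma>' ** (\<sigma>' ** A) = A" using SL2Z_adj2_mult(2)[OF lines_SL2Z[OF s(2)]] by (simp add: matrix_mul_assoc)
  finally have "int l dvd (adj2 \<sigma>' ** (\<gamma> ** \<sigma>)) $ 2 $ 1 - A $ 2 $ 1" unfolding mcong_iff by blast
  then have "int l dvd (adj2 \<sigma>' ** (\<gamma> ** \<sigma>)) $ 2 $ 1" using c(2) unfolding Hl_iff by (metis diff_add_cancel dvd_add)
  then have "par l (col \<sigma>') (col (\<gamma> ** \<sigma>))" unfolding adj2_mult_21 .
  then have "par l (col \<sigma>') (col \<sigma>)" using pm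
    by (elim disjE) (auto simp: par_def dvd_diff_commute)
  then show "\<sigma> = \<sigma>'" using lines_eqI[OF prime s(2,1)] by simp
qed

end

lemma nbf_exists_other:
  assumes "vx x" "eventually Q (nbf x)" shows "\<exists>\<tau>. Q \<tau> \<and> Pt \<tau> \<noteq> x"
proof (cases x)
  case (Pt \<tau>0)
  then have "eventually Q (at \<tau>0)" using assms(2) by (simp add: eventually_nhds_conv_at)
  moreover have "eventually (\<lambda>\<tau>. \<tau> \<noteq> \<tau>0) (at \<tau>0)" by (simp add: eventually_at_filter)
  ultimately have "eventually (\<lambda>\<tau>. Q \<tau> \<and> \<tau> \<noteq> \<tau>0) (at \<tau>0)" by (rule eventually_conj)
  then show ?thesis using eventually_happens'[OF at_neq_bot] Pt by blast
next
  case (Cu c)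
  then show ?thesis using eventually_happens'[OF nbf_ne_bot[OF assms(1)] assms(2)] by blast
qed

context level
begin

text \<open>Supplies the nonisolation hypothesis of \<open>ram_index_eqI\<close>: if a nearby \<tau>
  were equivalent to \<open>x\<close>, the matrix relating them would fix \<open>x\<close> by
  \<open>nbf_apart\<close>, so \<tau> would be \<open>x\<close>.\<close>

lemma ept_not_isolated:
  assumes x: "vx x" "cop g" and W: "openin (X_top n H) W" "ept n H x g \<in> W"
  shows "\<exists>y\<in>W. y \<noteq> ept n H x g"
proof -
  obtain V V' where V: "eventually (\<lambda>\<tau>. \<tau> \<in> V) (nbf x)" "eventually (\<lambda>\<tau>. \<tau> \<in> V') (nbf x)"
    and ap: "\<And>\<gamma> \<sigma>. \<gamma> \<in> SL2Z \<Longrightarrow> \<sigma> \<in> V \<Longrightarrow> Im \<sigma> > 0 \<Longrightarrow> mob \<gamma> \<sigma> \<in> V' \<Longrightarrow> xeq x (act \<gamma> x)"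
    using nbf_apart[OF x(1) x(1)] by blast
  have "eventually (\<lambda>\<tau>. ept n H (Pt \<tau>) g \<in> W) (nbf x)"
    using limitin_ept[OF x] W by (simp add: limitin_def)
  then have "eventually (\<lambda>\<tau>. (ept n H (Pt \<tau>) g \<in> W \<and> Im \<tau> > 0) \<and> \<tau> \<in> V') (nbf x)"
    using eventually_Im_pos[OF x(1)] V(2) by (intro eventually_conj)
  then obtain \<tau> where t: "ept n H (Pt \<tau>) g \<in> W" "Im \<tau> > 0" "\<tau> \<in> V'" "Pt \<tau> \<noteq> x"
    using nbf_exists_other[OF x(1)] by blast
  have "ept n H (Pt \<tau>) g \<noteq> ept n H x g"
  proof
    assume "ept n H (Pt \<tau>) g = ept n H x g"
    then have "orb n H x g (Pt \<tau>) g" using ept_eq_iff[of x "Pt \<tau>" g g] x t(2) by simp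
    then obtain \<gamma> where c: "\<gamma> \<in> SL2Z" "xeq (Pt \<tau>) (act \<gamma> x)" by (auto simp: orb_def)
    then obtain \<tau>0 where t0: "x = Pt \<tau>0" "\<tau> = mob \<gamma> \<tau>0" by (cases x) auto
    have "\<tau>0 \<in> V" using V(1) t0(1) eventually_nhds_x_imp_x[of "\<lambda>\<tau>. \<tau> \<in> V" \<tau>0] by simp
    then have "xeq x (act \<gamma> x)" using ap[OF c(1), of \<tau>0] x(1) t0 t(3) by simp
    then show False using t0 t(4) by simp
  qed
  then show ?thesis using t(1) by blast
qed

end

context hecke_level
begin

text \<open>In a neighbourhood of \<open>R\<close> that avoids the other preimages, the lifts of a
  nearby \<tau> are those whose limit is \<open>R\<close>. Away from \<open>x\<close> they are
  pairwise distinct by \<open>Phi_inj\<close>, so counting them counts lines.\<close>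

lemma ram_pr:
  assumes x: "vx x" "cop g" and R: "R \<in> Phi x g ` lines l"
  shows "ram_index (X_top (n * l) Hl) (X_top n H) (pr_map n H l) R = card {\<sigma> \<in> lines l. Phi x g \<sigma> = R}"
proof (rule ram_index_eqI)
  let ?X = "X_top (n * l) Hl" and ?Y = "X_top n H" and ?f = "pr_map n H l"
  obtain \<sigma>0 where s0: "\<sigma>0 \<in> lines l" "R = Phi x g \<sigma>0" using R by blast
  have fR: "?f R = ept n H x g" unfolding s0(2) by (rule pr_Phi[OF x s0(1)])
  show Rt: "R \<in> topspace ?X" unfolding L.topspace_X_top s0(2) by (rule Phi_mem[OF x s0(1)])
  show "\<exists>y\<in>W. y \<noteq> ?f R" if "openin ?Y W" "?f R \<in> W" for W
    using that unfolding fR by (rule ept_not_isolated[OF x])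
  fix U0 assume U0: "openin ?X U0" "R \<in> U0"
  have "\<exists>A B. openin ?X A \<and> openin ?X B \<and> R \<in> A \<and> Phi x g \<sigma> \<in> B \<and> disjnt A B"
    if "\<sigma> \<in> lines l" "Phi x g \<sigma> \<noteq> R" for \<sigma>
    using L.Hausdorff_X_top Rt Phi_mem[OF x that(1)] that(2)
    unfolding Hausdorff_space_def L.topspace_X_top by metis
  then obtain A B where AB: "\<And>\<sigma>. \<sigma> \<in> lines l \<Longrightarrow> Phi x g \<sigma> \<noteq> R \<Longrightarrow>
      openin ?X (A \<sigma>) \<and> openin ?X (B \<sigma>) \<and> R \<in> A \<sigma> \<and> Phi x g \<sigma> \<in> B \<sigma> \<and> disjnt (A \<sigma>) (B \<sigma>)" by metis
  \<comment> \<open>Shrinks the given neighbourhood of \<open>R\<close> so that it is disjoint from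
    a neighbourhood of each of the finitely many other preimages.\<close>
  define O' where "O' = U0 \<inter> (\<Inter>\<sigma>\<in>{\<sigma>\<in>lines l. Phi x g \<sigma> \<noteq> R}. topspace ?X \<inter> A \<sigma>)"
  have OO: "openin ?X O'"
  proof (cases "{\<sigma>\<in>lines l. Phi x g \<sigma> \<noteq> R} = {}")
    case True then show ?thesis using U0 unfolding O'_def True by simp
  next
    case False
    then show ?thesis unfolding O'_def using U0 AB finite_lines by (intro openin_Int openin_Inter) auto
  qed
  have RO: "R \<in> O'" unfolding O'_def using U0 AB Rt by auto
  have lim: "limitin ?X (\<lambda>\<tau>. Phi (Pt \<tau>) g \<sigma>) (Phi x g \<sigma>) (nbf x)" if "\<sigma> \<in> lines l" for \<sigma>
    unfolding Phi_def by (rule L.limitin_ept[OF x(1) cop_gs[OF x(2) that]])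
  have ev1: "eventually (\<lambda>\<tau>. Phi (Pt \<tau>) g \<sigma> \<in> O' \<longleftrightarrow> Phi x g \<sigma> = R) (nbf x)" if s: "\<sigma> \<in> lines l" for \<sigma>
  proof (cases "Phi x g \<sigma> = R")
    case True
    then have "eventually (\<lambda>\<tau>. Phi (Pt \<tau>) g \<sigma> \<in> O') (nbf x)" using lim[OF s] OO RO by (simp add: limitin_def)
    then show ?thesis by eventually_elim (simp add: True)
  next
    case False
    then have "eventually (\<lambda>\<tau>. Phi (Pt \<tau>) g \<sigma> \<in> B \<sigma>) (nbf x)" using lim[OF s] AB[OF s] by (simp add: limitin_def)
    then show ?thesis
    proof eventually_elim
      case (elim \<tau>)
      then have "Phi (Pt \<tau>) g \<sigma> \<notin> A \<sigma>" using AB[OF s False] by (auto simp: disjnt_def)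
      then show ?case using False s by (auto simp: O'_def)
    qed
  qed
  have ev2: "eventually (\<lambda>\<tau>. \<forall>\<sigma>\<in>lines l. Phi (Pt \<tau>) g \<sigma> \<in> O' \<longleftrightarrow> Phi x g \<sigma> = R) (nbf x)"
    using ev1 by (intro eventually_ball_finite finite_lines) blast
  \<comment> \<open>At \<open>x\<close> itself the lifts may coincide; injectivity is used only over
    values different from the image of \<open>R\<close>, so only over \<tau> different from
    \<open>x\<close>.\<close>
  define good where "good \<tau> \<longleftrightarrow> (\<forall>\<sigma>\<in>lines l. Phi (Pt \<tau>) g \<sigma> \<in> O' \<longleftrightarrow> Phi x g \<sigma> = R) \<and>
      (Pt \<tau> \<noteq> x \<longrightarrow> (\<forall>\<gamma>\<in>SL2Z. mob \<gamma> \<tau> = \<tau> \<longrightarrow> \<gamma> = mat 1 \<or> \<gamma> = - mat 1))" for \<tau>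
  have ev: "eventually good (nbf x)"
    unfolding good_def using ev2 eventually_no_stabilizer[OF x(1)] by (rule eventually_conj)
  obtain V where V: "open V" "\<And>\<tau>. \<tau> \<in> V \<Longrightarrow> Im \<tau> > 0" "eventually (\<lambda>\<tau>. \<tau> \<in> V) (nbf x)"
    and Vg: "\<And>\<tau>. \<tau> \<in> V \<Longrightarrow> good \<tau>" by (rule nbf_open[OF x(1) ev]) blast
  note VP = Vg[unfolded good_def]
  define W where "W = insert (ept n H x g) ((\<lambda>\<tau>. ept n H (Pt \<tau>) g) ` V)"
  have W: "openin ?Y W" unfolding openin_X_top W_def by (rule X_open_base[OF x V])
  define U where "U = O' \<inter> {R \<in> topspace ?X. ?f R \<in> W}"
  have "openin ?X U" unfolding U_def
    by (intro openin_Int OO openin_continuous_map_preimage[OF pr_continuous W])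
  moreover have "R \<in> U" unfolding U_def using RO Rt fR by (simp add: W_def)
  moreover have "U \<subseteq> U0" by (auto simp: U_def O'_def)
  moreover have "?f R \<in> W" by (simp add: fR W_def)
  moreover have "finite {R' \<in> U. ?f R' = y} \<and> card {R' \<in> U. ?f R' = y} = card {\<sigma> \<in> lines l. Phi x g \<sigma> = R}"
    if y: "y \<in> W - {?f R}" for y
  proof -
    obtain \<tau> where t: "\<tau> \<in> V" "y = ept n H (Pt \<tau>) g" using y unfolding fR W_def by blast
    have v: "vx (Pt \<tau>)" using V(2)[OF t(1)] by simp
    have nx: "Pt \<tau> \<noteq> x"
    proof
      assume e: "Pt \<tau> = x"
      have "y = ?f R" unfolding t(2) e fR ..
      then show False using y by simp
    qed
    have "{R' \<in> U. ?f R' = y} = Phi (Pt \<tau>) g ` {\<sigma> \<in> lines l. Phi x g \<sigma> = R}"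
    proof (rule equalityI; rule subsetI)
      fix R' assume R': "R' \<in> {R' \<in> U. ?f R' = y}"
      then have "R' \<in> X_points (n * l) Hl" "?f R' = ept n H (Pt \<tau>) g" "R' \<in> O'"
        using t(2) by (auto simp: U_def L.topspace_X_top)
      then obtain \<sigma> where s: "\<sigma> \<in> lines l" "R' = Phi (Pt \<tau>) g \<sigma>" using fibre_pr[OF v x(2)] by blast
      then have "Phi x g \<sigma> = R" using VP[OF t(1)] \<open>R' \<in> O'\<close> by blast
      then show "R' \<in> Phi (Pt \<tau>) g ` {\<sigma> \<in> lines l. Phi x g \<sigma> = R}" using s by blast
    next
      fix R' assume "R' \<in> Phi (Pt \<tau>) g ` {\<sigma> \<in> lines l. Phi x g \<sigma> = R}"
      then obtain \<sigma> where s: "\<sigma> \<in> lines l" "R' = Phi (Pt \<tau>) g \<sigma>" "Phi x g \<sigma> = R" by blast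
      have "R' \<in> O'" using VP[OF t(1)] s by blast
      moreover have "?f R' = y" unfolding s(2) t(2) by (rule pr_Phi[OF v x(2) s(1)])
      moreover have "R' \<in> topspace ?X" unfolding s(2) L.topspace_X_top by (rule Phi_mem[OF v x(2) s(1)])
      moreover have "y \<in> W" using t by (simp add: W_def)
      ultimately show "R' \<in> {R' \<in> U. ?f R' = y}" by (simp add: U_def)
    qed
    moreover have "inj_on (Phi (Pt \<tau>) g) {\<sigma> \<in> lines l. Phi x g \<sigma> = R}"
      by (rule inj_on_subset[OF Phi_inj[OF V(2)[OF t(1)] x(2)]]) (use VP[OF t(1)] nx in auto)
    ultimately show ?thesis using finite_lines by (simp add: card_image)
  qed
  ultimately show "\<exists>U W. openin ?X U \<and> R \<in> U \<and> U \<subseteq> U0 \<and> openin ?Y W \<and> ?f R \<in> W \<and>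
      (\<forall>y\<in>W - {?f R}. finite {x \<in> U. ?f x = y} \<and> card {x \<in> U. ?f x = y} = card {\<sigma> \<in> lines l. Phi x g \<sigma> = R})"
    using W by blast
qed

text \<open>The ramification index of \<open>R\<close> counts the lines with lift \<open>R\<close>;
  hence the weighted sum over the fibre is a plain sum over lines, regrouped by their lifts.\<close>

theorem multiplicity_hecke:
  assumes x: "vx x" "cop g"
  shows "multiplicity_at (hecke n H l (frag_of (ept n H x g))) Q = int (card {\<sigma> \<in> lines l. qt_map n H l (Phi x g \<sigma>) = Q})"
proof -
  let ?F = "Phi x g ` lines l" and ?r = "ram_index (X_top (n * l) Hl) (X_top n H) (pr_map n H l)"
  have fib: "{R \<in> topspace (X_top (n * l) Hl). pr_map n H l R = ept n H x g} = ?F"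
    unfolding L.topspace_X_top using fibre_pr[OF x] pr_Phi[OF x] Phi_mem[OF x] by blast
  have "hecke n H l (frag_of (ept n H x g)) =
      div_pushforward (qt_map n H l) (\<Sum>R\<in>?F. frag_cmul (int (?r R)) (frag_of R))"
    unfolding hecke_def div_pullback_def comp_def frag_extend_of fib ..
  also have "\<dots> = (\<Sum>R\<in>?F. frag_cmul (int (?r R)) (frag_of (qt_map n H l R)))"
    unfolding div_pushforward_def
    by (subst frag_extend_sum) (auto simp: finite_lines frag_extend_cmul)
  finally have T: "hecke n H l (frag_of (ept n H x g)) = (\<Sum>R\<in>?F. frag_cmul (int (?r R)) (frag_of (qt_map n H l R)))" .
  have "multiplicity_at (hecke n H l (frag_of (ept n H x g))) Q =
      (\<Sum>R\<in>?F. int (?r R) * (if qt_map n H l R = Q then 1 else 0))"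
    unfolding T lookup_sum by (intro sum.cong refl) auto
  also have "\<dots> = (\<Sum>R\<in>?F. \<Sum>\<sigma> | \<sigma> \<in> lines l \<and> Phi x g \<sigma> = R. if qt_map n H l (Phi x g \<sigma>) = Q then 1 else 0)"
  proof (rule sum.cong[OF refl])
    fix R assume "R \<in> ?F"
    then have "?r R = card {\<sigma> \<in> lines l. Phi x g \<sigma> = R}" by (rule ram_pr[OF x])
    moreover have "(\<Sum>\<sigma> | \<sigma> \<in> lines l \<and> Phi x g \<sigma> = R. if qt_map n H l (Phi x g \<sigma>) = Q then 1 else 0)
        = (\<Sum>\<sigma> | \<sigma> \<in> lines l \<and> Phi x g \<sigma> = R. if qt_map n H l R = Q then 1 else (0 :: int))"
      by (rule sum.cong) auto
    ultimately show "int (?r R) * (if qt_map n H l R = Q then 1 else 0) =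
        (\<Sum>\<sigma> | \<sigma> \<in> lines l \<and> Phi x g \<sigma> = R. if qt_map n H l (Phi x g \<sigma>) = Q then 1 else 0)" by simp
  qed
  also have "\<dots> = (\<Sum>\<sigma>\<in>lines l. if qt_map n H l (Phi x g \<sigma>) = Q then 1 else 0)"
    by (rule sum.image_gen[symmetric]) (rule finite_lines)
  also have "\<dots> = int (card {\<sigma> \<in> lines l. qt_map n H l (Phi x g \<sigma>) = Q})"
    by (simp add: sum.If_cases finite_lines Int_def)
  finally show ?thesis .
qed

section \<open>The second map on the fibre, and the cusps\<close>

text \<open>The isogeny with kernel the line of \<sigma>: the adjugate moves the line to (1 : 0),
  then \<tau> becomes l\<tau>.\<close>

definition del :: "int^2^2 \<Rightarrow> int^2^2" where
  "del \<sigma> = mk2 (int l) 0 0 1 ** adj2 \<sigma>"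

lemma det_del: "\<sigma> \<in> lines l \<Longrightarrow> det (del \<sigma>) = int l"
  using lines_SL2Z[of \<sigma> l] by (simp add: del_def det_mul SL2Z_iff) (simp add: det_2)

lemma qt_Phi:
  assumes t: "Im \<tau> > 0" "cop g" and s: "\<sigma> \<in> lines l"
  shows "qt_map n H l (Phi (Pt \<tau>) g \<sigma>) = ept n H (Pt (mob (del \<sigma>) \<tau>)) (del \<sigma> ** g)"
proof -
  have s1: "adj2 \<sigma> \<in> SL2Z" "det \<sigma> = 1" using lines_SL2Z[OF s] SL2Z_adj2 by (auto simp: SL2Z_iff)
  have n21: "int l dvd (adj2 \<sigma> ** gs g \<sigma>) $ 2 $ 1"
  proof -
    have "mcong l (adj2 \<sigma> ** gs g \<sigma>) (adj2 \<sigma> ** \<sigma>)" using gs(2) by (rule mcong_mult_left)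
    then have "mcong l (adj2 \<sigma> ** gs g \<sigma>) (mat 1)" using SL2Z_adj2_mult(2)[OF lines_SL2Z[OF s]] by simp
    then have "int l dvd (adj2 \<sigma> ** gs g \<sigma>) $ 2 $ 1 - (mat 1 :: int^2^2) $ 2 $ 1" unfolding mcong_iff by blast
    then show ?thesis by (simp only: mat_nth2 diff_zero)
  qed
  have I: "Im (mob (adj2 \<sigma>) \<tau>) > 0" using Im_mob_SL2Z[OF t(1) s1(1)] .
  have "mob (del \<sigma>) \<tau> = mob (mk2 (int l) 0 0 1) (mob (adj2 \<sigma>) \<tau>)"
    unfolding del_def by (rule mob_mult[OF t(1)]) (use s1 in simp)
  then have m: "mob (del \<sigma>) \<tau> = of_nat l * mob (adj2 \<sigma>) \<tau>" by (simp add: mob_def[of "mk2 _ _ _ _"] num_def den_def)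
  have "mcong n (Dk ** (adj2 \<sigma> ** gs g \<sigma>)) (Dk ** (adj2 \<sigma> ** scal (int l) g))"
    using gs(1) by (intro mcong_mult_left)
  also have "Dk ** (adj2 \<sigma> ** scal (int l) g) = scal (int l) Dk ** (adj2 \<sigma> ** g)" by simp
  \<comment> \<open>The factor \<open>l\<close> put into \<open>gs\<close> meets the
    \<open>kk\<close> inside \<open>Dk\<close>, which leaves diag(l, 1) modulo
    \<open>n\<close>.\<close>
  also have "mcong n \<dots> (mk2 (int l) 0 0 1 ** (adj2 \<sigma> ** g))"
    by (rule mcong_mult_right) (use kk in \<open>simp add: mcong_iff forall_2 Dk_def\<close>)
  also have "mk2 (int l) 0 0 1 ** (adj2 \<sigma> ** g) = del \<sigma> ** g" by (simp add: del_def matrix_mul_assoc)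
  finally have mc: "mcong n (Dk ** (adj2 \<sigma> ** gs g \<sigma>)) (del \<sigma> ** g)" .
  have cop: "L.cop (gs g \<sigma>)" by (rule cop_gs[OF t(2) s])
  then have "coprime (det (gs g \<sigma>)) (int n)" by simp
  then have copD: "cop (Dk ** (adj2 \<sigma> ** gs g \<sigma>))" using coprime_kk s1(2) by (simp add: det_mul det_Dk)
  have "qt_map n H l (Phi (Pt \<tau>) g \<sigma>) = ept n H (Pt (of_nat l * mob (adj2 \<sigma>) \<tau>)) (Dk ** (adj2 \<sigma> ** gs g \<sigma>))"
    unfolding Phi_def qt_ell_point[OF t(1) cop] by (rule qt_std[OF t(1) cop s1(1) n21])
  also have "\<dots> = ept n H (Pt (of_nat l * mob (adj2 \<sigma>) \<tau>)) (del \<sigma> ** g)"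
    by (rule ept_cong[OF _ copD mc]) (use I lpos in simp)
  finally show ?thesis unfolding m .
qed

text \<open>Over the cusp \<open>\<infinity>\<close>, the translation by a multiple of \<open>n\<close> permutes all lines but one transitively.\<close>

lemma Phi_infinity:
  assumes g: "cop g" and s: "\<sigma> \<in> lines l - {mat 1}" "\<sigma>' \<in> lines l - {mat 1}"
  shows "Phi (Cu (vector [1, 0])) g \<sigma> = Phi (Cu (vector [1, 0])) g \<sigma>'"
proof -
  let ?x = "Cu (vector [1, 0])"
  obtain i j where ij: "\<sigma> = mk2 (- i) 1 (- 1) 0" "\<sigma>' = mk2 (- j) 1 (- 1) 0" using s by (auto simp: lines_def)
  have "coprime (int n) (int l)" using cop_nl by simp
  then obtain r where r: "int l dvd int n * r - 1" using exists_inverse_mod by blast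
  define m where "m = r * (j - i)"
  have "int l dvd (int n * r - 1) * (j - i)" using r by (rule dvd_mult2)
  then have m: "int l dvd int n * m - (j - i)" by (simp add: m_def algebra_simps)
  define \<gamma> where "\<gamma> = mk2 1 (int n * m) 0 1"
  have c: "\<gamma> \<in> SL2Z" by (simp add: \<gamma>_def SL2Z_iff det_2)
  have cn: "mcong n \<gamma> (mat 1)" by (simp add: \<gamma>_def mcong_iff forall_2)
  have "mcong n (\<gamma> ** gs g \<sigma>) (mat 1 ** scal (int l) g)" by (rule mcong_mult[OF cn gs(1)])
  also have "mat 1 ** scal (int l) g = scal (int l) g ** mat 1" by simp
  also have "mcong n \<dots> (scal (int l) g ** red_mat n (mat 1))" by (rule mcong_mult_left) simp
  finally have 1: "mcong n (\<gamma> ** gs g \<sigma>) (scal (int l) g ** red_mat n (mat 1))" .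
  have "mcong l (adj2 \<sigma>' ** (\<gamma> ** gs g \<sigma>)) (adj2 \<sigma>' ** (\<gamma> ** \<sigma>))" using gs(2) by (intro mcong_mult_left)
  then have "int l dvd (adj2 \<sigma>' ** (\<gamma> ** gs g \<sigma>)) $ 2 $ 1 - (adj2 \<sigma>' ** (\<gamma> ** \<sigma>)) $ 2 $ 1" unfolding mcong_iff by blast
  moreover have "int l dvd (adj2 \<sigma>' ** (\<gamma> ** \<sigma>)) $ 2 $ 1"
    using m by (simp add: ij \<gamma>_def algebra_simps dvd_diff_commute)
  ultimately have "int l dvd (adj2 \<sigma>' ** (\<gamma> ** gs g \<sigma>)) $ 2 $ 1" by (metis diff_add_cancel dvd_add)
  then have 2: "par l (col \<sigma>') (col (\<gamma> ** gs g \<sigma>))" unfolding adj2_mult_21 .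
  have v: "vx ?x" by simp
  have "orb (n * l) Hl ?x (gs g \<sigma>) ?x (gs g \<sigma>')"
    by (rule orb_gs[OF 1 subgroup_GL2D(2)[OF sub] cop_gs[OF g] c _ 2])
      (use s in \<open>auto simp: \<gamma>_def vec2_eq_iff\<close>)
  then show ?thesis unfolding Phi_def
    using L.ept_eq_iff[OF v v cop_gs[OF g] cop_gs[OF g]] s by blast
qed

lemma ept_cusp_infinity:
  assumes "coprime (c $ 1) (c $ 2)" "cop g"
  shows "\<exists>g'. cop g' \<and> ept n H (Cu c) g = ept n H (Cu (vector [1, 0])) g'"
proof -
  obtain \<gamma> where c: "\<gamma> \<in> SL2Z" "\<gamma> *v vector [1, 0] = c" using exists_SL2Z_column[OF assms(1)] by blast
  have v: "vx (Cu c)" "vx (Cu (vector [1, 0]))" using assms by simp_all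
  have cop: "cop (adj2 \<gamma> ** g)" using assms(2) c(1) by (simp add: det_mul SL2Z_iff)
  have "adj2 \<gamma> *v c = vector [1, 0]"
    unfolding c(2)[symmetric] using SL2Z_adj2_mult(2)[OF c(1)] by (simp add: matrix_vector_mul_assoc)
  then have "xeq (Cu (vector [1, 0])) (act (adj2 \<gamma>) (Cu c))" by simp
  moreover have "mcong n (adj2 \<gamma> ** g) ((adj2 \<gamma> ** g) ** red_mat n (mat 1))"
    using mcong_mult_left[of n "mat 1" "red_mat n (mat 1)" "adj2 \<gamma> ** g"] by simp
  ultimately have "orb n H (Cu c) g (Cu (vector [1, 0])) (adj2 \<gamma> ** g)"
    unfolding orb_def using SL2Z_adj2[OF c(1)] subgroup_GL2D(2)[OF sub] by blast
  then show ?thesis using ept_eq_iff[OF v assms(2) cop] cop by blast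
qed

text \<open>The \<open>l\<close> lines other than \<open>mat 1\<close> have the same image, which
  that of \<open>mat 1\<close> may or may not equal. So a fibre has at least \<open>l\<close> lines
  or at most one.\<close>

lemma multiplicity_cusp:
  assumes "P \<in> cusps n H"
  shows "\<exists>Q\<in>X_points n H. multiplicity_at (hecke n H l (frag_of P)) Q \<ge> 4"
    and "multiplicity_at (hecke n H l (frag_of P)) Q \<noteq> 2"
    and "multiplicity_at (hecke n H l (frag_of P)) Q \<noteq> 3"
proof -
  have "P \<in> X_points n H" using assms by (simp add: X_points_def)
  then obtain x g where x: "vx x" "cop g" "P = ept n H x g" unfolding X_points_iff by blast
  then obtain c where "x = Cu c" using assms cusps_iff by blast
  then obtain g' where g': "cop g'" "P = ept n H (Cu (vector [1, 0])) g'"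
    using ept_cusp_infinity[of c g] x by auto
  let ?x = "Cu (vector [1, 0])"
  have v: "vx ?x" by simp
  define f where "f \<sigma> = qt_map n H l (Phi ?x g' \<sigma>)" for \<sigma>
  have mult: "multiplicity_at (hecke n H l (frag_of P)) Q = int (card {\<sigma> \<in> lines l. f \<sigma> = Q})" for Q
    unfolding g'(2) f_def by (rule multiplicity_hecke[OF v g'(1)])
  have const: "f \<sigma> = f \<sigma>'" if "\<sigma> \<in> lines l - {mat 1}" "\<sigma>' \<in> lines l - {mat 1}" for \<sigma> \<sigma>'
    unfolding f_def using Phi_infinity[OF g'(1) that] by simp
  have m1: "mat 1 \<in> lines l" by (simp add: lines_def)
  have cl: "card (lines l - {mat 1}) = l" using m1 by (simp add: card_lines)
  have sub2: "card {\<sigma> \<in> lines l. f \<sigma> = Q} \<ge> l \<or> card {\<sigma> \<in> lines l. f \<sigma> = Q} \<le> 1" for Q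
  proof (cases "\<exists>\<sigma>\<in>lines l - {mat 1}. f \<sigma> = Q")
    case True
    then have "lines l - {mat 1} \<subseteq> {\<sigma> \<in> lines l. f \<sigma> = Q}" using const by blast
    then show ?thesis using card_mono[of "{\<sigma> \<in> lines l. f \<sigma> = Q}" "lines l - {mat 1}"] finite_lines cl by simp
  next
    case False
    then have "{\<sigma> \<in> lines l. f \<sigma> = Q} \<subseteq> {mat 1}" by blast
    then show ?thesis using card_mono[of "{mat 1 :: int^2^2}" "{\<sigma> \<in> lines l. f \<sigma> = Q}"] by simp
  qed
  then show "multiplicity_at (hecke n H l (frag_of P)) Q \<noteq> 2" "multiplicity_at (hecke n H l (frag_of P)) Q \<noteq> 3"
    unfolding mult using l5 sub2[of Q] by linarith+
  have "lines l - {mat 1} \<noteq> {}" using cl lpos by (metis card.empty less_irrefl)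
  then obtain \<sigma>0 where s0: "\<sigma>0 \<in> lines l - {mat 1}" by blast
  then have "lines l - {mat 1} \<subseteq> {\<sigma> \<in> lines l. f \<sigma> = f \<sigma>0}" using const by blast
  then have "card {\<sigma> \<in> lines l. f \<sigma> = f \<sigma>0} \<ge> l"
    using card_mono[of "{\<sigma> \<in> lines l. f \<sigma> = f \<sigma>0}" "lines l - {mat 1}"] finite_lines cl by simp
  then have "multiplicity_at (hecke n H l (frag_of P)) (f \<sigma>0) \<ge> 4" unfolding mult using l5 by linarith
  moreover have "f \<sigma>0 \<in> X_points n H" unfolding f_def using s0 by (intro qt_mem Phi_mem v g'(1)) simp
  ultimately show "\<exists>Q\<in>X_points n H. multiplicity_at (hecke n H l (frag_of P)) Q \<ge> 4" by blast
qed

end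

section \<open>Endomorphisms of complex tori as integer matrices\<close>

lemma mob_fixedD:
  assumes "Im \<tau> > 0" "det A \<noteq> 0" "mob A \<tau> = \<tau>" shows "num A \<tau> = \<tau> * den A \<tau>"
  using mob_eq_iff[OF assms(1,2)] assms(3) by blast

lemma num_den_eqD:
  assumes "Im \<tau> > 0" "num A \<tau> = num B \<tau>" "den A \<tau> = den B \<tau>" shows "A = B"
  using of_int_lin_eq_iff[OF assms(1)] assms(2,3) unfolding num_def den_def mat2_eq_iff by blast

text \<open>A matrix fixing \<tau> acts on the lattice of \<tau> as a complex scalar, and
  \<open>den\<close> records that scalar up to inversion and the determinant; with the fixed point
  equation it determines \<open>num\<close> as well.\<close>

lemma fixed_eqI:
  assumes "Im \<tau> > 0" "det A \<noteq> 0" "det B \<noteq> 0" "mob A \<tau> = \<tau>" "mob B \<tau> = \<tau>" "den A \<tau> = den B \<tau>"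
  shows "A = B"
  using mob_fixedD[OF assms(1,2,4)] mob_fixedD[OF assms(1,3,5)] num_den_eqD[OF assms(1)] assms(6) by simp

lemma fixed_mult:
  assumes "Im \<tau> > 0" "det A \<noteq> 0" "det B \<noteq> 0" "mob A \<tau> = \<tau>" "mob B \<tau> = \<tau>"
  shows "mob (A ** B) \<tau> = \<tau>" "den (A ** B) \<tau> = den A \<tau> * den B \<tau>"
  using mob_mult[OF assms(1,3), of A] den_mult(1)[OF assms(1,3), of A] assms(4,5) by simp_all

text \<open>At a common fixed point \<open>den\<close> is multiplicative, so both products have the
  same automorphy factor.\<close>

lemma fixed_commute:
  assumes "Im \<tau> > 0" "det A \<noteq> 0" "det B \<noteq> 0" "mob A \<tau> = \<tau>" "mob B \<tau> = \<tau>"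
  shows "A ** B = B ** A"
  by (rule fixed_eqI[OF assms(1)])
    (use fixed_mult[OF assms] fixed_mult[OF assms(1,3,2,5,4)] assms in \<open>simp_all add: det_mul\<close>)

definition tr2 :: "int^2^2 \<Rightarrow> int" where "tr2 A = A $ 1 $ 1 + A $ 2 $ 2"

text \<open>\<open>den U \<tau>\<close> is a root of the characteristic polynomial of
  \<open>U\<close>. If the lower left entry is nonzero the root is not real, so its real part is
  half the trace; otherwise \<open>U\<close> is 1 or -1.\<close>

lemma fixed_SL2Z_den:
  assumes t: "Im \<tau> > 0" and U: "U \<in> SL2Z" "mob U \<tau> = \<tau>"
  shows "2 * Re (den U \<tau>) = of_int (tr2 U)"
    and "4 * (Im (den U \<tau>))\<^sup>2 = 4 - (of_int (tr2 U))\<^sup>2"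
    and "Im (den U \<tau>) = of_int (U $ 2 $ 1) * Im \<tau>"
    and "U $ 2 $ 1 = 0 \<Longrightarrow> U = mat 1 \<or> U = - mat 1"
proof -
  have d: "det U = 1" using U(1) by (simp add: SL2Z_iff)
  have f: "num U \<tau> = \<tau> * den U \<tau>" using mob_fixedD[OF t _ U(2)] d by simp
  show i: "Im (den U \<tau>) = of_int (U $ 2 $ 1) * Im \<tau>" by (simp add: den_def)
  let ?L = "den U \<tau>" and ?a = "of_int (U $ 1 $ 1) :: complex" and ?b = "of_int (U $ 1 $ 2) :: complex"
    and ?c = "of_int (U $ 2 $ 1) :: complex" and ?d = "of_int (U $ 2 $ 2) :: complex"
  have 1: "(?L - ?a) * \<tau> = ?b" using f by (simp add: num_def algebra_simps)
  have 2: "?L - ?d = ?c * \<tau>" by (simp add: den_def)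
  have "(?L - ?a) * (?L - ?d) = ?c * ((?L - ?a) * \<tau>)" unfolding 2 by (simp add: algebra_simps)
  then have "(?L - ?a) * (?L - ?d) = ?b * ?c" unfolding 1 by simp
  moreover have "?a * ?d - ?b * ?c = 1"
    using arg_cong[OF d, of "of_int :: int \<Rightarrow> complex"] by (simp add: det_2)
  ultimately have q: "?L * ?L - of_int (tr2 U) * ?L + 1 = 0" by (simp add: tr2_def algebra_simps)
  have id: "U = mat 1 \<or> U = - mat 1" if c0: "U $ 2 $ 1 = 0"
  proof -
    have "of_int (U $ 1 $ 1) * \<tau> + of_int (U $ 1 $ 2) = of_int (U $ 2 $ 2) * \<tau> + of_int 0"
      using f c0 by (simp add: num_def den_def algebra_simps)
    then have e: "U $ 1 $ 1 = U $ 2 $ 2" "U $ 1 $ 2 = 0" using of_int_lin_eq_iff[OF t] by blast+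
    then have "U $ 2 $ 2 * U $ 2 $ 2 = 1" using d c0 by (simp add: det_2)
    then have "U $ 2 $ 2 = 1 \<or> U $ 2 $ 2 = -1" by (simp add: zmult_eq_1_iff)
    then show ?thesis using e c0 by (auto simp: mat2_eq_iff)
  qed
  then show "U $ 2 $ 1 = 0 \<Longrightarrow> U = mat 1 \<or> U = - mat 1" .
  show r: "2 * Re ?L = of_int (tr2 U)"
  proof (cases "U $ 2 $ 1 = 0")
    case True
    then show ?thesis using id[OF True] by (auto simp: den_def tr2_def)
  next
    case False
    then have nz: "Im ?L \<noteq> 0" using t i by simp
    have "Im (?L * ?L - of_int (tr2 U) * ?L + 1) = 0" using q by simp
    then have "Im ?L * (2 * Re ?L - of_int (tr2 U)) = 0" by (simp add: algebra_simps)
    then show ?thesis using nz by simp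
  qed
  have re: "Re ?L = of_int (tr2 U) / 2" using r by simp
  have "Re (?L * ?L - of_int (tr2 U) * ?L + 1) = 0" using q by simp
  then have "Re ?L * Re ?L - (Im ?L)\<^sup>2 - of_int (tr2 U) * Re ?L + 1 = 0" by (simp add: power2_eq_square)
  then show "4 * (Im ?L)\<^sup>2 = 4 - (of_int (tr2 U))\<^sup>2" unfolding re by (simp add: power2_eq_square field_simps)
qed

lemma adj2_fixed:
  assumes "Im \<tau> > 0" "U \<in> SL2Z" "mob U \<tau> = \<tau>" shows "mob (adj2 U) \<tau> = \<tau>"
  using mob_adj2_SL2Z[OF assms(1,2)] assms(3) by simp

text \<open>The characteristic polynomial has a root that is not real, so its discriminant, the
  squared trace minus 4, is negative.\<close>

lemma elliptic_trace:
  assumes t: "Im \<tau> > 0" and U: "U \<in> SL2Z" "mob U \<tau> = \<tau>" "U \<noteq> mat 1" "U \<noteq> - mat 1"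
  shows "tr2 U = 0 \<or> tr2 U = 1 \<or> tr2 U = -1"
proof -
  have "U $ 2 $ 1 \<noteq> 0" using fixed_SL2Z_den(4)[OF t U(1,2)] U(3,4) by blast
  then have "Im (den U \<tau>) \<noteq> 0" unfolding fixed_SL2Z_den(3)[OF t U(1,2)] using t by simp
  then have "(Im (den U \<tau>))\<^sup>2 > 0" by simp
  then have "(of_int (tr2 U) :: real)\<^sup>2 < 4" using fixed_SL2Z_den(2)[OF t U(1,2)] by linarith
  then have "\<bar>of_int (tr2 U) :: real\<bar> < 2" using abs_square_less_1 power2_less_imp_less[of "\<bar>of_int (tr2 U)\<bar>" "2::real"] by simp
  then have "\<bar>tr2 U\<bar> < 2" by linarith
  then show ?thesis by linarith
qed

text \<open>An automorphism of order 4 and one of order 3 would compose to one of trace \<open>\<plusminus>\<surd>3\<close>.\<close>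

lemma elliptic_trace_exclusive:
  assumes t: "Im \<tau> > 0" and U: "U \<in> SL2Z" "mob U \<tau> = \<tau>" and V: "V \<in> SL2Z" "mob V \<tau> = \<tau>"
    and tr: "tr2 U = 0" "(tr2 V)\<^sup>2 = 1"
  shows False
proof -
  have dd: "det U \<noteq> 0" "det V \<noteq> 0" using U V by (simp_all add: SL2Z_iff)
  note UV = fixed_mult[OF t dd U(2) V(2)]
  have "2 * Re (den U \<tau> * den V \<tau>) = of_int (tr2 (U ** V))"
    using fixed_SL2Z_den(1)[OF t SL2Z_mult[OF U(1) V(1)] UV(1)] UV(2) by simp
  moreover have "Re (den U \<tau>) = 0" using fixed_SL2Z_den(1)[OF t U] tr by simp
  ultimately have "of_int (tr2 (U ** V)) = - 2 * (Im (den U \<tau>) * Im (den V \<tau>))" by simp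
  then have "(of_int (tr2 (U ** V)) :: real)\<^sup>2 = 4 * ((Im (den U \<tau>))\<^sup>2 * (Im (den V \<tau>))\<^sup>2)"
    by (simp add: power_mult_distrib)
  moreover have "(Im (den U \<tau>))\<^sup>2 = 1" using fixed_SL2Z_den(2)[OF t U] tr by simp
  moreover have "4 * (Im (den V \<tau>))\<^sup>2 = 3"
    using fixed_SL2Z_den(2)[OF t V] arg_cong[OF tr(2), of "of_int :: int \<Rightarrow> real"] by simp
  ultimately have "(of_int (tr2 (U ** V)) :: real)\<^sup>2 = 3" by simp
  then have "of_int ((tr2 (U ** V))\<^sup>2) = (of_int 3 :: real)" by simp
  then have s: "(tr2 (U ** V))\<^sup>2 = 3" by linarith
  have "\<bar>tr2 (U ** V)\<bar> \<le> 1 \<or> \<bar>tr2 (U ** V)\<bar> \<ge> 2" by linarith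
  then show False
  proof
    assume "\<bar>tr2 (U ** V)\<bar> \<le> 1"
    then have "(tr2 (U ** V))\<^sup>2 \<le> 1" by (simp add: abs_square_le_1)
    then show False using s by simp
  next
    assume "\<bar>tr2 (U ** V)\<bar> \<ge> 2"
    then have "2\<^sup>2 \<le> (tr2 (U ** V))\<^sup>2" using abs_le_square_iff[of 2 "tr2 (U ** V)"] by simp
    then show False using s by simp
  qed
qed

text \<open>The trace determines the real part of the factor, and the square of its imaginary part.
  The four choices of signs are realized by these four matrices, and \<open>fixed_eqI\<close>
  applies.\<close>

lemma elliptic_same_trace:
  assumes t: "Im \<tau> > 0" and U: "U \<in> SL2Z" "mob U \<tau> = \<tau>" and V: "V \<in> SL2Z" "mob V \<tau> = \<tau>"
    and tr: "(tr2 U)\<^sup>2 = (tr2 V)\<^sup>2"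
  shows "V = U \<or> V = - U \<or> V = adj2 U \<or> V = - adj2 U"
proof -
  have eq: "V = W" if "W \<in> SL2Z" "mob W \<tau> = \<tau>" "Re (den V \<tau>) = Re (den W \<tau>)" "Im (den V \<tau>) = Im (den W \<tau>)" for W
    by (rule fixed_eqI[OF t]) (use that V in \<open>simp_all add: SL2Z_iff complex_eq_iff\<close>)
  have nU: "- U \<in> SL2Z" "mob (- U) \<tau> = \<tau>" using U SL2Z_uminus by simp_all
  have aU: "adj2 U \<in> SL2Z" "mob (adj2 U) \<tau> = \<tau>" using U SL2Z_adj2 adj2_fixed[OF t U] by simp_all
  have naU: "- adj2 U \<in> SL2Z" "mob (- adj2 U) \<tau> = \<tau>" using aU SL2Z_uminus by simp_all
  have dn: "den (- W) \<tau> = - den W \<tau>" for W by (simp add: den_def)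
  have "tr2 (adj2 U) = tr2 U" by (simp add: tr2_def)
  then have ra: "Re (den (adj2 U) \<tau>) = Re (den U \<tau>)"
    using fixed_SL2Z_den(1)[OF t aU] fixed_SL2Z_den(1)[OF t U] by simp
  have ia: "Im (den (adj2 U) \<tau>) = - Im (den U \<tau>)" by (simp add: den_def)
  have "tr2 V = tr2 U \<or> tr2 V = - tr2 U" using tr unfolding power2_eq_iff by auto
  then have R: "Re (den V \<tau>) = Re (den U \<tau>) \<or> Re (den V \<tau>) = - Re (den U \<tau>)"
    using fixed_SL2Z_den(1)[OF t U] fixed_SL2Z_den(1)[OF t V] by auto
  have "(of_int (tr2 U) :: real)\<^sup>2 = (of_int (tr2 V))\<^sup>2" using tr by (metis of_int_power)
  then have "(Im (den V \<tau>))\<^sup>2 = (Im (den U \<tau>))\<^sup>2"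
    using fixed_SL2Z_den(2)[OF t U] fixed_SL2Z_den(2)[OF t V] by simp
  then have I: "Im (den V \<tau>) = Im (den U \<tau>) \<or> Im (den V \<tau>) = - Im (den U \<tau>)" by (simp add: power2_eq_iff)
  show ?thesis using R I eq[OF U] eq[OF nU] eq[OF aU] eq[OF naU] unfolding dn uminus_complex.sel ra ia minus_minus by auto
qed

section \<open>Lines modulo a prime\<close>

definition vz :: "nat \<Rightarrow> int^2 \<Rightarrow> bool" where
  "vz l v \<longleftrightarrow> int l dvd v $ 1 \<and> int l dvd v $ 2"

definition mz :: "nat \<Rightarrow> int^2^2 \<Rightarrow> bool" where
  "mz l A \<longleftrightarrow> (\<forall>i j. int l dvd A $ i $ j)"

lemma par_sym: "par l u v \<Longrightarrow> par l v u"
  unfolding par_def by (metis dvd_diff_commute mult.commute)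

lemma par_vz: "vz l u \<Longrightarrow> par l u v" "vz l v \<Longrightarrow> par l u v"
  by (auto simp: vz_def par_def)

text \<open>The cross product of \<open>u\<close> and \<open>w\<close>, multiplied by any coordinate
  of \<open>v\<close>, is a combination of the two given ones; some coordinate of \<open>v\<close>
  is a unit modulo \<open>l\<close>.\<close>

lemma par_trans:
  assumes l: "prime l" and v: "\<not> vz l v" and p: "par l u v" "par l v w" shows "par l u w"
proof -
  let ?c = "u $ 1 * w $ 2 - u $ 2 * w $ 1"
  have "?c * v $ 1 = (u $ 1 * v $ 2 - u $ 2 * v $ 1) * w $ 1 + (v $ 1 * w $ 2 - v $ 2 * w $ 1) * u $ 1"
    "?c * v $ 2 = (u $ 1 * v $ 2 - u $ 2 * v $ 1) * w $ 2 + (v $ 1 * w $ 2 - v $ 2 * w $ 1) * u $ 2"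
    by (simp_all add: algebra_simps)
  then have "int l dvd ?c * v $ 1" "int l dvd ?c * v $ 2"
    using p unfolding par_def by (metis dvd_add dvd_mult2)+
  then show ?thesis using v l prime_dvd_mult_iff[of "int l"] by (auto simp: vz_def par_def)
qed

lemma par_mult:
  assumes "par l u v" shows "par l (A *v u) (A *v v)"
proof -
  have "(A *v u) $ 1 * (A *v v) $ 2 - (A *v u) $ 2 * (A *v v) $ 1 = det A * (u $ 1 * v $ 2 - u $ 2 * v $ 1)"
    by (simp add: det_2 algebra_simps)
  then show ?thesis using assms unfolding par_def by simp
qed

lemma vz_mult: "vz l v \<Longrightarrow> vz l (A *v v)"
  by (auto simp: vz_def)

text \<open>Modulo \<open>l\<close> the vector \<open>c\<close> is a multiple of \<open>w\<close>.
  The identities in \<open>e\<close> say this without division, after multiplying by the coordinates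
  of \<open>w\<close>.\<close>

lemma vz_par_mult:
  assumes l: "prime l" and w: "\<not> vz l w" "par l w c" and A: "vz l (A *v w)" shows "vz l (A *v c)"
proof -
  have 1: "int l dvd w $ 1 * c $ 2 - w $ 2 * c $ 1" using w(2) by (simp add: par_def)
  have e: "w $ 1 * (A *v c) $ i - c $ 1 * (A *v w) $ i = (w $ 1 * c $ 2 - w $ 2 * c $ 1) * A $ i $ 2"
    "w $ 2 * (A *v c) $ i - c $ 2 * (A *v w) $ i = - (w $ 1 * c $ 2 - w $ 2 * c $ 1) * A $ i $ 1" for i
    by (simp_all add: algebra_simps)
  have Ai: "int l dvd (A *v w) $ i" for i using A exhaust_2[of i] by (auto simp only: vz_def)
  have "int l dvd w $ 1 * (A *v c) $ i - c $ 1 * (A *v w) $ i" "int l dvd w $ 2 * (A *v c) $ i - c $ 2 * (A *v w) $ i" for i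
    unfolding e using 1 by (simp_all only: dvd_mult2 dvd_minus_iff)
  then have "int l dvd w $ 1 * (A *v c) $ i" "int l dvd w $ 2 * (A *v c) $ i" for i
    using dvd_mult[OF Ai] by (metis diff_add_cancel dvd_add)+
  then show ?thesis using w(1) l prime_dvd_mult_iff[of "int l"] unfolding vz_def by (metis prime_nat_int_transfer)
qed

text \<open>A nonzero matrix over a field has a kernel of dimension at most one: each entry of
  \<open>B\<close> times the cross product is a combination of coordinates of \<open>B *v u\<close>
  and \<open>B *v w\<close>.\<close>

lemma kernel_line:
  assumes l: "prime l" and B: "\<not> mz l B" and u: "vz l (B *v u)" and w: "vz l (B *v w)"
  shows "par l u w"
proof -
  let ?c = "u $ 1 * w $ 2 - u $ 2 * w $ 1"
  have "?c * B $ i $ 1 = (B *v u) $ i * w $ 2 - (B *v w) $ i * u $ 2"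
    "?c * B $ i $ 2 = (B *v w) $ i * u $ 1 - (B *v u) $ i * w $ 1" for i
    by (simp_all add: algebra_simps)
  moreover have "int l dvd (B *v u) $ i" "int l dvd (B *v w) $ i" for i
    using u w exhaust_2[of i] by (auto simp only: vz_def)
  ultimately have "int l dvd ?c * B $ i $ j" for i j using exhaust_2[of j] by (metis dvd_diff dvd_mult2)
  then have "int l dvd ?c" using B l prime_dvd_mult_iff[of "int l" ?c] unfolding mz_def by (metis prime_nat_int_transfer)
  then show ?thesis by (simp add: par_def)
qed

lemma line_not_vz: "prime l \<Longrightarrow> \<sigma> \<in> lines l \<Longrightarrow> \<not> vz l (col \<sigma>)"
proof -
  assume l: "prime l" and s: "\<sigma> \<in> lines l"
  have "\<not> int l dvd det \<sigma>" using lines_SL2Z[OF s] prime_gt_1_nat[OF l] by (simp add: SL2Z_iff)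
  then show ?thesis using SL2Z_col_ndvd[OF l] by (simp add: vz_def)
qed

text \<open>The permutation action on the projective line over Z/lZ, transported to the chosen
  representatives.\<close>

definition lact :: "nat \<Rightarrow> int^2^2 \<Rightarrow> int^2^2 \<Rightarrow> int^2^2" where
  "lact l U \<sigma> = (THE \<sigma>'. \<sigma>' \<in> lines l \<and> par l (col \<sigma>') (U *v col \<sigma>))"

lemma SL2Z_not_vz: "U \<in> SL2Z \<Longrightarrow> \<not> vz l v \<Longrightarrow> \<not> vz l (U *v v)"
  using vz_mult[of l "U *v v" "adj2 U"] SL2Z_adj2_mult(2)[of U] by (auto simp: matrix_vector_mul_assoc)

context
  fixes l :: nat
  assumes l: "prime l"
begin

lemma lact:
  assumes "U \<in> SL2Z" "\<sigma> \<in> lines l"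
  shows "lact l U \<sigma> \<in> lines l" "par l (col (lact l U \<sigma>)) (U *v col \<sigma>)"
  using theI'[OF lines_unique[OF l, of "U *v col \<sigma>"]] SL2Z_not_vz[OF assms(1) line_not_vz[OF l assms(2)]]
  unfolding lact_def[symmetric] vz_def by blast+

lemma lact_eqI:
  assumes "U \<in> SL2Z" "\<sigma> \<in> lines l" "\<sigma>' \<in> lines l" "par l (col \<sigma>') (U *v col \<sigma>)"
  shows "lact l U \<sigma> = \<sigma>'"
  using lines_unique[OF l, of "U *v col \<sigma>"] lact[OF assms(1,2)] assms(3,4)
    SL2Z_not_vz[OF assms(1) line_not_vz[OF l assms(2)]] unfolding vz_def by blast

lemma lact_mult:
  assumes "U \<in> SL2Z" "V \<in> SL2Z" "\<sigma> \<in> lines l"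
  shows "lact l (U ** V) \<sigma> = lact l U (lact l V \<sigma>)"
proof (rule lact_eqI[OF SL2Z_mult[OF assms(1,2)] assms(3)])
  note V = lact[OF assms(2,3)] and U = lact[OF assms(1) lact(1)[OF assms(2,3)]]
  show "lact l U (lact l V \<sigma>) \<in> lines l" by (rule U(1))
  have "par l (U *v col (lact l V \<sigma>)) (U *v (V *v col \<sigma>))" by (rule par_mult[OF V(2)])
  then show "par l (col (lact l U (lact l V \<sigma>))) ((U ** V) *v col \<sigma>)"
    unfolding matrix_vector_mul_assoc[symmetric]
    by (rule par_trans[OF l SL2Z_not_vz[OF assms(1) line_not_vz[OF l V(1)]] U(2)])
qed

lemma lact_one: "\<sigma> \<in> lines l \<Longrightarrow> lact l (mat 1) \<sigma> = \<sigma>"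
  by (rule lact_eqI[OF SL2Z_one]) simp_all

lemma lact_uminus: "U \<in> SL2Z \<Longrightarrow> \<sigma> \<in> lines l \<Longrightarrow> lact l (- U) \<sigma> = lact l U \<sigma>"
proof (rule lact_eqI)
  assume U: "U \<in> SL2Z" "\<sigma> \<in> lines l"
  have "par l (col (lact l U \<sigma>)) (U *v col \<sigma>)" by (rule lact[OF U])
  then have "int l dvd - (col (lact l U \<sigma>) $ 1 * (U *v col \<sigma>) $ 2 - col (lact l U \<sigma>) $ 2 * (U *v col \<sigma>) $ 1)"
    unfolding par_def dvd_minus_iff .
  then show "par l (col (lact l U \<sigma>)) (- U *v col \<sigma>)" unfolding par_def by (simp add: algebra_simps)
qed (auto intro: lact SL2Z_uminus)

lemma lact_adj2: "U \<in> SL2Z \<Longrightarrow> \<sigma> \<in> lines l \<Longrightarrow> lact l (adj2 U) (lact l U \<sigma>) = \<sigma>"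
  "U \<in> SL2Z \<Longrightarrow> \<sigma> \<in> lines l \<Longrightarrow> lact l U (lact l (adj2 U) \<sigma>) = \<sigma>"
  using lact_mult[OF SL2Z_adj2, of U U \<sigma>] lact_mult[of U "adj2 U" \<sigma>] SL2Z_adj2 SL2Z_adj2_mult lact_one by auto

text \<open>A matrix fixing three points of a projective line is scalar, so its discriminant
  vanishes. The affine coordinates of fixed lines are roots of c x^2 + e x - b; three roots, or two
  together with (1 : 0), make \<open>c\<close> and \<open>e\<close> vanish modulo \<open>l\<close>,
  and the discriminant is e^2 + 4bc.\<close>

lemma three_fixed_lines:
  assumes U: "U \<in> SL2Z" and s: "\<sigma>1 \<in> lines l" "\<sigma>2 \<in> lines l" "\<sigma>3 \<in> lines l" "\<sigma>1 \<noteq> \<sigma>2" "\<sigma>1 \<noteq> \<sigma>3" "\<sigma>2 \<noteq> \<sigma>3"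
    and fx: "lact l U \<sigma>1 = \<sigma>1" "lact l U \<sigma>2 = \<sigma>2" "lact l U \<sigma>3 = \<sigma>3"
  shows "int l dvd (tr2 U)\<^sup>2 - 4"
proof -
  have pl: "Factorial_Ring.prime (int l)" using l by simp
  let ?c = "U $ 2 $ 1" and ?e = "U $ 2 $ 2 - U $ 1 $ 1" and ?b = "U $ 1 $ 2"
  have inf: "int l dvd ?c" if "lact l U (mat 1) = mat 1" "mat 1 \<in> lines l"
    using lact(2)[OF U that(2)] that by (simp add: par_def)
  have root: "int l dvd ?c * j * j + ?e * j - ?b" if "mk2 (- j) 1 (- 1) 0 \<in> lines l" "lact l U (mk2 (- j) 1 (- 1) 0) = mk2 (- j) 1 (- 1) 0" for j
    using lact(2)[OF U that(1)] unfolding that(2) by (simp add: par_def algebra_simps dvd_diff_commute)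
  have ndiff: "\<not> int l dvd i - j" if "mk2 (- i) 1 (- 1) 0 \<in> lines l" "mk2 (- j) 1 (- 1) 0 \<in> lines l" "mk2 (- i) 1 (- 1) 0 \<noteq> mk2 (- j) 1 (- 1) 0" for i j
  proof
    assume "int l dvd i - j"
    then have "par l (col (mk2 (- i) 1 (- 1) 0)) (col (mk2 (- j) 1 (- 1) 0))" by (simp add: par_def)
    then show False using lines_eqI[OF l that(1,2)] that(3) by blast
  qed
  have slope: "int l dvd ?c * (i + j) + ?e"
    if i: "mk2 (- i) 1 (- 1) 0 \<in> lines l" "lact l U (mk2 (- i) 1 (- 1) 0) = mk2 (- i) 1 (- 1) 0"
      and j: "mk2 (- j) 1 (- 1) 0 \<in> lines l" "lact l U (mk2 (- j) 1 (- 1) 0) = mk2 (- j) 1 (- 1) 0"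
      and ne: "mk2 (- i) 1 (- 1) 0 \<noteq> mk2 (- j) 1 (- 1) 0" for i j
  proof -
    have "int l dvd (?c * i * i + ?e * i - ?b) - (?c * j * j + ?e * j - ?b)"
      by (rule dvd_diff[OF root[OF i] root[OF j]])
    moreover have "(?c * i * i + ?e * i - ?b) - (?c * j * j + ?e * j - ?b) = (i - j) * (?c * (i + j) + ?e)"
      by (simp add: algebra_simps)
    ultimately have "int l dvd (i - j) * (?c * (i + j) + ?e)" by simp
    then show ?thesis using ndiff[OF i(1) j(1) ne] prime_dvd_mult_iff[OF pl] by blast
  qed
  have fin: "int l dvd (tr2 U)\<^sup>2 - 4" if z: "int l dvd ?c" "int l dvd ?e"
  proof -
    have "det U = 1" using U by (simp add: SL2Z_iff)
    then have "(tr2 U)\<^sup>2 - 4 = ?e * ?e + 4 * (?b * ?c)" by (simp add: tr2_def det_2 power2_eq_square algebra_simps)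
    then show ?thesis using z by simp
  qed
  have two: "int l dvd (tr2 U)\<^sup>2 - 4"
    if i: "mk2 (- i) 1 (- 1) 0 \<in> lines l" "lact l U (mk2 (- i) 1 (- 1) 0) = mk2 (- i) 1 (- 1) 0"
      and j: "mk2 (- j) 1 (- 1) 0 \<in> lines l" "lact l U (mk2 (- j) 1 (- 1) 0) = mk2 (- j) 1 (- 1) 0"
      and ne: "mk2 (- i) 1 (- 1) 0 \<noteq> mk2 (- j) 1 (- 1) 0" and c: "int l dvd ?c" for i j
  proof -
    have "int l dvd ?c * (i + j)" using c by simp
    then have "int l dvd ?e" using slope[OF i j ne] by (simp add: dvd_add_right_iff)
    then show ?thesis using fin c by blast
  qed
  have three: "int l dvd (tr2 U)\<^sup>2 - 4"
    if i: "mk2 (- i) 1 (- 1) 0 \<in> lines l" "lact l U (mk2 (- i) 1 (- 1) 0) = mk2 (- i) 1 (- 1) 0"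
      and j: "mk2 (- j) 1 (- 1) 0 \<in> lines l" "lact l U (mk2 (- j) 1 (- 1) 0) = mk2 (- j) 1 (- 1) 0"
      and k: "mk2 (- k) 1 (- 1) 0 \<in> lines l" "lact l U (mk2 (- k) 1 (- 1) 0) = mk2 (- k) 1 (- 1) 0"
      and ne: "mk2 (- i) 1 (- 1) 0 \<noteq> mk2 (- j) 1 (- 1) 0" "mk2 (- i) 1 (- 1) 0 \<noteq> mk2 (- k) 1 (- 1) 0"
       "mk2 (- j) 1 (- 1) 0 \<noteq> mk2 (- k) 1 (- 1) 0" for i j k
  proof -
    have "int l dvd (?c * (i + j) + ?e) - (?c * (i + k) + ?e)"
      by (rule dvd_diff[OF slope[OF i j ne(1)] slope[OF i k ne(2)]])
    then have "int l dvd (j - k) * ?c" by (simp add: algebra_simps)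
    then have "int l dvd ?c" using ndiff[OF j(1) k(1) ne(3)] prime_dvd_mult_iff[OF pl] by blast
    then show ?thesis using two[OF i j ne(1)] by blast
  qed
  have sh: "\<sigma> = mat 1 \<or> (\<exists>j. \<sigma> = mk2 (- j) 1 (- 1) 0)" if "\<sigma> \<in> lines l" for \<sigma> using that by (auto simp: lines_def)
  have m2: "int l dvd (tr2 U)\<^sup>2 - 4" if "lact l U (mat 1) = mat 1" "mat 1 \<in> lines l"
    "\<sigma> \<in> lines l" "\<sigma>' \<in> lines l" "\<sigma> \<noteq> mat 1" "\<sigma>' \<noteq> mat 1" "\<sigma> \<noteq> \<sigma>'" "lact l U \<sigma> = \<sigma>" "lact l U \<sigma>' = \<sigma>'" for \<sigma> \<sigma>'
    using sh[OF that(3)] sh[OF that(4)] two inf[OF that(1,2)] that by blast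
  show ?thesis
  proof (cases "\<sigma>1 = mat 1 \<or> \<sigma>2 = mat 1 \<or> \<sigma>3 = mat 1")
    case True
    then show ?thesis using m2[of \<sigma>2 \<sigma>3] m2[of \<sigma>1 \<sigma>3] m2[of \<sigma>1 \<sigma>2] s fx by metis
  next
    case False
    then obtain i j k where "\<sigma>1 = mk2 (- i) 1 (- 1) 0" "\<sigma>2 = mk2 (- j) 1 (- 1) 0" "\<sigma>3 = mk2 (- k) 1 (- 1) 0"
      using sh s by blast
    then show ?thesis using three s fx by blast
  qed
qed

text \<open>
  \<open>typ2\<close> describes an endomorphism of norm \<open>l\<^sup>2\<close> not divisible by \<open>l\<close>; its kernel and image modulo
  \<open>l\<close> are the lines of \<open>\<sigma>\<close> and \<open>\<sigma>'\<close>.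
\<close>

definition typ2 :: "complex \<Rightarrow> int^2^2 \<Rightarrow> int^2^2 \<Rightarrow> int^2^2 \<Rightarrow> bool" where
  "typ2 \<tau> B \<sigma> \<sigma>' \<longleftrightarrow> \<sigma> \<in> lines l \<and> \<sigma>' \<in> lines l \<and> \<sigma> \<noteq> \<sigma>' \<and> det B \<noteq> 0 \<and> mob B \<tau> = \<tau> \<and> \<not> mz l B \<and>
     vz l (B *v col \<sigma>) \<and> (\<forall>v. par l (col \<sigma>') (B *v v))"

lemma typ2_not_kernel:
  assumes "typ2 \<tau> B \<sigma> \<sigma>'" shows "\<not> vz l (B *v col \<sigma>')"
  using kernel_line[OF l, of B "col \<sigma>" "col \<sigma>'"] lines_eqI[OF l, of \<sigma> \<sigma>'] assms unfolding typ2_def by blast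

text \<open>By \<open>fixed_commute\<close> the matrix \<open>M\<close> commutes with
  \<open>B\<close>, so it preserves the kernel and the image of \<open>B\<close> modulo
  \<open>l\<close>. The image line is spanned by \<open>B *v col \<sigma>'\<close>, which is nonzero
  because the kernel is another line.\<close>

lemma typ2_eigenlines:
  assumes t: "Im \<tau> > 0" and B: "typ2 \<tau> B \<sigma> \<sigma>'" and M: "det M \<noteq> 0" "mob M \<tau> = \<tau>"
  shows "par l (col \<sigma>) (M *v col \<sigma>)" "par l (col \<sigma>') (M *v col \<sigma>')"
proof -
  have b: "\<sigma> \<in> lines l" "\<sigma>' \<in> lines l" "\<not> mz l B" "vz l (B *v col \<sigma>)" "\<And>v. par l (col \<sigma>') (B *v v)"
    "det B \<noteq> 0" "mob B \<tau> = \<tau>" using B by (auto simp: typ2_def)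
  have com: "B *v (M *v v) = M *v (B *v v)" for v
    using fixed_commute[OF t M(1) b(6) M(2) b(7)] by (simp add: matrix_vector_mul_assoc)
  have "vz l (B *v (M *v col \<sigma>))" unfolding com by (rule vz_mult[OF b(4)])
  then show "par l (col \<sigma>) (M *v col \<sigma>)" by (rule kernel_line[OF l b(3,4)])
  let ?w = "B *v col \<sigma>'"
  have w: "\<not> vz l ?w" by (rule typ2_not_kernel[OF B])
  have wc: "par l ?w (col \<sigma>')" by (rule par_sym[OF b(5)])
  have cM: "par l (col \<sigma>') (M *v ?w)" unfolding com[symmetric] by (rule b(5))
  show "par l (col \<sigma>') (M *v col \<sigma>')"
  \<comment> \<open>If \<open>M\<close> kills the spanning vector it kills the whole line, and zero
    is parallel to everything; otherwise the vector can serve as middle term of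
    \<open>par_trans\<close>.\<close>
  proof (cases "vz l (M *v ?w)")
    case True
    then show ?thesis using par_vz(2) vz_par_mult[OF l w wc] by blast
  next
    case False
    then show ?thesis by (rule par_trans[OF l _ cM par_mult[OF wc]])
  qed
qed

text \<open>A line stable under \<open>C\<close> is its kernel or its image modulo \<open>l\<close>.
  Both \<sigma> and \<sigma>' are stable under \<open>C\<close> by
  \<open>typ2_eigenlines\<close>.\<close>

lemma typ2_unique:
  assumes t: "Im \<tau> > 0" and B: "typ2 \<tau> B \<sigma> \<sigma>'" and C: "typ2 \<tau> C \<rho> \<rho>'"
  shows "{\<sigma>, \<sigma>'} = {\<rho>, \<rho>'}"
proof -
  have c: "\<rho> \<in> lines l" "\<rho>' \<in> lines l" "\<not> mz l C" "vz l (C *v col \<rho>)" "\<And>v. par l (col \<rho>') (C *v v)"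
    "det C \<noteq> 0" "mob C \<tau> = \<tau>" using C by (auto simp: typ2_def)
  have b: "\<sigma> \<in> lines l" "\<sigma>' \<in> lines l" "\<sigma> \<noteq> \<sigma>'" using B by (auto simp: typ2_def)
  have key: "s = \<rho> \<or> s = \<rho>'" if s: "s \<in> lines l" "par l (col s) (C *v col s)" for s
  proof (cases "vz l (C *v col s)")
    case True
    then have "par l (col s) (col \<rho>)" by (rule kernel_line[OF l c(3) _ c(4)])
    then show ?thesis using lines_eqI[OF l s(1) c(1)] by blast
  next
    case False
    then have "par l (col s) (col \<rho>')" by (rule par_trans[OF l _ s(2) par_sym[OF c(5)]])
    then show ?thesis using lines_eqI[OF l s(1) c(2)] by blast
  qed
  show ?thesis using key[OF b(1) typ2_eigenlines(1)[OF t B c(6,7)]] key[OF b(2) typ2_eigenlines(2)[OF t B c(6,7)]] b(3) by blast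
qed

lemma typ2_fixed:
  assumes t: "Im \<tau> > 0" and B: "typ2 \<tau> B \<sigma> \<sigma>'" and U: "U \<in> SL2Z" "mob U \<tau> = \<tau>"
  shows "lact l U \<sigma> = \<sigma>" "lact l U \<sigma>' = \<sigma>'"
proof -
  have d: "det U \<noteq> 0" using U(1) by (simp add: SL2Z_iff)
  have b: "\<sigma> \<in> lines l" "\<sigma>' \<in> lines l" using B by (auto simp: typ2_def)
  show "lact l U \<sigma> = \<sigma>" "lact l U \<sigma>' = \<sigma>'"
    using lact_eqI[OF U(1) b(1,1)] lact_eqI[OF U(1) b(2,2)] typ2_eigenlines[OF t B d U(2)] by blast+
qed

end

lemma tr2_commute: "tr2 (A ** B) = tr2 (B ** A)"
  by (simp add: tr2_def algebra_simps)

lemma tr2_conj: "\<gamma> \<in> SL2Z \<Longrightarrow> tr2 (\<gamma> ** U ** adj2 \<gamma>) = tr2 U"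
  using tr2_commute[of "\<gamma> ** U" "adj2 \<gamma>"] SL2Z_adj2_mult(2)[of \<gamma>] by (simp add: matrix_mul_assoc)

lemma adj2_mult_rev: "adj2 (A ** B) = adj2 B ** adj2 A"
  by (simp add: mat2_eq_iff algebra_simps)

lemma mob_conj:
  assumes "Im \<tau> > 0" "\<gamma> \<in> SL2Z" "U \<in> SL2Z" "mob U \<tau> = \<tau>"
  shows "mob (\<gamma> ** U ** adj2 \<gamma>) (mob \<gamma> \<tau>) = mob \<gamma> \<tau>"
proof -
  have I: "Im (mob \<gamma> \<tau>) > 0" using Im_mob_SL2Z assms by blast
  have "mob (\<gamma> ** U ** adj2 \<gamma>) (mob \<gamma> \<tau>) = mob (\<gamma> ** U) (mob (adj2 \<gamma>) (mob \<gamma> \<tau>))"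
    by (rule mob_mult_SL2Z[OF I SL2Z_adj2[OF assms(2)]])
  also have "\<dots> = mob \<gamma> (mob U \<tau>)" unfolding mob_adj2_SL2Z[OF assms(1,2)] by (rule mob_mult_SL2Z[OF assms(1,3)])
  finally show ?thesis unfolding assms(4) .
qed

lemma SL2Z_conj_trivial:
  assumes "\<gamma> \<in> SL2Z" "\<gamma> ** U ** adj2 \<gamma> = mat 1 \<or> \<gamma> ** U ** adj2 \<gamma> = - mat 1"
  shows "U = mat 1 \<or> U = - mat 1"
proof -
  have "adj2 \<gamma> ** (\<gamma> ** U ** adj2 \<gamma>) ** \<gamma> = (adj2 \<gamma> ** \<gamma>) ** U ** (adj2 \<gamma> ** \<gamma>)" by (simp only: matrix_mul_assoc)
  then have e: "adj2 \<gamma> ** (\<gamma> ** U ** adj2 \<gamma>) ** \<gamma> = U" using SL2Z_adj2_mult(2)[OF assms(1)] by simp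
  have "adj2 \<gamma> ** mat 1 ** \<gamma> = mat 1" "adj2 \<gamma> ** (- mat 1) ** \<gamma> = - mat 1"
    using SL2Z_adj2_mult(2)[OF assms(1)] by (simp_all add: mat2_eq_iff)
  then show ?thesis using assms(2) e by metis
qed

section \<open>Elliptic points\<close>

text \<open>Reduction of the binary quadratic form attached to an elliptic element.\<close>

lemma elliptic_reduce:
  assumes "U \<in> SL2Z" "(tr2 U)\<^sup>2 < 4"
  shows "\<exists>\<gamma>\<in>SL2Z. \<bar>(\<gamma> ** U ** adj2 \<gamma>) $ 2 $ 1\<bar> = 1"
  using assms
proof (induction "nat \<bar>U $ 2 $ 1\<bar>" arbitrary: U rule: less_induct)
  case less
  let ?c = "U $ 2 $ 1" and ?e = "U $ 1 $ 1 - U $ 2 $ 2"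
  have disc: "(V $ 1 $ 1 - V $ 2 $ 2)\<^sup>2 + 4 * (V $ 1 $ 2 * V $ 2 $ 1) = (tr2 V)\<^sup>2 - 4" if "V \<in> SL2Z" for V
  proof -
    have "V $ 1 $ 1 * V $ 2 $ 2 - V $ 1 $ 2 * V $ 2 $ 1 = 1" using that by (simp add: SL2Z_iff det_2)
    then show ?thesis by (simp add: tr2_def power2_eq_square algebra_simps)
  qed
  have c0: "?c \<noteq> 0"
  proof
    assume "?c = 0"
    then have "?e\<^sup>2 < 0" using disc[OF less.prems(1)] less.prems(2) by simp
    then show False by simp
  qed
  show ?case
  proof (cases "\<bar>?c\<bar> = 1")
    case True
    then show ?thesis by (intro bexI[of _ "mat 1"]) (auto simp: SL2Z_one)
  next
    case False
    then have c2: "\<bar>?c\<bar> \<ge> 2" using c0 by linarith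
    \<comment> \<open>Rounding to a nearest integer: the translation by \<open>k\<close> brings the
      middle coefficient into the interval from -|c| to |c|.\<close>
    define q where "q = (?e + \<bar>?c\<bar>) div (2 * \<bar>?c\<bar>)"
    define k where "k = - q * sgn ?c"
    define r where "r = ?e + 2 * k * ?c"
    have "r = (?e + \<bar>?c\<bar>) - (2 * \<bar>?c\<bar>) * q - \<bar>?c\<bar>"
      by (simp add: r_def k_def abs_sgn algebra_simps)
    also have "\<dots> = (?e + \<bar>?c\<bar>) mod (2 * \<bar>?c\<bar>) - \<bar>?c\<bar>"
      unfolding q_def by (simp add: minus_mult_div_eq_mod)
    finally have r: "r = (?e + \<bar>?c\<bar>) mod (2 * \<bar>?c\<bar>) - \<bar>?c\<bar>" .
    have "0 \<le> (?e + \<bar>?c\<bar>) mod (2 * \<bar>?c\<bar>)" "(?e + \<bar>?c\<bar>) mod (2 * \<bar>?c\<bar>) < 2 * \<bar>?c\<bar>"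
      using c2 by (intro pos_mod_sign pos_mod_bound; linarith)+
    then have rc: "\<bar>r\<bar> \<le> \<bar>?c\<bar>" unfolding r by linarith
    let ?T = "mk2 1 k 0 1" and ?S = "mk2 0 (- 1) 1 0"
    have TS: "?T \<in> SL2Z" "?S \<in> SL2Z" by (simp_all add: SL2Z_iff det_2)
    define U1 where "U1 = ?T ** U ** adj2 ?T"
    define U2 where "U2 = ?S ** U1 ** adj2 ?S"
    have U1: "U1 \<in> SL2Z" unfolding U1_def using TS less.prems(1) by (intro SL2Z_mult SL2Z_adj2)
    have U2: "U2 \<in> SL2Z" unfolding U2_def using TS U1 by (intro SL2Z_mult SL2Z_adj2)
    have t1: "tr2 U1 = tr2 U" unfolding U1_def by (rule tr2_conj[OF TS(1)])
    have t2: "tr2 U2 = tr2 U" unfolding U2_def t1[symmetric] by (rule tr2_conj[OF TS(2)])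
    have "U1 $ 2 $ 1 = ?c" "U1 $ 1 $ 1 - U1 $ 2 $ 2 = r" by (simp_all add: U1_def r_def algebra_simps)
    then have d: "r\<^sup>2 + 4 * (U1 $ 1 $ 2 * ?c) = (tr2 U)\<^sup>2 - 4" using disc[OF U1] t1 by simp
    \<comment> \<open>The discriminant is at least -4 and r^2 is at most c^2, so for |c| at least 2
      the upper right entry is smaller than \<open>c\<close>. The inversion \<open>?S\<close> then
      makes it the new lower left entry, up to sign.\<close>
    have "4 * (\<bar>U1 $ 1 $ 2\<bar> * \<bar>?c\<bar>) = \<bar>4 * (U1 $ 1 $ 2 * ?c)\<bar>" by (simp add: abs_mult)
    also have "\<dots> = \<bar>(tr2 U)\<^sup>2 - 4 - r\<^sup>2\<bar>" using d by (intro arg_cong[of _ _ abs]) linarith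
    also have "\<dots> \<le> 4 + r\<^sup>2" using less.prems(2) zero_le_power2[of "tr2 U"] zero_le_power2[of r] by linarith
    also have "r\<^sup>2 \<le> ?c\<^sup>2" using rc by (simp add: abs_le_square_iff)
    also have "4 + ?c\<^sup>2 < 4 * (\<bar>?c\<bar> * \<bar>?c\<bar>)"
    proof -
      have "2 * 2 \<le> \<bar>?c\<bar> * \<bar>?c\<bar>" using c2 by (intro mult_mono) auto
      moreover have "?c\<^sup>2 = \<bar>?c\<bar> * \<bar>?c\<bar>" by (simp add: power2_eq_square)
      ultimately show ?thesis by linarith
    qed
    finally have "\<bar>U1 $ 1 $ 2\<bar> * \<bar>?c\<bar> < \<bar>?c\<bar> * \<bar>?c\<bar>" by linarith
    then have "\<bar>U1 $ 1 $ 2\<bar> < \<bar>?c\<bar>" by (rule mult_right_less_imp_less) simp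
    moreover have "U2 $ 2 $ 1 = - U1 $ 1 $ 2" by (simp add: U2_def)
    ultimately have "nat \<bar>U2 $ 2 $ 1\<bar> < nat \<bar>?c\<bar>" by simp
    from less.hyps[OF this U2] less.prems(2) t2
    obtain \<gamma> where g: "\<gamma> \<in> SL2Z" "\<bar>(\<gamma> ** U2 ** adj2 \<gamma>) $ 2 $ 1\<bar> = 1" by auto
    have "\<gamma> ** U2 ** adj2 \<gamma> = (\<gamma> ** ?S ** ?T) ** U ** adj2 (\<gamma> ** ?S ** ?T)"
      unfolding U2_def U1_def adj2_mult_rev by (simp only: matrix_mul_assoc)
    moreover have "\<gamma> ** ?S ** ?T \<in> SL2Z" using g TS by (intro SL2Z_mult)
    ultimately show ?thesis using g(2) by metis
  qed
qed

definition rho :: complex where "rho = Complex (- 1 / 2) (sqrt 3 / 2)"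

lemma rho_exp: "exp (2 * of_real pi * \<i> / 3) = rho"
proof -
  have "exp (2 * of_real pi * \<i> / 3) = cis (2 * pi / 3)" by (simp add: cis_conv_exp mult.commute)
  also have "\<dots> = rho" by (simp add: complex_eq_iff rho_def cos_120 sin_120)
  finally show ?thesis .
qed

text \<open>Once the lower left entry is 1 or -1, the trace determines \<open>Im z\<close>, and
  \<open>2 * Re z\<close> is an integer of the same parity as the trace. A translation
  finishes.\<close>

lemma elliptic_orbit:
  assumes t: "Im \<tau> > 0" and U: "U \<in> SL2Z" "mob U \<tau> = \<tau>" "U \<noteq> mat 1" "U \<noteq> - mat 1"
  shows "tr2 U = 0 \<Longrightarrow> \<exists>\<gamma>\<in>SL2Z. mob \<gamma> \<tau> = \<i>" and "(tr2 U)\<^sup>2 = 1 \<Longrightarrow> \<exists>\<gamma>\<in>SL2Z. mob \<gamma> \<tau> = rho"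
proof -
  have tr: "tr2 U = 0 \<or> tr2 U = 1 \<or> tr2 U = -1" by (rule elliptic_trace[OF t U])
  then have "(tr2 U)\<^sup>2 < 4" by auto
  then obtain \<gamma> where g: "\<gamma> \<in> SL2Z" "\<bar>(\<gamma> ** U ** adj2 \<gamma>) $ 2 $ 1\<bar> = 1" using elliptic_reduce[OF U(1)] by blast
  define W where "W = \<gamma> ** U ** adj2 \<gamma>"
  define z where "z = mob \<gamma> \<tau>"
  have z: "Im z > 0" unfolding z_def using Im_mob_SL2Z t g by blast
  have W: "W \<in> SL2Z" unfolding W_def using g U by (intro SL2Z_mult SL2Z_adj2)
  have Wz: "mob W z = z" unfolding W_def z_def by (rule mob_conj[OF t g(1) U(1,2)])
  have tW: "tr2 W = tr2 U" unfolding W_def by (rule tr2_conj[OF g(1)])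
  let ?c = "W $ 2 $ 1" and ?d = "W $ 2 $ 2"
  have c: "?c = 1 \<or> ?c = -1" using g(2) unfolding W_def by linarith
  note F = fixed_SL2Z_den[OF z W Wz, unfolded tW]
  have re: "2 * (of_int ?c * Re z + of_int ?d) = of_int (tr2 U)" using F(1) by (simp add: den_def)
  have "4 * (of_int ?c * Im z)\<^sup>2 = 4 - (of_int (tr2 U))\<^sup>2" using F(2) unfolding F(3) .
  then have im: "4 * (Im z)\<^sup>2 = 4 - (of_int (tr2 U))\<^sup>2" using c by auto
  have shift: "\<exists>\<gamma>\<in>SL2Z. mob \<gamma> \<tau> = z + of_int k" for k
  proof
    have T: "mk2 1 k 0 1 \<in> SL2Z" by (simp add: SL2Z_iff det_2)
    show "mk2 1 k 0 1 ** \<gamma> \<in> SL2Z" using T g(1) by (rule SL2Z_mult)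
    show "mob (mk2 1 k 0 1 ** \<gamma>) \<tau> = z + of_int k"
      unfolding mob_mult_SL2Z[OF t g(1)] z_def[symmetric] by (simp add: mob_def num_def den_def)
  qed
  show "\<exists>\<gamma>\<in>SL2Z. mob \<gamma> \<tau> = \<i>" if t0: "tr2 U = 0"
  proof -
    have "(Im z)\<^sup>2 = 1\<^sup>2" using im t0 by simp
    then have "Im z = 1" using z by (intro power2_eq_imp_eq[of "Im z" 1]) auto
    moreover have "Re z + of_int (?c * ?d) = 0" using re t0 c by auto
    ultimately have "z + of_int (?c * ?d) = \<i>" by (simp add: complex_eq_iff)
    then show ?thesis using shift by metis
  qed
  show "\<exists>\<gamma>\<in>SL2Z. mob \<gamma> \<tau> = rho" if t1: "(tr2 U)\<^sup>2 = 1"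
  proof -
    have t1': "tr2 U = 1 \<or> tr2 U = -1" using t1 tr by auto
    then have "4 * (Im z)\<^sup>2 = 3" using im by auto
    moreover have "(sqrt 3 / 2)\<^sup>2 = (3 / 4 :: real)" by (simp add: power_divide)
    ultimately have "(Im z)\<^sup>2 = (sqrt 3 / 2)\<^sup>2" by linarith
    then have iz: "Im z = sqrt 3 / 2" by (rule power2_eq_imp_eq) (use z in simp_all)
    have "\<exists>k. Re z + of_int k = - 1 / 2"
    proof -
      consider "?c = 1" "tr2 U = 1" | "?c = 1" "tr2 U = -1" | "?c = -1" "tr2 U = 1" | "?c = -1" "tr2 U = -1"
        using c t1' by blast
      then show ?thesis
      proof cases
        case 1 then show ?thesis using re by (intro exI[of _ "?d - 1"]) simp
      next
        case 2 then show ?thesis using re by (intro exI[of _ "?d"]) simp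
      next
        case 3 then show ?thesis using re by (intro exI[of _ "- ?d"]) simp
      next
        case 4 then show ?thesis using re by (intro exI[of _ "- 1 - ?d"]) simp
      qed
    qed
    then obtain k where "Re z + of_int k = - 1 / 2" by blast
    then have "z + of_int k = rho" using iz by (simp add: complex_eq_iff rho_def)
    then show ?thesis using shift by metis
  qed
qed

context level
begin

text \<open>
  \<open>EE \<tau> g U\<close>: an automorphism of \<open>\<complex>/(\<int> + \<int>\<tau>)\<close> other than \<open>\<plusminus>1\<close>, given by its matrix \<open>U\<close>, acts on the level
  structure of \<open>g\<close> through \<open>H\<close>.
\<close>

definition EE :: "complex \<Rightarrow> int^2^2 \<Rightarrow> int^2^2 \<Rightarrow> bool" where
  "EE \<tau> g U \<longleftrightarrow> U \<in> SL2Z \<and> mob U \<tau> = \<tau> \<and> U \<noteq> mat 1 \<and> U \<noteq> - mat 1 \<and> (\<exists>h\<in>H. mcong n (U ** g) (g ** h))"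

text \<open>Conjugation by \<gamma> on the left corresponds to conjugation of \<open>h\<close> by
  the element \<open>h0\<close> of \<open>H\<close> on the right.\<close>

lemma EE_transfer:
  assumes t: "Im \<tau> > 0" and o: "orb n H (Pt \<tau>) g (Pt \<tau>') g'" and U: "EE \<tau> g U"
  shows "\<exists>W. EE \<tau>' g' W \<and> tr2 W = tr2 U"
proof -
  obtain \<gamma> h0 where c: "\<gamma> \<in> SL2Z" "h0 \<in> H" "\<tau>' = mob \<gamma> \<tau>" "mcong n (\<gamma> ** g) (g' ** h0)"
    using o by (auto simp: orb_def)
  obtain k where k: "k \<in> H" "mcong n (h0 ** k) (mat 1)" using subgroup_GL2D(4)[OF sub c(2)] by blast
  obtain h where h: "h \<in> H" "mcong n (U ** g) (g ** h)" using U by (auto simp: EE_def)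
  have U': "U \<in> SL2Z" "mob U \<tau> = \<tau>" "U \<noteq> mat 1" "U \<noteq> - mat 1" using U by (auto simp: EE_def)
  let ?W = "\<gamma> ** U ** adj2 \<gamma>"
  have gg: "\<gamma> ** U ** adj2 \<gamma> ** (\<gamma> ** g) = \<gamma> ** (U ** g)"
  proof -
    have "\<gamma> ** U ** adj2 \<gamma> ** (\<gamma> ** g) = \<gamma> ** U ** (adj2 \<gamma> ** \<gamma>) ** g" by (simp only: matrix_mul_assoc)
    also have "\<dots> = \<gamma> ** (U ** g)" unfolding SL2Z_adj2_mult(2)[OF c(1)] by (simp add: matrix_mul_assoc)
    finally show ?thesis .
  qed
  have "mcong n (g' ** mat 1) (g' ** (h0 ** k))" using mcong_sym[OF k(2)] by (rule mcong_mult_left)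
  also have "g' ** (h0 ** k) = (g' ** h0) ** k" by (simp add: matrix_mul_assoc)
  also have "mcong n \<dots> ((\<gamma> ** g) ** k)" using mcong_sym[OF c(4)] by (rule mcong_mult_right)
  finally have "mcong n g' ((\<gamma> ** g) ** k)" by simp
  then have "mcong n (?W ** g') (?W ** ((\<gamma> ** g) ** k))" by (rule mcong_mult_left)
  also have "?W ** ((\<gamma> ** g) ** k) = (?W ** (\<gamma> ** g)) ** k" by (simp only: matrix_mul_assoc)
  also have "\<dots> = \<gamma> ** ((U ** g) ** k)" unfolding gg by (simp only: matrix_mul_assoc)
  also have "mcong n \<dots> (\<gamma> ** ((g ** h) ** k))" using h(2) by (intro mcong_mult_left mcong_mult_right)
  also have "\<gamma> ** ((g ** h) ** k) = (\<gamma> ** g) ** (h ** k)" by (simp only: matrix_mul_assoc)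
  also have "mcong n \<dots> ((g' ** h0) ** (h ** k))" using c(4) by (rule mcong_mult_right)
  also have "(g' ** h0) ** (h ** k) = g' ** (h0 ** (h ** k))" by (simp only: matrix_mul_assoc)
  also have "mcong n \<dots> (g' ** red_mat n (h0 ** red_mat n (h ** k)))" by (rule mcong_mult_left) simp
  finally have m: "mcong n (?W ** g') (g' ** red_mat n (h0 ** red_mat n (h ** k)))" .
  have "red_mat n (h0 ** red_mat n (h ** k)) \<in> H"
    using subgroup_GL2D(3)[OF sub c(2) subgroup_GL2D(3)[OF sub h(1) k(1)]] .
  moreover have "?W \<in> SL2Z" using c U' by (intro SL2Z_mult SL2Z_adj2)
  moreover have "mob ?W \<tau>' = \<tau>'" unfolding c(3) by (rule mob_conj[OF t c(1) U'(1,2)])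
  moreover have "?W \<noteq> mat 1" "?W \<noteq> - mat 1" using SL2Z_conj_trivial[OF c(1)] U' by blast+
  ultimately have "EE \<tau>' g' ?W" unfolding EE_def using m by blast
  then show ?thesis using tr2_conj[OF c(1)] by blast
qed

text \<open>The sign is central, so it can be moved from the element of
  \<open>plus_minus n H\<close> to \<open>M\<close>.\<close>

lemma plus_minus_iff:
  "(\<exists>A\<in>plus_minus n H. mcong n M (g ** A)) \<longleftrightarrow> (\<exists>h\<in>H. mcong n M (g ** h) \<or> mcong n (- M) (g ** h))"
proof -
  have pm: "plus_minus n H = {red_mat n h | h. h \<in> H} \<union> {red_mat n (- h) | h. h \<in> H}"
  proof -
    have "red_mat n (red_mat n (- mat 1) ** h) = red_mat n (- h)" for h
    proof -
      have "- mat 1 ** h = - h" by (simp add: mat2_eq_iff)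
      then show ?thesis by (simp only: red_mult_red)
    qed
    then show ?thesis unfolding plus_minus_def set_mult_def by auto
  qed
  have 1: "mcong n M (g ** red_mat n h) \<longleftrightarrow> mcong n M (g ** h)" for h
    using mcong_mult_left[of n h "red_mat n h" g] by (meson mcong_red mcong_refl mcong_sym mcong_trans)
  have "g ** (- h) = - (g ** h)" for h :: "int^2^2" by (simp add: mat2_eq_iff)
  then have 2: "mcong n M (g ** red_mat n (- h)) \<longleftrightarrow> mcong n (- M) (g ** h)" for h
    using 1[of "- h"] mcong_uminus[of n M "- (g ** h)"] mcong_uminus[of n "- M" "g ** h"] by auto
  show ?thesis unfolding pm using 1 2 by blast
qed

text \<open>
  The matrix \<open>V\<close> describes multiplication by \<open>\<alpha>\<close> on \<open>\<int> + \<int>\<alpha>\<close> in the coordinates of the standard level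
  structure.
\<close>

lemma represented_iff:
  assumes a: "Im \<alpha> > 0" and V: "V \<in> SL2Z" "mob V \<alpha> = \<alpha>" "\<alpha> * den V \<alpha> = 1"
  shows "represented_with_automorphism \<alpha> n H P \<longleftrightarrow>
    (\<exists>g. cop g \<and> P = ept n H (Pt \<alpha>) g \<and> (\<exists>h\<in>H. mcong n (V ** g) (g ** h) \<or> mcong n (- (V ** g)) (g ** h)))"
proof -
  have PL: "period_lattice 1 \<alpha> = ulat 1 \<alpha>" using period_lattice_ulat[of 1 \<alpha>] by simp
  have a0: "\<alpha> \<noteq> 0" using a by auto
  have d: "det V = 1" using V by (simp add: SL2Z_iff)
  have J: "\<alpha> * Jf w \<alpha> = Jf (V *v w) \<alpha>" for w
  proof -
    have "Jf (V *v w) \<alpha> * den V \<alpha> = Jf w \<alpha>" using Jf_mob[OF a, of V w] d V(2) by simp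
    then have "\<alpha> * Jf w \<alpha> = Jf (V *v w) \<alpha> * (\<alpha> * den V \<alpha>)" by (metis mult.assoc mult.commute)
    then show ?thesis unfolding V(3) by simp
  qed
  have L: "z \<in> ulat 1 \<alpha> \<longleftrightarrow> \<alpha> * z \<in> ulat 1 \<alpha>" for z
  proof
    assume "z \<in> ulat 1 \<alpha>"
    then obtain w where "z = 1 * Jf w \<alpha>" by (elim ulat_memE)
    then have "\<alpha> * z = 1 * Jf (V *v w) \<alpha>" using J by simp
    then show "\<alpha> * z \<in> ulat 1 \<alpha>" using ulat_memI by metis
  next
    assume "\<alpha> * z \<in> ulat 1 \<alpha>"
    then obtain w where w: "\<alpha> * z = 1 * Jf w \<alpha>" by (elim ulat_memE)
    have "\<alpha> * Jf (adj2 V *v w) \<alpha> = Jf w \<alpha>" unfolding J SL2Z_vec_cancel[OF V(1)] ..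
    then have "\<alpha> * z = \<alpha> * Jf (adj2 V *v w) \<alpha>" using w by simp
    then have "z = 1 * Jf (adj2 V *v w) \<alpha>" using a0 by simp
    then show "z \<in> ulat 1 \<alpha>" using ulat_memI by metis
  qed
  note sc = scaling_torus_isos(2)[OF csub_ulat csub_ulat a0 L]
  note eq = tp_Jf_eq_iff[OF npos one_neq_zero a]
  have lm: "level_matrix n \<phi> ((`) ((*) \<alpha>)) \<phi> A \<longleftrightarrow> A \<in> carrier (GL2 n) \<and> mcong n (V ** g) (g ** A)"
    if \<phi>: "\<And>v. v \<in> carrier (vec2_group n) \<Longrightarrow> \<phi> v = torus_point (ulat 1 \<alpha>) (1 * (Jf (g *v v) \<alpha> / of_nat n))" for \<phi> g A
  proof -
    have l: "(*) \<alpha> ` \<phi> v = torus_point (ulat 1 \<alpha>) (1 * (Jf ((V ** g) *v v) \<alpha> / of_nat n))"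
      if v: "v \<in> carrier (vec2_group n)" for v
    proof -
      have e: "\<alpha> * (1 * (Jf (g *v v) \<alpha> / of_nat n)) = 1 * (Jf ((V ** g) *v v) \<alpha> / of_nat n)"
        using J[of "g *v v"] by (simp add: matrix_vector_mul_assoc)
      show ?thesis unfolding \<phi>[OF v] sc e ..
    qed
    have r: "\<phi> (red_vec n (A *v v)) = torus_point (ulat 1 \<alpha>) (1 * (Jf ((g ** A) *v v) \<alpha> / of_nat n))" for v
    proof -
      have "\<phi> (red_vec n (A *v v)) = torus_point (ulat 1 \<alpha>) (1 * (Jf (g *v red_vec n (A *v v)) \<alpha> / of_nat n))"
        by (rule \<phi>) (simp add: carrier_vec2)
      also have "\<dots> = torus_point (ulat 1 \<alpha>) (1 * (Jf ((g ** A) *v v) \<alpha> / of_nat n))"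
        unfolding eq matrix_vector_mul_assoc[symmetric] by (rule vcong_mult) auto
      finally show ?thesis .
    qed
    have "(\<forall>v\<in>carrier (vec2_group n). (*) \<alpha> ` \<phi> v = \<phi> (red_vec n (A *v v))) \<longleftrightarrow>
        (\<forall>v\<in>carrier (vec2_group n). vcong n ((V ** g) *v v) ((g ** A) *v v))"
      using l r eq by simp
    also have "\<dots> \<longleftrightarrow> mcong n (V ** g) (g ** A)"
      using vcong_all_imp_mcong[of n "V ** g" "g ** A"] vcong_mult[of n "V ** g" "g ** A"] by auto
    finally show ?thesis unfolding level_matrix_def by simp
  qed
  have pmc: "A \<in> carrier (GL2 n)" if "A \<in> plus_minus n H" for A
  proof -
    obtain B h where "B = red_mat n (mat 1) \<or> B = red_mat n (- mat 1)" "h \<in> H" "A = red_mat n (B ** h)"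
      using \<open>A \<in> plus_minus n H\<close> unfolding plus_minus_def set_mult_def mult_GL2 by blast
    moreover have "coprime (det h) (int n)" using subgroup_GL2D(1)[OF sub calculation(2)] GL2_coprime by blast
    moreover have "coprime (det (red_mat n (mat 1))) (int n)" "coprime (det (red_mat n (- mat 1))) (int n)"
      using mcong_coprime_det[of n "red_mat n (mat 1)" "mat 1"] mcong_coprime_det[of n "red_mat n (- mat 1)" "- mat 1"]
      by simp_all
    ultimately show ?thesis by (auto simp: GL2_red_mem det_mul simp del: red_mult_red)
  qed
  show ?thesis
  proof
    assume "represented_with_automorphism \<alpha> n H P"
    then obtain \<phi> A where p: "(ulat 1 \<alpha>, \<phi>) \<in> level_pairs n" "P = ell_point n H (ulat 1 \<alpha>, \<phi>)"
      and A: "A \<in> plus_minus n H" "level_matrix n \<phi> ((`) ((*) \<alpha>)) \<phi> A"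
      unfolding represented_with_automorphism_def PL by blast
    obtain g where g: "cop g"
      "\<And>v. v \<in> carrier (vec2_group n) \<Longrightarrow> \<phi> v = torus_point (ulat 1 \<alpha>) (1 * (Jf (g *v v) \<alpha> / of_nat n))"
      using level_structure_matrix[OF npos one_neq_zero a p(1)] by blast
    have "rep n (ulat 1 \<alpha>, \<phi>) \<alpha> g" unfolding rep_def fst_conv snd_conv using a g one_neq_zero by blast
    then have "P = ept n H (Pt \<alpha>) g" unfolding p(2) by (rule ell_point_rep)
    moreover have "level_matrix n \<phi> ((`) ((*) \<alpha>)) \<phi> A \<longleftrightarrow> A \<in> carrier (GL2 n) \<and> mcong n (V ** g) (g ** A)"
      by (rule lm) (rule g(2))
    then have "\<exists>h\<in>H. mcong n (V ** g) (g ** h) \<or> mcong n (- (V ** g)) (g ** h)"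
      using A plus_minus_iff by blast
    ultimately show "\<exists>g. cop g \<and> P = ept n H (Pt \<alpha>) g \<and> (\<exists>h\<in>H. mcong n (V ** g) (g ** h) \<or> mcong n (- (V ** g)) (g ** h))"
      using g(1) by blast
  next
    assume "\<exists>g. cop g \<and> P = ept n H (Pt \<alpha>) g \<and> (\<exists>h\<in>H. mcong n (V ** g) (g ** h) \<or> mcong n (- (V ** g)) (g ** h))"
    then obtain g where g: "cop g" "P = ept n H (Pt \<alpha>) g"
      and "\<exists>h\<in>H. mcong n (V ** g) (g ** h) \<or> mcong n (- (V ** g)) (g ** h)" by blast
    then obtain A where A: "A \<in> plus_minus n H" "mcong n (V ** g) (g ** A)" using plus_minus_iff by blast
    define \<phi> where "\<phi> = snd (std_pair n \<alpha> g)"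
    have sp: "std_pair n \<alpha> g = (ulat 1 \<alpha>, \<phi>)" by (simp add: \<phi>_def std_pair_def PL)
    have \<phi>: "\<phi> v = torus_point (ulat 1 \<alpha>) (1 * (Jf (g *v v) \<alpha> / of_nat n))" for v
      by (simp add: \<phi>_def std_pair_def Let_def Jf_def PL)
    have "(ulat 1 \<alpha>, \<phi>) \<in> level_pairs n"
      using rep_level_pairs[OF npos rep_std[OF a g(1)]] unfolding sp .
    moreover have "P = ell_point n H (ulat 1 \<alpha>, \<phi>)" unfolding g(2) ept.simps sp ..
    moreover have "level_matrix n \<phi> ((`) ((*) \<alpha>)) \<phi> A"
    proof -
      have "level_matrix n \<phi> ((`) ((*) \<alpha>)) \<phi> A \<longleftrightarrow> A \<in> carrier (GL2 n) \<and> mcong n (V ** g) (g ** A)"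
        by (rule lm) (rule \<phi>)
      then show ?thesis using A(2) pmc[OF A(1)] by blast
    qed
    ultimately show "represented_with_automorphism \<alpha> n H P"
      unfolding represented_with_automorphism_def PL using A(1) by blast
  qed
qed

text \<open>After moving \<tau> to \<alpha>, an automorphism with the trace of \<open>V\<close> up
  to sign is, up to sign, \<open>V\<close> or its inverse by \<open>elliptic_same_trace\<close>. The
  sign is absorbed by the sign in \<open>plus_minus\<close>, and the inverse by the inverse of
  \<open>h\<close> in \<open>H\<close>.\<close>

lemma represented_EE_iff:
  assumes a: "Im \<alpha> > 0" and V: "V \<in> SL2Z" "mob V \<alpha> = \<alpha>" "\<alpha> * den V \<alpha> = 1" "V \<noteq> mat 1" "V \<noteq> - mat 1"
    and orbit: "\<And>\<tau> U. Im \<tau> > 0 \<Longrightarrow> U \<in> SL2Z \<Longrightarrow> mob U \<tau> = \<tau> \<Longrightarrow> U \<noteq> mat 1 \<Longrightarrow> U \<noteq> - mat 1 \<Longrightarrow>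
      (tr2 U)\<^sup>2 = (tr2 V)\<^sup>2 \<Longrightarrow> \<exists>\<gamma>\<in>SL2Z. mob \<gamma> \<tau> = \<alpha>"
    and t: "Im \<tau> > 0" "cop g"
  shows "represented_with_automorphism \<alpha> n H (ept n H (Pt \<tau>) g) \<longleftrightarrow> (\<exists>U. EE \<tau> g U \<and> (tr2 U)\<^sup>2 = (tr2 V)\<^sup>2)"
  unfolding represented_iff[OF a V(1-3)]
proof
  have nV: "- V \<in> SL2Z" "mob (- V) \<alpha> = \<alpha>" "- V \<noteq> mat 1" "- V \<noteq> - mat 1" "tr2 (- V) = - tr2 V"
    using V SL2Z_uminus by (auto simp: tr2_def minus_equation_iff[of V])
  have nVg: "- V ** g' = - (V ** g')" for g' :: "int^2^2" by (simp add: mat2_eq_iff)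
  assume "\<exists>g'. cop g' \<and> ept n H (Pt \<tau>) g = ept n H (Pt \<alpha>) g' \<and>
      (\<exists>h\<in>H. mcong n (V ** g') (g' ** h) \<or> mcong n (- (V ** g')) (g' ** h))"
  then obtain g' h where g': "cop g'" "ept n H (Pt \<tau>) g = ept n H (Pt \<alpha>) g'" "h \<in> H"
    "mcong n (V ** g') (g' ** h) \<or> mcong n (- (V ** g')) (g' ** h)" by blast
  have "EE \<alpha> g' V \<or> EE \<alpha> g' (- V)" unfolding EE_def nVg using V nV g'(3,4) by blast
  then obtain W where W: "EE \<alpha> g' W" "(tr2 W)\<^sup>2 = (tr2 V)\<^sup>2" using nV(5) by (metis power2_minus)
  have v: "vx (Pt \<tau>)" "vx (Pt \<alpha>)" using a t by simp_all
  have "orb n H (Pt \<alpha>) g' (Pt \<tau>) g" using ept_eq_iff[OF v(2,1) g'(1) t(2)] g'(2) by simp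
  then show "\<exists>U. EE \<tau> g U \<and> (tr2 U)\<^sup>2 = (tr2 V)\<^sup>2" using EE_transfer[OF a _ W(1)] W(2) by metis
next
  assume "\<exists>U. EE \<tau> g U \<and> (tr2 U)\<^sup>2 = (tr2 V)\<^sup>2"
  then obtain U where U: "EE \<tau> g U" "(tr2 U)\<^sup>2 = (tr2 V)\<^sup>2" by blast
  then obtain \<gamma> where c: "\<gamma> \<in> SL2Z" "mob \<gamma> \<tau> = \<alpha>" using orbit[OF t(1), of U] by (auto simp: EE_def)
  have v: "vx (Pt \<tau>)" "vx (Pt \<alpha>)" using a t by simp_all
  have cop': "cop (\<gamma> ** g)" using t(2) c(1) by (simp add: det_mul SL2Z_iff)
  have "mcong n (\<gamma> ** g) ((\<gamma> ** g) ** red_mat n (mat 1))"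
    using mcong_mult_left[of n "mat 1" "red_mat n (mat 1)" "\<gamma> ** g"] by simp
  then have o: "orb n H (Pt \<tau>) g (Pt \<alpha>) (\<gamma> ** g)"
    unfolding orb_def using c subgroup_GL2D(2)[OF sub] by (intro bexI[of _ \<gamma>] bexI[of _ "red_mat n (mat 1)"] conjI) simp_all
  obtain W where W: "EE \<alpha> (\<gamma> ** g) W" "tr2 W = tr2 U" using EE_transfer[OF t(1) o U(1)] by blast
  let ?g = "\<gamma> ** g"
  obtain h where h: "W \<in> SL2Z" "mob W \<alpha> = \<alpha>" "h \<in> H" "mcong n (W ** ?g) (?g ** h)" using W(1) by (auto simp: EE_def)
  obtain k where k: "k \<in> H" "mcong n (h ** k) (mat 1)" using subgroup_GL2D(4)[OF sub h(3)] by blast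
  \<comment> \<open>The inverse of \<open>W\<close> acts on the level structure through the inverse
    \<open>k\<close> of \<open>h\<close>.\<close>
  have "mcong n (adj2 W ** (?g ** mat 1)) (adj2 W ** (?g ** (h ** k)))"
    using mcong_sym[OF k(2)] by (intro mcong_mult_left)
  also have "adj2 W ** (?g ** (h ** k)) = adj2 W ** ((?g ** h) ** k)" by (simp only: matrix_mul_assoc)
  also have "mcong n \<dots> (adj2 W ** ((W ** ?g) ** k))" using mcong_sym[OF h(4)] by (intro mcong_mult_left mcong_mult_right)
  also have "adj2 W ** ((W ** ?g) ** k) = (adj2 W ** W) ** (?g ** k)" by (simp only: matrix_mul_assoc)
  also have "\<dots> = ?g ** k" unfolding SL2Z_adj2_mult(2)[OF h(1)] by simp
  finally have aW: "mcong n (adj2 W ** ?g) (?g ** k)" by simp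
  have "(tr2 W)\<^sup>2 = (tr2 V)\<^sup>2" using W(2) U(2) by simp
  then have VW: "V = W \<or> V = - W \<or> V = adj2 W \<or> V = - adj2 W" by (rule elliptic_same_trace[OF a h(1,2) V(1,2)])
  have nW: "- W ** ?g = - (W ** ?g)" "- adj2 W ** ?g = - (adj2 W ** ?g)" by (simp_all add: mat2_eq_iff)
  have "\<exists>h\<in>H. mcong n (V ** ?g) (?g ** h) \<or> mcong n (- (V ** ?g)) (?g ** h)"
    using VW
  proof (elim disjE)
    assume "V = W" then show ?thesis using h by blast
  next
    assume e: "V = - W" show ?thesis unfolding e nW minus_minus using h by blast
  next
    assume "V = adj2 W" then show ?thesis using k aW by blast
  next
    assume e: "V = - adj2 W" show ?thesis unfolding e nW minus_minus using k aW by blast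
  qed
  moreover have "ept n H (Pt \<tau>) g = ept n H (Pt \<alpha>) ?g" using ept_eq_iff[OF v t(2) cop'] o by blast
  ultimately show "\<exists>g'. cop g' \<and> ept n H (Pt \<tau>) g = ept n H (Pt \<alpha>) g' \<and>
      (\<exists>h\<in>H. mcong n (V ** g') (g' ** h) \<or> mcong n (- (V ** g')) (g' ** h))" using cop' by blast
qed

lemma represented_i_iff:
  assumes t: "Im \<tau> > 0" "cop g"
  shows "represented_with_automorphism \<i> n H (ept n H (Pt \<tau>) g) \<longleftrightarrow> (\<exists>U. EE \<tau> g U \<and> tr2 U = 0)"
proof -
  \<comment> \<open>Chosen so that \<open>den\<close> at \<i> is -\<i>, the inverse of the
    multiplier.\<close>
  let ?V = "mk2 0 1 (- 1) 0"
  have tr: "tr2 ?V = 0" by (simp add: tr2_def)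
  have "represented_with_automorphism \<i> n H (ept n H (Pt \<tau>) g) \<longleftrightarrow> (\<exists>U. EE \<tau> g U \<and> (tr2 U)\<^sup>2 = (tr2 ?V)\<^sup>2)"
  proof (rule represented_EE_iff[OF _ _ _ _ _ _ _ t])
    show "mob ?V \<i> = \<i>" by (simp add: mob_def num_def den_def)
    show "\<i> * den ?V \<i> = 1" by (simp add: den_def)
  qed (use elliptic_orbit(1) tr in \<open>auto simp: SL2Z_iff det_2 mat2_eq_iff\<close>)
  then show ?thesis unfolding tr by simp
qed

lemma represented_rho_iff:
  assumes t: "Im \<tau> > 0" "cop g"
  shows "represented_with_automorphism rho n H (ept n H (Pt \<tau>) g) \<longleftrightarrow> (\<exists>U. EE \<tau> g U \<and> (tr2 U)\<^sup>2 = 1)"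
proof -
  \<comment> \<open>Chosen so that \<open>den\<close> at \<open>rho\<close> is -1 -
    \<open>rho\<close>, the square of \<open>rho\<close> and hence its inverse.\<close>
  let ?V = "mk2 0 1 (- 1) (- 1)"
  have tr: "tr2 ?V = -1" by (simp add: tr2_def)
  have inv: "rho * den ?V rho = 1"
    by (simp add: den_def rho_def complex_eq_iff)
  have "represented_with_automorphism rho n H (ept n H (Pt \<tau>) g) \<longleftrightarrow> (\<exists>U. EE \<tau> g U \<and> (tr2 U)\<^sup>2 = (tr2 ?V)\<^sup>2)"
  proof (rule represented_EE_iff[OF _ _ _ inv _ _ _ t])
    show "Im rho > 0" by (simp add: rho_def)
    have "den ?V rho \<noteq> 0" using inv by auto
    then show "mob ?V rho = rho" using inv by (simp add: mob_def num_def field_simps)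
  qed (use elliptic_orbit(2) tr in \<open>auto simp: SL2Z_iff det_2 mat2_eq_iff\<close>)
  then show ?thesis unfolding tr by simp
qed

end

section \<open>Coincidences among the quotients of a curve\<close>

context hecke_level
begin

definition fpt :: "complex \<Rightarrow> int^2^2 \<Rightarrow> int^2^2 \<Rightarrow> modular_point" where
  "fpt \<tau> g \<sigma> = ept n H (Pt (mob (del \<sigma>) \<tau>)) (del \<sigma> ** g)"

text \<open>Already the two preimages upstairs coincide: \<open>U\<close> carries one line to the
  other and respects the level structure, so \<open>orb_gs\<close> applies with \<gamma> equal to
  \<open>U\<close>.\<close>

lemma fpt_lact:
  assumes t: "Im \<tau> > 0" "cop g" and U: "EE \<tau> g U" and s: "\<sigma> \<in> lines l"
  shows "fpt \<tau> g (lact l U \<sigma>) = fpt \<tau> g \<sigma>"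
proof -
  obtain h where c: "U \<in> SL2Z" "mob U \<tau> = \<tau>" "h \<in> H" "mcong n (U ** g) (g ** h)" using U by (auto simp: EE_def)
  note s' = lact[OF prime c(1) s]
  have "mcong n (U ** gs g \<sigma>) (U ** scal (int l) g)" using gs(1) by (rule mcong_mult_left)
  also have "U ** scal (int l) g = scal (int l) (U ** g)" by simp
  also have "mcong n \<dots> (scal (int l) (g ** h))" using c(4) by (rule mcong_scal[rotated]) simp
  also have "scal (int l) (g ** h) = scal (int l) g ** h" by simp
  finally have m: "mcong n (U ** gs g \<sigma>) (scal (int l) g ** h)" .
  have "par l (col (lact l U \<sigma>)) (U *v col \<sigma>)" by (rule s'(2))
  then have "int l dvd (adj2 (lact l U \<sigma>) ** (U ** \<sigma>)) $ 2 $ 1"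
    unfolding adj2_mult_21[symmetric] col_def matrix_vector_mul_assoc .
  moreover have "mcong l (adj2 (lact l U \<sigma>) ** (U ** gs g \<sigma>)) (adj2 (lact l U \<sigma>) ** (U ** \<sigma>))"
    using gs(2) by (intro mcong_mult_left)
  then have "int l dvd (adj2 (lact l U \<sigma>) ** (U ** gs g \<sigma>)) $ 2 $ 1 - (adj2 (lact l U \<sigma>) ** (U ** \<sigma>)) $ 2 $ 1"
    unfolding mcong_iff by blast
  ultimately have "int l dvd (adj2 (lact l U \<sigma>) ** (U ** gs g \<sigma>)) $ 2 $ 1" by (metis diff_add_cancel dvd_add)
  then have p: "par l (col (lact l U \<sigma>)) (col (U ** gs g \<sigma>))" unfolding adj2_mult_21 .
  have v: "vx (Pt \<tau>)" using t by simp
  have "orb (n * l) Hl (Pt \<tau>) (gs g \<sigma>) (Pt \<tau>) (gs g (lact l U \<sigma>))"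
    by (rule orb_gs[OF m c(3) cop_gs[OF t(2) s] c(1) s'(1) p]) (simp add: c(2))
  then have "Phi (Pt \<tau>) g \<sigma> = Phi (Pt \<tau>) g (lact l U \<sigma>)"
    unfolding Phi_def using L.ept_eq_iff[OF v v cop_gs[OF t(2) s] cop_gs[OF t(2) s'(1)]] by blast
  then show ?thesis unfolding fpt_def using qt_Phi[OF t s] qt_Phi[OF t s'(1)] by simp
qed

lemma del_kernel:
  assumes "\<sigma> \<in> lines l" shows "vz l (del \<sigma> *v col \<sigma>)" and "vz l (del \<sigma> *v w) \<Longrightarrow> par l (col \<sigma>) w"
proof -
  have "\<sigma> $ 2 $ 2 * \<sigma> $ 1 $ 1 - \<sigma> $ 1 $ 2 * \<sigma> $ 2 $ 1 = 1" using lines_SL2Z[OF assms] by (simp add: SL2Z_iff det_2 mult.commute)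
  moreover have "(del \<sigma> *v col \<sigma>) $ 1 = int l * (\<sigma> $ 2 $ 2 * \<sigma> $ 1 $ 1 - \<sigma> $ 1 $ 2 * \<sigma> $ 2 $ 1)" "(del \<sigma> *v col \<sigma>) $ 2 = 0"
    by (simp_all add: del_def algebra_simps)
  ultimately show "vz l (del \<sigma> *v col \<sigma>)" by (simp add: vz_def)
  have "(del \<sigma> *v w) $ 2 = \<sigma> $ 1 $ 1 * w $ 2 - \<sigma> $ 2 $ 1 * w $ 1" by (simp add: del_def algebra_simps)
  then show "vz l (del \<sigma> *v w) \<Longrightarrow> par l (col \<sigma>) w" by (simp add: vz_def par_def)
qed

text \<open>The dual of the quotient by a line has that same line as its image modulo
  \<open>l\<close>. This is where the image in \<open>typ2\<close> comes from.\<close>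

lemma adj_del_image: "par l (col \<sigma>) (adj2 (del \<sigma>) *v y)"
proof -
  have "\<sigma> $ 1 $ 1 * (adj2 (del \<sigma>) *v y) $ 2 - \<sigma> $ 2 $ 1 * (adj2 (del \<sigma>) *v y) $ 1
      = int l * ((\<sigma> $ 1 $ 1 * \<sigma> $ 2 $ 2 - \<sigma> $ 2 $ 1 * \<sigma> $ 1 $ 2) * y $ 2)"
    by (simp add: del_def algebra_simps)
  then show ?thesis by (simp add: par_def)
qed

text \<open>
  An isomorphism of the quotients by two lines gives an endomorphism \<open>B\<close> of degree \<open>l\<^sup>2\<close>: the first
  projection, the isomorphism, and the dual of the second projection.  If \<open>l\<close> divides \<open>B\<close>, then \<open>B/l\<close> is an
  automorphism.
\<close>

lemma fpt_eqD:
  assumes t: "Im \<tau> > 0" "cop g" and s: "\<sigma> \<in> lines l" "\<sigma>' \<in> lines l" "\<sigma> \<noteq> \<sigma>'" and e: "fpt \<tau> g \<sigma> = fpt \<tau> g \<sigma>'"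
  shows "(\<exists>U. EE \<tau> g U \<and> lact l U \<sigma> = \<sigma>') \<or> (\<exists>B. typ2 l \<tau> B \<sigma> \<sigma>')"
proof -
  have l0: "int l \<noteq> 0" using lpos by simp
  have dd: "det (del \<sigma>) = int l" "det (del \<sigma>') = int l" using det_del s by blast+
  have I: "Im (mob (del \<sigma>) \<tau>) > 0" "Im (mob (del \<sigma>') \<tau>) > 0" using Im_mob_pos[OF t(1)] dd lpos by simp_all
  have ln: "coprime (int l) (int n)" using cop_nl by (simp add: coprime_commute)
  have copd: "cop (del \<sigma> ** g)" "cop (del \<sigma>' ** g)" using dd t(2) ln by (simp_all add: det_mul)
  have "orb n H (Pt (mob (del \<sigma>) \<tau>)) (del \<sigma> ** g) (Pt (mob (del \<sigma>') \<tau>)) (del \<sigma>' ** g)"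
    using ept_eq_iff[of "Pt (mob (del \<sigma>) \<tau>)" "Pt (mob (del \<sigma>') \<tau>)"] I copd e unfolding fpt_def by simp
  then obtain \<gamma> h where c: "\<gamma> \<in> SL2Z" "h \<in> H" "mob (del \<sigma>') \<tau> = mob \<gamma> (mob (del \<sigma>) \<tau>)"
    "mcong n (\<gamma> ** (del \<sigma> ** g)) ((del \<sigma>' ** g) ** h)" by (auto simp: orb_def)
  have d1: "det \<gamma> = 1" using c(1) by (simp add: SL2Z_iff)
  define B where "B = adj2 (del \<sigma>') ** (\<gamma> ** del \<sigma>)"
  have dB: "det B = int l * int l" by (simp add: B_def det_mul dd d1)
  have fB: "mob B \<tau> = \<tau>"
  proof -
    have "mob B \<tau> = mob (adj2 (del \<sigma>')) (mob (\<gamma> ** del \<sigma>) \<tau>)"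
      unfolding B_def by (rule mob_mult[OF t(1)]) (simp add: det_mul dd d1 lpos)
    also have "mob (\<gamma> ** del \<sigma>) \<tau> = mob \<gamma> (mob (del \<sigma>) \<tau>)" by (rule mob_mult[OF t(1)]) (simp add: dd lpos)
    also have "\<dots> = mob (del \<sigma>') \<tau>" using c(3) by simp
    also have "mob (adj2 (del \<sigma>')) (mob (del \<sigma>') \<tau>) = \<tau>" by (rule mob_adj2[OF t(1)]) (simp add: dd lpos)
    finally show ?thesis .
  qed
  have Bg: "mcong n (B ** g) (scal (int l) (g ** h))"
  proof -
    have "B ** g = adj2 (del \<sigma>') ** (\<gamma> ** (del \<sigma> ** g))" unfolding B_def by (simp only: matrix_mul_assoc)
    also have "mcong n \<dots> (adj2 (del \<sigma>') ** ((del \<sigma>' ** g) ** h))" using c(4) by (rule mcong_mult_left)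
    also have "adj2 (del \<sigma>') ** ((del \<sigma>' ** g) ** h) = (adj2 (del \<sigma>') ** del \<sigma>') ** (g ** h)" by (simp only: matrix_mul_assoc)
    also have "\<dots> = scal (int l) (g ** h)" unfolding adj2_mult dd by simp
    finally show ?thesis .
  qed
  have Bv: "B *v v = adj2 (del \<sigma>') *v (\<gamma> *v (del \<sigma> *v v))" for v
    unfolding B_def by (simp only: matrix_vector_mul_assoc matrix_mul_assoc)
  have ker: "vz l (B *v col \<sigma>)" unfolding Bv by (intro vz_mult del_kernel(1) s(1))
  have im: "par l (col \<sigma>') (B *v v)" for v unfolding Bv by (rule adj_del_image)
  show ?thesis
  proof (cases "mz l B")
    case False
    have "typ2 l \<tau> B \<sigma> \<sigma>'"
      unfolding typ2_def[OF prime] using s dB l0 fB False ker im by simp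
    then show ?thesis by blast
  next
    case True
    define U where "U = mk2 (B $ 1 $ 1 div int l) (B $ 1 $ 2 div int l) (B $ 2 $ 1 div int l) (B $ 2 $ 2 div int l)"
    have BU: "B = scal (int l) U" using True by (simp add: mat2_eq_iff U_def mz_def)
    have "int l * int l * det U = int l * int l * 1" using dB unfolding BU by simp
    then have dU: "det U = 1" using l0 by (simp only: mult_cancel_left) simp
    then have U: "U \<in> SL2Z" by (simp add: SL2Z_iff)
    have fU: "mob U \<tau> = \<tau>" using fB unfolding BU mob_scal[OF l0] .
    have "mcong n (U ** g) (g ** h)"
    proof -
      have "mcong n (U ** g) (scal kk (scal (int l) (U ** g)))" by (rule mcong_sym[OF mcong_kk_l(1)])
      also have "mcong n \<dots> (scal kk (scal (int l) (g ** h)))"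
        by (rule mcong_scal) (use Bg in \<open>simp_all add: BU\<close>)
      also have "mcong n \<dots> (g ** h)" by (rule mcong_kk_l(1))
      finally show ?thesis .
    qed
    \<comment> \<open>Cancelling \<open>l\<close> shows that \<open>U\<close> lifts the isomorphism
      \<gamma> of the quotients, so it carries the kernel of the first projection to that of the
      second.\<close>
    moreover have "scal (int l) (del \<sigma>' ** U) = scal (int l) (\<gamma> ** del \<sigma>)"
    proof -
      have "scal (int l) (del \<sigma>' ** U) = del \<sigma>' ** B" unfolding BU by simp
      also have "\<dots> = (del \<sigma>' ** adj2 (del \<sigma>')) ** (\<gamma> ** del \<sigma>)" unfolding B_def by (simp only: matrix_mul_assoc)
      also have "\<dots> = scal (int l) (\<gamma> ** del \<sigma>)" unfolding adj2_mult dd by simp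
      finally show ?thesis .
    qed
    then have dU': "del \<sigma>' ** U = \<gamma> ** del \<sigma>" using l0 unfolding mat2_eq_iff scal_nth by simp
    have "del \<sigma>' *v (U *v col \<sigma>) = \<gamma> *v (del \<sigma> *v col \<sigma>)" unfolding matrix_vector_mul_assoc dU' ..
    then have "vz l (del \<sigma>' *v (U *v col \<sigma>))" using vz_mult[OF del_kernel(1)[OF s(1)]] by simp
    then have "par l (col \<sigma>') (U *v col \<sigma>)" by (rule del_kernel(2)[OF s(2)])
    then have lU: "lact l U \<sigma> = \<sigma>'" by (rule lact_eqI[OF prime U s(1,2)])
    have "U \<noteq> mat 1" using lU s(3) lact_one[OF prime s(1)] by auto
    moreover have "U \<noteq> - mat 1"
      using lU s(3) lact_one[OF prime s(1)] lact_uminus[OF prime SL2Z_one s(1)] by auto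
    ultimately show ?thesis unfolding EE_def using U fU lU c(2) by blast
  qed
qed

section \<open>Sizes of the fibres over an interior point\<close>

definition NN :: "complex \<Rightarrow> int^2^2 \<Rightarrow> modular_point \<Rightarrow> (int^2^2) set" where
  "NN \<tau> g Q = {\<sigma> \<in> lines l. fpt \<tau> g \<sigma> = Q}"

lemma multiplicity_NN:
  assumes "Im \<tau> > 0" "cop g"
  shows "multiplicity_at (hecke n H l (frag_of (ept n H (Pt \<tau>) g))) Q = int (card (NN \<tau> g Q))"
proof -
  have "{\<sigma> \<in> lines l. qt_map n H l (Phi (Pt \<tau>) g \<sigma>) = Q} = NN \<tau> g Q"
    unfolding NN_def fpt_def using qt_Phi[OF assms] by auto
  then show ?thesis using multiplicity_hecke[of "Pt \<tau>" g Q] assms by simp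
qed

lemma fpt_mem:
  assumes "Im \<tau> > 0" "cop g" "\<sigma> \<in> lines l" shows "fpt \<tau> g \<sigma> \<in> X_points n H"
proof -
  have "Phi (Pt \<tau>) g \<sigma> \<in> X_points (n * l) Hl" using Phi_mem[of "Pt \<tau>"] assms by simp
  then show ?thesis using qt_mem qt_Phi[OF assms] unfolding fpt_def by metis
qed

context
  fixes \<tau> g
  assumes t: "Im \<tau> > 0" and g: "cop g"
begin

lemma NN_fixed_typ2:
  assumes "\<sigma> \<in> NN \<tau> g Q" "\<sigma>' \<in> NN \<tau> g Q" "\<sigma> \<noteq> \<sigma>'" "\<And>U. EE \<tau> g U \<Longrightarrow> lact l U \<sigma> = \<sigma>"
  shows "\<exists>B. typ2 l \<tau> B \<sigma> \<sigma>'"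
  using fpt_eqD[OF t g, of \<sigma> \<sigma>'] assms unfolding NN_def by auto

text \<open>Automorphisms cannot move \<sigma>, so each coincidence with \<sigma> comes from a
  \<open>typ2\<close> pair, and there is only one such pair.\<close>

lemma NN_fixed_le_2:
  assumes s: "\<sigma> \<in> NN \<tau> g Q" "\<And>U. EE \<tau> g U \<Longrightarrow> lact l U \<sigma> = \<sigma>"
  shows "card (NN \<tau> g Q) \<le> 2"
proof (cases "NN \<tau> g Q \<subseteq> {\<sigma>}")
  case True
  then have "card (NN \<tau> g Q) \<le> card {\<sigma>}" by (intro card_mono) auto
  then show ?thesis by simp
next
  case False
  then obtain \<sigma>' where s': "\<sigma>' \<in> NN \<tau> g Q" "\<sigma> \<noteq> \<sigma>'" by blast
  obtain B where B: "typ2 l \<tau> B \<sigma> \<sigma>'" using NN_fixed_typ2[OF s(1) s' s(2)] by blast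
  have "NN \<tau> g Q \<subseteq> {\<sigma>, \<sigma>'}"
  proof
    fix \<rho> assume r: "\<rho> \<in> NN \<tau> g Q"
    show "\<rho> \<in> {\<sigma>, \<sigma>'}"
    proof (cases "\<rho> = \<sigma>")
      case False
      then obtain C where "typ2 l \<tau> C \<sigma> \<rho>" using NN_fixed_typ2[OF s(1) r _ s(2)] by blast
      then show ?thesis using typ2_unique[OF prime t B] by blast
    qed simp
  qed
  then have "card (NN \<tau> g Q) \<le> card {\<sigma>, \<sigma>'}" by (intro card_mono) auto
  then show ?thesis using s'(2) by simp
qed

text \<open>Both double points come from the single \<open>typ2\<close> pair, so their fibres share
  a line.\<close>

lemma NN_fixed_pair_unique:
  assumes s: "\<sigma> \<in> NN \<tau> g Q" "\<And>U. EE \<tau> g U \<Longrightarrow> lact l U \<sigma> = \<sigma>" "card (NN \<tau> g Q) = 2"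
    and r: "\<rho> \<in> NN \<tau> g R" "\<And>U. EE \<tau> g U \<Longrightarrow> lact l U \<rho> = \<rho>" "card (NN \<tau> g R) = 2"
  shows "Q = R"
proof -
  have ex: "\<exists>\<sigma>'\<in>NN \<tau> g Q. \<sigma> \<noteq> \<sigma>'" if "card (NN \<tau> g Q) = 2" for Q \<sigma>
  proof (rule ccontr)
    assume "\<not> (\<exists>\<sigma>'\<in>NN \<tau> g Q. \<sigma> \<noteq> \<sigma>')"
    then have "card (NN \<tau> g Q) \<le> card {\<sigma>}" by (intro card_mono) auto
    then show False using that by simp
  qed
  obtain \<sigma>' where s': "\<sigma>' \<in> NN \<tau> g Q" "\<sigma> \<noteq> \<sigma>'" using ex[OF s(3)] by blast
  obtain \<rho>' where r': "\<rho>' \<in> NN \<tau> g R" "\<rho> \<noteq> \<rho>'" using ex[OF r(3)] by blast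
  obtain B where B: "typ2 l \<tau> B \<sigma> \<sigma>'" using NN_fixed_typ2[OF s(1) s' s(2)] by blast
  obtain C where C: "typ2 l \<tau> C \<rho> \<rho>'" using NN_fixed_typ2[OF r(1) r' r(2)] by blast
  have "\<sigma> \<in> {\<rho>, \<rho>'}" using typ2_unique[OF prime t B C] by blast
  then have "\<sigma> \<in> NN \<tau> g R" using r(1) r'(1) by blast
  then show ?thesis using s(1) by (simp add: NN_def)
qed

text \<open>Three fixed lines would make \<open>l\<close> divide the squared trace minus 4, which is
  -4 or -3.\<close>

lemma card_fixed_lines:
  assumes U: "EE \<tau> g U" shows "card {\<sigma> \<in> lines l. lact l U \<sigma> = \<sigma>} \<le> 2"
proof (rule ccontr)
  assume "\<not> ?thesis"
  then have "3 \<le> card {\<sigma> \<in> lines l. lact l U \<sigma> = \<sigma>}" by simp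
  then obtain T where T: "T \<subseteq> {\<sigma> \<in> lines l. lact l U \<sigma> = \<sigma>}" "card T = 3" "finite T"
    by (rule obtain_subset_with_card_n)
  then obtain a b c where "T = {a, b, c}" "a \<noteq> b" "a \<noteq> c" "b \<noteq> c" by (auto simp: card_3_iff)
  moreover have "U \<in> SL2Z" using U by (simp add: EE_def)
  ultimately have "int l dvd (tr2 U)\<^sup>2 - 4" using three_fixed_lines[OF prime, of U a b c] T(1) by blast
  moreover have "tr2 U = 0 \<or> tr2 U = 1 \<or> tr2 U = -1" using U elliptic_trace[OF t, of U] by (auto simp: EE_def)
  ultimately have "int l dvd 4 \<or> int l dvd 3" by auto
  then have "int l \<le> 4" using zdvd_imp_le[of "int l" 4] zdvd_imp_le[of "int l" 3] by auto
  then show False using l5 by simp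
qed

lemma card_moved_lines:
  assumes U: "EE \<tau> g U" shows "card {\<sigma> \<in> lines l. lact l U \<sigma> \<noteq> \<sigma>} \<ge> 4"
proof -
  have "{\<sigma> \<in> lines l. lact l U \<sigma> \<noteq> \<sigma>} = lines l - {\<sigma> \<in> lines l. lact l U \<sigma> = \<sigma>}" by blast
  then have "card {\<sigma> \<in> lines l. lact l U \<sigma> \<noteq> \<sigma>} = l + 1 - card {\<sigma> \<in> lines l. lact l U \<sigma> = \<sigma>}"
    using finite_lines by (simp add: card_Diff_subset card_lines)
  then show ?thesis using card_fixed_lines[OF U] l5 by linarith
qed

lemma NN_generic:
  assumes "\<not> (\<exists>U. EE \<tau> g U)"
  shows "card (NN \<tau> g Q) \<le> 2" and "card (NN \<tau> g Q) = 2 \<Longrightarrow> card (NN \<tau> g R) = 2 \<Longrightarrow> Q = R"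
proof -
  have le: "card (NN \<tau> g Q) \<le> 2" for Q
  proof (cases "NN \<tau> g Q = {}")
    case False
    then obtain \<sigma> where "\<sigma> \<in> NN \<tau> g Q" by blast
    then show ?thesis by (rule NN_fixed_le_2) (use assms in blast)
  qed simp
  then show "card (NN \<tau> g Q) \<le> 2" .
  assume c: "card (NN \<tau> g Q) = 2" "card (NN \<tau> g R) = 2"
  then obtain \<sigma> \<rho> where sr: "\<sigma> \<in> NN \<tau> g Q" "\<rho> \<in> NN \<tau> g R" by fastforce
  show "Q = R" by (rule NN_fixed_pair_unique[OF sr(1) _ c(1) sr(2) _ c(2)]) (use assms in blast)+
qed

lemma EE_D: "EE \<tau> g U \<Longrightarrow> U \<in> SL2Z" "EE \<tau> g U \<Longrightarrow> mob U \<tau> = \<tau>"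
  by (simp_all add: EE_def)

text \<open>Traces 0 and 1 up to sign exclude each other, so \<open>U\<close> and \<open>V\<close>
  have the same trace up to sign. Hence \<open>V\<close> is, up to sign, \<open>U\<close> or its
  inverse, and signs act trivially on lines. For trace 0 the inverse is the negative.\<close>

lemma EE_lact:
  assumes U: "EE \<tau> g U" and V: "EE \<tau> g V" and s: "\<sigma> \<in> lines l"
  shows "lact l V \<sigma> = lact l U \<sigma> \<or> lact l V \<sigma> = lact l (adj2 U) \<sigma>"
    and "tr2 U = 0 \<Longrightarrow> lact l V \<sigma> = lact l U \<sigma>"
proof -
  note u = EE_D[OF U] and v = EE_D[OF V]
  have "tr2 U = 0 \<or> tr2 U = 1 \<or> tr2 U = -1" "tr2 V = 0 \<or> tr2 V = 1 \<or> tr2 V = -1"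
    using U V elliptic_trace[OF t] by (simp_all add: EE_def)
  then have "(tr2 U)\<^sup>2 = (tr2 V)\<^sup>2"
    using elliptic_trace_exclusive[OF t u v] elliptic_trace_exclusive[OF t v u] by auto
  then have "V = U \<or> V = - U \<or> V = adj2 U \<or> V = - adj2 U" by (rule elliptic_same_trace[OF t u v])
  then show a: "lact l V \<sigma> = lact l U \<sigma> \<or> lact l V \<sigma> = lact l (adj2 U) \<sigma>"
    using lact_uminus[OF prime u(1) s] lact_uminus[OF prime SL2Z_adj2[OF u(1)] s] by auto
  assume "tr2 U = 0"
  then have "adj2 U = - U" by (simp add: mat2_eq_iff tr2_def)
  then show "lact l V \<sigma> = lact l U \<sigma>" using a lact_uminus[OF prime u(1) s] by auto
qed

lemma EE_fixed:
  assumes U: "EE \<tau> g U" and s: "\<sigma> \<in> lines l" "lact l U \<sigma> = \<sigma>" and V: "EE \<tau> g V"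
  shows "lact l V \<sigma> = \<sigma>"
  using EE_lact(1)[OF U V s(1)] lact_adj2(1)[OF prime EE_D(1)[OF U] s(1)] s(2) by auto

text \<open>A line moved by \<open>U\<close> belongs to no \<open>typ2\<close> pair, by
  \<open>typ2_fixed\<close>; so its fibre is just its orbit under the automorphisms.\<close>

lemma NN_moved:
  assumes U: "EE \<tau> g U" and s: "\<sigma> \<in> lines l" "lact l U \<sigma> \<noteq> \<sigma>"
  shows "NN \<tau> g (fpt \<tau> g \<sigma>) = {\<sigma>, lact l U \<sigma>, lact l (adj2 U) \<sigma>}"
proof (rule equalityI; rule subsetI)
  note u = EE_D[OF U]
  fix \<rho> assume r: "\<rho> \<in> NN \<tau> g (fpt \<tau> g \<sigma>)"
  show "\<rho> \<in> {\<sigma>, lact l U \<sigma>, lact l (adj2 U) \<sigma>}"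
  proof (cases "\<rho> = \<sigma>")
    case False
    then have "(\<exists>V. EE \<tau> g V \<and> lact l V \<sigma> = \<rho>) \<or> (\<exists>B. typ2 l \<tau> B \<sigma> \<rho>)"
      using fpt_eqD[OF t g s(1), of \<rho>] r by (auto simp: NN_def)
    moreover have "\<not> typ2 l \<tau> B \<sigma> \<rho>" for B using typ2_fixed(1)[OF prime t _ u] s(2) by blast
    ultimately show ?thesis using EE_lact(1)[OF U _ s(1)] by blast
  qed simp
next
  note u = EE_D[OF U]
  note a = lact(1)[OF prime SL2Z_adj2[OF u(1)] s(1)]
  have "fpt \<tau> g (lact l (adj2 U) \<sigma>) = fpt \<tau> g \<sigma>"
    using fpt_lact[OF t g U a] unfolding lact_adj2(2)[OF prime u(1) s(1)] by simp
  moreover have "fpt \<tau> g (lact l U \<sigma>) = fpt \<tau> g \<sigma>" by (rule fpt_lact[OF t g U s(1)])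
  moreover fix \<rho> assume "\<rho> \<in> {\<sigma>, lact l U \<sigma>, lact l (adj2 U) \<sigma>}"
  ultimately show "\<rho> \<in> NN \<tau> g (fpt \<tau> g \<sigma>)" unfolding NN_def using s(1) a lact(1)[OF prime u(1) s(1)] by blast
qed

lemma NN_order4:
  assumes U: "EE \<tau> g U" "tr2 U = 0"
  shows "card (NN \<tau> g Q) \<le> 2"
    and "\<exists>Q\<in>X_points n H. \<exists>R\<in>X_points n H. Q \<noteq> R \<and> card (NN \<tau> g Q) = 2 \<and> card (NN \<tau> g R) = 2"
proof -
  note u = EE_D[OF U(1)]
  have adj: "adj2 U = - U" using U(2) by (simp add: mat2_eq_iff tr2_def)
  have mv: "NN \<tau> g (fpt \<tau> g \<sigma>) = {\<sigma>, lact l U \<sigma>}" if "\<sigma> \<in> lines l" "lact l U \<sigma> \<noteq> \<sigma>" for \<sigma>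
    unfolding NN_moved[OF U(1) that] adj lact_uminus[OF prime u(1) that(1)] by simp
  show "card (NN \<tau> g Q) \<le> 2"
  proof (cases "NN \<tau> g Q = {}")
    case False
    then obtain \<sigma> where s: "\<sigma> \<in> NN \<tau> g Q" by blast
    then have s1: "\<sigma> \<in> lines l" "Q = fpt \<tau> g \<sigma>" by (auto simp: NN_def)
    show ?thesis
    proof (cases "lact l U \<sigma> = \<sigma>")
      case True
      show ?thesis by (rule NN_fixed_le_2[OF s EE_fixed[OF U(1) s1(1) True]])
    next
      case False
      then show ?thesis unfolding s1(2) mv[OF s1(1) False] by simp
    qed
  qed simp
  have c4: "card {\<sigma> \<in> lines l. lact l U \<sigma> \<noteq> \<sigma>} \<ge> 4" by (rule card_moved_lines[OF U(1)])
  have nsub: "\<not> {\<sigma> \<in> lines l. lact l U \<sigma> \<noteq> \<sigma>} \<subseteq> T" if "finite T" "card T \<le> 2" for T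
    using card_mono[OF that(1), of "{\<sigma> \<in> lines l. lact l U \<sigma> \<noteq> \<sigma>}"] c4 that(2) by linarith
  obtain \<sigma> where s: "\<sigma> \<in> lines l" "lact l U \<sigma> \<noteq> \<sigma>" using nsub[of "{}"] by auto
  have "card {\<sigma>, lact l U \<sigma>} \<le> 2" by (simp add: card_insert_if)
  \<comment> \<open>At least four lines are moved, so one lies outside the first orbit of
    two.\<close>
  then obtain \<rho> where r: "\<rho> \<in> lines l" "lact l U \<rho> \<noteq> \<rho>" "\<rho> \<notin> {\<sigma>, lact l U \<sigma>}"
    using nsub[of "{\<sigma>, lact l U \<sigma>}"] by blast
  have "fpt \<tau> g \<rho> \<noteq> fpt \<tau> g \<sigma>" using r(1,3) unfolding mv[OF s, symmetric] NN_def by blast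
  moreover have "card (NN \<tau> g (fpt \<tau> g \<sigma>)) = 2" "card (NN \<tau> g (fpt \<tau> g \<rho>)) = 2"
    unfolding mv[OF s] mv[OF r(1,2)] using s(2) r(2) by (simp_all add: card_insert_if)
  ultimately show "\<exists>Q\<in>X_points n H. \<exists>R\<in>X_points n H. Q \<noteq> R \<and> card (NN \<tau> g Q) = 2 \<and> card (NN \<tau> g R) = 2"
    using fpt_mem[OF t g s(1)] fpt_mem[OF t g r(1)] by blast
qed

text \<open>Moved lines have fibres of size three. A fibre of size two therefore contains a line
  fixed by all automorphisms, and \<open>NN_fixed_pair_unique\<close> applies.\<close>

lemma NN_order3:
  assumes U: "EE \<tau> g U" "(tr2 U)\<^sup>2 = 1"
  shows "card (NN \<tau> g Q) \<le> 3" and "\<exists>Q\<in>X_points n H. card (NN \<tau> g Q) = 3"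
    and "card (NN \<tau> g Q) = 2 \<Longrightarrow> card (NN \<tau> g R) = 2 \<Longrightarrow> Q = R"
proof -
  note u = EE_D[OF U(1)]
  have mv: "card (NN \<tau> g (fpt \<tau> g \<sigma>)) = 3" if s: "\<sigma> \<in> lines l" "lact l U \<sigma> \<noteq> \<sigma>" for \<sigma>
  proof -
    note Us = lact[OF prime u(1) s(1)] and As = lact[OF prime SL2Z_adj2[OF u(1)] s(1)]
    have "lact l (adj2 U) \<sigma> \<noteq> \<sigma>" using lact_adj2(2)[OF prime u(1) s(1)] s(2) by auto
    moreover have "lact l U \<sigma> \<noteq> lact l (adj2 U) \<sigma>"
    proof
      assume "lact l U \<sigma> = lact l (adj2 U) \<sigma>"
      then have "lact l (U ** U) \<sigma> = \<sigma>"
        unfolding lact_mult[OF prime u(1) u(1) s(1)] using lact_adj2(2)[OF prime u(1) s(1)] by simp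
      then have p: "par l (col \<sigma>) ((U ** U) *v col \<sigma>)" using lact(2)[OF prime SL2Z_mult[OF u(1) u(1)] s(1)] by simp
      \<comment> \<open>By Cayley-Hamilton the square of \<open>U\<close> is the trace times
        \<open>U\<close>, up to a multiple of the identity. As the trace is 1 or -1, a line fixed by
        the square is fixed by \<open>U\<close>; so the orbit really has three elements.\<close>
      have "col \<sigma> $ 1 * ((U ** U) *v col \<sigma>) $ 2 - col \<sigma> $ 2 * ((U ** U) *v col \<sigma>) $ 1
          = tr2 U * (col \<sigma> $ 1 * (U *v col \<sigma>) $ 2 - col \<sigma> $ 2 * (U *v col \<sigma>) $ 1)"
        by (simp add: tr2_def algebra_simps)
      then have "int l dvd tr2 U * (col \<sigma> $ 1 * (U *v col \<sigma>) $ 2 - col \<sigma> $ 2 * (U *v col \<sigma>) $ 1)"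
        using p unfolding par_def by simp
      moreover have "tr2 U = 1 \<or> tr2 U = -1" using U(2) by (simp add: power2_eq_1_iff)
      ultimately have "int l dvd col \<sigma> $ 1 * (U *v col \<sigma>) $ 2 - col \<sigma> $ 2 * (U *v col \<sigma>) $ 1"
        by (metis dvd_minus_iff mult_1 mult_minus1)
      then have "par l (col \<sigma>) (U *v col \<sigma>)" unfolding par_def .
      then show False using lact_eqI[OF prime u(1) s(1,1)] s(2) by blast
    qed
    ultimately show ?thesis unfolding NN_moved[OF U(1) s] using s(2) by (simp add: card_insert_if)
  qed
  have cases: "card (NN \<tau> g Q) = 3 \<or> NN \<tau> g Q = {} \<or> (\<exists>\<sigma>\<in>NN \<tau> g Q. \<forall>V. EE \<tau> g V \<longrightarrow> lact l V \<sigma> = \<sigma>)" for Q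
  proof (cases "NN \<tau> g Q = {}")
    case False
    then obtain \<sigma> where s: "\<sigma> \<in> NN \<tau> g Q" by blast
    then have s1: "\<sigma> \<in> lines l" "Q = fpt \<tau> g \<sigma>" by (auto simp: NN_def)
    show ?thesis
    proof (cases "lact l U \<sigma> = \<sigma>")
      case True
      then show ?thesis using EE_fixed[OF U(1) s1(1) True] s by blast
    next
      case False
      then show ?thesis using mv[OF s1(1) False] s1(2) by simp
    qed
  qed simp
  show "card (NN \<tau> g Q) \<le> 3"
    using cases[of Q]
  proof (elim disjE bexE)
    fix \<sigma> assume "\<sigma> \<in> NN \<tau> g Q" "\<forall>V. EE \<tau> g V \<longrightarrow> lact l V \<sigma> = \<sigma>"
    then have "card (NN \<tau> g Q) \<le> 2" using NN_fixed_le_2 by blast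
    then show ?thesis by simp
  qed simp_all
  have "{\<sigma> \<in> lines l. lact l U \<sigma> \<noteq> \<sigma>} \<noteq> {}" using card_moved_lines[OF U(1)] by (metis card.empty not_numeral_le_zero)
  then obtain \<sigma> where s: "\<sigma> \<in> lines l" "lact l U \<sigma> \<noteq> \<sigma>" by blast
  then show "\<exists>Q\<in>X_points n H. card (NN \<tau> g Q) = 3" using mv[OF s] fpt_mem[OF t g s(1)] by blast
  assume c: "card (NN \<tau> g Q) = 2" "card (NN \<tau> g R) = 2"
  have "NN \<tau> g Q \<noteq> {}" "NN \<tau> g R \<noteq> {}" using c by auto
  then obtain \<sigma> \<rho> where "\<sigma> \<in> NN \<tau> g Q" "\<forall>V. EE \<tau> g V \<longrightarrow> lact l V \<sigma> = \<sigma>"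
    "\<rho> \<in> NN \<tau> g R" "\<forall>V. EE \<tau> g V \<longrightarrow> lact l V \<rho> = \<rho>"
    using cases[of Q] cases[of R] c by auto
  then show "Q = R" using NN_fixed_pair_unique c by blast
qed

end

text \<open>Three cases: no extra automorphism compatible with the level, one of trace 0, or one of
  trace 1 or -1. The last two cannot occur together, so each case decides both equivalences.\<close>

lemma multiplicities_noncusp:
  assumes t: "Im \<tau> > 0" "cop g" and P: "P = ept n H (Pt \<tau>) g"
  defines "T \<equiv> hecke n H l (frag_of P)"
  shows "\<not> multiplicity_at T Q \<ge> 4"
    and "(\<exists>Q\<in>X_points n H. multiplicity_at T Q = 3) \<longleftrightarrow> represented_with_automorphism rho n H P"
    and "(\<exists>Q\<in>X_points n H. \<exists>R\<in>X_points n H. Q \<noteq> R \<and> multiplicity_at T Q = 2 \<and> multiplicity_at T R = 2)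
      \<longleftrightarrow> represented_with_automorphism \<i> n H P"
proof -
  have m: "multiplicity_at T Q = int (card (NN \<tau> g Q))" for Q
    unfolding T_def P by (rule multiplicity_NN[OF t])
  have rr: "represented_with_automorphism rho n H P \<longleftrightarrow> (\<exists>U. EE \<tau> g U \<and> (tr2 U)\<^sup>2 = 1)"
    unfolding P by (rule represented_rho_iff[OF t])
  have ri: "represented_with_automorphism \<i> n H P \<longleftrightarrow> (\<exists>U. EE \<tau> g U \<and> tr2 U = 0)"
    unfolding P by (rule represented_i_iff[OF t])
  have excl: False if "EE \<tau> g U" "tr2 U = 0" "EE \<tau> g V" "(tr2 V)\<^sup>2 = 1" for U V
    using elliptic_trace_exclusive[OF t(1)] that by (auto simp: EE_def)
  have m3: "multiplicity_at T Q = 3 \<longleftrightarrow> card (NN \<tau> g Q) = 3" "multiplicity_at T Q = 2 \<longleftrightarrow> card (NN \<tau> g Q) = 2"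
    "multiplicity_at T Q \<ge> 4 \<longleftrightarrow> card (NN \<tau> g Q) \<ge> 4" for Q
    unfolding m by linarith+
  consider (A) "\<not> (\<exists>U. EE \<tau> g U)" | (B) U where "EE \<tau> g U" "tr2 U = 0" | (C) U where "EE \<tau> g U" "(tr2 U)\<^sup>2 = 1"
  proof (cases "\<exists>U. EE \<tau> g U")
    case True
    then obtain U where U: "EE \<tau> g U" by blast
    then have "tr2 U = 0 \<or> tr2 U = 1 \<or> tr2 U = -1" using elliptic_trace[OF t(1)] by (simp add: EE_def)
    then have "tr2 U = 0 \<or> (tr2 U)\<^sup>2 = 1" by auto
    then show thesis using U that(2,3) by blast
  qed (use that(1) in blast)
  then have "(\<forall>Q. card (NN \<tau> g Q) \<le> 3) \<and>
     ((\<exists>Q\<in>X_points n H. card (NN \<tau> g Q) = 3) \<longleftrightarrow> (\<exists>U. EE \<tau> g U \<and> (tr2 U)\<^sup>2 = 1)) \<and>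
     ((\<exists>Q\<in>X_points n H. \<exists>R\<in>X_points n H. Q \<noteq> R \<and> card (NN \<tau> g Q) = 2 \<and> card (NN \<tau> g R) = 2)
       \<longleftrightarrow> (\<exists>U. EE \<tau> g U \<and> tr2 U = 0))"
  proof cases
    case A
    have le: "card (NN \<tau> g Q) \<le> 2" for Q by (rule NN_generic(1)[OF t A])
    then have "card (NN \<tau> g Q) \<le> 3" "card (NN \<tau> g Q) \<noteq> 3" for Q using le[of Q] by linarith+
    then show ?thesis using NN_generic(2)[OF t A] A by blast
  next
    case B
    have le: "card (NN \<tau> g Q) \<le> 2" for Q by (rule NN_order4(1)[OF t B])
    then have "card (NN \<tau> g Q) \<le> 3" "card (NN \<tau> g Q) \<noteq> 3" for Q using le[of Q] by linarith+
    then show ?thesis using NN_order4(2)[OF t B] B excl by blast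
  next
    case C
    show ?thesis using NN_order3[OF t C] C excl by blast
  qed
  then have res: "\<And>Q. card (NN \<tau> g Q) \<le> 3"
    "(\<exists>Q\<in>X_points n H. card (NN \<tau> g Q) = 3) \<longleftrightarrow> (\<exists>U. EE \<tau> g U \<and> (tr2 U)\<^sup>2 = 1)"
    "(\<exists>Q\<in>X_points n H. \<exists>R\<in>X_points n H. Q \<noteq> R \<and> card (NN \<tau> g Q) = 2 \<and> card (NN \<tau> g R) = 2)
       \<longleftrightarrow> (\<exists>U. EE \<tau> g U \<and> tr2 U = 0)" by blast+
  show "\<not> multiplicity_at T Q \<ge> 4" unfolding m3 using res(1)[of Q] by linarith
  show "(\<exists>Q\<in>X_points n H. multiplicity_at T Q = 3) \<longleftrightarrow> represented_with_automorphism rho n H P"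
    unfolding m3 rr by (rule res(2))
  show "(\<exists>Q\<in>X_points n H. \<exists>R\<in>X_points n H. Q \<noteq> R \<and> multiplicity_at T Q = 2 \<and> multiplicity_at T R = 2)
      \<longleftrightarrow> represented_with_automorphism \<i> n H P"
    unfolding m3 ri by (rule res(3))
qed

end

theorem theorem2p4:
  fixes n l :: nat and H :: "(int^2^2) set" and P :: modular_point
  assumes "n > 0"
    and "subgroup H (GL2 n)"
    and "prime l" and "l \<ge> 5" and "\<not> l dvd n"
    and "P \<in> X_points n H"
  defines "T \<equiv> hecke n H l (frag_of P)"
  shows "((\<exists>Q \<in> X_points n H. multiplicity_at T Q \<ge> 4) \<longleftrightarrow> P \<in> cusps n H) \<and>
         ((\<exists>Q \<in> X_points n H. multiplicity_at T Q = 3) \<longleftrightarrow>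
            represented_with_automorphism (exp (2 * of_real pi * \<i> / 3)) n H P) \<and>
         ((\<exists>Q \<in> X_points n H. \<exists>R \<in> X_points n H.
              Q \<noteq> R \<and> multiplicity_at T Q = 2 \<and> multiplicity_at T R = 2) \<longleftrightarrow>
            represented_with_automorphism \<i> n H P)"
proof -
  interpret hecke_level n H l 
    using assms(1-5) by (intro hecke_level.intro level.intro hecke_level_axioms.intro)
  obtain x g where x: "vx x" "cop g" "P = ept n H x g" using assms(6) unfolding X_points_iff by blast
  show ?thesis
  proof (cases x)
    case (Pt \<tau>)
    then have t: "Im \<tau> > 0" "P = ept n H (Pt \<tau>) g" using x by simp_all
    have "P \<notin> cusps n H" using cusps_iff[OF x(1,2)] unfolding x(3) Pt by blast
    then show ?thesis unfolding T_def rho_exp using multiplicities_noncusp[OF t(1) x(2) t(2)] by blast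
  next
    case (Cu c)
    then have P: "P \<in> cusps n H" using cusps_iff[OF x(1,2)] x(3) by blast
    have "\<not> represented_with_automorphism \<alpha> n H P" for \<alpha>
      using x(3) unfolding Cu by (auto simp: represented_with_automorphism_def ell_point_def cusp_point_def)
    then show ?thesis unfolding T_def using multiplicity_cusp[OF P] P by blast
  qed
qed

end
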